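(* Let $\mu\in\Omega$. For all $\lambda\in\Omega$, $$P_{\mu,G^3}\,f_{G^3}^{\lambda+\mu}=b_{\mu,G^3}(\lambda)\,f_{G^3}^{\lambda},\qquad\text{where}\qquad b_{\mu,G^3}(\lambda)=\frac{H(\lambda+\mu)}{H(\lambda)}\,b_{\mu,K}(\lambda),$$ with $H(\lambda)=\langle u_{-\lambda},u_\lambda\rangle$ and $b_{\mu,K}(\lambda)$ the scalar defined by $P_{\mu,K}\,f_K^{\lambda+\mu}=b_{\mu,K}(\lambda)\,f_K^\lambda$.
   Context: Let $n\ge 2$, $G=SL_n(\mathbb C)$, $\mathcal F$ its flag variety, $X=\mathcal F\times\mathcal F\times\mathbb P^{n-1}$, viewed as the set of triples $(B_1,B_2,P)$ of two Borel subgroups and a subgroup $P\subset G$ that is the stabilizer of a line in $\mathbb C^n$; $X'=\mathcal F\times\mathcal F\times(\mathbb P^{n-1})^\vee$ is the set of triples $(B_1',B_2',P')$ of two Borel subgroups and the stabilizer $P'$ of a line in $(\mathbb C^n)^*$. $G$ acts diagonally on $X$ and on $X'$, with an open orbit on each. **Representations.** For $\lambda=(\lambda_1,\lambda_2,l)$ with $\lambda_1,\lambda_2$ dominant integral weights and $l\in\mathbb Z_{\ge0}$, put $V_\lambda=V_{\lambda_1}\otimes V_{\lambda_2}\otimes \mathrm{Sym}^l\mathbb C^n$, an irreducible representation of $G^3$. $\Omega$ is the set of those $\lambda$ such that $V_\lambda^*$ has a nonzero vector invariant under the diagonal $G$. **Vectors and sections.** Fix $(B_1,B_2,P)\in X$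 and $(B_1',B_2',P')\in X'$ in general position: each lies in the open diagonal $G$-orbit, $B_i$ and $B_i'$ are opposite, and the line fixed by $P'$ pairs nontrivially with the line fixed by $P$. For each $\lambda\in\Omega$ choose: $v_\lambda\in V_\lambda$ a highest weight vector for $B_1\times B_2\times P$ (tensor product of the $B_1$- and $B_2$-highest weight vectors and the $l$-th power of a vector spanning the line fixed by $P$); $v_{-\lambda}\in V_\lambda^*$ a highest weight vector for $B_1'\times B_2'\times P'$ with $\langle v_{-\lambda},v_\lambda\rangle=1$; the diagonally $G$-invariant (unique up to scaling) vectors $u_{-\lambda}\in V_\lambda^*$ and $u_\lambda\in V_\lambda$ with $\langle u_{-\lambda},v_\lambda\rangle=1$, $\langle v_{-\lambda},u_\lambda\rangle=1$. By Borel–Weil, $w\in V_\lambda^*$ corresponds to the section $g\mapsto\langle w,gv_\lambda\rangle$ ($g\in G^3$) of the line bundle $L_\lambda$ on $X$. Let $f_{G^3}^\lambda(g)=\langle u_{-\lambda},gv_\lambda\rangle$ and $f_K^\lambda(g)=\langle v_{-\lambda},gv_\lambda\rangle$. **Operators.** For a Borel subgroup $B$ with Lie algebra $\mathfrak b$, nilradical $\mathfrak n$, Cartan $\mathfrak h$, and $\mu$ dominant integral, let $(V_\mu^*\otimes U\mathfrak g/(U\mathfrak g)\mathfrak n)^{\mathfrak b_{-\mu}}$ be the space of elements killed by $\mathfrak n$ and of $\mathfrak h$-weight $-\mu$ ($\mathfrak b$ acting on the second factor by the adjoint action). It is known to be a free right $U\mathfrak h$-module of rank 1; fix a generator $P^\mu=\sum_i\xi_i\otimes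 y_i$. For $v\in V_\mu$ let $v\otimes P^\mu$ be the twisted differential operator $\varphi\mapsto[g\mapsto\sum_i\langle\xi_i,g^{-1}v\rangle (R(y_i)\varphi)(g)]$, where $R$ extends $(R(y)\varphi)(g)=\frac{d}{dt}|_{t=0}\varphi(ge^{ty})$ to $U\mathfrak g$; it maps sections of $L_{\lambda+\mu}$ on $G/B$ to sections of $L_\lambda$. For $\mathbb P^{n-1}$, sections of $\mathcal O(l)$ are degree $l$ homogeneous polynomials on $\mathbb C^n$, and for $v\in\mathrm{Sym}^m\mathbb C^n$ let $v\otimes P^m$ be the constant-coefficient differential operator $\partial_v$. For $\mu=(\mu_1,\mu_2,m)\in\Omega$ and $v=v_1\otimes v_2\otimes v_3\in V_\mu$ let $v\otimes P$ be the product of $v_1\otimes P^{\mu_1}$, $v_2\otimes P^{\mu_2}$, $v_3\otimes P^m$ acting on the three factors of $X$ (first two for $B_1,B_2$), extended linearly to all $v\in V_\mu$. Put $P_{\mu,K}=v_\mu\otimes P$ and $P_{\mu,G^3}=u_\mu\otimes P$. It is known that $P_{\mu,K}f_K^{\lambda+\mu}$ is a scalar multiple $b_{\mu,K}(\lambda)$ of $f_K^\lambda$. *)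

theory Defs
  imports "HOL-Analysis.Analysis" "HOL-Library.Multiset"
begin

type_synonym 'n cmat = "complex^'n^'n"

definition SL :: "('n::finite) cmat set" where
  "SL = {g. det g = 1}"

text \<open>Flags are indexed by all natural numbers and are constant from index \<open>n\<close> on.\<close>

definition complete_flag :: "(nat \<Rightarrow> (complex^'n::finite) set) \<Rightarrow> bool" where
  "complete_flag F \<longleftrightarrow>
     (\<forall>i. vec.subspace (F i) \<and> F i \<subseteq> F (Suc i) \<and> vec.dim (F i) = min i CARD('n))"

definition flag_stab :: "(nat \<Rightarrow> (complex^'n::finite) set) \<Rightarrow> 'n cmat set" where
  "flag_stab F = {g \<in> SL. \<forall>i. \<forall>x \<in> F i. g *v x \<in> F i}"

definition borel_subgroups :: "('n::finite) cmat set set" where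
  "borel_subgroups = {B. \<exists>F. complete_flag F \<and> B = flag_stab F}"

definition flag_of :: "('n::finite) cmat set \<Rightarrow> nat \<Rightarrow> (complex^'n) set" where
  "flag_of B = (THE F. complete_flag F \<and> B = flag_stab F)"

definition is_line :: "(complex^'n::finite) set \<Rightarrow> bool" where
  "is_line L \<longleftrightarrow> vec.subspace L \<and> vec.dim L = 1"

definition line_stab :: "(complex^'n::finite) set \<Rightarrow> 'n cmat set" where
  "line_stab L = {g \<in> SL. \<forall>x \<in> L. g *v x \<in> L}"

text \<open>The dual space of \<open>\<complex>\<^sup>n\<close> is identified with row vectors \<open>\<eta>\<close>, paired with \<open>x\<close> by
  \<open>\<Sum>i. \<eta>\<^sub>i x\<^sub>i\<close>; the group acts on it by \<open>(g \<eta>)(x) = \<eta> (g\<^sup>-\<^sup>1 x)\<close>.\<close>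

definition coline_stab :: "(complex^'n::finite) set \<Rightarrow> 'n cmat set" where
  "coline_stab L = {g \<in> SL. \<forall>\<eta> \<in> L. \<eta> v* matrix_inv g \<in> L}"

definition line_of :: "('n::finite) cmat set \<Rightarrow> (complex^'n) set" where
  "line_of P = (THE L. is_line L \<and> P = line_stab L)"

definition coline_of :: "('n::finite) cmat set \<Rightarrow> (complex^'n) set" where
  "coline_of P = (THE L. is_line L \<and> P = coline_stab L)"

definition diagonal_mat :: "('n::finite) cmat \<Rightarrow> bool" where
  "diagonal_mat A \<longleftrightarrow> (\<forall>i j. i \<noteq> j \<longrightarrow> A $ i $ j = 0)"

definition maximal_torus :: "('n::finite) cmat set \<Rightarrow> bool" where
  "maximal_torus T \<longleftrightarrow>
     (\<exists>p :: 'n cmat. invertible p \<and> T = {g \<in> SL. diagonal_mat (matrix_inv p ** g ** p)})"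

definition opposite_borels :: "('n::finite) cmat set \<Rightarrow> 'n cmat set \<Rightarrow> bool" where
  "opposite_borels B B' \<longleftrightarrow>
     B \<in> borel_subgroups \<and> B' \<in> borel_subgroups \<and> maximal_torus (B \<inter> B')"

type_synonym 'n triple = "'n cmat set \<times> 'n cmat set \<times> 'n cmat set"

definition X_var :: "('n::finite) triple set" where
  "X_var = borel_subgroups \<times> borel_subgroups \<times> {P. \<exists>L. is_line L \<and> P = line_stab L}"

definition X'_var :: "('n::finite) triple set" where
  "X'_var = borel_subgroups \<times> borel_subgroups \<times> {P. \<exists>L. is_line L \<and> P = coline_stab L}"

definition G3 :: "(('n::finite) cmat \<times> 'n cmat \<times> 'n cmat) set" where
  "G3 = SL \<times> SL \<times> SL"

definition conj_set :: "('n::finite) cmat \<Rightarrow> 'n cmat set \<Rightarrow> 'n cmat set" where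
  "conj_set g B = (\<lambda>b. g ** b ** matrix_inv g) ` B"

definition conj3 :: "('n::finite) cmat \<times> 'n cmat \<times> 'n cmat \<Rightarrow> 'n triple \<Rightarrow> 'n triple" where
  "conj3 = (\<lambda>(g1, g2, g3) (B1, B2, P). (conj_set g1 B1, conj_set g2 B2, conj_set g3 P))"

text \<open>\<open>X\<close> and \<open>X'\<close> are homogeneous under \<open>G\<^sup>3\<close> and carry the quotient topology of the orbit maps
  (for the classical topology of \<open>G\<^sup>3\<close>; an orbit of an algebraic group is open in this sense iff
  it is Zariski open).\<close>

definition open_in_var :: "('n::finite) triple set \<Rightarrow> 'n triple set \<Rightarrow> bool" where
  "open_in_var X U \<longleftrightarrow> U \<subseteq> X \<and>
     (\<forall>x \<in> X. openin (top_of_set G3) {g \<in> G3. conj3 g x \<in> U})"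

definition in_open_orbit :: "('n::finite) triple set \<Rightarrow> 'n triple \<Rightarrow> bool" where
  "in_open_orbit X x \<longleftrightarrow> x \<in> X \<and> open_in_var X {conj3 (g, g, g) x | g. g \<in> SL}"

definition general_position :: "('n::finite) triple \<Rightarrow> 'n triple \<Rightarrow> bool" where
  "general_position = (\<lambda>(B1, B2, P) (B1', B2', P').
     in_open_orbit X_var (B1, B2, P) \<and> in_open_orbit X'_var (B1', B2', P') \<and>
     opposite_borels B1 B1' \<and> opposite_borels B2 B2' \<and>
     (\<exists>x \<in> line_of P. \<exists>\<eta> \<in> coline_of P'. (\<Sum>i\<in>UNIV. \<eta> $ i * x $ i) \<noteq> 0))"

text \<open>An integral weight is given by its coefficients with respect to the fundamental weights
  \<open>\<omega>\<^sub>1, \<dots>, \<omega>\<^sub>n\<^sub>-\<^sub>1\<close>; it is dominant when these are natural numbers.\<close>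

type_synonym weight = "nat \<Rightarrow> nat"
type_synonym weight3 = "weight \<times> weight \<times> nat"

definition dominant_weights :: "'n::finite itself \<Rightarrow> weight set" where
  "dominant_weights _ = {\<mu>. \<forall>i. i \<notin> {1..<CARD('n)} \<longrightarrow> \<mu> i = 0}"

definition wplus :: "weight3 \<Rightarrow> weight3 \<Rightarrow> weight3" (infixl \<open>\<oplus>\<^sub>w\<close> 65) where
  "wplus = (\<lambda>(l1, l2, l) (m1, m2, m). (\<lambda>i. l1 i + m1 i, \<lambda>i. l2 i + m2 i, l + m))"

text \<open>The scalar by which a matrix preserving the flag \<open>F\<close> acts on \<open>F\<^sub>j / F\<^sub>j\<^sub>-\<^sub>1\<close>.\<close>

definition flag_eig :: "(nat \<Rightarrow> (complex^'n::finite) set) \<Rightarrow> nat \<Rightarrow> 'n cmat \<Rightarrow> complex" where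
  "flag_eig F j A = (THE c. \<forall>x \<in> F j. A *v x - c *s x \<in> F (j - 1))"

text \<open>The fundamental weight \<open>\<omega>\<^sub>i\<close> of the Borel subgroup stabilizing \<open>F\<close> is the determinant
  (for the Lie algebra: the trace) of the action on \<open>F\<^sub>i\<close>.\<close>

definition weight_char ::
    "(nat \<Rightarrow> (complex^'n::finite) set) \<Rightarrow> weight \<Rightarrow> 'n cmat \<Rightarrow> complex" where
  "weight_char F \<mu> b = (\<Prod>i\<in>{1..<CARD('n)}. (\<Prod>j\<in>{1..i}. flag_eig F j b) ^ \<mu> i)"

definition weight_lie ::
    "(nat \<Rightarrow> (complex^'n::finite) set) \<Rightarrow> weight \<Rightarrow> 'n cmat \<Rightarrow> complex" where
  "weight_lie F \<mu> h = (\<Sum>i\<in>{1..<CARD('n)}. of_nat (\<mu> i) * (\<Sum>j\<in>{1..i}. flag_eig F j h))"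

definition cspace :: "'i set \<Rightarrow> ('i \<Rightarrow> complex) set" where
  "cspace I = {v. \<forall>i. i \<notin> I \<longrightarrow> v i = 0}"

definition mat_act :: "'i set \<Rightarrow> ('i \<Rightarrow> 'i \<Rightarrow> complex) \<Rightarrow> ('i \<Rightarrow> complex) \<Rightarrow> 'i \<Rightarrow> complex" where
  "mat_act I A v = (\<lambda>i. if i \<in> I then \<Sum>j\<in>I. A i j * v j else 0)"

definition pairing :: "'i set \<Rightarrow> ('i \<Rightarrow> complex) \<Rightarrow> ('i \<Rightarrow> complex) \<Rightarrow> complex" where
  "pairing I w v = (\<Sum>i\<in>I. w i * v i)"

inductive_set polynomial_functions :: "('a \<Rightarrow> complex) set \<Rightarrow> ('a \<Rightarrow> complex) set"
  for X :: "('a \<Rightarrow> complex) set" where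
  const: "(\<lambda>_. c) \<in> polynomial_functions X"
| coord: "f \<in> X \<Longrightarrow> f \<in> polynomial_functions X"
| add: "f \<in> polynomial_functions X \<Longrightarrow> g \<in> polynomial_functions X \<Longrightarrow>
    (\<lambda>x. f x + g x) \<in> polynomial_functions X"
| mult: "f \<in> polynomial_functions X \<Longrightarrow> g \<in> polynomial_functions X \<Longrightarrow>
    (\<lambda>x. f x * g x) \<in> polynomial_functions X"

definition vec_coords :: "(complex^'n::finite \<Rightarrow> complex) set" where
  "vec_coords = {\<lambda>x. x $ i | i. True}"

definition mat_coords :: "(('n::finite) cmat \<Rightarrow> complex) set" where
  "mat_coords = {\<lambda>A. A $ i $ j | i j. True}"

text \<open>A finite-dimensional representation is given, after a choice of basis, by its dimension \<open>d\<close>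
  and its matrix entries \<open>\<rho> g i j\<close> with \<open>i, j < d\<close>.\<close>

type_synonym 'n matrep = "'n cmat \<Rightarrow> nat \<Rightarrow> nat \<Rightarrow> complex"

definition rational_rep :: "nat \<Rightarrow> ('n::finite) matrep \<Rightarrow> bool" where
  "rational_rep d \<rho> \<longleftrightarrow>
     (\<forall>i<d. \<forall>j<d. \<rho> (mat 1) i j = (if i = j then 1 else 0)) \<and>
     (\<forall>g\<in>SL. \<forall>h\<in>SL. \<forall>i<d. \<forall>j<d. \<rho> (g ** h) i j = (\<Sum>k<d. \<rho> g i k * \<rho> h k j)) \<and>
     (\<forall>i<d. \<forall>j<d. \<exists>p \<in> polynomial_functions mat_coords. \<forall>g\<in>SL. \<rho> g i j = p g)"

definition irreducible_rep :: "nat \<Rightarrow> ('n::finite) matrep \<Rightarrow> bool" where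
  "irreducible_rep d \<rho> \<longleftrightarrow> rational_rep d \<rho> \<and> d > 0 \<and>
     (\<forall>W. W \<subseteq> cspace {..<d} \<longrightarrow> (\<lambda>_. 0) \<in> W \<longrightarrow>
        (\<forall>v\<in>W. \<forall>w\<in>W. (\<lambda>i. v i + w i) \<in> W) \<longrightarrow>
        (\<forall>c. \<forall>v\<in>W. (\<lambda>i. c * v i) \<in> W) \<longrightarrow>
        (\<forall>g\<in>SL. \<forall>v\<in>W. mat_act {..<d} (\<rho> g) v \<in> W) \<longrightarrow>
        W = {\<lambda>_. 0} \<or> W = cspace {..<d})"

definition irrep_of_highest_weight :: "weight \<Rightarrow> nat \<Rightarrow> ('n::finite) matrep \<Rightarrow> bool" where
  "irrep_of_highest_weight \<mu> d \<rho> \<longleftrightarrow> irreducible_rep d \<rho> \<and>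
     (\<forall>F. complete_flag F \<longrightarrow> (\<exists>v \<in> cspace {..<d}. v \<noteq> (\<lambda>_. 0) \<and>
        (\<forall>b \<in> flag_stab F. mat_act {..<d} (\<rho> b) v = (\<lambda>i. weight_char F \<mu> b * v i))))"

text \<open>Highest weight vectors for \<open>B\<close> in an irreducible representation are the nonzero vectors
  spanning a \<open>B\<close>-stable line.\<close>

definition highest_weight_vector ::
    "nat \<Rightarrow> ('n::finite) matrep \<Rightarrow> 'n cmat set \<Rightarrow> (nat \<Rightarrow> complex) \<Rightarrow> bool" where
  "highest_weight_vector d \<rho> B v \<longleftrightarrow> v \<in> cspace {..<d} \<and> v \<noteq> (\<lambda>_. 0) \<and>
     (\<forall>b\<in>B. \<exists>c. mat_act {..<d} (\<rho> b) v = (\<lambda>i. c * v i))"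

definition contragredient :: "('n::finite) matrep \<Rightarrow> 'n matrep" where
  "contragredient \<rho> = (\<lambda>g i j. \<rho> (matrix_inv g) j i)"

text \<open>\<open>Sym\<^sup>l \<complex>\<^sup>n\<close> is realized by symmetric tensors: coordinates indexed by lists of length \<open>l\<close> and
  depending only on the underlying multiset, with \<open>e\<^sup>l = e \<otimes> \<dots> \<otimes> e\<close>. The dual
  \<open>V\<^sub>\<lambda>\<^sup>*\<close> is the space with the same index set, in dual coordinates, with the contragredient action;
  \<open>(Sym\<^sup>l \<complex>\<^sup>n)\<^sup>*\<close> is thereby \<open>Sym\<^sup>l\<close> of the dual of \<open>\<complex>\<^sup>n\<close>.\<close>

type_synonym 'n tensor = "nat \<times> nat \<times> 'n list \<Rightarrow> complex"

definition idx :: "(weight \<Rightarrow> nat) \<Rightarrow> weight3 \<Rightarrow> (nat \<times> nat \<times> 'n::finite list) set" where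
  "idx d = (\<lambda>(l1, l2, l). {..<d l1} \<times> {..<d l2} \<times> {xs. length xs = l})"

definition V_space :: "(weight \<Rightarrow> nat) \<Rightarrow> weight3 \<Rightarrow> ('n::finite) tensor set" where
  "V_space d lam = {t \<in> cspace (idx d lam).
     \<forall>i j xs ys. mset xs = mset ys \<longrightarrow> t (i, j, xs) = t (i, j, ys)}"

definition kron ::
    "(nat \<Rightarrow> nat \<Rightarrow> complex) \<Rightarrow> (nat \<Rightarrow> nat \<Rightarrow> complex) \<Rightarrow> ('n::finite) cmat \<Rightarrow>
     nat \<times> nat \<times> 'n list \<Rightarrow> nat \<times> nat \<times> 'n list \<Rightarrow> complex" where
  "kron A1 A2 A3 = (\<lambda>(i, j, xs) (i', j', ys).
     A1 i i' * A2 j j' * (\<Prod>k<length xs. A3 $ (xs ! k) $ (ys ! k)))"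

definition V_act ::
    "(weight \<Rightarrow> nat) \<Rightarrow> (weight \<Rightarrow> ('n::finite) matrep) \<Rightarrow> weight3 \<Rightarrow>
     'n cmat \<times> 'n cmat \<times> 'n cmat \<Rightarrow> 'n tensor \<Rightarrow> 'n tensor" where
  "V_act d \<rho> = (\<lambda>(l1, l2, l) (g1, g2, g3).
     mat_act (idx d (l1, l2, l)) (kron (\<rho> l1 g1) (\<rho> l2 g2) g3))"

definition V_coact ::
    "(weight \<Rightarrow> nat) \<Rightarrow> (weight \<Rightarrow> ('n::finite) matrep) \<Rightarrow> weight3 \<Rightarrow>
     'n cmat \<times> 'n cmat \<times> 'n cmat \<Rightarrow> 'n tensor \<Rightarrow> 'n tensor" where
  "V_coact d \<rho> = (\<lambda>(l1, l2, l) (g1, g2, g3).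
     mat_act (idx d (l1, l2, l))
       (kron (contragredient (\<rho> l1) g1) (contragredient (\<rho> l2) g2) (transpose (matrix_inv g3))))"

definition V_invariant ::
    "(weight \<Rightarrow> nat) \<Rightarrow> (weight \<Rightarrow> ('n::finite) matrep) \<Rightarrow> weight3 \<Rightarrow> 'n tensor \<Rightarrow> bool" where
  "V_invariant d \<rho> lam t \<longleftrightarrow> t \<in> V_space d lam \<and> (\<forall>g\<in>SL. V_act d \<rho> lam (g, g, g) t = t)"

definition V_coinvariant ::
    "(weight \<Rightarrow> nat) \<Rightarrow> (weight \<Rightarrow> ('n::finite) matrep) \<Rightarrow> weight3 \<Rightarrow> 'n tensor \<Rightarrow> bool" where
  "V_coinvariant d \<rho> lam w \<longleftrightarrow> w \<in> V_space d lam \<and> (\<forall>g\<in>SL. V_coact d \<rho> lam (g, g, g) w = w)"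

definition Omega :: "(weight \<Rightarrow> nat) \<Rightarrow> (weight \<Rightarrow> ('n::finite) matrep) \<Rightarrow> weight3 set" where
  "Omega d \<rho> = {(l1, l2, l). l1 \<in> dominant_weights TYPE('n) \<and> l2 \<in> dominant_weights TYPE('n) \<and>
     (\<exists>w. V_coinvariant d \<rho> (l1, l2, l) w \<and> w \<noteq> (\<lambda>_. 0))}"

definition pure_tensor ::
    "nat \<Rightarrow> (nat \<Rightarrow> complex) \<Rightarrow> (nat \<Rightarrow> complex) \<Rightarrow> complex^'n::finite \<Rightarrow> 'n tensor" where
  "pure_tensor l v1 v2 e = (\<lambda>(i, j, xs).
     if length xs = l then v1 i * v2 j * prod_list (map (\<lambda>k. e $ k) xs) else 0)"

definition V_highest ::
    "(weight \<Rightarrow> nat) \<Rightarrow> (weight \<Rightarrow> ('n::finite) matrep) \<Rightarrow> 'n triple \<Rightarrow> weight3 \<Rightarrow> 'n tensor \<Rightarrow> bool"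
  where
  "V_highest d \<rho> = (\<lambda>(B1, B2, P) (l1, l2, l) t. \<exists>v1 v2 e.
     highest_weight_vector (d l1) (\<rho> l1) B1 v1 \<and>
     highest_weight_vector (d l2) (\<rho> l2) B2 v2 \<and>
     e \<in> line_of P \<and> e \<noteq> 0 \<and> t = pure_tensor l v1 v2 e)"

definition V_cohighest ::
    "(weight \<Rightarrow> nat) \<Rightarrow> (weight \<Rightarrow> ('n::finite) matrep) \<Rightarrow> 'n triple \<Rightarrow> weight3 \<Rightarrow> 'n tensor \<Rightarrow> bool"
  where
  "V_cohighest d \<rho> = (\<lambda>(B1', B2', P') (l1, l2, l) t. \<exists>\<xi>1 \<xi>2 \<eta>.
     highest_weight_vector (d l1) (contragredient (\<rho> l1)) B1' \<xi>1 \<and>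
     highest_weight_vector (d l2) (contragredient (\<rho> l2)) B2' \<xi>2 \<and>
     \<eta> \<in> coline_of P' \<and> \<eta> \<noteq> 0 \<and> t = pure_tensor l \<xi>1 \<xi>2 \<eta>)"

definition V_pairing ::
    "(weight \<Rightarrow> nat) \<Rightarrow> weight3 \<Rightarrow> ('n::finite) tensor \<Rightarrow> 'n tensor \<Rightarrow> complex" where
  "V_pairing d lam w t = pairing (idx d lam) w t"

definition V_section ::
    "(weight \<Rightarrow> nat) \<Rightarrow> (weight \<Rightarrow> ('n::finite) matrep) \<Rightarrow> weight3 \<Rightarrow> 'n tensor \<Rightarrow> 'n tensor \<Rightarrow>
     'n cmat \<times> 'n cmat \<times> 'n cmat \<Rightarrow> complex" where
  "V_section d \<rho> lam w v = (\<lambda>g. V_pairing d lam w (V_act d \<rho> lam g v))"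

typedef (overloaded) 'n sl = "{A :: ('n::finite) cmat. trace A = 0}"
  morphisms sl_mat Abs_sl
  by (rule exI[of _ 0]) (simp add: trace_def)

setup_lifting type_definition_sl

instantiation sl :: (finite) ab_group_add
begin
lift_definition zero_sl :: "'a sl" is 0 by (simp add: trace_def)
lift_definition plus_sl :: "'a sl \<Rightarrow> 'a sl \<Rightarrow> 'a sl" is "(+)" by (simp add: trace_add)
lift_definition minus_sl :: "'a sl \<Rightarrow> 'a sl \<Rightarrow> 'a sl" is "(-)" by (simp add: trace_sub)
lift_definition uminus_sl :: "'a sl \<Rightarrow> 'a sl" is "uminus" by (simp add: trace_def sum_negf)
instance by standard (transfer; simp)+
end

lift_definition sl_scale :: "complex \<Rightarrow> ('n::finite) sl \<Rightarrow> 'n sl" is "\<lambda>c A. (\<chi> i j. c * A $ i $ j)"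
  by (simp add: trace_def sum_distrib_left[symmetric])

lift_definition sl_bracket :: "('n::finite) sl \<Rightarrow> 'n sl \<Rightarrow> 'n sl" is "\<lambda>A B. A ** B - B ** A"
  by (metis trace_sub trace_mul_sym right_minus_eq)

text \<open>\<open>U\<gg>\<close> is presented by generators and relations: formal algebra expressions in the elements
  of \<open>\<gg>\<close>, modulo the congruence generated by the axioms of unital associative complex algebras,
  linearity of the inclusion of \<open>\<gg>\<close>, and \<open>[x, y] = x y - y x\<close>.\<close>

datatype 'n uterm =
    UC complex
  | UG "('n::finite) sl"
  | UA "'n uterm" "'n uterm"
  | UM "'n uterm" "'n uterm"

inductive ucong :: "('n::finite) uterm \<Rightarrow> 'n uterm \<Rightarrow> bool" where
  refl: "ucong a a"
| sym: "ucong a b \<Longrightarrow> ucong b a"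
| trans: "ucong a b \<Longrightarrow> ucong b c \<Longrightarrow> ucong a c"
| add_cong: "ucong a a' \<Longrightarrow> ucong b b' \<Longrightarrow> ucong (UA a b) (UA a' b')"
| mult_cong: "ucong a a' \<Longrightarrow> ucong b b' \<Longrightarrow> ucong (UM a b) (UM a' b')"
| add_assoc: "ucong (UA (UA a b) c) (UA a (UA b c))"
| add_comm: "ucong (UA a b) (UA b a)"
| add_zero: "ucong (UA (UC 0) a) a"
| add_neg: "ucong (UA (UM (UC (-1)) a) a) (UC 0)"
| mult_assoc: "ucong (UM (UM a b) c) (UM a (UM b c))"
| mult_one_left: "ucong (UM (UC 1) a) a"
| mult_one_right: "ucong (UM a (UC 1)) a"
| distrib_left: "ucong (UM a (UA b c)) (UA (UM a b) (UM a c))"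
| distrib_right: "ucong (UM (UA a b) c) (UA (UM a c) (UM b c))"
| const_add: "ucong (UC (c + c')) (UA (UC c) (UC c'))"
| const_mult: "ucong (UC (c * c')) (UM (UC c) (UC c'))"
| const_comm: "ucong (UM (UC c) a) (UM a (UC c))"
| gen_add: "ucong (UG (x + y)) (UA (UG x) (UG y))"
| gen_scale: "ucong (UG (sl_scale c x)) (UM (UC c) (UG x))"
| gen_bracket:
    "ucong (UG (sl_bracket x y)) (UA (UM (UG x) (UG y)) (UM (UC (-1)) (UM (UG y) (UG x))))"

lemma ucong_equivp: "equivp ucong"
  by (intro equivpI reflpI sympI transpI) (fact ucong.refl, erule ucong.sym, erule (1) ucong.trans)

quotient_type (overloaded) 'n Ug = "('n::finite) uterm" / ucong
  by (rule ucong_equivp)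

text \<open>The augmentation, used only to see that \<open>0 \<noteq> 1\<close> in \<open>U\<gg>\<close>.\<close>

primrec uaug :: "('n::finite) uterm \<Rightarrow> complex" where
  "uaug (UC c) = c"
| "uaug (UG x) = 0"
| "uaug (UA a b) = uaug a + uaug b"
| "uaug (UM a b) = uaug a * uaug b"

lemma ucong_uaug: "ucong a b \<Longrightarrow> uaug a = uaug b"
  by (induction rule: ucong.induct) (simp_all add: algebra_simps)

instantiation Ug :: (finite) ring_1
begin
lift_definition zero_Ug :: "'a Ug" is "UC 0" .
lift_definition one_Ug :: "'a Ug" is "UC 1" .
lift_definition plus_Ug :: "'a Ug \<Rightarrow> 'a Ug \<Rightarrow> 'a Ug" is UA by (rule ucong.add_cong)
lift_definition times_Ug :: "'a Ug \<Rightarrow> 'a Ug \<Rightarrow> 'a Ug" is UM by (rule ucong.mult_cong)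
lift_definition uminus_Ug :: "'a Ug \<Rightarrow> 'a Ug" is "UM (UC (-1))"
  by (rule ucong.mult_cong[OF ucong.refl])
definition minus_Ug :: "'a Ug \<Rightarrow> 'a Ug \<Rightarrow> 'a Ug" where "minus_Ug a b = a + - b"
instance
proof
  fix a b c :: "'a Ug"
  show "a + b + c = a + (b + c)" by transfer (rule ucong.add_assoc)
  show "a + b = b + a" by transfer (rule ucong.add_comm)
  show "0 + a = a" by transfer (rule ucong.add_zero)
  show "- a + a = 0" by transfer (rule ucong.add_neg)
  show "a - b = a + - b" by (rule minus_Ug_def)
  show "a * b * c = a * (b * c)" by transfer (rule ucong.mult_assoc)
  show "1 * a = a" by transfer (rule ucong.mult_one_left)
  show "a * 1 = a" by transfer (rule ucong.mult_one_right)
  show "a * (b + c) = a * b + a * c" by transfer (rule ucong.distrib_left)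
  show "(a + b) * c = a * c + b * c" by transfer (rule ucong.distrib_right)
  show "(0::'a Ug) \<noteq> 1" by transfer (auto dest: ucong_uaug)
qed
end

lift_definition U_const :: "complex \<Rightarrow> ('n::finite) Ug" is UC .
lift_definition U_gen :: "('n::finite) sl \<Rightarrow> 'n Ug" is UG .

inductive_set left_ideal :: "('n::finite) sl set \<Rightarrow> 'n Ug set" for S where
  zero: "0 \<in> left_ideal S"
| step: "a \<in> left_ideal S \<Longrightarrow> x \<in> S \<Longrightarrow> a + u * U_gen x \<in> left_ideal S"

inductive_set U_subalgebra :: "('n::finite) sl set \<Rightarrow> 'n Ug set" for S where
  const: "U_const c \<in> U_subalgebra S"
| gen: "x \<in> S \<Longrightarrow> U_gen x \<in> U_subalgebra S"
| add: "a \<in> U_subalgebra S \<Longrightarrow> b \<in> U_subalgebra S \<Longrightarrow> a + b \<in> U_subalgebra S"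
| mult: "a \<in> U_subalgebra S \<Longrightarrow> b \<in> U_subalgebra S \<Longrightarrow> a * b \<in> U_subalgebra S"

primrec matpow :: "('n::finite) cmat \<Rightarrow> nat \<Rightarrow> 'n cmat" where
  "matpow A 0 = mat 1"
| "matpow A (Suc k) = A ** matpow A k"

definition mexp :: "('n::finite) cmat \<Rightarrow> 'n cmat" where
  "mexp A = (\<Sum>k. (1 / fact k) *\<^sub>R matpow A k)"

definition lie_algebra_of :: "('n::finite) cmat set \<Rightarrow> 'n sl set" where
  "lie_algebra_of B = {x. \<forall>t::real. mexp (t *\<^sub>R sl_mat x) \<in> B}"

text \<open>For the Borel subgroup stabilizing a flag, the nilradical of the Lie algebra consists of
  the matrices mapping each step of the flag into the preceding one.\<close>

definition nilradical :: "('n::finite) cmat set \<Rightarrow> 'n sl set" where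
  "nilradical B = {x \<in> lie_algebra_of B. \<forall>i. \<forall>v \<in> flag_of B (Suc i). sl_mat x *v v \<in> flag_of B i}"

definition cartan_subalgebra :: "('n::finite) sl set \<Rightarrow> bool" where
  "cartan_subalgebra \<hh> \<longleftrightarrow>
     (\<exists>p :: 'n cmat. invertible p \<and> \<hh> = {x. diagonal_mat (matrix_inv p ** sl_mat x ** p)})"

definition lie_rep :: "('n::finite) matrep \<Rightarrow> 'n sl \<Rightarrow> nat \<Rightarrow> nat \<Rightarrow> complex" where
  "lie_rep \<rho> x i j = vector_derivative (\<lambda>t::real. \<rho> (mexp (t *\<^sub>R sl_mat x)) i j) (at 0)"

text \<open>With \<open>\<xi>\<^sub>i\<close> the coordinate functionals of \<open>V\<^sub>\<mu>\<close>, a family \<open>y\<close> represents the element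
  \<open>\<Sum>i<d. \<xi>\<^sub>i \<otimes> y\<^sub>i\<close> of \<open>V\<^sub>\<mu>\<^sup>* \<otimes> U\<gg>/(U\<gg>)\<nn>\<close>; two families represent the same element iff they agree
  componentwise modulo \<open>(U\<gg>)\<nn>\<close>. An element \<open>x\<close> of the Lie algebra of the Borel subgroup acts by
  the contragredient representation on the first factor and by the adjoint action on the second.\<close>

definition tensor_lie_act ::
    "nat \<Rightarrow> ('n::finite) matrep \<Rightarrow> 'n sl \<Rightarrow> (nat \<Rightarrow> 'n Ug) \<Rightarrow> nat \<Rightarrow> 'n Ug" where
  "tensor_lie_act d \<rho> x y = (\<lambda>i.
     (\<Sum>j<d. U_const (lie_rep (contragredient \<rho>) x i j) * y j) + (U_gen x * y i - y i * U_gen x))"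

definition semi_invariants ::
    "nat \<Rightarrow> ('n::finite) matrep \<Rightarrow> weight \<Rightarrow> 'n cmat set \<Rightarrow> 'n sl set \<Rightarrow> (nat \<Rightarrow> 'n Ug) set" where
  "semi_invariants d \<rho> \<mu> B \<hh> = {y.
     (\<forall>x \<in> nilradical B. \<forall>i<d. tensor_lie_act d \<rho> x y i \<in> left_ideal (nilradical B)) \<and>
     (\<forall>h \<in> \<hh>. \<forall>i<d.
        tensor_lie_act d \<rho> h y i + U_const (weight_lie (flag_of B) \<mu> (sl_mat h)) * y i
          \<in> left_ideal (nilradical B))}"

definition semi_invariant_generator ::
    "nat \<Rightarrow> ('n::finite) matrep \<Rightarrow> weight \<Rightarrow> 'n cmat set \<Rightarrow> 'n sl set \<Rightarrow> (nat \<Rightarrow> 'n Ug) \<Rightarrow> bool" where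
  "semi_invariant_generator d \<rho> \<mu> B \<hh> p \<longleftrightarrow> p \<in> semi_invariants d \<rho> \<mu> B \<hh> \<and>
     (\<forall>y \<in> semi_invariants d \<rho> \<mu> B \<hh>. \<exists>a \<in> U_subalgebra \<hh>.
        \<forall>i<d. y i - p i * a \<in> left_ideal (nilradical B))"

primrec R_term :: "('n::finite) uterm \<Rightarrow> ('n cmat \<Rightarrow> complex) \<Rightarrow> 'n cmat \<Rightarrow> complex" where
  "R_term (UC c) \<phi> = (\<lambda>g. c * \<phi> g)"
| "R_term (UG x) \<phi> = (\<lambda>g. vector_derivative (\<lambda>t::real. \<phi> (g ** mexp (t *\<^sub>R sl_mat x))) (at 0))"
| "R_term (UA a b) \<phi> = (\<lambda>g. R_term a \<phi> g + R_term b \<phi> g)"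
| "R_term (UM a b) \<phi> = R_term a (R_term b \<phi>)"

text \<open>On regular functions on \<open>G\<close> the operator does not depend on the chosen representative.\<close>

definition R_op :: "('n::finite) Ug \<Rightarrow> ('n cmat \<Rightarrow> complex) \<Rightarrow> 'n cmat \<Rightarrow> complex" where
  "R_op u = R_term (rep_Ug u)"

definition flag_operator ::
    "nat \<Rightarrow> ('n::finite) matrep \<Rightarrow> (nat \<Rightarrow> 'n Ug) \<Rightarrow> (nat \<Rightarrow> complex) \<Rightarrow>
     ('n cmat \<Rightarrow> complex) \<Rightarrow> 'n cmat \<Rightarrow> complex" where
  "flag_operator d \<rho> p v \<phi> = (\<lambda>g. \<Sum>i<d. mat_act {..<d} (\<rho> (matrix_inv g)) v i * R_op (p i) \<phi> g)"

text \<open>A section of \<open>O(l)\<close>, viewed as a function \<open>\<phi>\<close> on \<open>G\<close>, corresponds to the homogeneous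
  polynomial \<open>q\<close> with \<open>\<phi> g = q (g e)\<close>, where \<open>e\<close> is a fixed spanning vector of the line of \<open>P\<close>.\<close>

definition section_poly :: "complex^'n::finite \<Rightarrow> ('n cmat \<Rightarrow> complex) \<Rightarrow> complex^'n \<Rightarrow> complex" where
  "section_poly e \<phi> = (THE q. q \<in> polynomial_functions vec_coords \<and> (\<forall>g\<in>SL. \<phi> g = q (g *v e)))"

definition partial_deriv :: "'n::finite \<Rightarrow> (complex^'n \<Rightarrow> complex) \<Rightarrow> complex^'n \<Rightarrow> complex" where
  "partial_deriv k q x = deriv (\<lambda>z. q (x + axis k z)) 0"

definition proj_operator ::
    "complex^'n::finite \<Rightarrow> nat \<Rightarrow> ('n list \<Rightarrow> complex) \<Rightarrow> ('n cmat \<Rightarrow> complex) \<Rightarrow> 'n cmat \<Rightarrow> complex" where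
  "proj_operator e m v \<phi> = (\<lambda>g.
     \<Sum>xs | length xs = m. v xs * foldr partial_deriv xs (section_poly e \<phi>) (g *v e))"

definition on_fst3 :: "(('a \<Rightarrow> complex) \<Rightarrow> 'a \<Rightarrow> complex) \<Rightarrow> ('a \<times> 'b \<times> 'c \<Rightarrow> complex) \<Rightarrow> 'a \<times> 'b \<times> 'c \<Rightarrow> complex" where
  "on_fst3 D \<phi> = (\<lambda>(a, b, c). D (\<lambda>a'. \<phi> (a', b, c)) a)"

definition on_snd3 :: "(('b \<Rightarrow> complex) \<Rightarrow> 'b \<Rightarrow> complex) \<Rightarrow> ('a \<times> 'b \<times> 'c \<Rightarrow> complex) \<Rightarrow> 'a \<times> 'b \<times> 'c \<Rightarrow> complex" where
  "on_snd3 D \<phi> = (\<lambda>(a, b, c). D (\<lambda>b'. \<phi> (a, b', c)) b)"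

definition on_trd3 :: "(('c \<Rightarrow> complex) \<Rightarrow> 'c \<Rightarrow> complex) \<Rightarrow> ('a \<times> 'b \<times> 'c \<Rightarrow> complex) \<Rightarrow> 'a \<times> 'b \<times> 'c \<Rightarrow> complex" where
  "on_trd3 D \<phi> = (\<lambda>(a, b, c). D (\<lambda>c'. \<phi> (a, b, c')) c)"

definition unit_vec :: "nat \<Rightarrow> nat \<Rightarrow> complex" where
  "unit_vec i = (\<lambda>k. if k = i then 1 else 0)"

text \<open>The operator \<open>v \<otimes> P\<close> for \<open>v \<in> V\<^sub>\<mu>\<close>: the linear extension is made explicit by
  \<open>v = \<Sum>i j. e\<^sub>i \<otimes> e\<^sub>j \<otimes> v(i, j, _)\<close>, where the last factors lie in \<open>Sym\<^sup>m \<complex>\<^sup>n\<close>.\<close>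

definition V_operator ::
    "(weight \<Rightarrow> nat) \<Rightarrow> (weight \<Rightarrow> ('n::finite) matrep) \<Rightarrow> (nat \<Rightarrow> 'n Ug) \<Rightarrow> (nat \<Rightarrow> 'n Ug) \<Rightarrow> complex^'n \<Rightarrow>
     weight3 \<Rightarrow> 'n tensor \<Rightarrow> ('n cmat \<times> 'n cmat \<times> 'n cmat \<Rightarrow> complex) \<Rightarrow>
     'n cmat \<times> 'n cmat \<times> 'n cmat \<Rightarrow> complex" where
  "V_operator d \<rho> p1 p2 e = (\<lambda>(m1, m2, m) v \<phi> g.
     \<Sum>i<d m1. \<Sum>j<d m2.
       on_fst3 (flag_operator (d m1) (\<rho> m1) p1 (unit_vec i))
         (on_snd3 (flag_operator (d m2) (\<rho> m2) p2 (unit_vec j))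
           (on_trd3 (proj_operator e m (\<lambda>xs. v (i, j, xs))) \<phi>)) g)"

definition b_K ::
    "(weight \<Rightarrow> nat) \<Rightarrow> (weight \<Rightarrow> ('n::finite) matrep) \<Rightarrow> (nat \<Rightarrow> 'n Ug) \<Rightarrow> (nat \<Rightarrow> 'n Ug) \<Rightarrow> complex^'n \<Rightarrow>
     (weight3 \<Rightarrow> 'n tensor) \<Rightarrow> (weight3 \<Rightarrow> 'n tensor) \<Rightarrow> weight3 \<Rightarrow> weight3 \<Rightarrow> complex" where
  "b_K d \<rho> p1 p2 e v vm \<mu> lam = (THE c. \<forall>g\<in>G3.
     V_operator d \<rho> p1 p2 e \<mu> (v \<mu>)
       (V_section d \<rho> (lam \<oplus>\<^sub>w \<mu>) (vm (lam \<oplus>\<^sub>w \<mu>)) (v (lam \<oplus>\<^sub>w \<mu>))) g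
     = c * V_section d \<rho> lam (vm lam) (v lam) g)"

end

theory Submission
  imports Defs "HOL-Complex_Analysis.Conformal_Mappings"
begin

text \<open>In frames adapted to the opposite pairs, \<open>B\<^sub>i\<close> is upper and \<open>B'\<^sub>i\<close> is lower triangular. Weight
  considerations on the big cell show that for \<open>w \<in> V\<^sub>\<mu>\<close> the operator \<open>w \<otimes> P\<close> maps the section of a
  translate \<open>h v\<^sub>-\<^sub>(\<^sub>\<lambda>\<^sub>+\<^sub>\<mu>\<^sub>)\<close>, \<open>h \<in> G\<^sup>3\<close>, to \<open>c \<langle>h v\<^sub>-\<^sub>\<mu>, w\<rangle>\<close> times the section of \<open>h v\<^sub>-\<^sub>\<lambda>\<close>, where \<open>c\<close> depends
  neither on \<open>h\<close> nor on \<open>w\<close>; the case \<open>h = 1\<close>, \<open>w = v\<^sub>\<mu>\<close> gives \<open>c = b\<^sub>K\<close>. Write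
  \<open>u\<^sub>-\<^sub>(\<^sub>\<lambda>\<^sub>+\<^sub>\<mu>\<^sub>) = \<Sum>\<^sub>j a\<^sub>j h\<^sub>j v\<^sub>-\<^sub>(\<^sub>\<lambda>\<^sub>+\<^sub>\<mu>\<^sub>)\<close>. The image of its section under \<open>u\<^sub>\<mu> \<otimes> P\<close> is the section of
  \<open>\<Theta> = c \<Sum>\<^sub>j a\<^sub>j \<langle>h\<^sub>j v\<^sub>-\<^sub>\<mu>, u\<^sub>\<mu>\<rangle> h\<^sub>j v\<^sub>-\<^sub>\<lambda>\<close>, which is invariant and hence, as \<open>X\<close> has an open orbit, a
  multiple of \<open>u\<^sub>-\<^sub>\<lambda>\<close>. The open orbit on \<open>X'\<close> makes \<open>h \<mapsto> \<langle>h v\<^sub>-\<^sub>\<lambda>, u\<^sub>\<lambda>\<rangle>\<close> multiplicative in \<open>\<lambda>\<close>, so pairing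
  \<open>\<Theta>\<close> with \<open>u\<^sub>\<lambda>\<close> gives \<open>c \<langle>u\<^sub>-\<^sub>(\<^sub>\<lambda>\<^sub>+\<^sub>\<mu>\<^sub>), u\<^sub>\<lambda>\<^sub>+\<^sub>\<mu>\<rangle>\<close>. That \<open>\<lambda> + \<mu> \<in> \<Omega>\<close> and that \<open>H \<lambda> \<noteq> 0\<close> both follow
  from positivity of the kernel \<open>(h, g) \<mapsto> \<psi>\<^sub>\<lambda> (h\<^sup>* g)\<close>, where \<open>\<psi>\<^sub>\<lambda>\<close> is the extremal matrix coefficient in
  unitary frames.\<close>

text \<open>Highest weight theory enters only through irreducibility and one vector per flag with
  the prescribed character. Multiplicity one, uniqueness of highest weight lines and the shape of
  extremal coefficients are rederived by two analytic devices: a polynomial on \<open>SL\<close>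
  that vanishes on the big cell vanishes, and a torus-invariant value at a unipotent element equals
  the value at 1, because a one-parameter subgroup contracts the element to 1. The operators become
  algebra, since right differentiation of a matrix coefficient acts on its vector.

  Closure of \<Omega> under addition must come before \<open>um\<close> and \<open>u\<close> mean
  anything at \<lambda> + \<mu>, and H \<lambda> \<noteq> 0 before the quotient can be cleared. Both
  are semisimplicity statements; positivity of a kernel takes the place of complete reducibility.

  The Cartan subalgebra chosen for a generator need not be the one of the opposite pair, and unitary
  frames are a third choice. All frames of one flag give the same weight character, which is what
  lets the results be combined.\<close>

section \<open>Spans and separating functionals in coordinate spaces\<close>

inductive_set cspan :: "('i \<Rightarrow> complex) set \<Rightarrow> ('i \<Rightarrow> complex) set" for S where
  zero: "(\<lambda>_. 0) \<in> cspan S"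
| step: "u \<in> cspan S \<Longrightarrow> s \<in> S \<Longrightarrow> (\<lambda>i. u i + c * s i) \<in> cspan S"

lemma cspan_base: "s \<in> S \<Longrightarrow> s \<in> cspan S"
  using cspan.step[OF cspan.zero, of s S 1] by simp

lemma cspan_add_scaled:
  assumes "u \<in> cspan S" "w \<in> cspan S"
  shows "(\<lambda>i. u i + c * w i) \<in> cspan S"
  using assms(2)
proof induction
  case zero
  then show ?case using assms(1) by simp
next
  case (step w s c')
  from cspan.step[OF step.IH step.hyps(2), of "c * c'"] show ?case
    by (simp add: algebra_simps)
qed

lemma cspan_sum_representation:
  assumes "u \<in> cspan S"
  shows "\<exists>(n::nat) a s. (\<forall>j<n. s j \<in> S) \<and> u = (\<lambda>i. \<Sum>j<n. a j * s j i)"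
  using assms
proof induction
  case zero
  show ?case by (rule exI[of _ 0]) simp
next
  case (step u s c)
  then obtain n :: nat and a t where t: "\<forall>j<n. t j \<in> S" "u = (\<lambda>i. \<Sum>j<n. a j * t j i)"
    by blast
  have "(\<lambda>i. u i + c * s i) = (\<lambda>i. \<Sum>j<Suc n. (a(n := c)) j * (t(n := s)) j i)"
    using t(2) by (auto intro!: ext sum.cong)
  moreover have "\<forall>j<Suc n. (t(n := s)) j \<in> S" using t(1) step.hyps(2) by auto
  ultimately show ?case by blast
qed

lemma cspan_sum_indexed:
  assumes "u \<in> cspan (\<phi> ` A)"
  shows "\<exists>(n::nat) a g. (\<forall>j<n. g j \<in> A) \<and> u = (\<lambda>i. \<Sum>j<n. a j * \<phi> (g j) i)"
proof -
  obtain n :: nat and a s where s: "\<forall>j<n. s j \<in> \<phi> ` A" "u = (\<lambda>i. \<Sum>j<n. a j * s j i)"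
    using cspan_sum_representation[OF assms] by blast
  then have "\<forall>j. \<exists>g. j < n \<longrightarrow> g \<in> A \<and> s j = \<phi> g" by blast
  then obtain g where g: "\<forall>j. j < n \<longrightarrow> g j \<in> A \<and> s j = \<phi> (g j)" by metis
  then have "u = (\<lambda>i. \<Sum>j<n. a j * \<phi> (g j) i)"
    unfolding s(2) by (auto intro!: ext sum.cong)
  then show ?thesis using g by blast
qed

lemma cspace_zero_outside: "v \<in> cspace I \<Longrightarrow> i \<notin> I \<Longrightarrow> v i = 0"
  by (simp add: cspace_def)

lemma cspan_subset_cspace: "S \<subseteq> cspace I \<Longrightarrow> cspan S \<subseteq> cspace I"
proof
  fix u assume S: "S \<subseteq> cspace I" and "u \<in> cspan S"
  from this(2) show "u \<in> cspace I"
    by induction (use S in \<open>auto simp: cspace_def\<close>)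
qed

text \<open>Induction on the index set, eliminating the coordinate \<open>a\<close>. If all of
  \<open>U\<close> vanishes at \<open>a\<close>, either \<open>w\<close> does too or the coordinate
  \<open>a\<close> itself separates. Otherwise some \<open>u0\<close> in \<open>U\<close> has
  \<open>u0 a = 1\<close>, and subtracting multiples of \<open>u0\<close> reduces \<open>U\<close>
  and \<open>w\<close> to the smaller index set.\<close>

lemma separation_subspace:
  assumes "finite I"
    and "U \<subseteq> cspace I" "(\<lambda>_. 0) \<in> U" "\<And>u u' c. u \<in> U \<Longrightarrow> u' \<in> U \<Longrightarrow> (\<lambda>i. u i + c * u' i) \<in> U"
    and "w \<in> cspace I" "w \<notin> U"
  shows "\<exists>x\<in>cspace I. (\<forall>u\<in>U. pairing I u x = 0) \<and> pairing I w x \<noteq> 0"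
  using assms
proof (induction I arbitrary: U w rule: finite_induct)
  case empty
  then have "w = (\<lambda>_. 0)" by (auto simp: cspace_def)
  with empty show ?case by simp
next
  case (insert a I)
  have pair: "pairing (insert a I) u x = u a * x a + pairing I u x" for u x
    using insert.hyps by (simp add: pairing_def)
  define U' where "U' = {u \<in> U. u a = 0}"
  have U': "U' \<subseteq> cspace I" "(\<lambda>_. 0) \<in> U'"
    "\<And>u u' c. u \<in> U' \<Longrightarrow> u' \<in> U' \<Longrightarrow> (\<lambda>i. u i + c * u' i) \<in> U'"
  proof -
    show "U' \<subseteq> cspace I"
    proof
      fix u assume u: "u \<in> U'"
      then have "u \<in> cspace (insert a I)" "u a = 0" using insert.prems(1) by (auto simp: U'_def)
      then show "u \<in> cspace I" unfolding cspace_def by force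
    qed
  qed (use insert.prems(2,3) in \<open>auto simp: U'_def\<close>)
  have pI: "pairing I u (x(a := z)) = pairing I u x" for u x z
    unfolding pairing_def by (rule sum.cong) (use insert.hyps in auto)
  show ?case
  proof (cases "\<forall>u\<in>U. u a = 0")
    case True
    show ?thesis
    proof (cases "w a = 0")
      case True
      then have "w \<in> cspace I" "w \<notin> U'" using insert.prems(4,5) by (auto simp: cspace_def U'_def)
      from insert.IH[OF U' this] obtain x where
        x: "x \<in> cspace I" "\<forall>u\<in>U'. pairing I u x = 0" "pairing I w x \<noteq> 0" by blast
      have "U = U'" using \<open>\<forall>u\<in>U. u a = 0\<close> by (auto simp: U'_def)
      with x True \<open>\<forall>u\<in>U. u a = 0\<close> show ?thesis
        by (intro bexI[of _ x]) (auto simp: pair cspace_def)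
    next
      case False
      have "pairing I u (\<lambda>i. if i = a then 1 else 0) = 0" for u
        unfolding pairing_def by (rule sum.neutral) (use insert.hyps in auto)
      with False True show ?thesis
        by (intro bexI[of _ "\<lambda>i. if i = a then 1 else 0"]) (auto simp: pair cspace_def)
    qed
  next
    case False
    then obtain u1 where u1: "u1 \<in> U" "u1 a \<noteq> 0" by blast
    define u0 where "u0 = (\<lambda>i. 0 + inverse (u1 a) * u1 i)"
    have u0: "u0 \<in> U" "u0 a = 1"
      using insert.prems(3)[OF insert.prems(2) u1(1), of "inverse (u1 a)"] u1(2)
      by (auto simp: u0_def)
    define w' where "w' = (\<lambda>i. w i + (- w a) * u0 i)"
    have w': "w' \<in> cspace I"
    proof -
      have "u0 \<in> cspace (insert a I)" using insert.prems(1) u0(1) by blast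
      then have "w' i = 0" if "i \<notin> I" for i
        using insert.prems(4) u0(2) that by (cases "i = a") (auto simp: w'_def cspace_def)
      then show ?thesis by (simp add: cspace_def)
    qed
    have "w' \<notin> U'"
    proof
      assume "w' \<in> U'"
      then have "w' \<in> U" by (simp add: U'_def)
      from insert.prems(3)[OF this u0(1), of "w a"] have "w \<in> U" by (simp add: w'_def)
      with insert.prems(5) show False by simp
    qed
    from insert.IH[OF U' w' this] obtain x where
      x: "x \<in> cspace I" "\<forall>u\<in>U'. pairing I u x = 0" "pairing I w' x \<noteq> 0" by blast
    \<comment> \<open>The new coordinate is the one that makes the lifted functional annihilate
      \<open>u0\<close>.\<close>
    define y where "y = x(a := - pairing I u0 x)"
    have p: "pairing (insert a I) u y = pairing I (\<lambda>i. u i + (- u a) * u0 i) x" for u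
      unfolding pair y_def pI
      by (simp add: pairing_def algebra_simps sum_subtractf sum_distrib_left)
    have "pairing (insert a I) u y = 0" if "u \<in> U" for u
    proof -
      have "(\<lambda>i. u i + (- u a) * u0 i) \<in> U'"
        using insert.prems(3)[OF that u0(1), of "- u a"] u0(2) by (simp add: U'_def)
      with x(2) show ?thesis unfolding p by blast
    qed
    moreover have "pairing (insert a I) w y \<noteq> 0"
      using x(3) unfolding p w'_def .
    moreover have "y \<in> cspace (insert a I)" using x(1) by (auto simp: y_def cspace_def)
    ultimately show ?thesis by blast
  qed
qed

lemma separation:
  assumes "finite I" "S \<subseteq> cspace I" "w \<in> cspace I" "w \<notin> cspan S"
  shows "\<exists>x\<in>cspace I. (\<forall>s\<in>S. pairing I s x = 0) \<and> pairing I w x \<noteq> 0"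
proof -
  from separation_subspace[OF assms(1) cspan_subset_cspace[OF assms(2)] cspan.zero
      cspan_add_scaled assms(3,4)]
  show ?thesis using cspan_base by (metis (no_types, lifting))
qed

text \<open>Separates the last coordinate vector from the graph of \<open>f\<close>.\<close>

lemma functional_from_relations:
  fixes vec :: "'g \<Rightarrow> 'i \<Rightarrow> complex"
  assumes "finite I" "\<And>g. g \<in> A \<Longrightarrow> vec g \<in> cspace I"
    and rel: "\<And>(n::nat) c g. (\<forall>j<n. g j \<in> A) \<Longrightarrow> (\<forall>i. (\<Sum>j<n. c j * vec (g j) i) = 0) \<Longrightarrow>
      (\<Sum>j<n. c j * f (g j)) = 0"
  shows "\<exists>w\<in>cspace I. \<forall>g\<in>A. pairing I w (vec g) = f g"
proof -
  define J where "J = insert None (Some ` I)"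
  define S where "S = (\<lambda>g. case_option (f g) (vec g)) ` A"
  have fin: "finite J" using assms(1) by (simp add: J_def)
  have S: "S \<subseteq> cspace J"
    using assms(2) by (force simp: S_def J_def cspace_def split: option.split)
  define w0 :: "'i option \<Rightarrow> complex" where "w0 = case_option 1 (\<lambda>_. 0)"
  have w0: "w0 \<in> cspace J" by (auto simp: w0_def J_def cspace_def split: option.split)
  \<comment> \<open>An element of the span whose ordinary coordinates all vanish is a linear
    relation between the vectors \<open>vec g\<close>; by \<open>rel\<close> its last coordinate is
    then 0, whereas that of \<open>w0\<close> is 1.\<close>
  have "w0 \<notin> cspan S"
  proof
    assume "w0 \<in> cspan S"
    from cspan_sum_indexed[OF this[unfolded S_def]]
    obtain n :: nat and c g where g: "\<forall>j<n. g j \<in> A"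
      and w: "w0 = (\<lambda>i. \<Sum>j<n. c j * case_option (f (g j)) (vec (g j)) i)" by blast
    have "\<forall>i. (\<Sum>j<n. c j * vec (g j) i) = 0"
    proof
      fix i
      have "w0 (Some i) = (\<Sum>j<n. c j * vec (g j) i)" unfolding w by simp
      then show "(\<Sum>j<n. c j * vec (g j) i) = 0" by (simp add: w0_def)
    qed
    from rel[OF g this] have "w0 None = 0" unfolding w by simp
    then show False by (simp add: w0_def)
  qed
  from separation[OF fin S w0 this] obtain x where
    x: "\<forall>s\<in>S. pairing J s x = 0" "pairing J w0 x \<noteq> 0" by blast
  have pair: "pairing J s x = s None * x None + (\<Sum>i\<in>I. s (Some i) * x (Some i))" for s
    using assms(1) by (simp add: pairing_def J_def sum.reindex)
  have x0: "x None \<noteq> 0" using x(2) by (simp add: pair w0_def)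
  define w where "w = (\<lambda>i. if i \<in> I then - x (Some i) / x None else 0)"
  have "pairing I w (vec g) = f g" if "g \<in> A" for g
  proof -
    have "f g * x None + (\<Sum>i\<in>I. vec g i * x (Some i)) = 0"
      using x(1) that unfolding pair S_def by force
    then have "f g = - (\<Sum>i\<in>I. vec g i * x (Some i)) / x None"
      using x0 by (simp add: field_simps add_eq_0_iff)
    also have "\<dots> = pairing I w (vec g)"
      by (simp add: pairing_def w_def sum_negf[symmetric] sum_divide_distrib mult.commute)
    finally show ?thesis by simp
  qed
  moreover have "w \<in> cspace I" by (simp add: w_def cspace_def)
  ultimately show ?thesis by blast
qed

section \<open>Inverses in \<open>SL\<close> and change of basis\<close>

lemma matrix_inv_both:
  fixes A :: "('n::finite) cmat"
  assumes "invertible A"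
  shows "A ** matrix_inv A = mat 1" "matrix_inv A ** A = mat 1"
proof -
  from assms obtain B where "A ** B = mat 1 \<and> B ** A = mat 1" unfolding invertible_def by blast
  then have "A ** matrix_inv A = mat 1 \<and> matrix_inv A ** A = mat 1"
    unfolding matrix_inv_def by (rule someI)
  then show "A ** matrix_inv A = mat 1" "matrix_inv A ** A = mat 1" by auto
qed

lemma matrix_inv_eqI:
  fixes A :: "('n::finite) cmat"
  assumes "A ** B = mat 1" shows "matrix_inv A = B" "invertible A"
proof -
  have BA: "B ** A = mat 1" using assms matrix_left_right_inverse by blast
  then show inv: "invertible A" using assms unfolding invertible_def by blast
  have "matrix_inv A = matrix_inv A ** (A ** B)" by (simp add: assms)
  also have "\<dots> = B" unfolding matrix_mul_assoc matrix_inv_both(2)[OF inv] by simp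
  finally show "matrix_inv A = B" .
qed

lemma SL_invertible: "g \<in> SL \<Longrightarrow> invertible g"
  by (simp add: SL_def invertible_det_nz)

lemma SL_inv: "g \<in> SL \<Longrightarrow> g ** matrix_inv g = mat 1" "g \<in> SL \<Longrightarrow> matrix_inv g ** g = mat 1"
  using SL_invertible matrix_inv_both by blast+

lemma SL_one [simp]: "mat 1 \<in> SL" by (simp add: SL_def)

lemma SL_mult [simp]: "g \<in> SL \<Longrightarrow> h \<in> SL \<Longrightarrow> g ** h \<in> SL" by (simp add: SL_def det_mul)

lemma SL_inverse [simp]: "g \<in> SL \<Longrightarrow> matrix_inv g \<in> SL"
  using arg_cong[OF SL_inv(1), of g det] by (simp add: SL_def det_mul)

lemma matrix_inv_mult_SL: "g \<in> SL \<Longrightarrow> h \<in> SL \<Longrightarrow> matrix_inv (g ** h) = matrix_inv h ** matrix_inv g"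
  by (rule matrix_inv_eqI) (metis SL_inv(1) matrix_mul_assoc matrix_mul_rid)

lemma matrix_inv_inv_SL: "g \<in> SL \<Longrightarrow> matrix_inv (matrix_inv g) = g"
  by (rule matrix_inv_eqI) (rule SL_inv(2))

lemma matrix_inv_one [simp]: "matrix_inv (mat 1 :: ('n::finite) cmat) = mat 1"
  by (rule matrix_inv_eqI) simp

lemma transpose_SL: "g \<in> SL \<Longrightarrow> transpose g \<in> SL" by (simp add: SL_def det_transpose)

text \<open>With the columns of \<open>p\<close> as a basis, \<open>conj_from p M\<close> is the
  matrix of the endomorphism \<open>M\<close> in that basis, and \<open>conj_to p\<close> is the way
  back.\<close>

definition conj_to :: "('n::finite) cmat \<Rightarrow> 'n cmat \<Rightarrow> 'n cmat" where
  "conj_to p M = p ** M ** matrix_inv p"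

definition conj_from :: "('n::finite) cmat \<Rightarrow> 'n cmat \<Rightarrow> 'n cmat" where
  "conj_from p M = matrix_inv p ** M ** p"

context
  fixes p :: "('n::finite) cmat" assumes p: "invertible p"
begin

lemma conj_from_to: "conj_from p (conj_to p M) = M"
proof -
  have "conj_from p (conj_to p M) = (matrix_inv p ** p) ** M ** (matrix_inv p ** p)"
    by (simp only: conj_to_def conj_from_def matrix_mul_assoc)
  then show ?thesis using matrix_inv_both[OF p] by simp
qed

lemma conj_to_from: "conj_to p (conj_from p M) = M"
proof -
  have "conj_to p (conj_from p M) = (p ** matrix_inv p) ** M ** (p ** matrix_inv p)"
    by (simp only: conj_to_def conj_from_def matrix_mul_assoc)
  then show ?thesis using matrix_inv_both[OF p] by simp
qed

lemma conj_to_mult: "conj_to p (A ** B) = conj_to p A ** conj_to p B"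
proof -
  have "conj_to p A ** conj_to p B = p ** A ** (matrix_inv p ** p) ** B ** matrix_inv p"
    by (simp only: conj_to_def matrix_mul_assoc)
  then show ?thesis using matrix_inv_both[OF p] by (simp add: conj_to_def matrix_mul_assoc)
qed

lemma conj_from_mult: "conj_from p (A ** B) = conj_from p A ** conj_from p B"
proof -
  have "conj_from p A ** conj_from p B = matrix_inv p ** A ** (p ** matrix_inv p) ** B ** p"
    by (simp only: conj_from_def matrix_mul_assoc)
  then show ?thesis using matrix_inv_both[OF p] by (simp add: conj_from_def matrix_mul_assoc)
qed

lemma det_matrix_inv: "det (matrix_inv p) * det p = 1"
  using arg_cong[OF matrix_inv_both(2)[OF p], of det] by (simp add: det_mul)

lemma det_conj_from: "det (conj_from p M) = det M"
  using det_matrix_inv by (simp add: conj_from_def det_mul algebra_simps)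

lemma det_conj_to: "det (conj_to p M) = det M"
  using det_matrix_inv by (simp add: conj_to_def det_mul algebra_simps)

lemma conj_to_one: "conj_to p (mat 1) = mat 1"
  using matrix_inv_both[OF p] by (simp add: conj_to_def)

lemma conj_from_one: "conj_from p (mat 1) = mat 1"
  using matrix_inv_both[OF p] by (simp add: conj_from_def)

end

subsection \<open>Polynomial functions and analytic continuation on \<open>SL\<close>\<close>

definition triple_coords :: "(('n::finite) cmat \<times> 'n cmat \<times> 'n cmat \<Rightarrow> complex) set" where
  "triple_coords = {\<lambda>(a, b, c). a $ i $ j | i j. True} \<union> {\<lambda>(a, b, c). b $ i $ j | i j. True} \<union>
    {\<lambda>(a, b, c). c $ i $ j | i j. True}"

lemma polynomial_functions_sum:
  "finite A \<Longrightarrow> (\<And>a. a \<in> A \<Longrightarrow> f a \<in> polynomial_functions X) \<Longrightarrow>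
    (\<lambda>x. \<Sum>a\<in>A. f a x) \<in> polynomial_functions X"
  by (induction A rule: finite_induct) (auto intro: polynomial_functions.intros)

lemma polynomial_functions_prod:
  "finite A \<Longrightarrow> (\<And>a. a \<in> A \<Longrightarrow> f a \<in> polynomial_functions X) \<Longrightarrow>
    (\<lambda>x. \<Prod>a\<in>A. f a x) \<in> polynomial_functions X"
  by (induction A rule: finite_induct) (auto intro: polynomial_functions.intros)

lemma polynomial_functions_prod_list:
  "(\<And>a. f a \<in> polynomial_functions X) \<Longrightarrow>
    (\<lambda>x. prod_list (map (\<lambda>a. f a x) as)) \<in> polynomial_functions X"
  by (induction as) (auto intro: polynomial_functions.intros)

lemma polynomial_functions_cmult:
  "f \<in> polynomial_functions X \<Longrightarrow> (\<lambda>x. c * f x) \<in> polynomial_functions X"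
  by (auto intro: polynomial_functions.intros)

lemma polynomial_functions_diff:
  "f \<in> polynomial_functions X \<Longrightarrow> g \<in> polynomial_functions X \<Longrightarrow>
    (\<lambda>x. f x - g x) \<in> polynomial_functions X"
  using polynomial_functions.add[OF _ polynomial_functions_cmult[of g X "-1"], of f] by simp

lemma polynomial_functions_compose:
  assumes "f \<in> polynomial_functions X" "\<And>c. c \<in> X \<Longrightarrow> (\<lambda>y. c (\<phi> y)) \<in> polynomial_functions Y"
  shows "(\<lambda>y. f (\<phi> y)) \<in> polynomial_functions Y"
  using assms(1) by induction (auto intro: polynomial_functions.intros assms(2))

lemma polynomial_functions_holomorphic:
  assumes "f \<in> polynomial_functions X" "\<And>c. c \<in> X \<Longrightarrow> (\<lambda>z. c (\<gamma> z)) holomorphic_on S"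
  shows "(\<lambda>z. f (\<gamma> z)) holomorphic_on S"
  using assms(1) by induction (simp_all add: assms(2) holomorphic_on_add holomorphic_on_mult)

lemma polynomial_functions_continuous:
  assumes "f \<in> polynomial_functions X" "\<And>c. c \<in> X \<Longrightarrow> continuous_on S c"
  shows "continuous_on S f"
  using assms(1) by induction (simp_all add: assms(2) continuous_on_add continuous_on_mult)

lemma mat_coords_continuous: "f \<in> polynomial_functions mat_coords \<Longrightarrow> continuous_on S f"
  by (erule polynomial_functions_continuous) (auto simp: mat_coords_def intro!: continuous_intros)

text \<open>The plane minus a finite set is connected, so a holomorphic function vanishing near 0
  also vanishes at 1; near 0 the curve stays inside \<open>U\<close>. The exceptional set
  \<open>K\<close> leaves room for poles of the curve.\<close>

lemma identity_along_path:
  fixes \<gamma> :: "complex \<Rightarrow> 'a::topological_space"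
  assumes f: "f \<in> polynomial_functions X"
    and K: "finite K" "0 \<notin> K" "1 \<notin> K"
    and hol: "\<And>c. c \<in> X \<Longrightarrow> (\<lambda>z. c (\<gamma> z)) holomorphic_on (- K)"
    and cont: "continuous_on (- K) \<gamma>" and T: "\<And>z. z \<notin> K \<Longrightarrow> \<gamma> z \<in> T"
    and U: "openin (top_of_set T) U" "\<gamma> 0 \<in> U" "\<And>u. u \<in> U \<Longrightarrow> f u = 0"
  shows "f (\<gamma> 1) = 0"
proof -
  have op: "open (- K)" using K(1) by (simp add: finite_imp_closed open_Compl)
  have conn: "connected (- K)"
    using connected_open_delete_finite[of "UNIV :: complex set" K] K(1)
    by (simp add: Compl_eq_Diff_UNIV connected_UNIV)
  obtain V where V: "open V" "U = T \<inter> V" using U(1) by (auto simp: openin_open)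
  define s where "s = - K \<inter> \<gamma> -` V"
  have s: "open s" unfolding s_def using cont op V(1) 
    by (simp add: continuous_on_open_vimage Int_commute)
  show ?thesis
  proof (rule analytic_continuation_open[where f = "\<lambda>z. f (\<gamma> z)" and g = "\<lambda>_. 0", OF s op _ conn])
    show "s \<noteq> {}" using K(2) U(2) V(2) by (auto simp: s_def)
    show "(\<lambda>z. f (\<gamma> z)) holomorphic_on - K"
      by (rule polynomial_functions_holomorphic[OF f hol])
    show "f (\<gamma> z) = 0" if "z \<in> s" for z
      using that T V(2) U(3) by (auto simp: s_def)
  qed (use K(3) in \<open>auto simp: s_def\<close>)
qed

text \<open>The path is the segment from \<open>x\<close> to \<open>g\<close>, with one row divided by the determinant.\<close>

lemma SL_path:
  fixes x g :: "('n::finite) cmat"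
  assumes x: "x \<in> SL" and g: "g \<in> SL"
  shows "\<exists>K \<gamma>. finite K \<and> 0 \<notin> K \<and> 1 \<notin> K \<and> \<gamma> 0 = x \<and> \<gamma> 1 = g \<and> (\<forall>z. z \<notin> K \<longrightarrow> \<gamma> z \<in> SL) \<and>
    (\<forall>i j. (\<lambda>z. \<gamma> z $ i $ j) holomorphic_on (- K)) \<and> continuous_on (- K) \<gamma>"
proof -
  define A :: "complex \<Rightarrow> 'n cmat" where "A z = (\<chi> i j. x $ i $ j + z * (g $ i $ j - x $ i $ j))" for z
  \<comment> \<open>The determinant along the segment, as a polynomial in the parameter. It takes
    the value 1 at both ends, so it is nonzero and its finitely many roots avoid 0 and 1.\<close>
  define q where "q = det (\<chi> i j. [:x $ i $ j, g $ i $ j - x $ i $ j:] :: complex poly^'n^'n)"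
  have q: "det (A z) = poly q z" for z
    by (simp add: q_def det_def A_def poly_sum poly_prod mult.commute)
  define K where "K = {z. poly q z = 0}"
  define k0 :: 'n where "k0 = undefined"
  define \<gamma> :: "complex \<Rightarrow> 'n cmat"
    where "\<gamma> z = (\<chi> i. if i = k0 then (1 / det (A z)) *s (A z $ i) else A z $ i)" for z
  have A01: "A 0 = x" "A 1 = g" by (simp_all add: A_def vec_eq_iff)
  have det01: "det (A 0) = 1" "det (A 1) = 1" using x g by (simp_all add: A01 SL_def)
  have "q \<noteq> 0" using q[of 0] det01 by auto
  then have K: "finite K" "0 \<notin> K" "1 \<notin> K"
    using q[of 0] q[of 1] det01 by (auto simp: K_def poly_roots_finite)
  have \<gamma>01: "\<gamma> 0 = x" "\<gamma> 1 = g" using x g by (simp_all add: \<gamma>_def det01 A01 vec_eq_iff SL_def)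
  have SL: "\<gamma> z \<in> SL" if "z \<notin> K" for z
  proof -
    have "det (\<gamma> z) = 1 / det (A z) * det (\<chi> i. if i = k0 then A z $ i else A z $ i)"
      unfolding \<gamma>_def by (rule det_row_mul)
    also have "(\<chi> i. if i = k0 then A z $ i else A z $ i) = A z" by (simp add: vec_eq_iff)
    finally show ?thesis using that q[of z] by (simp add: SL_def K_def)
  qed
  have hol: "(\<lambda>z. \<gamma> z $ i $ j) holomorphic_on - K" for i j
    unfolding \<gamma>_def q by (cases "i = k0") (auto simp: A_def K_def intro!: holomorphic_intros)
  have "continuous_on (- K) (\<lambda>z. \<chi> i j. \<gamma> z $ i $ j)"
    by (intro continuous_on_vec_lambda holomorphic_on_imp_continuous_on hol)
  then have "continuous_on (- K) \<gamma>" by simp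
  with K \<gamma>01 SL hol show ?thesis by blast
qed

text \<open>Irreducibility of \<open>SL\<close> in analytic form: a nonempty set that is open for
  the classical topology is Zariski dense, because every \<open>g\<close> is joined to a point of it
  by a punctured holomorphic curve.\<close>

lemma identity_SL:
  assumes f: "f \<in> polynomial_functions mat_coords"
    and U: "openin (top_of_set SL) U" "x \<in> U" "\<And>u. u \<in> U \<Longrightarrow> f u = 0" and g: "g \<in> SL"
  shows "f g = 0"
proof -
  have "x \<in> SL" using U(1,2) openin_subset by fastforce
  from SL_path[OF this g] obtain K \<gamma> where K: "finite K" "0 \<notin> K" "1 \<notin> K"
    and \<gamma>: "\<gamma> 0 = x" "\<gamma> 1 = g" "\<forall>z. z \<notin> K \<longrightarrow> \<gamma> z \<in> SL"
      "\<forall>i j. (\<lambda>z. \<gamma> z $ i $ j) holomorphic_on (- K)" "continuous_on (- K) \<gamma>" by blast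
  have "f (\<gamma> 1) = 0"
    by (rule identity_along_path[OF f K _ \<gamma>(5) _ U(1)])
      (use \<gamma> U in \<open>auto simp: mat_coords_def\<close>)
  then show ?thesis by (simp add: \<gamma>)
qed

lemma identity_G3:
  assumes f: "f \<in> polynomial_functions triple_coords"
    and U: "openin (top_of_set G3) U" "x \<in> U" "\<And>u. u \<in> U \<Longrightarrow> f u = 0" and g: "g \<in> G3"
  shows "f g = 0"
proof -
  have "x \<in> G3" using U(1,2) openin_subset by fastforce
  then obtain x1 x2 x3 where x: "x = (x1, x2, x3)" "x1 \<in> SL" "x2 \<in> SL" "x3 \<in> SL"
    by (auto simp: G3_def)
  from g obtain g1 g2 g3 where g': "g = (g1, g2, g3)" "g1 \<in> SL" "g2 \<in> SL" "g3 \<in> SL"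
    by (auto simp: G3_def)
  from SL_path[OF x(2) g'(2)] obtain K1 \<gamma>1 where 1: "finite K1" "0 \<notin> K1" "1 \<notin> K1"
    "\<gamma>1 0 = x1" "\<gamma>1 1 = g1" "\<forall>z. z \<notin> K1 \<longrightarrow> \<gamma>1 z \<in> SL"
    "\<forall>i j. (\<lambda>z. \<gamma>1 z $ i $ j) holomorphic_on (- K1)" "continuous_on (- K1) \<gamma>1" by blast
  from SL_path[OF x(3) g'(3)] obtain K2 \<gamma>2 where 2: "finite K2" "0 \<notin> K2" "1 \<notin> K2"
    "\<gamma>2 0 = x2" "\<gamma>2 1 = g2" "\<forall>z. z \<notin> K2 \<longrightarrow> \<gamma>2 z \<in> SL"
    "\<forall>i j. (\<lambda>z. \<gamma>2 z $ i $ j) holomorphic_on (- K2)" "continuous_on (- K2) \<gamma>2" by blast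
  from SL_path[OF x(4) g'(4)] obtain K3 \<gamma>3 where 3: "finite K3" "0 \<notin> K3" "1 \<notin> K3"
    "\<gamma>3 0 = x3" "\<gamma>3 1 = g3" "\<forall>z. z \<notin> K3 \<longrightarrow> \<gamma>3 z \<in> SL"
    "\<forall>i j. (\<lambda>z. \<gamma>3 z $ i $ j) holomorphic_on (- K3)" "continuous_on (- K3) \<gamma>3" by blast
  define K where "K = K1 \<union> K2 \<union> K3"
  define \<gamma> where "\<gamma> z = (\<gamma>1 z, \<gamma>2 z, \<gamma>3 z)" for z
  have sub: "- K \<subseteq> - K1" "- K \<subseteq> - K2" "- K \<subseteq> - K3" by (auto simp: K_def)
  have "f (\<gamma> 1) = 0"
  proof (rule identity_along_path[OF f, of K \<gamma> G3 U])
    show "continuous_on (- K) \<gamma>" unfolding \<gamma>_def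
      by (intro continuous_intros continuous_on_subset[OF 1(8) sub(1)]
          continuous_on_subset[OF 2(8) sub(2)] continuous_on_subset[OF 3(8) sub(3)])
    show "(\<lambda>z. c (\<gamma> z)) holomorphic_on - K" if "c \<in> triple_coords" for c
      using that 1(7) 2(7) 3(7) holomorphic_on_subset sub
      unfolding triple_coords_def \<gamma>_def by fastforce
  qed (use 1 2 3 U x in \<open>auto simp: K_def \<gamma>_def G3_def\<close>)
  then show ?thesis by (simp add: \<gamma>_def g' 1 2 3)
qed

section \<open>Triangular matrices\<close>

text \<open>\<open>upr r\<close> is upper triangularity with respect to the order on the index type given by an
  injective \<open>r\<close>. Taking \<open>r = up\<close> and \<open>r = down\<close> treats a Borel subgroup and its opposite alike.\<close>

definition pos :: "'n::finite \<Rightarrow> nat" where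
  "pos = (SOME f. bij_betw f UNIV {..<CARD('n)})"

definition up :: "'n::finite \<Rightarrow> int" where "up k = int (pos k)"
definition down :: "'n::finite \<Rightarrow> int" where "down k = - int (pos k)"

definition upr :: "('n::finite \<Rightarrow> int) \<Rightarrow> 'n cmat \<Rightarrow> bool" where
  "upr r M \<longleftrightarrow> (\<forall>a b. r b < r a \<longrightarrow> M $ a $ b = 0)"

definition dmat :: "('n::finite \<Rightarrow> complex) \<Rightarrow> 'n cmat" where
  "dmat d = (\<chi> i j. if i = j then d i else 0)"

lemma pos_bij: "bij_betw (pos :: 'n::finite \<Rightarrow> nat) UNIV {..<CARD('n)}"
proof -
  have "\<exists>f. bij_betw f (UNIV :: 'n set) {..<CARD('n)}"
    using ex_bij_betw_finite_nat[of "UNIV :: 'n set"] by (simp add: atLeast0LessThan)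
  then show ?thesis unfolding pos_def by (rule someI_ex)
qed

lemma pos_eq [simp]: "pos a = pos b \<longleftrightarrow> a = b"
  using pos_bij by (auto simp: bij_betw_def inj_on_def)

lemma pos_less: "pos (k::'n::finite) < CARD('n)"
  using bij_betwE[OF pos_bij] by auto

lemma pos_surj: "i < CARD('n::finite) \<Longrightarrow> \<exists>k::'n. pos k = i"
  using pos_bij unfolding bij_betw_def by (metis imageE lessThan_iff)

lemma inj_up: "inj up" by (auto simp: inj_def up_def)
lemma inj_down: "inj down" by (auto simp: inj_def down_def)

lemma mm_entry: "(A ** B) $ i $ j = (\<Sum>k\<in>UNIV. A $ i $ k * B $ k $ j)"
  by (simp add: matrix_matrix_mult_def)

lemma mat_entry: "(mat c :: ('n::finite) cmat) $ i $ j = (if i = j then c else 0)"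
  by (simp add: mat_def)

lemma dmat_mult_entry: "(dmat d ** M) $ i $ j = d i * M $ i $ j"
  "(M ** dmat d) $ i $ j = M $ i $ j * d j"
  by (simp_all add: mm_entry dmat_def if_distrib[of "\<lambda>x. x * _"] if_distrib[of "\<lambda>x. _ * x"]
      cong: if_cong)

lemma dmat_mult: "dmat a ** dmat b = dmat (\<lambda>k. a k * b k)"
  by (simp add: vec_eq_iff dmat_mult_entry) (simp add: dmat_def)

lemma dmat_one: "dmat (\<lambda>_. 1) = mat 1" by (simp add: dmat_def mat_def vec_eq_iff)

text \<open>A permutation with nonzero contribution satisfies
  \<open>r i \<le> r (\<sigma> i)\<close> for all \<open>i\<close>. The two sides have the same sum
  over \<open>i\<close>, so equality holds throughout and injectivity of \<open>r\<close> leaves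
  only the identity.\<close>

lemma det_upr:
  assumes "inj r" "upr r M"
  shows "det M = (\<Prod>k\<in>UNIV. M $ k $ k)"
proof -
  have "(\<Prod>i\<in>UNIV. M $ i $ \<sigma> i) = 0" if "\<sigma> permutes UNIV" "\<sigma> \<noteq> id" for \<sigma>
  proof (rule ccontr)
    assume "(\<Prod>i\<in>UNIV. M $ i $ \<sigma> i) \<noteq> 0"
    then have "M $ i $ \<sigma> i \<noteq> 0" for i by auto
    then have le: "r i \<le> r (\<sigma> i)" for i using assms(2) unfolding upr_def by (meson not_le)
    have "(\<Sum>i\<in>UNIV. r (\<sigma> i)) = (\<Sum>i\<in>UNIV. r i)"
      by (rule sum.reindex_bij_betw) (rule permutes_imp_bij[OF that(1)])
    then have "(\<Sum>i\<in>UNIV. r (\<sigma> i) - r i) = 0" by (simp add: sum_subtractf)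
    then have "r (\<sigma> i) - r i = 0" for i
      using sum_nonneg_eq_0_iff[of UNIV "\<lambda>i. r (\<sigma> i) - r i"] le by auto
    then have "\<sigma> i = i" for i using assms(1) by (simp add: inj_eq)
    then show False using that(2) by auto
  qed
  then have "det M = (\<Sum>\<sigma>\<in>{id}. of_int (sign \<sigma>) * (\<Prod>i\<in>UNIV. M $ i $ \<sigma> i))"
    unfolding det_def by (intro sum.mono_neutral_right) (auto simp: finite_permutations permutes_id)
  then show ?thesis by simp
qed

lemma upr_mult:
  assumes "upr r A" "upr r B"
  shows "upr r (A ** B)"
  unfolding upr_def mm_entry
proof (intro allI impI sum.neutral ballI)
  fix a b k assume "r b < r a"
  then have "r b < r k \<or> r k < r a" by linarith
  then show "A $ a $ k * B $ k $ b = 0" using assms unfolding upr_def by auto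
qed

lemma upr_mult_diag:
  assumes "inj r" "upr r A" "upr r B"
  shows "(A ** B) $ k $ k = A $ k $ k * B $ k $ k"
proof -
  have "A $ k $ l * B $ l $ k = 0" if "l \<noteq> k" for l
  proof -
    have "r l \<noteq> r k" using that assms(1) by (simp add: inj_eq)
    then have "r l < r k \<or> r k < r l" by linarith
    then show ?thesis using assms(2,3) unfolding upr_def by auto
  qed
  then have "(A ** B) $ k $ k = (\<Sum>l\<in>{k}. A $ k $ l * B $ l $ k)"
    unfolding mm_entry by (intro sum.mono_neutral_right) auto
  then show ?thesis by simp
qed

text \<open>Back substitution in descending order of \<open>r\<close>: row \<open>a\<close> of the
  product involves only rows of \<open>Y\<close> at or above \<open>r a\<close>, and the strictly
  higher ones already vanish in column \<open>b\<close>. This yields triangularity of inverses and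
  of logarithmic derivatives.\<close>

lemma upr_solve:
  fixes Y :: "('n::finite) cmat"
  assumes "inj r" "upr r U" "\<And>k. U $ k $ k \<noteq> 0" "upr r (U ** Y)"
  shows "upr r Y"
proof -
  have "r b < r a \<Longrightarrow> Y $ a $ b = 0" for a b
  proof (induction "card {c. r a < r c}" arbitrary: a rule: less_induct)
    case less
    have "U $ a $ c * Y $ c $ b = 0" if "c \<noteq> a" for c
    proof (cases "r c < r a")
      case True
      then show ?thesis using assms(2) by (simp add: upr_def)
    next
      case False
      moreover have "r c \<noteq> r a" using that assms(1) by (simp add: inj_eq)
      ultimately have "r a < r c" by simp
      then have "{d. r c < r d} \<subset> {d. r a < r d}" by auto
      then have "card {d. r c < r d} < card {d. r a < r d}" by (simp add: psubset_card_mono)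
      from less(1)[OF this] \<open>r a < r c\<close> less(2) show ?thesis by simp
    qed
    then have "(U ** Y) $ a $ b = (\<Sum>c\<in>{a}. U $ a $ c * Y $ c $ b)"
      unfolding mm_entry by (intro sum.mono_neutral_right) auto
    then have "(U ** Y) $ a $ b = U $ a $ a * Y $ a $ b" by simp
    moreover have "(U ** Y) $ a $ b = 0" using assms(4) less(2) by (simp add: upr_def)
    ultimately show ?case using assms(3)[of a] by simp
  qed
  then show ?thesis by (simp add: upr_def)
qed

lemma upr_dmat: "upr r (dmat d)" by (auto simp: upr_def dmat_def)

lemma upr_one: "upr r (mat 1)" by (auto simp: upr_def mat_def)

lemma det_dmat: "det (dmat d) = (\<Prod>k\<in>UNIV. d k)"
  using det_upr[OF inj_up upr_dmat, of d] by (simp add: dmat_def)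

section \<open>Borel subgroups, unipotent radicals and the torus of a frame\<close>

definition borel_grp :: "('n::finite \<Rightarrow> int) \<Rightarrow> 'n cmat \<Rightarrow> 'n cmat set" where
  "borel_grp r p = {g \<in> SL. upr r (conj_from p g)}"

definition unip :: "('n::finite \<Rightarrow> int) \<Rightarrow> 'n cmat \<Rightarrow> 'n cmat set" where
  "unip r p = {g \<in> borel_grp r p. \<forall>k. conj_from p g $ k $ k = 1}"

definition torus :: "('n::finite) cmat \<Rightarrow> 'n cmat set" where
  "torus p = {conj_to p (dmat d) | d. (\<Prod>k\<in>UNIV. d k) = 1}"

text \<open>The character \<open>\<Sum>i. \<nu> i \<omega>\<^sub>i\<close>, written through diagonal
  entries in the frame. The same formula serves the upper and the lower triangular group, on each of
  which it is multiplicative.\<close>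

definition wt :: "('n::finite) cmat \<Rightarrow> weight \<Rightarrow> 'n cmat \<Rightarrow> complex" where
  "wt p \<nu> g = (\<Prod>i\<in>{1..<CARD('n)}. (\<Prod>k | pos k < i. conj_from p g $ k $ k) ^ \<nu> i)"

lemma wt_add: "wt p (\<lambda>i. \<nu> i + \<nu>' i) g = wt p \<nu> g * wt p \<nu>' g"
  by (simp add: wt_def power_add prod.distrib)

lemma borel_SL: "g \<in> borel_grp r p \<Longrightarrow> g \<in> SL" by (simp add: borel_grp_def)

lemma unip_borel: "n \<in> unip r p \<Longrightarrow> n \<in> borel_grp r p" by (simp add: unip_def)

context
  fixes p :: "('n::finite) cmat" and r :: "'n \<Rightarrow> int"
  assumes p: "invertible p" and r: "inj r"
begin

lemma borel_mult: "g \<in> borel_grp r p \<Longrightarrow> h \<in> borel_grp r p \<Longrightarrow> g ** h \<in> borel_grp r p"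
  by (simp add: borel_grp_def conj_from_mult[OF p] upr_mult)

lemma borel_diag_nz:
  assumes "g \<in> borel_grp r p"
  shows "conj_from p g $ k $ k \<noteq> 0"
proof -
  have "(\<Prod>k\<in>UNIV. conj_from p g $ k $ k) = 1"
    using det_upr[OF r, of "conj_from p g"] assms by (simp add: borel_grp_def det_conj_from[OF p] SL_def)
  then show ?thesis using prod_zero[of UNIV "\<lambda>k. conj_from p g $ k $ k"] by fastforce
qed

lemma borel_inverse:
  assumes "g \<in> borel_grp r p"
  shows "matrix_inv g \<in> borel_grp r p"
proof -
  have g: "g \<in> SL" "upr r (conj_from p g)" using assms by (auto simp: borel_grp_def)
  have "conj_from p g ** conj_from p (matrix_inv g) = mat 1"
    by (simp add: conj_from_mult[OF p, symmetric] SL_inv g conj_from_one[OF p])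
  then have "upr r (conj_from p (matrix_inv g))"
    by (rule_tac upr_solve[OF r g(2) borel_diag_nz[OF assms]]) (simp add: upr_one)
  then show ?thesis using g by (simp add: borel_grp_def)
qed

lemma borel_mult_diag:
  "g \<in> borel_grp r p \<Longrightarrow> h \<in> borel_grp r p \<Longrightarrow>
    conj_from p (g ** h) $ k $ k = conj_from p g $ k $ k * conj_from p h $ k $ k"
  by (simp add: conj_from_mult[OF p] borel_grp_def upr_mult_diag[OF r])

lemma wt_mult: "g \<in> borel_grp r p \<Longrightarrow> h \<in> borel_grp r p \<Longrightarrow> wt p \<nu> (g ** h) = wt p \<nu> g * wt p \<nu> h"
  by (simp add: wt_def borel_mult_diag prod.distrib power_mult_distrib)

lemma wt_one: "wt p \<nu> (mat 1) = 1"
  by (simp add: wt_def conj_from_one[OF p] mat_entry)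

lemma wt_inverse: "g \<in> borel_grp r p \<Longrightarrow> wt p \<nu> (matrix_inv g) * wt p \<nu> g = 1"
  using wt_mult[OF borel_inverse, of g g \<nu>] by (simp add: SL_inv borel_SL wt_one)

lemma wt_unip: "g \<in> unip r p \<Longrightarrow> wt p \<nu> g = 1"
  by (simp add: wt_def unip_def)

lemma torus_borel: "t \<in> torus p \<Longrightarrow> t \<in> borel_grp r p"
  by (auto simp: torus_def borel_grp_def conj_from_to[OF p] upr_dmat SL_def det_conj_to[OF p] det_dmat)

lemma torus_inverse:
  assumes "(\<Prod>k\<in>UNIV. d k) = 1"
  shows "matrix_inv (conj_to p (dmat d)) = conj_to p (dmat (\<lambda>k. inverse (d k)))"
proof (rule matrix_inv_eqI(1))
  have "d k \<noteq> 0" for k using assms prod_zero[of UNIV d] by fastforce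
  then show "conj_to p (dmat d) ** conj_to p (dmat (\<lambda>k. inverse (d k))) = mat 1"
    by (simp add: conj_to_mult[OF p, symmetric] dmat_mult dmat_one conj_to_one[OF p])
qed

lemma torus_inverse_mem: "t \<in> torus p \<Longrightarrow> matrix_inv t \<in> torus p"
proof -
  assume "t \<in> torus p"
  then obtain d where d: "t = conj_to p (dmat d)" "(\<Prod>k\<in>UNIV. d k) = 1" by (auto simp: torus_def)
  have "(\<Prod>k\<in>UNIV. inverse (d k)) = 1" using prod_inversef[of d UNIV] d(2) by (simp add: o_def)
  then show ?thesis unfolding d(1) torus_inverse[OF d(2)] torus_def by blast
qed

lemma borel_decomp:
  assumes "g \<in> borel_grp r p"
  shows "\<exists>t\<in>torus p. \<exists>n\<in>unip r p. g = t ** n"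
proof -
  define d where "d k = conj_from p g $ k $ k" for k
  have g: "g \<in> SL" "upr r (conj_from p g)" using assms by (auto simp: borel_grp_def)
  have d: "(\<Prod>k\<in>UNIV. d k) = 1"
    using det_upr[OF r g(2)] g(1) by (simp add: det_conj_from[OF p] SL_def d_def)
  define t where "t = conj_to p (dmat d)"
  have t: "t \<in> torus p" using d by (auto simp: t_def torus_def)
  define n where "n = matrix_inv t ** g"
  have nb: "n \<in> borel_grp r p"
    unfolding n_def by (intro borel_mult assms borel_inverse torus_borel t)
  have "conj_from p n $ k $ k = 1" for k
  proof -
    have "conj_from p n $ k $ k = conj_from p (matrix_inv t) $ k $ k * conj_from p g $ k $ k"
      unfolding n_def by (intro borel_mult_diag assms borel_inverse torus_borel t)
    also have "conj_from p (matrix_inv t) $ k $ k = inverse (d k)"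
      by (simp add: t_def torus_inverse[OF d] conj_from_to[OF p]) (simp add: dmat_def)
    finally show ?thesis using borel_diag_nz[OF assms, of k] by (simp add: d_def)
  qed
  then have "n \<in> unip r p" using nb by (simp add: unip_def)
  moreover have "g = t ** n"
    unfolding n_def matrix_mul_assoc using SL_inv(1)[OF borel_SL[OF torus_borel[OF t]]] by simp
  ultimately show ?thesis using t by blast
qed

lemma torus_contraction:
  "\<exists>t :: real \<Rightarrow> 'n cmat. (\<forall>\<tau>. t \<tau> \<in> torus p) \<and>
    (\<forall>n\<in>unip r p. ((\<lambda>\<tau>. t \<tau> ** n ** matrix_inv (t \<tau>)) \<longlongrightarrow> mat 1) at_top)"
proof -
  define R where "R = (\<Sum>k\<in>UNIV. r k)"
  \<comment> \<open>\<open>r\<close> recentred to sum zero, so that the diagonal exponentials have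
    determinant 1. Still \<open>a i < a j\<close> whenever \<open>r i < r j\<close>, so conjugation
    makes every off-diagonal entry of a unipotent matrix decay.\<close>
  define a :: "'n \<Rightarrow> real" where "a k = of_int (int CARD('n) * r k - R)" for k
  have suma: "(\<Sum>k\<in>UNIV. a k) = 0"
    unfolding a_def by (simp add: sum_subtractf sum_distrib_left[symmetric] R_def)
  define d :: "real \<Rightarrow> 'n \<Rightarrow> complex" where "d \<tau> k = of_real (exp (\<tau> * a k))" for \<tau> k
  have dprod: "(\<Prod>k\<in>UNIV. d \<tau> k) = 1" for \<tau>
    by (simp add: d_def of_real_prod[symmetric] exp_sum[symmetric] sum_distrib_left[symmetric] suma)
  have "((\<lambda>\<tau>. conj_to p (dmat (d \<tau>)) ** n ** matrix_inv (conj_to p (dmat (d \<tau>)))) \<longlongrightarrow> mat 1) at_top"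
    if n: "n \<in> unip r p" for n
  proof -
  define N where "N = conj_from p n"
  have N: "upr r N" "\<And>k. N $ k $ k = 1" using n by (auto simp: N_def unip_def borel_grp_def)
  define M :: "real \<Rightarrow> 'n cmat"
    where "M \<tau> = (\<chi> i j. of_real (exp (\<tau> * (a i - a j))) * N $ i $ j)" for \<tau>
  have conj: "conj_to p (dmat (d \<tau>)) ** n ** matrix_inv (conj_to p (dmat (d \<tau>))) = conj_to p (M \<tau>)" for \<tau>
  proof -
    have "n = conj_to p N" by (simp add: N_def conj_to_from[OF p])
    then have "conj_to p (dmat (d \<tau>)) ** n ** matrix_inv (conj_to p (dmat (d \<tau>))) =
      conj_to p (dmat (d \<tau>) ** N ** dmat (\<lambda>k. inverse (d \<tau> k)))"
      by (simp add: torus_inverse[OF dprod] conj_to_mult[OF p])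
    moreover have "dmat (d \<tau>) ** N ** dmat (\<lambda>k. inverse (d \<tau> k)) = M \<tau>"
      by (simp add: vec_eq_iff dmat_mult_entry M_def d_def right_diff_distrib exp_diff field_simps)
    ultimately show ?thesis by simp
  qed
  have lim: "(M \<longlongrightarrow> mat 1) at_top"
  proof (intro vec_tendstoI)
    fix i j
    show "((\<lambda>\<tau>. M \<tau> $ i $ j) \<longlongrightarrow> mat 1 $ i $ j) at_top"
    proof (cases "i = j")
      case True
      then show ?thesis using N(2) by (simp add: M_def mat_def)
    next
      case False
      then have "r i \<noteq> r j" using r by (simp add: inj_eq)
      then consider "r j < r i" | "r i < r j" by linarith
      then show ?thesis
      proof cases
        case 1
        then have "N $ i $ j = 0" using N(1) by (simp add: upr_def)
        then show ?thesis using False by (simp add: M_def mat_def)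
      next
        case 2
        have "a i - a j = real CARD('n) * of_int (r i - r j)" by (simp add: a_def algebra_simps)
        then have "a i - a j < 0" using 2 by (simp add: mult_less_0_iff)
        then have "filterlim (\<lambda>\<tau>. (a i - a j) * \<tau>) at_bot at_top"
          by (intro filterlim_tendsto_neg_mult_at_bot[OF tendsto_const]) (auto intro: filterlim_ident)
        then have "((\<lambda>\<tau>. exp (\<tau> * (a i - a j))) \<longlongrightarrow> 0) at_top"
          using filterlim_compose[OF exp_at_bot] by (simp add: mult.commute)
        then have "((\<lambda>\<tau>. of_real (exp (\<tau> * (a i - a j))) * N $ i $ j) \<longlongrightarrow> of_real 0 * N $ i $ j) at_top"
          by (intro tendsto_intros)
        then show ?thesis using False by (simp add: M_def mat_def)
      qed
    qed
  qed
  have "continuous_on UNIV (\<lambda>x. conj_to p (x :: 'n cmat))"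
  proof -
    have "continuous_on UNIV (\<lambda>x. \<chi> i j. conj_to p x $ i $ j)"
      by (intro continuous_on_vec_lambda) (simp add: conj_to_def mm_entry, intro continuous_intros)
    then show ?thesis by simp
  qed
  then have "((\<lambda>\<tau>. conj_to p (M \<tau>)) \<longlongrightarrow> conj_to p (mat 1)) at_top"
    by (intro isCont_tendsto_compose[OF _ lim]) (simp add: continuous_on_eq_continuous_at)
  then show ?thesis unfolding conj conj_to_one[OF p] .
  qed
  moreover have "conj_to p (dmat (d \<tau>)) \<in> torus p" for \<tau> using dprod by (auto simp: torus_def)
  ultimately show ?thesis by (intro exI[of _ "\<lambda>\<tau>. conj_to p (dmat (d \<tau>))"]) simp
qed

text \<open>The function is constant along the curve that contracts \<open>n\<close> to 1, and
  continuity gives the value at the end. This replaces decompositions into weight spaces in what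
  follows.\<close>

lemma torus_limit:
  assumes f: "f \<in> polynomial_functions mat_coords" and n: "n \<in> unip r p"
    and inv: "\<And>t. t \<in> torus p \<Longrightarrow> f (t ** n ** matrix_inv t) = f n"
  shows "f n = f (mat 1)"
proof -
  obtain t :: "real \<Rightarrow> 'n cmat" where t: "\<And>\<tau>. t \<tau> \<in> torus p"
    "((\<lambda>\<tau>. t \<tau> ** n ** matrix_inv (t \<tau>)) \<longlongrightarrow> mat 1) at_top"
    using torus_contraction n by blast
  have "((\<lambda>\<tau>. f (t \<tau> ** n ** matrix_inv (t \<tau>))) \<longlongrightarrow> f (mat 1)) at_top"
    using mat_coords_continuous[OF f, of UNIV] t(2)
    by (intro isCont_tendsto_compose[where g = f]) (simp_all add: continuous_on_eq_continuous_at)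
  then have "((\<lambda>\<tau>::real. f n) \<longlongrightarrow> f (mat 1)) at_top"
    by (simp add: inv t(1))
  then show ?thesis using tendsto_unique[OF _ tendsto_const] by (metis trivial_limit_at_top_linorder)
qed

end

subsection \<open>The big cell\<close>

lemma bounded_bilinear_matrix_mult: "bounded_bilinear ((**) :: ('n::finite) cmat \<Rightarrow> 'n cmat \<Rightarrow> 'n cmat)"
proof -
  have "bilinear ((**) :: 'n cmat \<Rightarrow> 'n cmat \<Rightarrow> 'n cmat)"
    unfolding bilinear_def
    by (auto intro!: linearI simp: vec_eq_iff mm_entry sum.distrib algebra_simps scaleR_sum_right)
  then show ?thesis by (simp add: bilinear_conv_bounded_bilinear)
qed

text \<open>The map \<Psi> multiplying the two triangular parts of 1 + Y has derivative
  \<open>lo + hi = id\<close> at 0, so its image contains a neighbourhood of 1. The diagonal is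
  assigned to \<open>hi\<close>, which makes the lower factor unipotent.\<close>

lemma lower_upper_factorization:
  "\<exists>U. open U \<and> mat 1 \<in> U \<and> (\<forall>g\<in>U. \<exists>L R. upr down L \<and> (\<forall>k. L $ k $ k = 1) \<and> upr up R \<and>
     (g :: ('n::finite) cmat) = L ** R)"
proof -
  define lo :: "'n cmat \<Rightarrow> 'n cmat" where "lo Y = (\<chi> i j. if pos j < pos i then Y $ i $ j else 0)" for Y
  define hi :: "'n cmat \<Rightarrow> 'n cmat" where "hi Y = (\<chi> i j. if pos j < pos i then 0 else Y $ i $ j)" for Y
  define \<Psi> where "\<Psi> Y = (mat 1 + lo Y) ** (mat 1 + hi Y)" for Y
  have "linear lo" "linear hi" by (auto intro!: linearI simp: lo_def hi_def vec_eq_iff)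
  then have bl: "bounded_linear lo" "bounded_linear hi" by (simp_all add: linear_conv_bounded_linear)
  have lohi: "lo H + hi H = H" for H by (simp add: lo_def hi_def vec_eq_iff)
  have zero: "lo 0 = 0" "hi 0 = 0" by (simp_all add: lo_def hi_def vec_eq_iff)
  have D1: "((\<lambda>Y. mat 1 + lo Y) has_derivative lo) (at x)" "((\<lambda>Y. mat 1 + hi Y) has_derivative hi) (at x)" for x
    by (auto intro!: derivative_eq_intros bounded_linear_imp_has_derivative bl)
  have D: "(\<Psi> has_derivative (\<lambda>H. (mat 1 + lo x) ** hi H + lo H ** (mat 1 + hi x))) (at x)" for x
    unfolding \<Psi>_def using bounded_bilinear.FDERIV[OF bounded_bilinear_matrix_mult D1(1) D1(2)] .
  have D0: "(\<Psi> has_derivative id) (at 0)"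
    using D[of 0] lohi by (simp add: zero id_def add.commute)
  have "\<Psi> 0 \<in> interior (\<Psi> ` UNIV)"
    by (rule sussmann_open_mapping[OF open_UNIV _ _ D0, where g' = id])
      (auto intro!: has_derivative_continuous_on[OF has_derivative_at_withinI[OF D]] bounded_linear_ident
        simp: id_def)
  moreover have "\<Psi> 0 = mat 1" by (simp add: \<Psi>_def zero)
  moreover have "\<exists>L R. upr down L \<and> (\<forall>k. L $ k $ k = 1) \<and> upr up R \<and> \<Psi> Y = L ** R" for Y
    by (rule exI[of _ "mat 1 + lo Y"], rule exI[of _ "mat 1 + hi Y"])
      (auto simp: \<Psi>_def upr_def lo_def hi_def mat_def down_def up_def)
  moreover have "\<exists>Y. g = \<Psi> Y" if "g \<in> interior (range \<Psi>)" for g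
    using that interior_subset by blast
  ultimately show ?thesis
    by (intro exI[of _ "interior (range \<Psi>)"]) (metis open_interior)
qed

text \<open>The products \<open>n ** b\<close> fill a neighbourhood of 1 in \<open>SL\<close>, so
  the identity principle applies. The lower factor has determinant 1; hence the upper one does as
  well, and both lie in \<open>SL\<close>.\<close>

lemma big_cell_identity:
  fixes p :: "('n::finite) cmat"
  assumes p: "invertible p" and f: "f \<in> polynomial_functions mat_coords"
    and cell: "\<And>n b. n \<in> unip down p \<Longrightarrow> b \<in> borel_grp up p \<Longrightarrow> f (n ** b) = 0"
    and g: "g \<in> SL"
  shows "f g = 0"
proof -
  obtain U :: "'n cmat set" where U: "open U" "mat 1 \<in> U"
    "\<And>g. g \<in> U \<Longrightarrow> \<exists>L R. upr down L \<and> (\<forall>k. L $ k $ k = 1) \<and> upr up R \<and> g = L ** R"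
    using lower_upper_factorization by blast
  define V where "V = SL \<inter> conj_from p -` U"
  have "continuous_on UNIV (\<lambda>x. conj_from p (x :: 'n cmat))"
  proof -
    have "continuous_on UNIV (\<lambda>x. \<chi> i j. conj_from p x $ i $ j)"
      by (intro continuous_on_vec_lambda) (simp add: conj_from_def mm_entry, intro continuous_intros)
    then show ?thesis by simp
  qed
  then have "open (conj_from p -` U)" using U(1) by (simp add: continuous_on_open_vimage)
  then have "openin (top_of_set SL) V" unfolding V_def by (rule openin_open_Int)
  moreover have "mat 1 \<in> V" using U(2) by (simp add: V_def conj_from_one[OF p])
  moreover have "f u = 0" if "u \<in> V" for u
  proof -
    have u: "u \<in> SL" "conj_from p u \<in> U" using that by (auto simp: V_def)
    then obtain L R where LR: "upr down L" "\<forall>k. L $ k $ k = 1" "upr up R" "conj_from p u = L ** R"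
      using U(3) by blast
    have dL: "det L = 1" using det_upr[OF inj_down LR(1)] LR(2) by simp
    have "det L * det R = 1" using arg_cong[OF LR(4), of det] u(1)
      by (simp add: det_conj_from[OF p] SL_def det_mul)
    then have dR: "det R = 1" using dL by simp
    have "u = conj_to p L ** conj_to p R"
      using LR(4) by (metis conj_to_from[OF p] conj_to_mult[OF p])
    moreover have "conj_to p L \<in> unip down p" "conj_to p R \<in> borel_grp up p"
      using LR dL dR by (auto simp: unip_def borel_grp_def conj_from_to[OF p] SL_def det_conj_to[OF p])
    ultimately show ?thesis using cell by simp
  qed
  ultimately show ?thesis using identity_SL[OF f _ _ _ g] by blast
qed

subsection \<open>The exponential curve\<close>

lemma matpow_entry_bound:
  "norm (matpow A k $ i $ j) \<le> (\<Sum>i\<in>UNIV. \<Sum>j\<in>UNIV. norm (A $ i $ j)) ^ k"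
proof (induction k arbitrary: i j)
  case 0
  then show ?case by (simp add: mat_def)
next
  case (Suc k)
  let ?M = "\<Sum>i\<in>UNIV. \<Sum>j\<in>UNIV. norm (A $ i $ j)"
  have "norm (matpow A (Suc k) $ i $ j) \<le> (\<Sum>l\<in>UNIV. norm (A $ i $ l * matpow A k $ l $ j))"
    by (simp add: mm_entry) (rule norm_sum)
  also have "\<dots> \<le> (\<Sum>l\<in>UNIV. norm (A $ i $ l) * ?M ^ k)"
    by (intro sum_mono) (simp add: norm_mult mult_left_mono Suc.IH)
  also have "\<dots> = (\<Sum>l\<in>UNIV. norm (A $ i $ l)) * ?M ^ k" by (simp add: sum_distrib_right)
  also have "(\<Sum>l\<in>UNIV. norm (A $ i $ l)) \<le> ?M"
    by (rule member_le_sum[where f = "\<lambda>i. \<Sum>l\<in>UNIV. norm (A $ i $ l)"]) (auto intro: sum_nonneg)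
  then have "(\<Sum>l\<in>UNIV. norm (A $ i $ l)) * ?M ^ k \<le> ?M * ?M ^ k"
    by (rule mult_right_mono) (simp add: sum_nonneg)
  finally show ?case by simp
qed

lemma matpow_commute: "matpow A k ** A = A ** matpow A k"
  by (induction k) (simp_all add: matrix_mul_assoc[symmetric])

lemma matpow_scaleR: "matpow (c *\<^sub>R A) k = c ^ k *\<^sub>R matpow A k"
  by (induction k) (simp_all add: vec_eq_iff mm_entry scaleR_sum_right mult.commute[of c])

text \<open>Taylor coefficients of a single matrix entry, so that convergence and differentiation of
  \<open>mexp\<close> reduce to scalar power series.\<close>

definition exp_coeff :: "('n::finite) cmat \<Rightarrow> 'n \<Rightarrow> 'n \<Rightarrow> nat \<Rightarrow> complex" where
  "exp_coeff A i j k = matpow A k $ i $ j / fact k"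

lemma exp_coeff_summable: "summable (\<lambda>k. exp_coeff A i j k * z ^ k)"
proof (rule summable_comparison_test')
  let ?M = "\<Sum>i\<in>UNIV. \<Sum>j\<in>UNIV. norm (A $ i $ j)"
  show "summable (\<lambda>k. inverse (fact k) * (?M * norm z) ^ k)" by (rule summable_exp)
  show "norm (exp_coeff A i j k * z ^ k) \<le> inverse (fact k) * (?M * norm z) ^ k" for k
    using mult_right_mono[OF matpow_entry_bound[of A k i j], of "norm z ^ k / fact k"]
    by (simp add: exp_coeff_def norm_mult norm_divide norm_power power_mult_distrib divide_simps)
qed

lemma mexp_sums_entries:
  "(\<lambda>k. (1 / fact k) *\<^sub>R matpow (t *\<^sub>R A) k) sums (\<chi> i j. \<Sum>k. exp_coeff A i j k * of_real t ^ k)"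
  unfolding sums_def
proof (intro vec_tendstoI)
  fix i j
  have "(\<lambda>k. exp_coeff A i j k * of_real t ^ k) sums (\<Sum>k. exp_coeff A i j k * of_real t ^ k)"
    by (rule summable_sums[OF exp_coeff_summable])
  then show "(\<lambda>n. (\<Sum>k<n. (1 / fact k) *\<^sub>R matpow (t *\<^sub>R A) k) $ i $ j) \<longlonglongrightarrow>
    (\<chi> i j. \<Sum>k. exp_coeff A i j k * of_real t ^ k) $ i $ j"
    unfolding sums_def
    by (simp add: matpow_scaleR exp_coeff_def scaleR_conv_of_real[where 'a = complex] mult.commute)
qed

lemma mexp_entry: "mexp (t *\<^sub>R A) $ i $ j = (\<Sum>k. exp_coeff A i j k * of_real t ^ k)"
  by (simp add: mexp_def sums_unique[OF mexp_sums_entries, symmetric])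

lemma mexp_sums: "(\<lambda>k. (1 / fact k) *\<^sub>R matpow (t *\<^sub>R A) k) sums mexp (t *\<^sub>R A)"
  unfolding mexp_def by (rule summable_sums[OF sums_summable[OF mexp_sums_entries]])

lemma has_vector_derivative_vec:
  assumes "\<And>i. ((\<lambda>t. f t $ i) has_vector_derivative f' $ i) (at t)"
  shows "(f has_vector_derivative f') (at t)"
  unfolding has_vector_derivative_def has_derivative_at_within
proof
  show "bounded_linear (\<lambda>x. x *\<^sub>R f')" by (rule bounded_linear_scaleR_left)
  show "((\<lambda>y. (f y - f t - (y - t) *\<^sub>R f') /\<^sub>R norm (y - t)) \<longlongrightarrow> 0) (at t)"
  proof (rule vec_tendstoI)
    fix i
    have "((\<lambda>y. (f y $ i - f t $ i - (y - t) *\<^sub>R f' $ i) /\<^sub>R norm (y - t)) \<longlongrightarrow> 0) (at t)"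
      using assms[of i] unfolding has_vector_derivative_def has_derivative_at_within by blast
    then show "((\<lambda>y. ((f y - f t - (y - t) *\<^sub>R f') /\<^sub>R norm (y - t)) $ i) \<longlongrightarrow> 0 $ i) (at t)"
      by simp
  qed
qed

lemma has_vector_derivative_vec_nth:
  assumes "(f has_vector_derivative f') (at t)"
  shows "((\<lambda>t. f t $ i) has_vector_derivative f' $ i) (at t)"
  using bounded_linear.has_vector_derivative[OF bounded_linear_vec_nth assms] .

lemma mexp_entry_derivative:
  assumes "\<And>k. diffs (exp_coeff A i j) k = D k"
  shows "((\<lambda>t. mexp (t *\<^sub>R A) $ i $ j) has_vector_derivative (\<Sum>k. D k * of_real t ^ k)) (at t)"
proof -
  have "((\<lambda>z. \<Sum>k. exp_coeff A i j k * z ^ k) has_field_derivative (\<Sum>k. D k * of_real t ^ k)) (at (of_real t))"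
    using termdiffs_strong_converges_everywhere[OF exp_coeff_summable, of A i j "of_real t"]
    by (simp add: assms)
  moreover have "(of_real has_vector_derivative (1::complex)) (at t)"
    by (auto intro!: derivative_eq_intros simp: has_vector_derivative_def scaleR_conv_of_real)
  ultimately have "((\<lambda>z. \<Sum>k. exp_coeff A i j k * z ^ k) \<circ> of_real has_vector_derivative
      (1 * (\<Sum>k. D k * of_real t ^ k))) (at t)"
    using field_vector_diff_chain_at by blast
  then show ?thesis by (simp add: mexp_entry o_def)
qed

lemma diffs_exp_coeff:
  "diffs (exp_coeff A i j) k = (\<Sum>l\<in>UNIV. A $ i $ l * exp_coeff A l j k)"
  "diffs (exp_coeff A i j) k = (\<Sum>l\<in>UNIV. exp_coeff A i l k * A $ l $ j)"
proof -
  have 1: "diffs (exp_coeff A i j) k = (A ** matpow A k) $ i $ j / fact k"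
    by (simp add: diffs_def exp_coeff_def field_simps del: of_nat_Suc)
  then show "diffs (exp_coeff A i j) k = (\<Sum>l\<in>UNIV. A $ i $ l * exp_coeff A l j k)"
    by (simp add: mm_entry exp_coeff_def sum_divide_distrib)
  show "diffs (exp_coeff A i j) k = (\<Sum>l\<in>UNIV. exp_coeff A i l k * A $ l $ j)"
    unfolding 1 matpow_commute[symmetric] by (simp add: mm_entry exp_coeff_def sum_divide_distrib)
qed

lemma mexp_derivative:
  "((\<lambda>t. mexp (t *\<^sub>R A)) has_vector_derivative A ** mexp (t *\<^sub>R A)) (at t)" (is ?l)
  "((\<lambda>t. mexp (t *\<^sub>R A)) has_vector_derivative mexp (t *\<^sub>R A) ** A) (at t)" (is ?r)
proof -
  have s: "(\<Sum>k. (\<Sum>l\<in>UNIV. c l * (exp_coeff A (a l) (b l) k)) * of_real t ^ k) =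
      (\<Sum>l\<in>UNIV. c l * mexp (t *\<^sub>R A) $ (a l) $ (b l))" for c a b
  proof -
    have "(\<lambda>k. (\<Sum>l\<in>UNIV. c l * (exp_coeff A (a l) (b l) k)) * of_real t ^ k) =
      (\<lambda>k. \<Sum>l\<in>UNIV. c l * (exp_coeff A (a l) (b l) k * of_real t ^ k))"
      by (simp add: sum_distrib_right mult.assoc)
    then show ?thesis
      by (simp add: mexp_entry suminf_sum[symmetric] exp_coeff_summable summable_mult suminf_mult[symmetric])
  qed
  show ?l
  proof (intro has_vector_derivative_vec)
    fix i j
    show "((\<lambda>t. mexp (t *\<^sub>R A) $ i $ j) has_vector_derivative (A ** mexp (t *\<^sub>R A)) $ i $ j) (at t)"
      using mexp_entry_derivative[OF diffs_exp_coeff(1), of A i j t] s[of "\<lambda>l. A $ i $ l" "\<lambda>l. l" "\<lambda>l. j"]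
      by (simp add: mm_entry)
  qed
  show ?r
  proof (intro has_vector_derivative_vec)
    fix i j
    show "((\<lambda>t. mexp (t *\<^sub>R A) $ i $ j) has_vector_derivative (mexp (t *\<^sub>R A) ** A) $ i $ j) (at t)"
      using mexp_entry_derivative[OF diffs_exp_coeff(2), of A i j t] s[of "\<lambda>l. A $ l $ j" "\<lambda>l. i" "\<lambda>l. l"]
      by (simp add: mm_entry mult.commute)
  qed
qed

lemma mexp_zero [simp]: "mexp 0 = (mat 1 :: ('n::finite) cmat)"
proof -
  have "mexp 0 $ i $ j = (mat 1 :: 'n cmat) $ i $ j" for i j
    using mexp_entry[of 0 0 i j] powser_zero[of "exp_coeff 0 i j"] by (simp add: exp_coeff_def)
  then show ?thesis by (simp add: vec_eq_iff)
qed

lemma has_vector_derivative_mult: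
  fixes f g :: "real \<Rightarrow> ('n::finite) cmat"
  assumes "(f has_vector_derivative f') (at t)" "(g has_vector_derivative g') (at t)"
  shows "((\<lambda>t. f t ** g t) has_vector_derivative (f t ** g' + f' ** g t)) (at t)"
  using bounded_bilinear.has_vector_derivative[OF bounded_bilinear_matrix_mult assms] .

lemma mexp_inverse: "mexp (t *\<^sub>R (- A)) ** mexp (t *\<^sub>R A) = mat 1"
proof -
  have zero: "((\<lambda>t. mexp (t *\<^sub>R (- A)) ** mexp (t *\<^sub>R A)) has_vector_derivative 0) (at t)" for t
  proof -
    have "mexp (t *\<^sub>R (- A)) ** (A ** mexp (t *\<^sub>R A)) + (mexp (t *\<^sub>R (- A)) ** (- A)) ** mexp (t *\<^sub>R A) = 0"
      by (simp add: vec_eq_iff matrix_mul_assoc[symmetric])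
        (simp add: mm_entry sum_negf matrix_mul_assoc[symmetric])
    then show ?thesis
      using has_vector_derivative_mult[OF mexp_derivative(2)[of "- A" t] mexp_derivative(1)[of A t]] by simp
  qed
  have "(\<lambda>t. mexp (t *\<^sub>R (- A)) ** mexp (t *\<^sub>R A)) t = (\<lambda>t. mexp (t *\<^sub>R (- A)) ** mexp (t *\<^sub>R A)) 0"
    using has_vector_derivative_zero_constant[OF convex_UNIV, of "\<lambda>t. mexp (t *\<^sub>R (- A)) ** mexp (t *\<^sub>R A)"] zero
    by (metis UNIV_I)
  then show ?thesis by simp
qed

text \<open>In the differentiated Leibniz sum one factor is omitted from each product. A permutation
  other than the identity moves at least two indices, so an off-diagonal entry of the identity
  matrix survives and kills its term.\<close>

lemma det_derivative_at_one:
  fixes \<gamma> :: "real \<Rightarrow> ('n::finite) cmat"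
  assumes "(\<gamma> has_vector_derivative X) (at t)" "\<gamma> t = mat 1"
  shows "((\<lambda>t. det (\<gamma> t)) has_vector_derivative trace X) (at t)"
proof -
  have e: "((\<lambda>t. \<gamma> t $ i $ j) has_derivative (\<lambda>y. y *\<^sub>R X $ i $ j)) (at t)" for i j
    using has_vector_derivative_vec_nth[OF has_vector_derivative_vec_nth[OF assms(1)], of i j]
    by (simp add: has_vector_derivative_def)
  have "((\<lambda>t. det (\<gamma> t)) has_derivative (\<lambda>y. \<Sum>\<sigma> | \<sigma> permutes UNIV. of_int (sign \<sigma>) *
      (\<Sum>i\<in>UNIV. y *\<^sub>R X $ i $ \<sigma> i * (\<Prod>j\<in>UNIV - {i}. \<gamma> t $ j $ \<sigma> j)))) (at t)"
    unfolding det_def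
    by (intro has_derivative_sum has_derivative_mult_right has_derivative_prod e)
  moreover have "(\<Sum>\<sigma> | \<sigma> permutes UNIV. of_int (sign \<sigma>) *
      (\<Sum>i\<in>UNIV. y *\<^sub>R X $ i $ \<sigma> i * (\<Prod>j\<in>UNIV - {i}. \<gamma> t $ j $ \<sigma> j))) = y *\<^sub>R trace X" for y
  proof -
    have "(\<Prod>j\<in>UNIV - {i}. \<gamma> t $ j $ \<sigma> j) = 0" if \<sigma>: "\<sigma> permutes UNIV" "\<sigma> \<noteq> id" for \<sigma> i
    proof -
      have "\<exists>j. j \<noteq> i \<and> \<sigma> j \<noteq> j"
      proof (rule ccontr)
        assume "\<not> ?thesis"
        then have fixed: "\<sigma> j = j" if "j \<noteq> i" for j using that by blast
        then have "\<sigma> i = i" using \<sigma>(1) by (metis permutes_inj inj_eq)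
        with fixed have "\<sigma> = id" by (metis eq_id_iff)
        with \<sigma>(2) show False by simp
      qed
      then obtain j where "j \<noteq> i" "\<sigma> j \<noteq> j" by blast
      then show ?thesis by (intro prod_zero) (auto simp: assms(2) mat_def intro!: bexI[of _ j])
    qed
    then have "(\<Sum>i\<in>UNIV. y *\<^sub>R X $ i $ \<sigma> i * (\<Prod>j\<in>UNIV - {i}. \<gamma> t $ j $ \<sigma> j)) = 0"
      if "\<sigma> permutes UNIV" "\<sigma> \<noteq> id" for \<sigma>
      using that by (intro sum.neutral ballI) (metis mult_zero_right)
    then have "(\<Sum>\<sigma> | \<sigma> permutes UNIV. of_int (sign \<sigma>) *
      (\<Sum>i\<in>UNIV. y *\<^sub>R X $ i $ \<sigma> i * (\<Prod>j\<in>UNIV - {i}. \<gamma> t $ j $ \<sigma> j))) =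
      (\<Sum>\<sigma>\<in>{id}. of_int (sign \<sigma>) *
      (\<Sum>i\<in>UNIV. y *\<^sub>R X $ i $ \<sigma> i * (\<Prod>j\<in>UNIV - {i}. \<gamma> t $ j $ \<sigma> j)))"
      by (intro sum.mono_neutral_right) (auto simp: finite_permutations permutes_id)
    also have "\<dots> = y *\<^sub>R trace X" by (simp add: assms(2) mat_def trace_def scaleR_sum_right)
    finally show ?thesis .
  qed
  ultimately show ?thesis by (simp add: has_vector_derivative_def)
qed

text \<open>The derivative at \<open>t\<close> is transported to the identity:
  \<open>?H t ** ?G s\<close> passes through 1 at \<open>s = t\<close> with velocity conjugate to
  \<open>A\<close>, hence of trace zero, and the remaining factor \<open>det (?G t)\<close> is
  constant in \<open>s\<close>.\<close>

lemma det_mexp: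
  fixes A :: "('n::finite) cmat"
  assumes "trace A = 0" shows "mexp (t *\<^sub>R A) \<in> SL"
proof -
  let ?G = "\<lambda>t. mexp (t *\<^sub>R A)" and ?H = "\<lambda>t. mexp (t *\<^sub>R (- A))"
  have zero: "((\<lambda>t. det (?G t)) has_vector_derivative 0) (at t)" for t
  proof -
    have HG: "?H t ** ?G t = mat 1" by (rule mexp_inverse)
    then have GH: "?G t ** ?H t = mat 1" using matrix_left_right_inverse by blast
    have "((\<lambda>s. ?H t ** ?G s) has_vector_derivative ?H t ** (A ** ?G t)) (at t)"
      using has_vector_derivative_mult[OF has_vector_derivative_const mexp_derivative(1)[of A t]] by simp
    from det_derivative_at_one[OF this HG]
    have "((\<lambda>s. det (?H t ** ?G s)) has_vector_derivative trace (?H t ** (A ** ?G t))) (at t)" .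
    moreover have "trace (?H t ** (A ** ?G t)) = 0"
      using assms GH trace_mul_sym[of "?H t" "A ** ?G t"] by (simp add: matrix_mul_assoc[symmetric])
    ultimately have "((\<lambda>s. det (?G t) * det (?H t ** ?G s)) has_vector_derivative det (?G t) * 0) (at t)"
      using has_vector_derivative_mult_right by metis
    moreover have "det (?G t) * det (?H t ** ?G s) = det (?G s)" for s
      using arg_cong[OF GH, of det] by (simp add: det_mul)
    ultimately show ?thesis by simp
  qed
  have "det (?G t) = det (?G 0)"
    using has_vector_derivative_zero_constant[OF convex_UNIV, of "\<lambda>t. det (?G t)"] zero
    by (metis UNIV_I)
  then show ?thesis by (simp add: SL_def)
qed

lemma mexp_sl: "mexp (t *\<^sub>R sl_mat x) \<in> SL"
  using det_mexp sl_mat by blast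

lemma matrix_inv_mexp: "matrix_inv (mexp (t *\<^sub>R A)) = mexp (t *\<^sub>R (- A))"
  by (rule matrix_inv_eqI(1)) (use mexp_inverse[of t "- A"] in simp)

lemma mexp_derivative_zero: "((\<lambda>t. mexp (t *\<^sub>R A)) has_vector_derivative A) (at 0)"
  using mexp_derivative(1)[of A 0] by simp

subsection \<open>Representations and their differentials\<close>

lemma mat_act_in: "i \<in> I \<Longrightarrow> mat_act I A v i = (\<Sum>j\<in>I. A i j * v j)"
  by (simp add: mat_act_def)

lemma mat_act_cspace [simp]: "mat_act I A v \<in> cspace I"
  by (simp add: cspace_def mat_act_def)

lemma mat_act_scale: "mat_act I A (\<lambda>j. c * v j) = (\<lambda>i. c * mat_act I A v i)"
  by (auto simp: mat_act_def sum_distrib_left mult.left_commute intro!: ext)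

lemma mat_act_add: "mat_act I A (\<lambda>j. v j + w j) = (\<lambda>i. mat_act I A v i + mat_act I A w i)"
  by (auto simp: mat_act_def sum.distrib algebra_simps intro!: ext)

lemma mat_act_sum: "mat_act I A (\<lambda>j. \<Sum>k\<in>K. v k j) = (\<lambda>i. \<Sum>k\<in>K. mat_act I A (v k) i)"
  by (auto simp: mat_act_def sum_distrib_left intro!: ext sum.swap)

lemma mat_act_zero: "mat_act I A (\<lambda>_. 0) = (\<lambda>_. 0)"
  by (auto simp: mat_act_def)

lemma pairing_mat_act: "pairing I w (mat_act I A v) = (\<Sum>i\<in>I. \<Sum>j\<in>I. w i * A i j * v j)"
  by (simp add: pairing_def mat_act_def sum_distrib_left mult.assoc)

lemma pairing_mat_act_transpose:
  assumes "\<And>i j. i \<in> I \<Longrightarrow> j \<in> I \<Longrightarrow> B j i = A i j"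
  shows "pairing I w (mat_act I A v) = pairing I (mat_act I B w) v"
proof -
  have "pairing I w (mat_act I A v) = (\<Sum>j\<in>I. \<Sum>i\<in>I. w i * A i j * v j)"
    unfolding pairing_mat_act by (rule sum.swap)
  also have "\<dots> = pairing I (mat_act I B w) v"
    by (simp add: pairing_def mat_act_def sum_distrib_left sum_distrib_right mult_ac assms)
  finally show ?thesis .
qed

lemma pairing_scale:
  "pairing I (\<lambda>i. c * w i) v = c * pairing I w v" "pairing I w (\<lambda>i. c * v i) = c * pairing I w v"
  by (simp_all add: pairing_def sum_distrib_left algebra_simps)

lemma pairing_add:
  "pairing I (\<lambda>i. w i + w' i) v = pairing I w v + pairing I w' v"
  "pairing I w (\<lambda>i. v i + v' i) = pairing I w v + pairing I w v'"
  by (simp_all add: pairing_def sum.distrib algebra_simps)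

lemma pairing_sum:
  "pairing I (\<lambda>i. \<Sum>k\<in>K. f k i) v = (\<Sum>k\<in>K. pairing I (f k) v)"
  "pairing I v (\<lambda>i. \<Sum>k\<in>K. f k i) = (\<Sum>k\<in>K. pairing I v (f k))"
  by (simp_all add: pairing_def sum_distrib_left sum_distrib_right sum.swap[of _ I K])

context
  fixes d :: nat and \<rho> :: "('n::finite) matrep"
  assumes R: "rational_rep d \<rho>"
begin

lemma rep_one: "i < d \<Longrightarrow> j < d \<Longrightarrow> \<rho> (mat 1) i j = (if i = j then 1 else 0)"
  using R by (simp add: rational_rep_def)

lemma rep_mult: "g \<in> SL \<Longrightarrow> h \<in> SL \<Longrightarrow> i < d \<Longrightarrow> j < d \<Longrightarrow> \<rho> (g ** h) i j = (\<Sum>k<d. \<rho> g i k * \<rho> h k j)"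
  using R by (simp add: rational_rep_def)

lemma rep_polynomial: "i < d \<Longrightarrow> j < d \<Longrightarrow> \<exists>p \<in> polynomial_functions mat_coords. \<forall>g\<in>SL. \<rho> g i j = p g"
  using R by (simp add: rational_rep_def)

lemma act_one: "v \<in> cspace {..<d} \<Longrightarrow> mat_act {..<d} (\<rho> (mat 1)) v = v"
  by (auto simp: mat_act_def rep_one cspace_def if_distrib[of "\<lambda>x. x * _"] cong: if_cong)

lemma act_mult:
  assumes "g \<in> SL" "h \<in> SL"
  shows "mat_act {..<d} (\<rho> (g ** h)) v = mat_act {..<d} (\<rho> g) (mat_act {..<d} (\<rho> h) v)"
proof
  fix i
  show "mat_act {..<d} (\<rho> (g ** h)) v i = mat_act {..<d} (\<rho> g) (mat_act {..<d} (\<rho> h) v) i"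
  proof (cases "i < d")
    case True
    have "mat_act {..<d} (\<rho> (g ** h)) v i = (\<Sum>j<d. \<Sum>k<d. \<rho> g i k * (\<rho> h k j * v j))"
      using True assms by (simp add: mat_act_in rep_mult sum_distrib_right mult.assoc)
    also have "\<dots> = (\<Sum>k<d. \<Sum>j<d. \<rho> g i k * (\<rho> h k j * v j))" by (rule sum.swap)
    finally show ?thesis using True by (simp add: mat_act_in sum_distrib_left)
  qed (simp add: mat_act_def)
qed

lemma act_inverse_cancel:
  assumes "g \<in> SL" "v \<in> cspace {..<d}"
  shows "mat_act {..<d} (\<rho> (matrix_inv g)) (mat_act {..<d} (\<rho> g) v) = v"
  using act_mult[of "matrix_inv g" g v] assms by (simp add: SL_inv act_one)

lemma pairing_contragredient:
  assumes "g \<in> SL"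
  shows "pairing {..<d} (mat_act {..<d} (contragredient \<rho> g) w) v =
    pairing {..<d} w (mat_act {..<d} (\<rho> (matrix_inv g)) v)"
  by (rule pairing_mat_act_transpose[symmetric]) (simp add: contragredient_def)

lemma pairing_act:
  assumes "g \<in> SL"
  shows "pairing {..<d} w (mat_act {..<d} (\<rho> g) v) =
    pairing {..<d} (mat_act {..<d} (contragredient \<rho> (matrix_inv g)) w) v"
  using assms by (simp add: pairing_contragredient matrix_inv_inv_SL)

lemma matrix_coefficient_polynomial:
  "\<exists>p\<in>polynomial_functions mat_coords. \<forall>g\<in>SL. pairing {..<d} w (mat_act {..<d} (\<rho> g) v) = p g"
proof -
  obtain q where q: "\<And>i j. i < d \<Longrightarrow> j < d \<Longrightarrow> q i j \<in> polynomial_functions mat_coords"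
    "\<And>i j g. i < d \<Longrightarrow> j < d \<Longrightarrow> g \<in> SL \<Longrightarrow> \<rho> g i j = q i j g"
    using rep_polynomial by metis
  have poly: "(\<lambda>g. \<Sum>i<d. \<Sum>j<d. w i * v j * q i j g) \<in> polynomial_functions mat_coords"
    by (intro polynomial_functions_sum polynomial_functions_cmult) (auto intro: q)
  have "pairing {..<d} w (mat_act {..<d} (\<rho> g) v) = (\<Sum>i<d. \<Sum>j<d. w i * v j * q i j g)"
    if "g \<in> SL" for g
    unfolding pairing_mat_act
  proof (rule sum.cong[OF HOL.refl], rule sum.cong[OF HOL.refl])
    fix i j assume "i \<in> {..<d}" "j \<in> {..<d}"
    then have "\<rho> g i j = q i j g" using q(2)[of i j g] that by blast
    then show "w i * \<rho> g i j * v j = w i * v j * q i j g" by (simp only: mult_ac)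
  qed
  then show ?thesis by (intro bexI[OF _ poly]) simp
qed

end

text \<open>Cramer's rule, whose denominator is 1 on \<open>SL\<close>.\<close>

lemma matrix_inv_polynomial:
  "\<exists>p\<in>polynomial_functions mat_coords. \<forall>g\<in>SL. matrix_inv g $ (k::'n::finite) $ j = p g"
proof -
  define M :: "'n cmat \<Rightarrow> 'n cmat"
    where "M g = (\<chi> i l. if l = k then axis j 1 $ i else g $ i $ l)" for g
  have poly: "(\<lambda>g. det (M g)) \<in> polynomial_functions mat_coords"
    unfolding det_def
  proof (intro polynomial_functions_sum polynomial_functions_cmult polynomial_functions_prod)
    fix \<sigma> :: "'n \<Rightarrow> 'n" and i
    show "(\<lambda>x. M x $ i $ \<sigma> i) \<in> polynomial_functions mat_coords"
      by (cases "\<sigma> i = k")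
        (auto simp: M_def mat_coords_def intro!: polynomial_functions.const polynomial_functions.coord)
  qed (auto simp: finite_permutations)
  have "matrix_inv g $ k $ j = det (M g)" if "g \<in> SL" for g
  proof -
    have "g *v (matrix_inv g *v axis j 1) = axis j 1"
      using SL_inv(1)[OF that] by (simp add: matrix_vector_mul_assoc)
    then have "det (M g) = (matrix_inv g *v axis j 1) $ k * det g"
      using cramer_lemma[where A = g and x = "matrix_inv g *v axis j 1" and k = k]
      unfolding M_def by (simp only:)
    then show ?thesis using that 
      by (simp add: SL_def matrix_vector_mult_def axis_def if_distrib[of "\<lambda>x. _ * x"] cong: if_cong)
  qed
  then show ?thesis by (intro bexI[OF _ poly]) simp
qed

lemma polynomial_matrix_inv:
  assumes "p \<in> polynomial_functions mat_coords"
  shows "\<exists>q\<in>polynomial_functions mat_coords. \<forall>g\<in>SL. p (matrix_inv (g :: ('n::finite) cmat)) = q g"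
  using assms
proof induction
  case (const c)
  then show ?case by (auto intro: polynomial_functions.const)
next
  case (coord f)
  then obtain i j where "f = (\<lambda>A. A $ i $ j)" by (auto simp: mat_coords_def)
  then show ?case using matrix_inv_polynomial by simp
next
  case (add f g)
  then obtain q q' where "q \<in> polynomial_functions mat_coords" "\<forall>x\<in>SL. f (matrix_inv x) = q x"
    "q' \<in> polynomial_functions mat_coords" "\<forall>x\<in>SL. g (matrix_inv x) = q' x" by blast
  then show ?case by (intro bexI[of _ "\<lambda>x. q x + q' x"]) (auto intro: polynomial_functions.add)
next
  case (mult f g)
  then obtain q q' where "q \<in> polynomial_functions mat_coords" "\<forall>x\<in>SL. f (matrix_inv x) = q x"
    "q' \<in> polynomial_functions mat_coords" "\<forall>x\<in>SL. g (matrix_inv x) = q' x" by blast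
  then show ?case by (intro bexI[of _ "\<lambda>x. q x * q' x"]) (auto intro: polynomial_functions.mult)
qed

lemma rational_rep_contragredient:
  assumes R: "rational_rep d \<rho>" shows "rational_rep d (contragredient \<rho>)"
  unfolding rational_rep_def
proof (intro conjI allI impI ballI)
  fix i j assume ij: "i < d" "j < d"
  show "contragredient \<rho> (mat 1) i j = (if i = j then 1 else 0)"
    using rep_one[OF R] ij by (auto simp: contragredient_def)
  show "\<exists>p\<in>polynomial_functions mat_coords. \<forall>g\<in>SL. contragredient \<rho> g i j = p g"
  proof -
    obtain p where p: "p \<in> polynomial_functions mat_coords" "\<forall>g\<in>SL. \<rho> g j i = p g"
      using rep_polynomial[OF R] ij by blast
    then show ?thesis using polynomial_matrix_inv[OF p(1)] by (simp add: contragredient_def)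
  qed
  fix g h :: "'a cmat" assume "g \<in> SL" "h \<in> SL"
  then show "contragredient \<rho> (g ** h) i j = (\<Sum>k<d. contragredient \<rho> g i k * contragredient \<rho> h k j)"
    using rep_mult[OF R, of "matrix_inv h" "matrix_inv g" j i] ij
    by (simp add: contragredient_def matrix_inv_mult_SL mult.commute)
qed

text \<open>The differential at 1 of some polynomial extension of the matrix entry to all matrices.
  Linearity is then automatic, and along curves inside \<open>SL\<close> the value does not depend
  on the extension.\<close>

definition rder :: "('n::finite) matrep \<Rightarrow> nat \<Rightarrow> nat \<Rightarrow> 'n cmat \<Rightarrow> complex" where
  "rder \<rho> i j = frechet_derivative
     (SOME p. p \<in> polynomial_functions mat_coords \<and> (\<forall>g\<in>SL. \<rho> g i j = p g)) (at (mat 1))"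

text \<open>A Frechet derivative is only real linear; complex homogeneity is carried through the
  induction because \<open>lie_rep\<close> must respect \<open>sl_scale\<close>.\<close>

lemma polynomial_has_derivative:
  assumes "p \<in> polynomial_functions mat_coords"
  shows "\<exists>D. (p has_derivative D) (at (A :: ('n::finite) cmat)) \<and>
    (\<forall>c X. D (\<chi> i j. c * X $ i $ j) = c * D X)"
  using assms
proof induction
  case (const c)
  then show ?case by (intro exI[of _ "\<lambda>_. 0"]) simp
next
  case (coord f)
  then obtain i j where f: "f = (\<lambda>A. A $ i $ j)" by (auto simp: mat_coords_def)
  have "bounded_linear f" unfolding f
    using bounded_linear_compose[OF bounded_linear_vec_nth bounded_linear_vec_nth] .
  then show ?case by (intro exI[of _ f]) (simp add: bounded_linear_imp_has_derivative, simp add: f)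
next
  case (add f g)
  then obtain D E where D: "(f has_derivative D) (at A)" "\<forall>c X. D (\<chi> i j. c * X $ i $ j) = c * D X"
    and E: "(g has_derivative E) (at A)" "\<forall>c X. E (\<chi> i j. c * X $ i $ j) = c * E X" by blast
  show ?case using has_derivative_add[OF D(1) E(1)] D(2) E(2)
    by (intro exI[of _ "\<lambda>X. D X + E X"] conjI allI) (simp_all add: ring_distribs)
next
  case (mult f g)
  then obtain D E where D: "(f has_derivative D) (at A)" "\<forall>c X. D (\<chi> i j. c * X $ i $ j) = c * D X"
    and E: "(g has_derivative E) (at A)" "\<forall>c X. E (\<chi> i j. c * X $ i $ j) = c * E X" by blast
  show ?case using has_derivative_mult[OF D(1) E(1)] D(2) E(2)
    by (intro exI[of _ "\<lambda>X. f A * E X + D X * g A"]) (simp add: algebra_simps)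
qed

context
  fixes d :: nat and \<rho> :: "('n::finite) matrep"
  assumes R: "rational_rep d \<rho>"
begin

lemma rder_witness:
  assumes "i < d" "j < d"
  shows "\<exists>p. (\<forall>g\<in>SL. \<rho> g i j = p g) \<and> (p has_derivative rder \<rho> i j) (at (mat 1)) \<and>
    (\<forall>c X. rder \<rho> i j (\<chi> i j. c * X $ i $ j) = c * rder \<rho> i j X)"
proof -
  define p where "p = (SOME p. p \<in> polynomial_functions mat_coords \<and> (\<forall>g\<in>SL. \<rho> g i j = p g))"
  have "\<exists>p. p \<in> polynomial_functions mat_coords \<and> (\<forall>g\<in>SL. \<rho> g i j = p g)"
    using rep_polynomial[OF R assms] by blast
  then have p: "p \<in> polynomial_functions mat_coords \<and> (\<forall>g\<in>SL. \<rho> g i j = p g)"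
    unfolding p_def by (rule someI_ex)
  obtain D where D: "(p has_derivative D) (at (mat 1))" "\<forall>c X. D (\<chi> i j. c * X $ i $ j) = c * D X"
    using polynomial_has_derivative p by blast
  have "rder \<rho> i j = D"
    unfolding rder_def p_def[symmetric] using frechet_derivative_at[OF D(1)] by simp
  then show ?thesis using p D by blast
qed

lemma rder_linear: "i < d \<Longrightarrow> j < d \<Longrightarrow> bounded_linear (rder \<rho> i j)"
  using rder_witness has_derivative_bounded_linear by blast

lemma rder_scale: "i < d \<Longrightarrow> j < d \<Longrightarrow> rder \<rho> i j (\<chi> i j. c * X $ i $ j) = c * rder \<rho> i j X"
  using rder_witness by blast

lemma rder_curve:
  assumes "i < d" "j < d" and \<gamma>: "\<And>t. \<gamma> t \<in> SL" "\<gamma> t0 = mat 1" "(\<gamma> has_vector_derivative X) (at t0)"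
  shows "((\<lambda>t. \<rho> (\<gamma> t) i j) has_vector_derivative rder \<rho> i j X) (at t0)"
proof -
  obtain p where p: "\<forall>g\<in>SL. \<rho> g i j = p g" "(p has_derivative rder \<rho> i j) (at (mat 1))"
    using rder_witness[OF assms(1,2)] by blast
  have "(p \<circ> \<gamma> has_derivative rder \<rho> i j \<circ> (\<lambda>y. y *\<^sub>R X)) (at t0)"
    using \<gamma>(2,3) p(2) by (intro diff_chain_at) (simp_all add: has_vector_derivative_def)
  moreover have "rder \<rho> i j \<circ> (\<lambda>y. y *\<^sub>R X) = (\<lambda>y. y *\<^sub>R rder \<rho> i j X)"
    using linear_scale[OF bounded_linear.linear[OF rder_linear[OF assms(1,2)]]] by (auto simp: o_def)
  ultimately show ?thesis using p(1) \<gamma>(1) by (simp add: has_vector_derivative_def o_def)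
qed

lemma lie_rep_eq: "i < d \<Longrightarrow> j < d \<Longrightarrow> lie_rep \<rho> x i j = rder \<rho> i j (sl_mat x)"
  unfolding lie_rep_def
  by (rule vector_derivative_at, rule rder_curve) (auto simp: mexp_sl mexp_derivative_zero)

lemma rder_neg: "i < d \<Longrightarrow> j < d \<Longrightarrow> rder \<rho> i j (- X) = - rder \<rho> i j X"
  using linear_neg[OF bounded_linear.linear[OF rder_linear]] .

lemma lie_rep_add: "i < d \<Longrightarrow> j < d \<Longrightarrow> lie_rep \<rho> (x + y) i j = lie_rep \<rho> x i j + lie_rep \<rho> y i j"
  using linear_add[OF bounded_linear.linear[OF rder_linear]] by (simp add: lie_rep_eq plus_sl.rep_eq)

lemma lie_rep_scale: "i < d \<Longrightarrow> j < d \<Longrightarrow> lie_rep \<rho> (sl_scale c x) i j = c * lie_rep \<rho> x i j"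
  by (simp add: lie_rep_eq sl_scale.rep_eq rder_scale)

lemma rder_conj:
  assumes ij: "i < d" "j < d" and g: "g \<in> SL"
  shows "rder \<rho> i j (g ** sl_mat y ** matrix_inv g) =
    (\<Sum>k<d. \<Sum>l<d. \<rho> g i k * lie_rep \<rho> y k l * \<rho> (matrix_inv g) l j)"
proof -
  let ?\<gamma> = "\<lambda>s. g ** mexp (s *\<^sub>R sl_mat y) ** matrix_inv g"
  have SL: "?\<gamma> s \<in> SL" for s using g by (simp add: mexp_sl)
  have "(?\<gamma> has_vector_derivative g ** sl_mat y ** matrix_inv g) (at 0)"
    using has_vector_derivative_mult[OF has_vector_derivative_mult[OF has_vector_derivative_const
        mexp_derivative_zero] has_vector_derivative_const] by simp
  then have "((\<lambda>s. \<rho> (?\<gamma> s) i j) has_vector_derivative rder \<rho> i j (g ** sl_mat y ** matrix_inv g)) (at 0)"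
    by (intro rder_curve ij SL) (simp add: SL_inv g)
  moreover have "\<rho> (?\<gamma> s) i j = (\<Sum>l<d. (\<Sum>k<d. \<rho> g i k * \<rho> (mexp (s *\<^sub>R sl_mat y)) k l) * \<rho> (matrix_inv g) l j)" for s
    using ij g by (simp add: mexp_sl rep_mult[OF R])
  moreover have "((\<lambda>s. \<Sum>l<d. (\<Sum>k<d. \<rho> g i k * \<rho> (mexp (s *\<^sub>R sl_mat y)) k l) * \<rho> (matrix_inv g) l j)
    has_vector_derivative (\<Sum>l<d. (\<Sum>k<d. \<rho> g i k * rder \<rho> k l (sl_mat y)) * \<rho> (matrix_inv g) l j)) (at 0)"
    by (intro has_vector_derivative_sum has_vector_derivative_mult_left has_vector_derivative_mult_right
        rder_curve mexp_sl mexp_derivative_zero) auto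
  ultimately have "rder \<rho> i j (g ** sl_mat y ** matrix_inv g) =
    (\<Sum>l<d. (\<Sum>k<d. \<rho> g i k * rder \<rho> k l (sl_mat y)) * \<rho> (matrix_inv g) l j)"
    using vector_derivative_unique_at by fastforce
  also have "\<dots> = (\<Sum>l<d. \<Sum>k<d. \<rho> g i k * lie_rep \<rho> y k l * \<rho> (matrix_inv g) l j)"
    by (simp add: sum_distrib_right lie_rep_eq)
  also have "\<dots> = (\<Sum>k<d. \<Sum>l<d. \<rho> g i k * lie_rep \<rho> y k l * \<rho> (matrix_inv g) l j)" by (rule sum.swap)
  finally show ?thesis .
qed

text \<open>The curve \<open>?G t ** ?Y ** ?H t\<close>, the adjoint orbit of \<open>y\<close> under
  the exponentials of \<open>x\<close>, is differentiated in two ways: as a matrix its velocity at 0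
  is the bracket, and through \<open>rder_conj\<close> it becomes the derivative of a triple product
  of representation matrices.\<close>

lemma lie_rep_bracket:
  assumes ij: "i < d" "j < d"
  shows "lie_rep \<rho> (sl_bracket x y) i j =
    (\<Sum>k<d. lie_rep \<rho> x i k * lie_rep \<rho> y k j) - (\<Sum>k<d. lie_rep \<rho> y i k * lie_rep \<rho> x k j)"
proof -
  let ?X = "sl_mat x" and ?Y = "sl_mat y"
  let ?G = "\<lambda>t. mexp (t *\<^sub>R ?X)" and ?H = "\<lambda>t. mexp (t *\<^sub>R (- ?X))"
  have H: "?H t \<in> SL" for t using mexp_sl[of t "- x"] by (simp add: uminus_sl.rep_eq)
  have "((\<lambda>t. ?G t ** ?Y ** ?H t) has_vector_derivative sl_mat (sl_bracket x y)) (at 0)"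
  proof -
    have "((\<lambda>t. ?G t ** ?Y ** ?H t) has_vector_derivative
        (?G 0 ** ?Y ** (- ?X) + (?G 0 ** 0 + ?X ** ?Y) ** ?H 0)) (at 0)"
      by (rule has_vector_derivative_mult[OF has_vector_derivative_mult[OF mexp_derivative_zero
          has_vector_derivative_const] mexp_derivative_zero])
    moreover have "?G 0 ** ?Y ** (- ?X) + (?G 0 ** 0 + ?X ** ?Y) ** ?H 0 = sl_mat (sl_bracket x y)"
      by (simp add: sl_bracket.rep_eq vec_eq_iff mm_entry sum_negf)
    ultimately show ?thesis by simp
  qed
  from bounded_linear.has_vector_derivative[OF rder_linear[OF ij] this]
  have 1: "((\<lambda>t. rder \<rho> i j (?G t ** ?Y ** ?H t)) has_vector_derivative lie_rep \<rho> (sl_bracket x y) i j) (at 0)"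
    by (simp add: lie_rep_eq ij)
  have "rder \<rho> i j (?G t ** ?Y ** ?H t) =
      (\<Sum>k<d. \<Sum>l<d. \<rho> (?G t) i k * lie_rep \<rho> y k l * \<rho> (?H t) l j)" for t
    using rder_conj[OF ij mexp_sl, of t x y] by (simp add: matrix_inv_mexp)
  moreover have "((\<lambda>t. \<Sum>k<d. \<Sum>l<d. \<rho> (?G t) i k * lie_rep \<rho> y k l * \<rho> (?H t) l j) has_vector_derivative
     (\<Sum>k<d. \<Sum>l<d. \<rho> (?G 0) i k * lie_rep \<rho> y k l * rder \<rho> l j (- ?X) +
        rder \<rho> i k ?X * lie_rep \<rho> y k l * \<rho> (?H 0) l j)) (at 0)"
    by (intro has_vector_derivative_sum has_vector_derivative_mult has_vector_derivative_mult_left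
        has_vector_derivative_mult_right bounded_bilinear.has_vector_derivative[OF bounded_bilinear_mult]
        rder_curve mexp_sl H mexp_derivative_zero) (use ij in auto)
  ultimately have "lie_rep \<rho> (sl_bracket x y) i j =
     (\<Sum>k<d. \<Sum>l<d. \<rho> (?G 0) i k * lie_rep \<rho> y k l * rder \<rho> l j (- ?X) +
        rder \<rho> i k ?X * lie_rep \<rho> y k l * \<rho> (?H 0) l j)"
    using vector_derivative_unique_at[OF 1] by simp
  also have "\<dots> = (\<Sum>k<d. \<Sum>l<d. (if i = k then 1 else 0) * lie_rep \<rho> y k l * - lie_rep \<rho> x l j) +
      (\<Sum>k<d. \<Sum>l<d. lie_rep \<rho> x i k * lie_rep \<rho> y k l * (if l = j then 1 else 0))"
    unfolding sum.distrib[symmetric]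
    by (intro sum.cong HOL.refl arg_cong2[of _ _ _ _ "(+)"]) (use ij in \<open>auto simp: rep_one[OF R] rder_neg lie_rep_eq\<close>)
  also have "(\<Sum>k<d. \<Sum>l<d. (if i = k then 1 else 0) * lie_rep \<rho> y k l * - lie_rep \<rho> x l j) =
      (\<Sum>k<d. if i = k then (\<Sum>l<d. lie_rep \<rho> y k l * - lie_rep \<rho> x l j) else 0)"
    by (intro sum.cong) auto
  also have "\<dots> = - (\<Sum>k<d. lie_rep \<rho> y i k * lie_rep \<rho> x k j)"
    using ij by (simp add: sum_negf)
  also have "(\<Sum>k<d. \<Sum>l<d. lie_rep \<rho> x i k * lie_rep \<rho> y k l * (if l = j then 1 else 0)) =
      (\<Sum>k<d. lie_rep \<rho> x i k * lie_rep \<rho> y k j)"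
    using ij by (simp add: if_distrib[of "\<lambda>x. _ * x"] cong: if_cong)
  finally show ?thesis by simp
qed

end

subsection \<open>The action of the enveloping algebra\<close>

primrec uact :: "nat \<Rightarrow> ('n::finite) matrep \<Rightarrow> 'n uterm \<Rightarrow> (nat \<Rightarrow> complex) \<Rightarrow> nat \<Rightarrow> complex" where
  "uact d \<rho> (UC c) v = (\<lambda>i. c * v i)"
| "uact d \<rho> (UG x) v = mat_act {..<d} (lie_rep \<rho> x) v"
| "uact d \<rho> (UA a b) v = (\<lambda>i. uact d \<rho> a v i + uact d \<rho> b v i)"
| "uact d \<rho> (UM a b) v = uact d \<rho> a (uact d \<rho> b v)"

lemma uact_cspace: "v \<in> cspace {..<d} \<Longrightarrow> uact d \<rho> a v \<in> cspace {..<d}"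
proof (induction a arbitrary: v)
  case (UG x)
  then show ?case by simp
qed (auto simp: cspace_def)

lemma uact_scale: "uact d \<rho> a (\<lambda>i. c * v i) = (\<lambda>i. c * uact d \<rho> a v i)"
  by (induction a arbitrary: v) (auto simp: mat_act_scale algebra_simps)

lemma uact_add: "uact d \<rho> a (\<lambda>i. v i + w i) = (\<lambda>i. uact d \<rho> a v i + uact d \<rho> a w i)"
  by (induction a arbitrary: v w) (auto simp: mat_act_add algebra_simps)

text \<open>Each defining relation of the enveloping algebra holds for the operators of a
  representation, so the action on expressions descends to \<open>Ug\<close> and may be computed on
  any representative.\<close>

lemma uact_ucong:
  assumes R: "rational_rep d \<rho>"
  shows "ucong a b \<Longrightarrow> v \<in> cspace {..<d} \<Longrightarrow> uact d \<rho> a v = uact d \<rho> b v"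
proof (induction arbitrary: v rule: ucong.induct)
  case (mult_cong a a' b b')
  then show ?case by (simp add: uact_cspace)
next
  case (gen_add x y)
  show ?case by (auto simp: mat_act_def lie_rep_add[OF R] sum.distrib algebra_simps intro!: ext)
next
  case (gen_scale c x)
  show ?case by (auto simp: mat_act_def lie_rep_scale[OF R] sum_distrib_left algebra_simps intro!: ext)
next
  case (gen_bracket x y)
  have M: "mat_act {..<d} A (mat_act {..<d} B v) i = (\<Sum>j<d. (\<Sum>k<d. A i k * B k j) * v j)" if "i < d" for A B i
  proof -
    have "mat_act {..<d} A (mat_act {..<d} B v) i = (\<Sum>k<d. \<Sum>j<d. A i k * B k j * v j)"
      using that by (simp add: mat_act_in sum_distrib_left mult.assoc)
    also have "\<dots> = (\<Sum>j<d. \<Sum>k<d. A i k * B k j * v j)" by (rule sum.swap)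
    finally show ?thesis by (simp add: sum_distrib_right)
  qed
  show ?case
  proof
    fix i
    show "uact d \<rho> (UG (sl_bracket x y)) v i =
      uact d \<rho> (UA (UM (UG x) (UG y)) (UM (UC (- 1)) (UM (UG y) (UG x)))) v i"
    proof (cases "i < d")
      case True
      then show ?thesis
        by (simp add: M) (simp add: mat_act_in lie_rep_bracket[OF R] left_diff_distrib sum_subtractf)
    qed (simp add: mat_act_def)
  qed
qed (auto simp: uact_scale uact_add algebra_simps)

definition Uact :: "nat \<Rightarrow> ('n::finite) matrep \<Rightarrow> 'n Ug \<Rightarrow> (nat \<Rightarrow> complex) \<Rightarrow> nat \<Rightarrow> complex" where
  "Uact d \<rho> u = uact d \<rho> (rep_Ug u)"

lemma ucong_rep_abs: "ucong (rep_Ug (abs_Ug a)) a"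
  by (rule rep_abs_rsp_left[OF Quotient3_Ug]) (rule ucong.refl)

lemma Uact_abs:
  assumes "rational_rep d \<rho>" "v \<in> cspace {..<d}"
  shows "Uact d \<rho> (abs_Ug a) v = uact d \<rho> a v"
  unfolding Uact_def by (rule uact_ucong[OF assms(1) ucong_rep_abs assms(2)])

lemma abs_rep_Ug: "abs_Ug (rep_Ug u) = u"
  by (rule Quotient3_abs_rep[OF Quotient3_Ug])

context
  fixes d :: nat and \<rho> :: "('n::finite) matrep" and v :: "nat \<Rightarrow> complex"
  assumes R: "rational_rep d \<rho>" and v: "v \<in> cspace {..<d}"
begin

lemma Uact_plus: "Uact d \<rho> (a + b) v = (\<lambda>i. Uact d \<rho> a v i + Uact d \<rho> b v i)"
proof -
  have "a + b = abs_Ug (UA (rep_Ug a) (rep_Ug b))"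
    using plus_Ug.abs_eq[of "rep_Ug a" "rep_Ug b"] by (simp add: abs_rep_Ug)
  then show ?thesis using Uact_abs[OF R v] by (simp add: Uact_def)
qed

lemma Uact_times: "Uact d \<rho> (a * b) v = Uact d \<rho> a (Uact d \<rho> b v)"
proof -
  have "a * b = abs_Ug (UM (rep_Ug a) (rep_Ug b))"
    using times_Ug.abs_eq[of "rep_Ug a" "rep_Ug b"] by (simp add: abs_rep_Ug)
  then show ?thesis using Uact_abs[OF R v] by (simp add: Uact_def)
qed

lemma Uact_const: "Uact d \<rho> (U_const c) v = (\<lambda>i. c * v i)"
  using Uact_abs[OF R v, of "UC c"] by (simp add: U_const.abs_eq)

lemma Uact_gen: "Uact d \<rho> (U_gen x) v = mat_act {..<d} (lie_rep \<rho> x) v"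
  using Uact_abs[OF R v, of "UG x"] by (simp add: U_gen.abs_eq)

lemma Uact_zero: "Uact d \<rho> 0 v = (\<lambda>_. 0)"
  using Uact_abs[OF R v, of "UC 0"] by (simp add: zero_Ug.abs_eq)

lemma Uact_minus: "Uact d \<rho> (a - b) v = (\<lambda>i. Uact d \<rho> a v i - Uact d \<rho> b v i)"
proof -
  have "- b = abs_Ug (UM (UC (-1)) (rep_Ug b))"
    using uminus_Ug.abs_eq[of "rep_Ug b"] by (simp add: abs_rep_Ug)
  then have "Uact d \<rho> (- b) v = (\<lambda>i. - Uact d \<rho> b v i)"
    using Uact_abs[OF R v] by (simp add: Uact_def)
  then show ?thesis using Uact_plus[of a "- b"] by simp
qed

end

lemma Uact_cspace: "v \<in> cspace {..<d} \<Longrightarrow> Uact d \<rho> u v \<in> cspace {..<d}"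
  unfolding Uact_def by (rule uact_cspace)

lemma Uact_sum:
  assumes "rational_rep d \<rho>" "v \<in> cspace {..<d}" "finite A"
  shows "Uact d \<rho> (\<Sum>a\<in>A. f a) v = (\<lambda>i. \<Sum>a\<in>A. Uact d \<rho> (f a) v i)"
  using assms(3) by (induction A rule: finite_induct)
    (simp_all add: Uact_zero[OF assms(1,2)] Uact_plus[OF assms(1,2)])

text \<open>Elements of the left ideal end, on the right, in something that kills \<open>v\<close>.
  With the nilradical for \<open>S\<close>, this is why classes modulo the left ideal act
  unambiguously on a highest weight vector.\<close>

lemma Uact_left_ideal:
  assumes R: "rational_rep d \<rho>" and v: "v \<in> cspace {..<d}"
    and S: "\<And>x. x \<in> S \<Longrightarrow> mat_act {..<d} (lie_rep \<rho> x) v = (\<lambda>_. 0)"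
    and u: "u \<in> left_ideal S"
  shows "Uact d \<rho> u v = (\<lambda>_. 0)"
  using u
proof induction
  case zero
  then show ?case by (rule Uact_zero[OF R v])
next
  case (step a x u)
  have "Uact d \<rho> u (\<lambda>_. 0) = (\<lambda>_. 0)"
    unfolding Uact_def using uact_scale[of d \<rho> "rep_Ug u" 0 "\<lambda>_. 0"] by simp
  then show ?case
    by (simp add: Uact_plus[OF R v] Uact_times[OF R v] Uact_gen[OF R v] S step)
qed

text \<open>Right translation of g \<mapsto> <w, g v> moves onto the vector \<open>v\<close>. This
  turns the differential operators of the theorem into the algebraic action of the enveloping
  algebra.\<close>

lemma R_term_matrix_coefficient:
  assumes R: "rational_rep d \<rho>"
    and "\<And>g. g \<in> SL \<Longrightarrow> \<phi> g = pairing {..<d} w (mat_act {..<d} (\<rho> g) v)" "g \<in> SL"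
  shows "R_term a \<phi> g = pairing {..<d} w (mat_act {..<d} (\<rho> g) (uact d \<rho> a v))"
  using assms(2,3)
proof (induction a arbitrary: \<phi> g v)
  case (UG x)
  let ?E = "\<lambda>t. mexp (t *\<^sub>R sl_mat x)"
  have E: "pairing {..<d} w (mat_act {..<d} (\<rho> (g ** ?E t)) v) =
     (\<Sum>i<d. w i * (\<Sum>k<d. \<rho> g i k * (\<Sum>j<d. \<rho> (?E t) k j * v j)))" for t
    using UG.prems(2) by (simp add: mexp_sl act_mult[OF R] pairing_def mat_act_in)
  have "((\<lambda>t. \<phi> (g ** ?E t)) has_vector_derivative
     (\<Sum>i<d. w i * (\<Sum>k<d. \<rho> g i k * (\<Sum>j<d. rder \<rho> k j (sl_mat x) * v j)))) (at 0)"
    unfolding UG.prems(1)[OF SL_mult[OF UG.prems(2) mexp_sl]] E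
    by (intro has_vector_derivative_sum has_vector_derivative_mult_left has_vector_derivative_mult_right
        rder_curve[OF R] mexp_sl mexp_derivative_zero) auto
  then have "R_term (UG x) \<phi> g = (\<Sum>i<d. w i * (\<Sum>k<d. \<rho> g i k * (\<Sum>j<d. rder \<rho> k j (sl_mat x) * v j)))"
    by (simp add: vector_derivative_at)
  then show ?case by (simp add: pairing_def mat_act_in lie_rep_eq[OF R])
next
  case (UM a b)
  show ?case using UM.IH(1)[of "R_term b \<phi>" "uact d \<rho> b v" g] UM.IH(2)[OF UM.prems(1)] UM.prems(2)
    by simp
qed (auto simp: mat_act_scale mat_act_add pairing_scale pairing_add)

lemma R_op_matrix_coefficient:
  assumes "rational_rep d \<rho>"
    and "\<And>g. g \<in> SL \<Longrightarrow> \<phi> g = pairing {..<d} w (mat_act {..<d} (\<rho> g) v)" "g \<in> SL"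
  shows "R_op u \<phi> g = pairing {..<d} w (mat_act {..<d} (\<rho> g) (Uact d \<rho> u v))"
  unfolding R_op_def Uact_def by (rule R_term_matrix_coefficient[OF assms])

subsection \<open>Frames of complete flags\<close>

lemma mv_entry: "(A *v x) $ i = (\<Sum>j\<in>UNIV. A $ i $ j * x $ j)"
  by (simp add: matrix_vector_mult_def)

lemma mv_axis: "((A :: ('n::finite) cmat) *v axis k 1) $ i = A $ i $ k"
  by (simp add: mv_entry axis_def if_distrib[of "\<lambda>x. _ * x"] cong: if_cong)

lemma mv_dmat: "(dmat d *v x) $ i = d i * x $ i"
  by (simp add: mv_entry dmat_def if_distrib[of "\<lambda>x. x * _"] cong: if_cong)

lemma mv_scale: "(A :: ('n::finite) cmat) *v (c *s x) = c *s (A *v x)"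
  by (simp add: vec_eq_iff mv_entry sum_distrib_left mult.left_commute)

lemma mv_inverse:
  assumes "invertible (p :: ('n::finite) cmat)"
  shows "matrix_inv p *v (p *v x) = x" "p *v (matrix_inv p *v x) = x"
  using matrix_inv_both[OF assms] by (simp_all add: matrix_vector_mul_assoc)

text \<open>The span of the columns of \<open>p\<close> in positions below \<open>i\<close>,
  expressed by vanishing coordinates so that membership is a pointwise condition.\<close>

definition frame_flag :: "('n::finite) cmat \<Rightarrow> nat \<Rightarrow> (complex^'n) set" where
  "frame_flag p i = {x. \<forall>k. i \<le> pos k \<longrightarrow> (matrix_inv p *v x) $ k = 0}"

lemma complete_flag_step:
  fixes F :: "nat \<Rightarrow> (complex^'n::finite) set"
  assumes F: "complete_flag F" and f: "f \<in> F (Suc i)" "f \<notin> F i" and x: "x \<in> F (Suc i)"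
  shows "\<exists>c. x - c *s f \<in> F i"
proof -
  have sub: "vec.subspace (F i)" "vec.subspace (F (Suc i))" "F i \<subseteq> F (Suc i)"
    "vec.dim (F i) = min i CARD('n)" "vec.dim (F (Suc i)) = min (Suc i) CARD('n)"
    using F by (auto simp: complete_flag_def)
  have span: "vec.span (F i) = F i" using sub(1) by (simp add: vec.span_eq_iff)
  have "vec.dim (insert f (F i)) = vec.dim (F i) + 1"
    using f(2) by (simp add: vec.dim_insert span)
  then have "vec.dim (F (Suc i)) \<le> vec.dim (vec.span (insert f (F i)))"
    using sub(4,5) by simp
  moreover have "vec.span (insert f (F i)) \<subseteq> F (Suc i)"
    using f(1) sub(2,3) by (intro vec.span_minimal) auto
  ultimately have "vec.span (insert f (F i)) = F (Suc i)"
    by (intro vec.subspace_dim_equal vec.subspace_span sub(2)) auto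
  then have "x \<in> vec.span (insert f (F i))" using x by simp
  then show ?thesis by (simp add: vec.span_breakdown_eq span)
qed

lemma complete_flag_strict:
  fixes F :: "nat \<Rightarrow> (complex^'n::finite) set"
  assumes F: "complete_flag F" and i: "i < CARD('n)"
  shows "\<exists>x. x \<in> F (Suc i) \<and> x \<notin> F i"
proof (rule ccontr)
  assume "\<not> ?thesis"
  then have "F (Suc i) \<subseteq> F i" by blast
  then have "vec.dim (F (Suc i)) \<le> vec.dim (F i)" by (rule vec.dim_subset)
  then show False using F i by (simp add: complete_flag_def)
qed

lemma complete_flag_mono: "complete_flag F \<Longrightarrow> i \<le> j \<Longrightarrow> F i \<subseteq> F j"
  by (rule lift_Suc_mono_le[of F]) (auto simp: complete_flag_def)

text \<open>Each step of the flag is one-dimensional modulo the previous one, so a vector that is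
  new at each step yields a basis adapted to the whole flag.\<close>

lemma frame_of_adapted_vectors:
  fixes F :: "nat \<Rightarrow> (complex^'n::finite) set"
  assumes F: "complete_flag F" and f: "\<And>k. f k \<in> F (Suc (pos k))" "\<And>k. f k \<notin> F (pos k)"
  defines "p \<equiv> (\<chi> i k. f k $ i)"
  shows "invertible p" "F = frame_flag p"
proof -
  have sub: "vec.subspace (F i)" for i using F by (auto simp: complete_flag_def)
  have pv: "p *v a = (\<Sum>k\<in>UNIV. a $ k *s f k)" for a
    by (simp add: vec_eq_iff mv_entry p_def mult.commute)
  have char: "x \<in> F i \<longleftrightarrow> (\<exists>a. (\<forall>k. i \<le> pos k \<longrightarrow> a $ k = 0) \<and> x = p *v a)" if "i \<le> CARD('n)" for i x
    using that
  proof (induction i arbitrary: x)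
    case 0
    have "vec.dim (F 0) = 0" using F by (simp add: complete_flag_def)
    then have "F 0 \<subseteq> {0}" by simp
    then have "F 0 = {0}" using vec.subspace_0[OF sub] by blast
    moreover have "(\<exists>a. (\<forall>k. 0 \<le> pos k \<longrightarrow> a $ k = 0) \<and> x = p *v a) \<longleftrightarrow> x = 0"
    proof
      assume "\<exists>a. (\<forall>k. 0 \<le> pos k \<longrightarrow> a $ k = 0) \<and> x = p *v a"
      then obtain a where "\<forall>k. a $ k = 0" "x = p *v a" by auto
      moreover from this(1) have "a = 0" by (simp add: vec_eq_iff)
      ultimately show "x = 0" by simp
    qed (auto intro!: exI[of _ "0 :: complex^'n"])
    ultimately show ?case by simp
  next
    case (Suc i)
    then obtain k0 :: 'n where k0: "pos k0 = i" using pos_surj by (metis Suc_le_lessD)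
    show ?case
    proof
      assume x: "x \<in> F (Suc i)"
      obtain c where c: "x - c *s f k0 \<in> F i"
        using complete_flag_step[OF F f(1,2)[of k0, unfolded k0] x] by blast
      with Suc obtain a where a: "\<forall>k. i \<le> pos k \<longrightarrow> a $ k = 0" "x - c *s f k0 = p *v a" by auto
      define b where "b = a + axis k0 c"
      have "p *v axis k0 c = c *s f k0"
        by (simp add: vec_eq_iff mv_entry p_def axis_def if_distrib[of "\<lambda>x. _ * x"] mult.commute cong: if_cong)
      then have "x = p *v b" using a(2) by (simp add: b_def matrix_vector_right_distrib algebra_simps)
      moreover have "b $ k = 0" if "Suc i \<le> pos k" for k
        using a(1) that k0 by (auto simp: b_def axis_def)
      ultimately show "\<exists>a. (\<forall>k. Suc i \<le> pos k \<longrightarrow> a $ k = 0) \<and> x = p *v a" by blast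
    next
      assume "\<exists>a. (\<forall>k. Suc i \<le> pos k \<longrightarrow> a $ k = 0) \<and> x = p *v a"
      then obtain a where a: "\<forall>k. Suc i \<le> pos k \<longrightarrow> a $ k = 0" "x = p *v a" by blast
      have "a $ k *s f k \<in> F (Suc i)" for k
      proof (cases "Suc i \<le> pos k")
        case True
        then show ?thesis using a(1) vec.subspace_0[OF sub] by simp
      next
        case False
        then have "F (Suc (pos k)) \<subseteq> F (Suc i)" by (intro complete_flag_mono[OF F]) simp
        then show ?thesis using f(1) vec.subspace_scale[OF sub] by blast
      qed
      then show "x \<in> F (Suc i)" unfolding a(2) pv by (intro vec.subspace_sum[OF sub])
    qed
  qed
  have full: "F i = UNIV" if "CARD('n) \<le> i" for i
  proof -
    have "vec.dim (F i) = vec.dim (UNIV :: (complex^'n) set)"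
      using F that by (simp add: complete_flag_def card_cart_basis)
    then show ?thesis using vec.subspace_dim_equal[OF sub, of UNIV i] by simp
  qed
  have "\<exists>a. x = p *v a" for x using char[of "CARD('n)" x] full by auto
  then have "surj ((*v) p)" by (auto simp: surj_def)
  then show p: "invertible p"
    using matrix_right_invertible_surjective invertible_right_inverse by blast
  show "F = frame_flag p"
  proof
    fix i
    show "F i = frame_flag p i"
    proof (cases "i \<le> CARD('n)")
      case True
      show ?thesis
      proof (intro set_eqI iffI)
        fix x assume "x \<in> F i"
        then obtain a where "\<forall>k. i \<le> pos k \<longrightarrow> a $ k = 0" "x = p *v a" using char[OF True] by blast
        then show "x \<in> frame_flag p i" by (simp add: frame_flag_def mv_inverse[OF p])
      next
        fix x assume "x \<in> frame_flag p i"
        then have "\<forall>k. i \<le> pos k \<longrightarrow> (matrix_inv p *v x) $ k = 0" "x = p *v (matrix_inv p *v x)"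
          by (simp_all add: frame_flag_def mv_inverse[OF p])
        then show "x \<in> F i" using char[OF True] by blast
      qed
    next
      case False
      then have "\<not> i \<le> pos k" for k :: 'n using pos_less[of k] by linarith
      then have "frame_flag p i = UNIV" by (simp add: frame_flag_def)
      then show ?thesis using full False by simp
    qed
  qed
qed

lemma complete_flag_frame:
  fixes F :: "nat \<Rightarrow> (complex^'n::finite) set"
  assumes F: "complete_flag F"
  shows "\<exists>p. invertible p \<and> F = frame_flag p"
proof -
  have "\<exists>x. x \<in> F (Suc (pos k)) \<and> x \<notin> F (pos k)" for k :: 'n
    by (rule complete_flag_strict[OF F pos_less])
  then obtain f where "\<And>k::'n. f k \<in> F (Suc (pos k)) \<and> f k \<notin> F (pos k)" by metis
  then show ?thesis using frame_of_adapted_vectors[OF F, of f] by blast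
qed

context
  fixes p :: "('n::finite) cmat" assumes p: "invertible p"
begin

lemma conj_from_coords: "matrix_inv p *v (A *v x) = conj_from p A *v (matrix_inv p *v x)"
proof -
  have "conj_from p A *v (matrix_inv p *v x) = (matrix_inv p ** A ** (p ** matrix_inv p)) *v x"
    by (simp only: conj_from_def matrix_vector_mul_assoc matrix_mul_assoc)
  then show ?thesis by (simp add: matrix_inv_both[OF p] matrix_vector_mul_assoc)
qed

lemma frame_vector_mem: "p *v axis k 1 \<in> frame_flag p i \<longleftrightarrow> pos k < i"
  by (auto simp: frame_flag_def mv_inverse[OF p] axis_def)

lemma upr_stabilizes_frame:
  "upr up (conj_from p A) \<longleftrightarrow> (\<forall>i. \<forall>x\<in>frame_flag p i. A *v x \<in> frame_flag p i)"
proof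
  assume U: "upr up (conj_from p A)"
  show "\<forall>i. \<forall>x\<in>frame_flag p i. A *v x \<in> frame_flag p i"
  proof (intro allI ballI)
    fix i x assume x: "x \<in> frame_flag p i"
    have "(conj_from p A *v (matrix_inv p *v x)) $ k = 0" if "i \<le> pos k" for k
      unfolding mv_entry[of "conj_from p A"]
    proof (intro sum.neutral ballI)
      fix l
      show "conj_from p A $ k $ l * (matrix_inv p *v x) $ l = 0"
      proof (cases "i \<le> pos l")
        case True
        then show ?thesis using x by (simp add: frame_flag_def)
      next
        case False
        then show ?thesis using U that by (simp add: upr_def up_def)
      qed
    qed
    then show "A *v x \<in> frame_flag p i" by (simp add: frame_flag_def conj_from_coords)
  qed
next
  assume S: "\<forall>i. \<forall>x\<in>frame_flag p i. A *v x \<in> frame_flag p i"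
  show "upr up (conj_from p A)"
    unfolding upr_def
  proof (intro allI impI)
    fix a b :: 'n assume ab: "up b < up a"
    have "A *v (p *v axis b 1) \<in> frame_flag p (Suc (pos b))"
      using S frame_vector_mem by blast
    then have "(conj_from p A *v axis b 1) $ a = 0"
      using ab by (simp add: frame_flag_def conj_from_coords[of A] mv_inverse[OF p] up_def)
    then show "conj_from p A $ a $ b = 0" by (simp add: mv_axis)
  qed
qed

lemma flag_stab_frame: "flag_stab (frame_flag p) = borel_grp up p"
  by (auto simp: flag_stab_def borel_grp_def upr_stabilizes_frame)

text \<open>Positions start at 0 while the quotients of the flag start at 1, hence
  \<open>Suc (pos k)\<close>. The eigenvalue is pinned down by the frame vector \<open>k\<close>,
  which lies in this step but not in the preceding one.\<close>

lemma flag_eig_frame: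
  assumes U: "upr up (conj_from p A)"
  shows "flag_eig (frame_flag p) (Suc (pos k)) A = conj_from p A $ k $ k"
  unfolding flag_eig_def
proof (rule the_equality)
  have coord: "(matrix_inv p *v (A *v x - c *s x)) $ l =
      (\<Sum>m\<in>UNIV. conj_from p A $ l $ m * (matrix_inv p *v x) $ m) - c * (matrix_inv p *v x) $ l" for x c l
    by (simp add: matrix_vector_mult_diff_distrib conj_from_coords mv_scale mv_entry[of "conj_from p A"])
  show "\<forall>x\<in>frame_flag p (Suc (pos k)). A *v x - conj_from p A $ k $ k *s x \<in> frame_flag p (Suc (pos k) - 1)"
  proof (intro ballI)
    fix x assume x: "x \<in> frame_flag p (Suc (pos k))"
    have "(matrix_inv p *v (A *v x - conj_from p A $ k $ k *s x)) $ l = 0" if l: "pos k \<le> pos l" for l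
    proof -
      have "conj_from p A $ l $ m * (matrix_inv p *v x) $ m = 0" if "m \<noteq> k" for m
      proof (cases "pos k < pos m")
        case True
        then show ?thesis using x by (simp add: frame_flag_def)
      next
        case False
        then have "pos m < pos k" using that by (metis linorder_neqE_nat pos_eq)
        then show ?thesis using U l by (simp add: upr_def up_def)
      qed
      then have "(\<Sum>m\<in>UNIV. conj_from p A $ l $ m * (matrix_inv p *v x) $ m) =
          (\<Sum>m\<in>{k}. conj_from p A $ l $ m * (matrix_inv p *v x) $ m)"
        by (intro sum.mono_neutral_right) auto
      then have s: "(\<Sum>m\<in>UNIV. conj_from p A $ l $ m * (matrix_inv p *v x) $ m) =
          conj_from p A $ l $ k * (matrix_inv p *v x) $ k" by simp
      show ?thesis
      proof (cases "l = k")
        case True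
        then show ?thesis unfolding coord s by simp
      next
        case False
        then have "pos k < pos l" using l by (metis le_neq_implies_less pos_eq)
        then have "conj_from p A $ l $ k = 0" "(matrix_inv p *v x) $ l = 0"
          using U x by (auto simp: upr_def up_def frame_flag_def)
        then show ?thesis by (simp add: coord s)
      qed
    qed
    then show "A *v x - conj_from p A $ k $ k *s x \<in> frame_flag p (Suc (pos k) - 1)"
      by (simp add: frame_flag_def)
  qed
  fix c assume c: "\<forall>x\<in>frame_flag p (Suc (pos k)). A *v x - c *s x \<in> frame_flag p (Suc (pos k) - 1)"
  have "p *v axis k 1 \<in> frame_flag p (Suc (pos k))" by (simp add: frame_vector_mem)
  with c have "A *v (p *v axis k 1) - c *s (p *v axis k 1) \<in> frame_flag p (pos k)" by auto
  then have "(matrix_inv p *v (A *v (p *v axis k 1) - c *s (p *v axis k 1))) $ k = 0"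
    by (simp add: frame_flag_def)
  then show "c = conj_from p A $ k $ k"
    by (simp add: coord mv_inverse[OF p] axis_def if_distrib[of "\<lambda>x. _ * x"] cong: if_cong)
qed

lemma pos_interval: "{1..i} = Suc ` pos ` {k::'n. pos k < i}" if "i < CARD('n)"
proof (intro set_eqI iffI)
  fix j assume j: "j \<in> {1..i}"
  then have "j - 1 < CARD('n)" using that by auto
  then obtain k :: 'n where "pos k = j - 1" using pos_surj by blast
  with j have "j = Suc (pos k)" "pos k < i" by auto
  then show "j \<in> Suc ` pos ` {k::'n. pos k < i}" by blast
qed auto

lemma weight_char_frame:
  assumes "b \<in> borel_grp up p"
  shows "weight_char (frame_flag p) \<nu> b = wt p \<nu> b"
proof -
  have U: "upr up (conj_from p b)" using assms by (simp add: borel_grp_def)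
  have "(\<Prod>j\<in>{1..i}. flag_eig (frame_flag p) j b) = (\<Prod>k | pos k < i. conj_from p b $ k $ k)"
    if "i \<in> {1..<CARD('n)}" for i
  proof -
    have "i < CARD('n)" using that by simp
    from pos_interval[OF this] show ?thesis
      by (simp only: image_image) (subst prod.reindex, auto simp: inj_on_def flag_eig_frame[OF U])
  qed
  then show ?thesis unfolding weight_char_def wt_def by (intro prod.cong) auto
qed

lemma weight_lie_frame:
  assumes U: "upr up (conj_from p A)"
  shows "weight_lie (frame_flag p) \<nu> A =
    (\<Sum>i\<in>{1..<CARD('n)}. of_nat (\<nu> i) * (\<Sum>k | pos k < i. conj_from p A $ k $ k))"
proof -
  have "(\<Sum>j\<in>{1..i}. flag_eig (frame_flag p) j A) = (\<Sum>k | pos k < i. conj_from p A $ k $ k)"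
    if "i \<in> {1..<CARD('n)}" for i
  proof -
    have "i < CARD('n)" using that by simp
    from pos_interval[OF this] show ?thesis
      by (simp only: image_image) (subst sum.reindex, auto simp: inj_on_def flag_eig_frame[OF U])
  qed
  then show ?thesis unfolding weight_lie_def by (intro sum.cong) auto
qed

text \<open>The differences \<open>t *v x - x\<close>, for torus elements \<open>t\<close> that
  change only the coordinates \<open>a\<close> and \<open>b\<close>, are combinations of the
  components of \<open>x\<close> at \<open>a\<close> and \<open>b\<close>. Two independent such
  combinations isolate the component at \<open>a\<close>.\<close>

lemma torus_stable_coordinates:
  assumes n: "CARD('n) \<ge> 2" and W: "vec.subspace W"
    and stable: "\<And>t x. t \<in> torus p \<Longrightarrow> x \<in> W \<Longrightarrow> t *v x \<in> W" and x: "x \<in> W"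
  shows "(matrix_inv p *v x) $ a *s (p *v axis a 1) \<in> W"
proof -
  obtain b where b: "b \<noteq> a"
  proof (rule ccontr)
    assume "\<not> thesis"
    then have "(UNIV :: 'n set) = {a}" using that by auto
    then have "CARD('n) = card {a}" by simp
    then show False using n by simp
  qed
  let ?E = "\<lambda>k. (matrix_inv p *v x) $ k *s (p *v axis k 1)"
  have tx: "conj_to p (dmat (\<lambda>k. 1 + d k)) *v x - x = d a *s ?E a + d b *s ?E b"
    if "\<And>k. k \<noteq> a \<Longrightarrow> k \<noteq> b \<Longrightarrow> d k = 0" for d
  proof -
    have "matrix_inv p *v (conj_to p (dmat (\<lambda>k. 1 + d k)) *v x) =
        dmat (\<lambda>k. 1 + d k) *v (matrix_inv p *v x)"
      by (simp add: conj_from_coords conj_from_to[OF p])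
    then have 1: "matrix_inv p *v (conj_to p (dmat (\<lambda>k. 1 + d k)) *v x - x) =
        (\<chi> k. d k * (matrix_inv p *v x) $ k)"
      by (simp add: matrix_vector_mult_diff_distrib vec_eq_iff)
        (simp add: mv_dmat algebra_simps)
    have 2: "matrix_inv p *v (d a *s ?E a + d b *s ?E b) = (\<chi> k. d k * (matrix_inv p *v x) $ k)"
      using b that
      by (auto simp: matrix_vector_right_distrib mv_scale mv_inverse[OF p] vec_eq_iff axis_def)
    have "p *v (matrix_inv p *v (conj_to p (dmat (\<lambda>k. 1 + d k)) *v x - x)) =
      p *v (matrix_inv p *v (d a *s ?E a + d b *s ?E b))" using 1 2 by simp
    then show ?thesis unfolding mv_inverse(2)[OF p] .
  qed
  have mem: "d a *s ?E a + d b *s ?E b \<in> W"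
    if "\<And>k. k \<noteq> a \<Longrightarrow> k \<noteq> b \<Longrightarrow> d k = 0" "(1 + d a) * (1 + d b) = 1" for d
  proof -
    have "(\<Prod>k\<in>UNIV. 1 + d k) = (\<Prod>k\<in>{a, b}. 1 + d k)"
      using that(1) by (intro prod.mono_neutral_right) auto
    then have "conj_to p (dmat (\<lambda>k. 1 + d k)) \<in> torus p"
      using that(2) b by (auto simp: torus_def intro!: exI[of _ "\<lambda>k. 1 + d k"])
    then show ?thesis
      using stable[OF _ x] x vec.subspace_diff[OF W] tx[of d, OF that(1)] by metis
  qed
  \<comment> \<open>The torus elements have entries 2, 1/2 and then -1, -1 at \<open>a\<close> and
    \<open>b\<close>; \<open>d\<close> records the entries minus 1. The coefficients 2/3 and -1/6
    used below cancel the component at \<open>b\<close>.\<close>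
  have 1: "1 *s ?E a + (- 1 / 2) *s ?E b \<in> W"
    using mem[of "\<lambda>k. if k = a then 1 else if k = b then - 1 / 2 else 0"] b by simp
  have 2: "(- 2) *s ?E a + (- 2) *s ?E b \<in> W"
    using mem[of "\<lambda>k. if k = a then - 2 else if k = b then - 2 else 0"] b by simp
  have "(2 / 3) *s (1 *s ?E a + (- 1 / 2) *s ?E b) - (1 / 6) *s ((- 2) *s ?E a + (- 2) *s ?E b) \<in> W"
    by (intro vec.subspace_diff[OF W] vec.subspace_scale[OF W] 1 2)
  moreover have "(2 / 3) *s (1 *s ?E a + (- 1 / 2) *s ?E b) - (1 / 6) *s ((- 2) *s ?E a + (- 2) *s ?E b) = ?E a"
    by (simp add: vec_eq_iff algebra_simps)
  ultimately show ?thesis by simp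
qed

end

section \<open>Flags fixed by a torus\<close>

definition permute_frame :: "('n::finite) cmat \<Rightarrow> ('n \<Rightarrow> 'n) \<Rightarrow> 'n cmat" where
  "permute_frame p \<sigma> = (\<chi> i k. p $ i $ \<sigma> k)"

lemma
  fixes p :: "('n::finite) cmat"
  assumes p: "invertible p" and \<sigma>: "bij \<sigma>"
  shows permute_frame_invertible: "invertible (permute_frame p \<sigma>)"
    and conj_from_permute_frame: "conj_from (permute_frame p \<sigma>) A $ a $ b = conj_from p A $ \<sigma> a $ \<sigma> b"
proof -
  have "permute_frame p \<sigma> ** (\<chi> i k. matrix_inv p $ \<sigma> i $ k) = p ** matrix_inv p"
    using sum.reindex_bij_betw[OF \<sigma>, of "\<lambda>k. p $ i $ k * matrix_inv p $ k $ j" for i j]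
    by (simp add: vec_eq_iff mm_entry permute_frame_def)
  then have inv: "permute_frame p \<sigma> ** (\<chi> i k. matrix_inv p $ \<sigma> i $ k) = mat 1"
    by (simp add: matrix_inv_both[OF p])
  show "invertible (permute_frame p \<sigma>)" by (rule matrix_inv_eqI(2)[OF inv])
  show "conj_from (permute_frame p \<sigma>) A $ a $ b = conj_from p A $ \<sigma> a $ \<sigma> b"
    unfolding conj_from_def matrix_inv_eqI(1)[OF inv] by (simp add: mm_entry permute_frame_def)
qed

text \<open>A flag whose steps contain the components of their vectors is made of coordinate
  subspaces; the frame vector that enters at each step defines the permutation.\<close>

lemma coordinate_flag_frame:
  fixes F :: "nat \<Rightarrow> (complex^'n::finite) set"
  assumes F: "complete_flag F" and p: "invertible p"
    and coord: "\<And>i x a. x \<in> F i \<Longrightarrow> (matrix_inv p *v x) $ a *s (p *v axis a 1) \<in> F i"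
  shows "\<exists>\<sigma>. bij \<sigma> \<and> F = frame_flag (permute_frame p \<sigma>)"
proof -
  have sub: "vec.subspace (F i)" for i using F by (auto simp: complete_flag_def)
  \<comment> \<open>If no frame vector were new at this step, all components of a new vector
    \<open>x\<close> would already lie in the previous step, and so would their sum
    \<open>x\<close>.\<close>
  have "\<exists>a. p *v axis a 1 \<in> F (Suc (pos k)) \<and> p *v axis a 1 \<notin> F (pos k)" for k :: 'n
  proof (rule ccontr)
    assume no: "\<not> ?thesis"
    obtain x where x: "x \<in> F (Suc (pos k))" "x \<notin> F (pos k)"
      using complete_flag_strict[OF F pos_less] by blast
    let ?E = "\<lambda>a. (matrix_inv p *v x) $ a *s (p *v axis a 1)"
    have "?E a \<in> F (pos k)" for a
    proof (cases "(matrix_inv p *v x) $ a = 0")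
      case True
      then show ?thesis using vec.subspace_0[OF sub] by simp
    next
      case False
      have "?E a \<in> F (Suc (pos k))" by (rule coord[OF x(1)])
      from vec.subspace_scale[OF sub this, of "inverse ((matrix_inv p *v x) $ a)"]
      have "p *v axis a 1 \<in> F (Suc (pos k))" using False by simp
      then have "p *v axis a 1 \<in> F (pos k)" using no by blast
      then show ?thesis by (rule vec.subspace_scale[OF sub])
    qed
    then have "(\<Sum>a\<in>UNIV. ?E a) \<in> F (pos k)" by (intro vec.subspace_sum[OF sub])
    moreover have "(\<Sum>a\<in>UNIV. ?E a) = p *v (matrix_inv p *v x)"
      by (simp add: vec_eq_iff mv_axis) (simp add: mv_entry[of p] mult.commute)
    ultimately show False using x(2) by (simp add: mv_inverse[OF p])
  qed
  then obtain \<sigma> where \<sigma>: "\<And>k::'n. p *v axis (\<sigma> k) 1 \<in> F (Suc (pos k))" "\<And>k. p *v axis (\<sigma> k) 1 \<notin> F (pos k)"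
    by metis
  have "(\<chi> i k. (p *v axis (\<sigma> k) 1) $ i) = permute_frame p \<sigma>"
    by (simp add: permute_frame_def mv_axis)
  then have "F = frame_flag (permute_frame p \<sigma>)"
    using frame_of_adapted_vectors[OF F, of "\<lambda>k. p *v axis (\<sigma> k) 1"] \<sigma> by simp
  moreover have "inj \<sigma>"
  proof (rule injI)
    fix a b assume ab: "\<sigma> a = \<sigma> b"
    have False if "pos c < pos d" "\<sigma> c = \<sigma> d" for c d
    proof -
      have "F (Suc (pos c)) \<subseteq> F (pos d)" using that by (intro complete_flag_mono[OF F]) simp
      then show False using \<sigma>(1)[of c] \<sigma>(2)[of d] that(2) by auto
    qed
    from this[of a b] this[of b a] ab show "a = b"
      by (metis linorder_neqE_nat pos_eq)
  qed
  then have "bij \<sigma>" by (simp add: bij_betw_def finite_UNIV_inj_surj)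
  ultimately show ?thesis by blast
qed

text \<open>The transvection 1 + E_ab of the frame, and the identity when \<open>a = b\<close>.
  Transvections detect which roots belong to a Borel subgroup containing the torus.\<close>

definition elem :: "('n::finite) cmat \<Rightarrow> 'n \<Rightarrow> 'n \<Rightarrow> 'n cmat" where
  "elem p a b = conj_to p (\<chi> i j. if i = j then 1 else if i = a \<and> j = b then 1 else 0)"

lemma elem_SL:
  assumes p: "invertible (p :: ('n::finite) cmat)"
  shows "elem p a b \<in> SL"
proof -
  let ?M = "(\<chi> i j. if i = j then 1 else if i = a \<and> j = b then 1 else 0) :: 'n cmat"
  have "det ?M = 1"
  proof (cases "pos a < pos b")
    case True
    then have "upr up ?M" by (auto simp: upr_def up_def)
    from det_upr[OF inj_up this] show ?thesis by simp
  next
    case False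
    then have "upr down ?M" by (auto simp: upr_def down_def)
    from det_upr[OF inj_down this] show ?thesis by simp
  qed
  then show ?thesis by (simp add: elem_def SL_def det_conj_to[OF p])
qed

lemma elem_conj_from:
  assumes "invertible (p :: ('n::finite) cmat)"
  shows "conj_from p (elem p a b) = (\<chi> i j. if i = j then 1 else if i = a \<and> j = b then 1 else 0)"
  unfolding elem_def by (rule conj_from_to[OF assms])

lemma complete_flag_permuted:
  fixes F :: "nat \<Rightarrow> (complex^'n::finite) set"
  assumes n: "CARD('n) \<ge> 2" and F: "complete_flag F" and p: "invertible p" and T: "torus p \<subseteq> flag_stab F"
  shows "\<exists>\<sigma>. bij \<sigma> \<and> F = frame_flag (permute_frame p \<sigma>)"
proof (rule coordinate_flag_frame[OF F p])
  fix i x a assume "x \<in> F i"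
  then show "(matrix_inv p *v x) $ a *s (p *v axis a 1) \<in> F i"
    using T F by (intro torus_stable_coordinates[OF p n]) (auto simp: flag_stab_def complete_flag_def)
qed

lemma elem_mem_permuted:
  assumes p: "invertible (p :: ('n::finite) cmat)" and \<sigma>: "bij \<sigma>" and ab: "pos a < pos b"
  shows "elem p (\<sigma> a) (\<sigma> b) \<in> flag_stab (frame_flag (permute_frame p \<sigma>))"
proof -
  have "upr up (conj_from (permute_frame p \<sigma>) (elem p (\<sigma> a) (\<sigma> b)))"
    using ab bij_is_inj[OF \<sigma>]
    by (auto simp: upr_def conj_from_permute_frame[OF p \<sigma>] elem_conj_from[OF p] up_def inj_eq)
  then show ?thesis
    by (simp add: flag_stab_frame[OF permute_frame_invertible[OF p \<sigma>]] borel_grp_def elem_SL[OF p])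
qed

lemma elem_notin_borel:
  assumes p: "invertible (p :: ('n::finite) cmat)" and ab: "pos b < pos a"
  shows "elem p a b \<notin> borel_grp up p"
  using ab by (auto simp: borel_grp_def upr_def up_def elem_conj_from[OF p] intro!: exI[of _ a] exI[of _ b])

lemma card_pos_less: "card {b::'n::finite. pos b < pos (a::'n)} = pos a"
proof -
  have "pos ` {b::'n. pos b < pos a} = {..<pos a}"
  proof (intro set_eqI iffI)
    fix i assume "i \<in> {..<pos a}"
    then have "i < CARD('n)" using pos_less[of a] by simp
    then obtain b :: 'n where "pos b = i" using pos_surj by blast
    then show "i \<in> pos ` {b::'n. pos b < pos a}" using \<open>i \<in> _\<close> by auto
  qed auto
  moreover have "inj_on pos {b::'n. pos b < pos a}" by (simp add: inj_on_def)
  ultimately show ?thesis by (metis card_image card_lessThan)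
qed

text \<open>The common stabilizer contains the torus of a frame of \<open>F\<close>, so
  \<open>F'\<close> is given by a permutation of that frame. The transvections in the stabilizer
  force the permutation to be increasing, hence trivial.\<close>

lemma flag_stab_inject:
  fixes F F' :: "nat \<Rightarrow> (complex^'n::finite) set"
  assumes n: "CARD('n) \<ge> 2" and F: "complete_flag F" and F': "complete_flag F'"
    and eq: "flag_stab F = flag_stab F'"
  shows "F = F'"
proof -
  obtain p where p: "invertible p" "F = frame_flag p" using complete_flag_frame[OF F] by blast
  have B: "flag_stab F = borel_grp up p" by (simp add: p flag_stab_frame)
  have "torus p \<subseteq> flag_stab F'" using torus_borel[OF p(1) inj_up] B eq by blast
  from complete_flag_permuted[OF n F' p(1) this] obtain \<sigma> where
    \<sigma>: "bij \<sigma>" "F' = frame_flag (permute_frame p \<sigma>)" by blast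
  have mono: "pos (\<sigma> a) < pos (\<sigma> b)" if "pos a < pos b" for a b
  proof (rule ccontr)
    assume no: "\<not> ?thesis"
    have "\<sigma> a \<noteq> \<sigma> b" using that bij_is_inj[OF \<sigma>(1)] by (auto simp: inj_eq)
    then have "pos (\<sigma> b) < pos (\<sigma> a)" using no by (metis linorder_neqE_nat pos_eq)
    from elem_notin_borel[OF p(1) this] elem_mem_permuted[OF p(1) \<sigma>(1) that] show False
      using B eq \<sigma>(2) by simp
  qed
  have "\<sigma> a = a" for a :: 'n
  proof -
    have "\<sigma> ` {b. pos b < pos a} = {c. pos c < pos (\<sigma> a)}"
    proof (intro set_eqI iffI)
      fix c :: 'n assume c: "c \<in> {c. pos c < pos (\<sigma> a)}"
      obtain b where b: "c = \<sigma> b" using bij_is_surj[OF \<sigma>(1)] by auto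
      have "pos b < pos a"
      proof (rule ccontr)
        assume "\<not> pos b < pos a"
        then have "b = a \<or> pos a < pos b" by (metis linorder_neqE_nat pos_eq)
        then show False using mono[of a b] c b by auto
      qed
      then show "c \<in> \<sigma> ` {b. pos b < pos a}" using b by simp
    qed (auto simp: mono)
    moreover have "inj_on \<sigma> {b. pos b < pos a}"
      by (rule inj_on_subset[OF bij_is_inj[OF \<sigma>(1)] subset_UNIV])
    ultimately have "pos (\<sigma> a) = pos a" using card_pos_less by (metis card_image)
    then show ?thesis by simp
  qed
  then have "permute_frame p \<sigma> = p" by (simp add: permute_frame_def)
  then show ?thesis using \<sigma>(2) p(2) by simp
qed

section \<open>Frames from opposite pairs and from Cartan subalgebras\<close>

lemma flag_of_flag_stab:
  fixes F :: "nat \<Rightarrow> (complex^'n::finite) set"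
  assumes "CARD('n) \<ge> 2" "complete_flag F"
  shows "flag_of (flag_stab F) = F"
  unfolding flag_of_def
proof (rule the_equality)
  show "complete_flag F \<and> flag_stab F = flag_stab F" using assms(2) by simp
  show "G = F" if "complete_flag G \<and> flag_stab F = flag_stab G" for G
    using flag_stab_inject[OF assms(1) assms(2), of G] that by simp
qed

text \<open>Both Borel subgroups contain the torus \<open>B \<inter> B'\<close>, so both flags are
  permutations of a frame diagonalizing it. Renaming makes the first permutation trivial; it remains
  to see that the second one reverses the order.\<close>

lemma opposite_borels_frame:
  fixes B B' :: "('n::finite) cmat set"
  assumes n: "CARD('n) \<ge> 2" and opp: "opposite_borels B B'"
  shows "\<exists>p F. invertible p \<and> complete_flag F \<and> F = frame_flag p \<and> B = flag_stab F \<and>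
    B = borel_grp up p \<and> B' = borel_grp down p"
proof -
  obtain F where F: "complete_flag F" "B = flag_stab F"
    using opp by (auto simp: opposite_borels_def borel_subgroups_def)
  obtain F' where F': "complete_flag F'" "B' = flag_stab F'"
    using opp by (auto simp: opposite_borels_def borel_subgroups_def)
  obtain q :: "'n cmat" where q: "invertible q" "B \<inter> B' = {g \<in> SL. diagonal_mat (matrix_inv q ** g ** q)}"
    using opp unfolding opposite_borels_def maximal_torus_def by blast
  have diag: "g \<in> torus r" if "g \<in> SL" "diagonal_mat (conj_from r g)" "invertible r" for g r :: "'n cmat"
  proof -
    define d where "d k = conj_from r g $ k $ k" for k
    have g: "conj_from r g = dmat d" using that(2) by (auto simp: diagonal_mat_def dmat_def d_def vec_eq_iff)
    then have "det (dmat d) = 1" using that(1) det_conj_from[OF that(3), of g] by (simp add: SL_def)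
    then have "(\<Prod>k\<in>UNIV. d k) = 1" by (simp add: det_dmat)
    moreover have "g = conj_to r (dmat d)" using g conj_to_from[OF that(3), of g] by simp
    ultimately show ?thesis by (auto simp: torus_def)
  qed
  have "torus q \<subseteq> B \<inter> B'"
  proof
    fix t assume t: "t \<in> torus q"
    then have "t \<in> SL" using borel_SL[OF torus_borel[OF q(1) inj_up]] by blast
    moreover have "diagonal_mat (conj_from q t)"
      using t by (auto simp: torus_def conj_from_to[OF q(1)] diagonal_mat_def dmat_def)
    ultimately show "t \<in> B \<inter> B'" by (simp add: q(2) conj_from_def)
  qed
  then have T: "torus q \<subseteq> flag_stab F" "torus q \<subseteq> flag_stab F'" using F(2) F'(2) by auto
  obtain \<sigma> where \<sigma>: "bij \<sigma>" "F = frame_flag (permute_frame q \<sigma>)"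
    using complete_flag_permuted[OF n F(1) q(1) T(1)] by blast
  define p where "p = permute_frame q \<sigma>"
  have p: "invertible p" unfolding p_def by (rule permute_frame_invertible[OF q(1) \<sigma>(1)])
  have FB: "F = frame_flag p" "B = borel_grp up p" using \<sigma>(2) F(2) flag_stab_frame[OF p] by (simp_all add: p_def)
  have diag_p: "conj_from p g $ a $ b = 0" if "g \<in> B \<inter> B'" "a \<noteq> b" for g a b
    using that bij_is_inj[OF \<sigma>(1)] unfolding q(2)
    by (auto simp: p_def conj_from_permute_frame[OF q(1) \<sigma>(1)] diagonal_mat_def conj_from_def[symmetric] inj_eq)
  have "torus p \<subseteq> flag_stab F'"
  proof
    fix t assume t: "t \<in> torus p"
    have "diagonal_mat (conj_from p t)"
      using t by (auto simp: torus_def conj_from_to[OF p] diagonal_mat_def dmat_def)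
    moreover have "\<exists>a'. a = \<sigma> a'" for a using bij_is_surj[OF \<sigma>(1)] by auto
    ultimately have "diagonal_mat (conj_from q t)"
      unfolding diagonal_mat_def p_def conj_from_permute_frame[OF q(1) \<sigma>(1)] by metis
    moreover have "t \<in> SL" using t borel_SL[OF torus_borel[OF p inj_up]] by blast
    ultimately have "t \<in> B \<inter> B'" unfolding q(2) by (simp add: conj_from_def)
    then show "t \<in> flag_stab F'" using F'(2) by simp
  qed
  from complete_flag_permuted[OF n F'(1) p this] obtain \<tau> where
    \<tau>: "bij \<tau>" "F' = frame_flag (permute_frame p \<tau>)" by blast
  \<comment> \<open>A pair kept in order would put one transvection into both groups, although their
    intersection is diagonal in the frame.\<close>
  have anti: "pos (\<tau> b) < pos (\<tau> a)" if "pos a < pos b" for a b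
  proof (rule ccontr)
    assume no: "\<not> ?thesis"
    have ne: "\<tau> a \<noteq> \<tau> b" using that bij_is_inj[OF \<tau>(1)] by (auto simp: inj_eq)
    then have lt: "pos (\<tau> a) < pos (\<tau> b)" using no by (metis linorder_neqE_nat pos_eq)
    have "elem p (\<tau> a) (\<tau> b) \<in> B'" using elem_mem_permuted[OF p \<tau>(1) that] F'(2) \<tau>(2) by simp
    moreover have "elem p (\<tau> a) (\<tau> b) \<in> B"
      using lt by (auto simp: FB(2) borel_grp_def elem_SL[OF p] upr_def up_def elem_conj_from[OF p])
    ultimately have "conj_from p (elem p (\<tau> a) (\<tau> b)) $ (\<tau> a) $ (\<tau> b) = 0" using diag_p ne by blast
    then show False using ne by (simp add: elem_conj_from[OF p])
  qed
  have anti_iff: "pos (\<tau> b) < pos (\<tau> a) \<longleftrightarrow> pos a < pos b" for a b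
    using anti[of a b] anti[of b a] by (metis linorder_neqE_nat order_less_asym pos_eq)
  have "upr up (conj_from (permute_frame p \<tau>) g) \<longleftrightarrow> upr down (conj_from p g)" for g
  proof
    assume U: "upr up (conj_from (permute_frame p \<tau>) g)"
    show "upr down (conj_from p g)"
      unfolding upr_def
    proof (intro allI impI)
      fix c d :: 'n assume cd: "down d < down c"
      obtain a b where ab: "c = \<tau> a" "d = \<tau> b" using bij_is_surj[OF \<tau>(1)] by (metis surjD)
      then show "conj_from p g $ c $ d = 0"
        using U cd by (simp add: anti_iff upr_def up_def down_def conj_from_permute_frame[OF p \<tau>(1)])
    qed
  next
    assume "upr down (conj_from p g)"
    then show "upr up (conj_from (permute_frame p \<tau>) g)"
      using anti_iff by (simp add: upr_def up_def down_def conj_from_permute_frame[OF p \<tau>(1)])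
  qed
  then have "B' = borel_grp down p"
    unfolding F'(2) \<tau>(2) flag_stab_frame[OF permute_frame_invertible[OF p \<tau>(1)]] borel_grp_def by simp
  then show ?thesis using p F FB by blast
qed

lemma lie_algebra_stabilizes_flag:
  fixes F :: "nat \<Rightarrow> (complex^'n::finite) set"
  assumes F: "complete_flag F" and x: "x \<in> lie_algebra_of (flag_stab F)" and v: "v \<in> F i"
  shows "sl_mat x *v v \<in> F i"
proof -
  obtain p where p: "invertible p" "F = frame_flag p" using complete_flag_frame[OF F] by blast
  have "(matrix_inv p *v (sl_mat x *v v)) $ k = 0" if k: "i \<le> pos k" for k
  proof -
    let ?f = "\<lambda>A :: 'n cmat. (matrix_inv p *v (A *v v)) $ k"
    have sc: "(r *\<^sub>R A) *v v = r *\<^sub>R (A *v v)" for r and A :: "'n cmat"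
      by (simp add: vec_eq_iff mv_entry scaleR_sum_right)
    have sc': "A *v (r *\<^sub>R w) = r *\<^sub>R (A *v w)" for r w and A :: "'n cmat"
      by (simp add: vec_eq_iff mv_entry scaleR_sum_right)
    have "linear ?f"
      by (intro linearI) (simp_all add: matrix_vector_mult_add_rdistrib matrix_vector_right_distrib
          sc sc')
    then have "bounded_linear ?f" by (simp add: linear_conv_bounded_linear)
    from bounded_linear.has_vector_derivative[OF this mexp_derivative_zero]
    have 1: "((\<lambda>t. ?f (mexp (t *\<^sub>R sl_mat x))) has_vector_derivative ?f (sl_mat x)) (at 0)" .
    have "mexp (t *\<^sub>R sl_mat x) \<in> flag_stab F" for t using x by (simp add: lie_algebra_of_def)
    then have "mexp (t *\<^sub>R sl_mat x) *v v \<in> frame_flag p i" for t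
      using v p(2) by (auto simp: flag_stab_def)
    then have "?f (mexp (t *\<^sub>R sl_mat x)) = 0" for t using k by (simp add: frame_flag_def)
    then have "((\<lambda>t::real. 0) has_vector_derivative ?f (sl_mat x)) (at 0)" using 1 by simp
    moreover have "((\<lambda>t::real. 0 :: complex) has_vector_derivative 0) (at 0)" by simp
    ultimately show ?thesis using vector_derivative_unique_at by blast
  qed
  then show ?thesis by (simp add: p(2) frame_flag_def)
qed

text \<open>The given Cartan subalgebra is not tied to the opposite pair, so its own frame is
  needed. Its diagonal matrices of trace zero play the part that the torus plays for a group
  stabilizer.\<close>

lemma cartan_frame:
  fixes F :: "nat \<Rightarrow> (complex^'n::finite) set"
  assumes n: "CARD('n) \<ge> 2" and F: "complete_flag F"
    and h: "cartan_subalgebra \<hh>" "\<hh> \<subseteq> lie_algebra_of (flag_stab F)"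
  shows "\<exists>p. invertible p \<and> F = frame_flag p \<and> \<hh> = {x. diagonal_mat (conj_from p (sl_mat x))}"
proof -
  obtain q where q: "invertible q" "\<hh> = {x. diagonal_mat (conj_from q (sl_mat x))}"
    using h(1) by (auto simp: cartan_subalgebra_def conj_from_def)
  have "\<exists>\<sigma>. bij \<sigma> \<and> F = frame_flag (permute_frame q \<sigma>)"
  proof (rule coordinate_flag_frame[OF F q(1)])
    fix i x and a :: 'n assume x: "x \<in> F i"
    have W: "vec.subspace (F i)" using F by (simp add: complete_flag_def)
    obtain b where b: "b \<noteq> a"
    proof (rule ccontr)
      assume "\<not> thesis"
      then have "(UNIV :: 'n set) = {a}" using that by auto
      then have "CARD('n) = card {a}" by simp
      then show False using n by simp
    qed
    define d where "d k = (if k = a then 1 else if k = b then - 1 else 0 :: complex)" for k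
    have "trace (conj_to q (dmat d)) = trace (dmat d)"
      using trace_mul_sym[of "q ** dmat d" "matrix_inv q"] matrix_inv_both[OF q(1)]
      by (simp add: conj_to_def matrix_mul_assoc)
    also have "\<dots> = (\<Sum>k\<in>{a, b}. d k)"
      unfolding trace_def dmat_def by (rule sum.mono_neutral_cong_right) (auto simp: d_def)
    also have "\<dots> = 0" using b by (simp add: d_def)
    finally have hd: "sl_mat (Abs_sl (conj_to q (dmat d))) = conj_to q (dmat d)"
      by (simp add: Abs_sl_inverse)
    have "Abs_sl (conj_to q (dmat d)) \<in> \<hh>"
      by (simp add: q(2) hd conj_from_to[OF q(1)]) (simp add: diagonal_mat_def dmat_def)
    then have st: "conj_to q (dmat d) *v y \<in> F i" if "y \<in> F i" for y
      using lie_algebra_stabilizes_flag[OF F _ that, of "Abs_sl (conj_to q (dmat d))"] h(2) hd by auto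
    have co: "matrix_inv q *v (conj_to q (dmat d) *v y) = dmat d *v (matrix_inv q *v y)" for y
      by (simp add: conj_from_coords[OF q(1), of "conj_to q (dmat d)"] conj_from_to[OF q(1)])
    let ?c = "conj_to q (dmat d)"
    \<comment> \<open>\<open>?c\<close> has eigenvalue 1 at \<open>a\<close>, -1 at \<open>b\<close>
      and 0 elsewhere, so half the sum of \<open>?c\<close> and its square is the projection to the
      frame line of \<open>a\<close>.\<close>
    have "(1 / 2) *s (?c *v x + ?c *v (?c *v x)) \<in> F i"
      by (intro vec.subspace_scale[OF W] vec.subspace_add[OF W] st x)
    moreover have "matrix_inv q *v ((1 / 2) *s (?c *v x + ?c *v (?c *v x))) =
        matrix_inv q *v ((matrix_inv q *v x) $ a *s (q *v axis a 1))"
      using b by (auto simp: mv_scale matrix_vector_right_distrib co mv_inverse[OF q(1)] vec_eq_iff mv_dmat d_def axis_def)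
    then have "(1 / 2) *s (?c *v x + ?c *v (?c *v x)) = (matrix_inv q *v x) $ a *s (q *v axis a 1)"
      by (metis mv_inverse(2)[OF q(1)])
    ultimately show "(matrix_inv q *v x) $ a *s (q *v axis a 1) \<in> F i" by simp
  qed
  then obtain \<sigma> where \<sigma>: "bij \<sigma>" "F = frame_flag (permute_frame q \<sigma>)" by blast
  have "diagonal_mat (conj_from (permute_frame q \<sigma>) A) \<longleftrightarrow> diagonal_mat (conj_from q A)" for A
  proof
    assume D: "diagonal_mat (conj_from (permute_frame q \<sigma>) A)"
    show "diagonal_mat (conj_from q A)"
      unfolding diagonal_mat_def
    proof (intro allI impI)
      fix c e :: 'n assume ce: "c \<noteq> e"
      obtain a b where ab: "c = \<sigma> a" "e = \<sigma> b" using bij_is_surj[OF \<sigma>(1)] by (metis surjD)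
      then have "a \<noteq> b" using ce by blast
      then have "conj_from (permute_frame q \<sigma>) A $ a $ b = 0" using D by (simp add: diagonal_mat_def)
      then show "conj_from q A $ c $ e = 0" by (simp add: ab conj_from_permute_frame[OF q(1) \<sigma>(1)])
    qed
  next
    assume "diagonal_mat (conj_from q A)"
    then show "diagonal_mat (conj_from (permute_frame q \<sigma>) A)"
      unfolding diagonal_mat_def conj_from_permute_frame[OF q(1) \<sigma>(1)]
      using injD[OF bij_is_inj[OF \<sigma>(1)]] by blast
  qed
  then show ?thesis using \<sigma> q permute_frame_invertible[OF q(1) \<sigma>(1)] by blast
qed

section \<open>Lines, colines and their stabilizers\<close>

lemma is_line_explicit:
  assumes "is_line (L :: (complex^'n::finite) set)"
  shows "\<exists>e. e \<noteq> 0 \<and> L = range (\<lambda>c. c *s e)"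
proof -
  have L: "vec.subspace L" "vec.dim L = 1" using assms by (auto simp: is_line_def)
  have "\<not> L \<subseteq> {0}" using L(2) by (metis vec.dim_eq_0 zero_neq_one)
  then obtain e where e: "e \<in> L" "e \<noteq> 0" by blast
  have "vec.span {e} = L"
    using e L vec.span_minimal[of "{e}" L]
    by (intro vec.subspace_dim_equal vec.subspace_span) auto
  then show ?thesis using e(2) by (auto simp: vec.span_singleton)
qed

lemma line_generator:
  assumes "is_line (L :: (complex^'n::finite) set)" "e \<in> L" "e \<noteq> 0"
  shows "L = range (\<lambda>c. c *s e)"
proof -
  obtain e0 where e0: "L = range (\<lambda>c. c *s e0)" using is_line_explicit[OF assms(1)] by blast
  then obtain c where c: "e = c *s e0" using assms(2) by blast
  then have "c \<noteq> 0" using assms(3) by auto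
  have "b *s e0 = (b / c) *s e" for b using \<open>c \<noteq> 0\<close> by (simp add: c)
  moreover have "b *s e = (b * c) *s e0" for b by (simp add: c)
  ultimately show ?thesis unfolding e0 by blast
qed

text \<open>Putting \<open>e\<close> into a column \<open>a\<close> of the identity matrix gives
  determinant \<open>e $ a\<close>, so \<open>a\<close> is taken with
  \<open>e $ a \<noteq> 0\<close>; a transposition then moves that column to
  \<open>k\<close>.\<close>

lemma frame_with_vector:
  fixes e :: "complex^'n::finite" and k :: 'n
  assumes "e \<noteq> 0"
  shows "\<exists>p. invertible p \<and> p *v axis k 1 = e"
proof -
  obtain a where a: "e $ a \<noteq> 0" using assms by (auto simp: vec_eq_iff)
  define M :: "'n cmat" where "M = (\<chi> i j. if j = a then e $ i else mat 1 $ i $ j)"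
  have "M = (\<chi> i j. if j = a then ((mat 1 :: 'n cmat) *v e) $ i else (mat 1 :: 'n cmat) $ i $ j)"
    unfolding M_def by (simp only: matrix_vector_mul_lid)
  then have "det M = e $ a * det (mat 1 :: 'n cmat)" by (simp only: cramer_lemma)
  then have M: "invertible M" using a by (simp add: invertible_det_nz)
  define \<sigma> where "\<sigma> = Transposition.transpose k a"
  have bij: "bij \<sigma>" by (simp add: \<sigma>_def)
  have "permute_frame M \<sigma> *v axis k 1 = e"
    by (simp add: vec_eq_iff mv_axis permute_frame_def \<sigma>_def M_def)
  then show ?thesis using permute_frame_invertible[OF M bij] by blast
qed

text \<open>In a frame whose vector \<open>k\<close> is \<open>e\<close>, the stabilizer contains
  the torus, so \<open>L'\<close> contains some frame vector \<open>a\<close>. If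
  \<open>a \<noteq> k\<close>, the transvection that adds vector \<open>k\<close> to vector
  \<open>a\<close> fixes \<open>e\<close>, hence preserves \<open>L'\<close> and brings
  \<open>e\<close> into it.\<close>

lemma line_stab_inject:
  fixes L L' :: "(complex^'n::finite) set"
  assumes n: "CARD('n) \<ge> 2" and L: "is_line L" and L': "is_line L'" and eq: "line_stab L = line_stab L'"
  shows "L = L'"
proof -
  obtain e where e: "e \<noteq> 0" "L = range (\<lambda>c. c *s e)" using is_line_explicit[OF L] by blast
  fix k :: 'n
  obtain p where p: "invertible p" "p *v axis k 1 = e" using frame_with_vector[OF e(1)] by blast
  obtain e' where e': "e' \<noteq> 0" "L' = range (\<lambda>c. c *s e')" using is_line_explicit[OF L'] by blast
  have sub: "vec.subspace L'" using L' by (simp add: is_line_def)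
  have "e' \<in> L'" using e'(2) by (metis rangeI vec.scale_one)
  have stabI: "g \<in> line_stab L" if "g \<in> SL" "g *v e = c *s e" for g c
    using that by (auto simp: line_stab_def e(2) mv_scale)
  have stab: "g *v x \<in> L'" if "g \<in> SL" "g *v e = c *s e" "x \<in> L'" for g c x
    using stabI[OF that(1,2)] that(3) eq by (auto simp: line_stab_def)
  have coord: "(matrix_inv p *v e') $ a *s (p *v axis a 1) \<in> L'" for a
  proof (rule torus_stable_coordinates[OF p(1) n sub _ \<open>e' \<in> L'\<close>])
    fix t x assume t: "t \<in> torus p" and x: "x \<in> L'"
    then obtain d where d: "t = conj_to p (dmat d)" by (auto simp: torus_def)
    have "matrix_inv p *v (t *v e) = matrix_inv p *v (d k *s e)"
      by (simp add: d conj_from_coords[OF p(1), of "conj_to p (dmat d)"] conj_from_to[OF p(1)]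
          p(2)[symmetric] mv_inverse[OF p(1)] mv_scale vec_eq_iff mv_dmat axis_def)
    then have "t *v e = d k *s e" by (metis mv_inverse(2)[OF p(1)])
    then show "t *v x \<in> L'" using stab[OF borel_SL[OF torus_borel[OF p(1) inj_up t]]] x by blast
  qed
  have "matrix_inv p *v e' \<noteq> 0"
    using e'(1) mv_inverse(2)[OF p(1), of e'] by auto
  then obtain a where a: "(matrix_inv p *v e') $ a \<noteq> 0" by (auto simp: vec_eq_iff)
  have pa: "p *v axis a 1 \<in> L'"
    using vec.subspace_scale[OF sub coord[of a], of "inverse ((matrix_inv p *v e') $ a)"] a by simp
  have pk: "p *v axis k 1 \<in> L'"
  proof (cases "a = k")
    case False
    have el: "matrix_inv p *v (elem p k a *v (p *v axis b 1)) =
        axis b 1 + (if b = a then axis k 1 else 0)" for b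
      using False
      by (simp add: conj_from_coords[OF p(1), of "elem p k a"] elem_conj_from[OF p(1)]
          mv_inverse[OF p(1)] vec_eq_iff mv_axis) (auto simp: axis_def)
    have "elem p k a *v e = 1 *s e"
      using el[of k] False mv_inverse(2)[OF p(1), of "elem p k a *v e"] by (simp add: p(2))
    then have "elem p k a *v (p *v axis a 1) \<in> L'" using stab[OF elem_SL[OF p(1)] _ pa] by blast
    moreover have "elem p k a *v (p *v axis a 1) = p *v axis a 1 + p *v axis k 1"
      using mv_inverse(2)[OF p(1), of "elem p k a *v (p *v axis a 1)"]
      unfolding el by (simp add: matrix_vector_right_distrib)
    ultimately show ?thesis using vec.subspace_diff[OF sub _ pa] by fastforce
  qed (use pa in simp)
  then have "L' = range (\<lambda>c. c *s e)" using line_generator[OF L'] p(2) e(1) by blast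
  then show ?thesis using e(2) by simp
qed

lemma line_of_line_stab:
  fixes L :: "(complex^'n::finite) set"
  assumes "CARD('n) \<ge> 2" "is_line L"
  shows "line_of (line_stab L) = L"
  unfolding line_of_def
proof (rule the_equality)
  show "L' = L" if "is_line L' \<and> line_stab L = line_stab L'" for L'
    using line_stab_inject[OF assms, of L'] that by simp
qed (use assms in simp)

lemma inverse_transpose_SL:
  assumes "g \<in> SL"
  shows "matrix_inv (transpose g) = transpose (matrix_inv g)"
  by (rule matrix_inv_eqI(1)) (simp add: matrix_transpose_mul[symmetric] SL_inv[OF assms])

lemma coline_stab_iff:
  "g \<in> coline_stab L \<longleftrightarrow> g \<in> SL \<and> transpose (matrix_inv g) \<in> line_stab L"
  by (auto simp: coline_stab_def line_stab_def transpose_SL)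

lemma coline_stab_inject:
  fixes L L' :: "(complex^'n::finite) set"
  assumes n: "CARD('n) \<ge> 2" and L: "is_line L" and L': "is_line L'" and eq: "coline_stab L = coline_stab L'"
  shows "L = L'"
proof (rule line_stab_inject[OF n L L'])
  have "g \<in> line_stab M \<longleftrightarrow> g \<in> SL \<and> transpose (matrix_inv g) \<in> coline_stab M" for g and M :: "(complex^'n) set"
    by (auto simp: coline_stab_iff transpose_SL inverse_transpose_SL matrix_inv_inv_SL line_stab_def)
  then show "line_stab L = line_stab L'" using eq by auto
qed

lemma coline_of_coline_stab:
  fixes L :: "(complex^'n::finite) set"
  assumes "CARD('n) \<ge> 2" "is_line L"
  shows "coline_of (coline_stab L) = L"
  unfolding coline_of_def
proof (rule the_equality)
  show "L' = L" if "is_line L' \<and> coline_stab L = coline_stab L'" for L'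
    using coline_stab_inject[OF assms, of L'] that by simp
qed (use assms in simp)

subsection \<open>Parabolic subgroups are self-normalizing\<close>

lemma subspace_image_matrix:
  fixes g :: "('n::finite) cmat"
  assumes g: "invertible g" and W: "vec.subspace W"
  shows "vec.subspace ((*v) g ` W)" "vec.dim ((*v) g ` W) = vec.dim W"
proof -
  have lin: "Vector_Spaces.linear (*s) (*s) ((*v) g)" by simp
  show "vec.subspace ((*v) g ` W)" using vec.linear_subspace_image[OF lin W] .
  have "inj ((*v) g)" using mv_inverse(1)[OF g] by (metis injI)
  then show "vec.dim ((*v) g ` W) = vec.dim W"
    by (intro vec.dim_image_eq[OF lin]) (auto intro: inj_on_subset)
qed

text \<open>Conjugating a stabilizer gives the stabilizer of the translated flag, and stabilizers
  determine flags. It identifies the isotropy groups of points of \<open>X_var\<close>, whose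
  components are subgroups and on which the group acts by conjugation.\<close>

lemma flag_stab_normalizer:
  fixes F :: "nat \<Rightarrow> (complex^'n::finite) set"
  assumes n: "CARD('n) \<ge> 2" and F: "complete_flag F" and g: "g \<in> SL"
    and eq: "conj_set g (flag_stab F) = flag_stab F"
  shows "g \<in> flag_stab F"
proof -
  have inv: "invertible g" by (rule SL_invertible[OF g])
  let ?G = "\<lambda>i. (*v) g ` F i"
  have G: "complete_flag ?G"
    using F subspace_image_matrix[OF inv] unfolding complete_flag_def by (metis image_mono)
  have "conj_set g (flag_stab F) = flag_stab ?G"
  proof (intro set_eqI iffI)
    fix h assume "h \<in> conj_set g (flag_stab F)"
    then obtain b where b: "b \<in> flag_stab F" "h = g ** b ** matrix_inv g" by (auto simp: conj_set_def)
    have "h *v (g *v x) = g *v (b *v x)" for x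
      by (simp add: b(2) matrix_vector_mul_assoc matrix_mul_assoc[symmetric] SL_inv[OF g])
    then show "h \<in> flag_stab ?G" using b g by (auto simp: flag_stab_def)
  next
    fix h assume h: "h \<in> flag_stab ?G"
    define b where "b = matrix_inv g ** h ** g"
    have "b *v x \<in> F i" if "x \<in> F i" for i x
    proof -
      have "h *v (g *v x) \<in> ?G i" using h that by (auto simp: flag_stab_def)
      then obtain y where y: "y \<in> F i" "h *v (g *v x) = g *v y" by auto
      have "b *v x = matrix_inv g *v (h *v (g *v x))" by (simp add: b_def matrix_vector_mul_assoc matrix_mul_assoc)
      then show ?thesis using y by (simp add: mv_inverse[OF inv])
    qed
    then have "b \<in> flag_stab F" using h g by (auto simp: b_def flag_stab_def)
    moreover have "h = g ** b ** matrix_inv g"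
    proof -
      have "g ** b ** matrix_inv g = (g ** matrix_inv g) ** h ** (g ** matrix_inv g)"
        by (simp only: b_def matrix_mul_assoc)
      then show ?thesis by (simp add: SL_inv[OF g])
    qed
    ultimately show "h \<in> conj_set g (flag_stab F)" unfolding conj_set_def by (intro image_eqI)
  qed
  then have "?G = F" by (intro flag_stab_inject[OF n G F HOL.trans[OF HOL.sym eq]])
  then have "(*v) g ` F i = F i" for i by metis
  then show ?thesis using g by (auto simp: flag_stab_def)
qed

lemma line_stab_normalizer:
  fixes L :: "(complex^'n::finite) set"
  assumes n: "CARD('n) \<ge> 2" and L: "is_line L" and g: "g \<in> SL"
    and eq: "conj_set g (line_stab L) = line_stab L"
  shows "g \<in> line_stab L"
proof -
  have inv: "invertible g" by (rule SL_invertible[OF g])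
  let ?G = "(*v) g ` L"
  have G: "is_line ?G" using L subspace_image_matrix[OF inv] by (simp add: is_line_def)
  have "conj_set g (line_stab L) = line_stab ?G"
  proof (intro set_eqI iffI)
    fix h assume "h \<in> conj_set g (line_stab L)"
    then obtain b where b: "b \<in> line_stab L" "h = g ** b ** matrix_inv g" by (auto simp: conj_set_def)
    have "h *v (g *v x) = g *v (b *v x)" for x
      by (simp add: b(2) matrix_vector_mul_assoc matrix_mul_assoc[symmetric] SL_inv[OF g])
    then show "h \<in> line_stab ?G" using b g by (auto simp: line_stab_def)
  next
    fix h assume h: "h \<in> line_stab ?G"
    define b where "b = matrix_inv g ** h ** g"
    have "b *v x \<in> L" if "x \<in> L" for x
    proof -
      have "h *v (g *v x) \<in> ?G" using h that by (auto simp: line_stab_def)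
      then obtain y where y: "y \<in> L" "h *v (g *v x) = g *v y" by auto
      have "b *v x = matrix_inv g *v (h *v (g *v x))" by (simp add: b_def matrix_vector_mul_assoc matrix_mul_assoc)
      then show ?thesis using y by (simp add: mv_inverse[OF inv])
    qed
    then have "b \<in> line_stab L" using h g by (auto simp: b_def line_stab_def)
    moreover have "h = g ** b ** matrix_inv g"
    proof -
      have "g ** b ** matrix_inv g = (g ** matrix_inv g) ** h ** (g ** matrix_inv g)"
        by (simp only: b_def matrix_mul_assoc)
      then show ?thesis by (simp add: SL_inv[OF g])
    qed
    ultimately show "h \<in> conj_set g (line_stab L)" unfolding conj_set_def by (intro image_eqI)
  qed
  then have "?G = L" by (intro line_stab_inject[OF n G L HOL.trans[OF HOL.sym eq]])
  then show ?thesis using g by (auto simp: line_stab_def)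
qed

text \<open>Transport by the automorphism \<open>?\<theta>\<close>, the inverse transpose, which
  exchanges stabilizers of lines and of colines.\<close>

lemma coline_stab_normalizer:
  fixes L :: "(complex^'n::finite) set"
  assumes n: "CARD('n) \<ge> 2" and L: "is_line L" and g: "g \<in> SL"
    and eq: "conj_set g (coline_stab L) = coline_stab L"
  shows "g \<in> coline_stab L"
proof -
  let ?\<theta> = "\<lambda>g :: 'n cmat. transpose (matrix_inv g)"
  have \<theta>\<theta>: "?\<theta> (?\<theta> h) = h" if "h \<in> SL" for h
    using that by (simp add: inverse_transpose_SL matrix_inv_inv_SL)
  have \<theta>SL: "?\<theta> h \<in> SL" if "h \<in> SL" for h using that by (simp add: transpose_SL)
  have \<theta>mult: "?\<theta> (a ** b) = ?\<theta> a ** ?\<theta> b" if "a \<in> SL" "b \<in> SL" for a b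
    using that by (simp add: matrix_inv_mult_SL matrix_transpose_mul)
  have \<theta>inv: "?\<theta> (matrix_inv a) = matrix_inv (?\<theta> a)" if "a \<in> SL" for a
    using that by (simp add: inverse_transpose_SL)
  have \<theta>conj: "?\<theta> (g ** b ** matrix_inv g) = ?\<theta> g ** ?\<theta> b ** matrix_inv (?\<theta> g)" if "b \<in> SL" for b
    using that g by (simp add: \<theta>mult \<theta>inv)
  have cl: "coline_stab L \<subseteq> SL" "line_stab L \<subseteq> SL" by (auto simp: coline_stab_def line_stab_def)
  have im: "?\<theta> ` coline_stab L = line_stab L"
  proof (intro set_eqI iffI)
    fix h assume h: "h \<in> line_stab L"
    then have "?\<theta> h \<in> coline_stab L" using cl \<theta>\<theta> \<theta>SL by (auto simp: coline_stab_iff)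
    then show "h \<in> ?\<theta> ` coline_stab L" using \<theta>\<theta>[of h] h cl(2) by (metis image_eqI subsetD)
  qed (auto simp: coline_stab_iff)
  have "conj_set (?\<theta> g) (line_stab L) = ?\<theta> ` conj_set g (coline_stab L)"
    unfolding im[symmetric] conj_set_def image_image using \<theta>conj cl(1)
    by (intro image_cong HOL.refl) auto
  also have "\<dots> = line_stab L" by (simp add: eq im)
  finally have "?\<theta> g \<in> line_stab L" by (rule line_stab_normalizer[OF n L \<theta>SL[OF g]])
  then show ?thesis using g by (simp add: coline_stab_iff)
qed

subsection \<open>Leading minors\<close>

text \<open>Padded by the identity so that the matrix type stays fixed; its determinant is the
  leading principal minor of size \<open>i\<close> in the order of \<open>pos\<close>.\<close>

definition block :: "nat \<Rightarrow> ('n::finite) cmat \<Rightarrow> 'n cmat" where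
  "block i A = (\<chi> a b. if pos a < i \<and> pos b < i then A $ a $ b else if a = b then 1 else 0)"

text \<open>The generalized minor of weight \<nu>: an explicit polynomial that will turn out to be
  the extremal matrix coefficient of every irreducible representation with highest weight
  \<nu>.\<close>

definition minors :: "('n::finite) cmat \<Rightarrow> weight \<Rightarrow> 'n cmat \<Rightarrow> complex" where
  "minors p \<nu> g = (\<Prod>i\<in>{1..<CARD('n)}. det (block i (conj_from p g)) ^ \<nu> i)"

lemma minors_add: "minors p (\<lambda>i. \<nu> i + \<nu>' i) g = minors p \<nu> g * minors p \<nu>' g"
  by (simp add: minors_def power_add prod.distrib)

text \<open>The mixed terms in the hypothesis vanish as soon as \<open>A\<close> is lower or
  \<open>B\<close> is upper triangular, which gives the eigenfunction property of
  \<open>minors\<close> on either side.\<close>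

lemma block_mult:
  assumes "\<And>a b k. pos a < i \<Longrightarrow> pos b < i \<Longrightarrow> \<not> pos k < i \<Longrightarrow> A $ a $ k * B $ k $ b = 0"
  shows "block i (A ** B) = block i A ** block i B"
proof -
  have "block i (A ** B) $ a $ b = (block i A ** block i B) $ a $ b" for a b
  proof (cases "pos a < i")
    case True
    have "(block i A ** block i B) $ a $ b = (\<Sum>k | pos k < i. A $ a $ k * block i B $ k $ b)"
      unfolding mm_entry by (rule sum.mono_neutral_cong_right) (use True in \<open>auto simp: block_def\<close>)
    also have "\<dots> = block i (A ** B) $ a $ b"
    proof (cases "pos b < i")
      case b: True
      have "(\<Sum>k | pos k < i. A $ a $ k * B $ k $ b) = (A ** B) $ a $ b"
        unfolding mm_entry using assms[OF True b] by (intro sum.mono_neutral_left) auto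
      then show ?thesis using True b by (simp add: block_def)
    next
      case False
      then show ?thesis using True by (auto simp: block_def intro!: sum.neutral)
    qed
    finally show ?thesis by simp
  next
    case False
    have "(block i A ** block i B) $ a $ b = (\<Sum>k\<in>{a}. block i A $ a $ k * block i B $ k $ b)"
      unfolding mm_entry by (rule sum.mono_neutral_right) (use False in \<open>auto simp: block_def\<close>)
    then show ?thesis using False by (simp add: block_def)
  qed
  then show ?thesis by (simp add: vec_eq_iff)
qed

lemma det_block_upr:
  assumes "inj r" "upr r A"
  shows "det (block i A) = (\<Prod>k | pos k < i. A $ k $ k)"
proof -
  have "upr r (block i A)" using assms(2) by (auto simp: upr_def block_def)
  then have "det (block i A) = (\<Prod>k\<in>UNIV. block i A $ k $ k)"
    by (rule det_upr[OF assms(1)])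
  also have "\<dots> = (\<Prod>k\<in>UNIV. if pos k < i then A $ k $ k else 1)"
    by (intro prod.cong) (auto simp: block_def)
  also have "\<dots> = (\<Prod>k | pos k < i. A $ k $ k)"
    by (rule prod.mono_neutral_cong_right) auto
  finally show ?thesis .
qed

lemma block_polynomial:
  fixes M :: "'x \<Rightarrow> ('n::finite) cmat"
  assumes "\<And>a b. (\<lambda>x. M x $ a $ b) \<in> polynomial_functions X"
  shows "(\<lambda>x. det (block i (M x))) \<in> polynomial_functions X"
  unfolding det_def
proof (intro polynomial_functions_sum polynomial_functions_cmult polynomial_functions_prod)
  fix \<sigma> and a :: 'n
  show "(\<lambda>x. block i (M x) $ a $ \<sigma> a) \<in> polynomial_functions X"
    by (cases "pos a < i \<and> pos (\<sigma> a) < i") (auto simp: block_def intro: assms polynomial_functions.const)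
qed (auto simp: finite_permutations)

lemma polynomial_functions_power:
  "f \<in> polynomial_functions X \<Longrightarrow> (\<lambda>x. f x ^ m) \<in> polynomial_functions X"
  by (induction m) (auto intro: polynomial_functions.intros)

lemma minors_polynomial: "minors p \<nu> \<in> polynomial_functions mat_coords"
proof -
  have "(\<lambda>g. conj_from p g $ a $ b) \<in> polynomial_functions mat_coords" for a b
    unfolding conj_from_def mm_entry
    by (intro polynomial_functions_sum polynomial_functions.mult polynomial_functions.const
        polynomial_functions.coord) (auto simp: mat_coords_def)
  then show ?thesis unfolding minors_def[abs_def]
    by (intro polynomial_functions_prod polynomial_functions_power block_polynomial) auto
qed

context
  fixes p :: "('n::finite) cmat" assumes p: "invertible p"
begin

lemma minors_mult_right:
  assumes b: "b \<in> borel_grp up p"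
  shows "minors p \<nu> (g ** b) = minors p \<nu> g * wt p \<nu> b"
proof -
  have U: "upr up (conj_from p b)" using b by (simp add: borel_grp_def)
  have "det (block i (conj_from p (g ** b))) = det (block i (conj_from p g)) * (\<Prod>k | pos k < i. conj_from p b $ k $ k)" for i
    unfolding conj_from_mult[OF p]
    by (subst block_mult) (use U in \<open>auto simp: upr_def up_def det_mul det_block_upr[OF inj_up U]\<close>)
  then show ?thesis by (simp add: minors_def wt_def power_mult_distrib prod.distrib)
qed

lemma minors_mult_left:
  assumes b: "b \<in> borel_grp down p"
  shows "minors p \<nu> (b ** g) = wt p \<nu> b * minors p \<nu> g"
proof -
  have U: "upr down (conj_from p b)" using b by (simp add: borel_grp_def)
  have "det (block i (conj_from p (b ** g))) = (\<Prod>k | pos k < i. conj_from p b $ k $ k) * det (block i (conj_from p g))" for i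
    unfolding conj_from_mult[OF p]
    by (subst block_mult) (use U in \<open>auto simp: upr_def down_def det_mul det_block_upr[OF inj_down U]\<close>)
  then show ?thesis by (simp add: minors_def wt_def power_mult_distrib prod.distrib)
qed

lemma minors_one: "minors p \<nu> (mat 1) = 1"
proof -
  have "block i (mat 1 :: 'n cmat) = mat 1" for i by (simp add: block_def mat_def vec_eq_iff)
  then show ?thesis by (simp add: minors_def conj_from_one[OF p])
qed

lemma minors_cell:
  assumes "n \<in> unip down p" "b \<in> borel_grp up p"
  shows "minors p \<nu> (n ** b) = wt p \<nu> b"
proof -
  have "minors p \<nu> n = 1"
    using minors_mult_left[OF unip_borel[OF assms(1)], of \<nu> "mat 1"] wt_unip[OF p inj_down assms(1)]
    by (simp add: minors_one)
  then show ?thesis using minors_mult_right[OF assms(2)] by simp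
qed

end

subsection \<open>Highest weight vectors in a frame\<close>

definition is_hwv :: "nat \<Rightarrow> ('n::finite) matrep \<Rightarrow> 'n cmat \<Rightarrow> weight \<Rightarrow> (nat \<Rightarrow> complex) \<Rightarrow> bool" where
  "is_hwv d \<rho> p \<nu> v \<longleftrightarrow> v \<in> cspace {..<d} \<and> v \<noteq> (\<lambda>_. 0) \<and>
     (\<forall>b\<in>borel_grp up p. mat_act {..<d} (\<rho> b) v = (\<lambda>i. wt p \<nu> b * v i))"

lemma irreducible_rational: "irreducible_rep d \<rho> \<Longrightarrow> rational_rep d \<rho>"
  by (simp add: irreducible_rep_def)

lemma pairing_unit_vec: "i < d \<Longrightarrow> pairing {..<d} w (unit_vec i) = w i"
  "i < d \<Longrightarrow> pairing {..<d} (unit_vec i) w = w i"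
  by (simp_all add: pairing_def unit_vec_def if_distrib[of "\<lambda>x. _ * x"] if_distrib[of "\<lambda>x. x * _"] cong: if_cong)

lemma unit_vec_cspace: "i < d \<Longrightarrow> unit_vec i \<in> cspace {..<d}"
  by (auto simp: unit_vec_def cspace_def)

text \<open>The vectors whose whole orbit is annihilated by \<open>w\<close> form an invariant
  subspace. Later arguments use irreducibility in this form.\<close>

lemma coefficient_nondegenerate:
  assumes irr: "irreducible_rep d \<rho>" and w: "w \<in> cspace {..<d}" and x: "x \<in> cspace {..<d}"
    and zero: "\<And>g. g \<in> SL \<Longrightarrow> pairing {..<d} w (mat_act {..<d} (\<rho> g) x) = 0"
  shows "w = (\<lambda>_. 0) \<or> x = (\<lambda>_. 0)"
proof -
  have R: "rational_rep d \<rho>" using irr by (rule irreducible_rational)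
  define W where "W = {y \<in> cspace {..<d}. \<forall>g\<in>SL. pairing {..<d} w (mat_act {..<d} (\<rho> g) y) = 0}"
  have "W = {\<lambda>_. 0} \<or> W = cspace {..<d}"
  proof -
    have 1: "W \<subseteq> cspace {..<d}" by (auto simp: W_def)
    have 2: "(\<lambda>_. 0) \<in> W" by (auto simp: W_def cspace_def mat_act_zero pairing_def)
    have 3: "\<forall>v\<in>W. \<forall>w\<in>W. (\<lambda>i. v i + w i) \<in> W"
      by (auto simp: W_def mat_act_add pairing_add cspace_def)
    have 4: "\<forall>c. \<forall>v\<in>W. (\<lambda>i. c * v i) \<in> W"
      by (auto simp: W_def mat_act_scale pairing_scale cspace_def)
    have 5: "\<forall>g\<in>SL. \<forall>v\<in>W. mat_act {..<d} (\<rho> g) v \<in> W"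
      by (auto simp: W_def act_mult[OF R, symmetric])
    show ?thesis using irr 1 2 3 4 5 unfolding irreducible_rep_def by blast
  qed
  then show ?thesis
  proof
    assume "W = {\<lambda>_. 0}"
    moreover have "x \<in> W" using x zero by (simp add: W_def)
    ultimately show ?thesis by simp
  next
    assume W: "W = cspace {..<d}"
    have "w i = 0" for i
    proof (cases "i < d")
      case True
      then have "unit_vec i \<in> W" using W unit_vec_cspace by blast
      then have "pairing {..<d} w (mat_act {..<d} (\<rho> (mat 1)) (unit_vec i)) = 0" by (simp add: W_def)
      then show ?thesis using True by (simp add: act_one[OF R] unit_vec_cspace pairing_unit_vec)
    qed (use w in \<open>simp add: cspace_def\<close>)
    then show ?thesis by auto
  qed
qed

lemma coefficient_determines:
  assumes irr: "irreducible_rep d \<rho>" and w: "w \<in> cspace {..<d}" "w' \<in> cspace {..<d}"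
    and x: "x \<in> cspace {..<d}" "x \<noteq> (\<lambda>_. 0)"
    and eq: "\<And>g. g \<in> SL \<Longrightarrow> pairing {..<d} w (mat_act {..<d} (\<rho> g) x) = pairing {..<d} w' (mat_act {..<d} (\<rho> g) x)"
  shows "w = w'"
proof -
  have "(\<lambda>i. w i + (- 1) * w' i) = (\<lambda>_. 0) \<or> x = (\<lambda>_. 0)"
  proof (rule coefficient_nondegenerate[OF irr _ x(1)])
    show "(\<lambda>i. w i + (- 1) * w' i) \<in> cspace {..<d}" using w by (simp add: cspace_def)
    show "pairing {..<d} (\<lambda>i. w i + (- 1) * w' i) (mat_act {..<d} (\<rho> g) x) = 0" if "g \<in> SL" for g
      unfolding pairing_add(1) pairing_scale(1) using eq[OF that] by simp
  qed
  then show ?thesis using x(2) by (auto simp: fun_eq_iff)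
qed

context
  fixes p :: "('n::finite) cmat" and d :: nat and \<rho> :: "'n matrep" and \<nu> :: weight and v :: "nat \<Rightarrow> complex"
  assumes p: "invertible p" and R: "rational_rep d \<rho>" and v: "is_hwv d \<rho> p \<nu> v"
begin

lemma hwv_cspace: "v \<in> cspace {..<d}" "v \<noteq> (\<lambda>_. 0)"
  using v by (auto simp: is_hwv_def)

lemma hwv_borel: "b \<in> borel_grp up p \<Longrightarrow> mat_act {..<d} (\<rho> b) v = (\<lambda>i. wt p \<nu> b * v i)"
  using v by (simp add: is_hwv_def)

lemma hwv_act_cell:
  assumes "g \<in> SL" "b \<in> borel_grp up p"
  shows "mat_act {..<d} (\<rho> (g ** b)) v = (\<lambda>i. wt p \<nu> b * mat_act {..<d} (\<rho> g) v i)"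
  using assms by (simp add: act_mult[OF R] borel_SL hwv_borel mat_act_scale)

text \<open>Linear relations between the vectors \<open>n b v\<close> of the big cell are preserved by the torus; in the
  limit of a contracting one-parameter subgroup each \<open>n\<close> becomes the identity.\<close>

lemma dual_vector_exists:
  "\<exists>\<xi>\<in>cspace {..<d}. \<forall>g\<in>SL. pairing {..<d} \<xi> (mat_act {..<d} (\<rho> g) v) = minors p \<nu> g"
proof -
  define A where "A = {(n, b). n \<in> unip down p \<and> b \<in> borel_grp up p}"
  obtain i0 where i0: "v i0 \<noteq> 0" using hwv_cspace(2) by (auto simp: fun_eq_iff)
  then have i0d: "i0 < d" using hwv_cspace(1) by (metis cspace_zero_outside lessThan_iff)
  have SL: "n \<in> SL" if "n \<in> unip r p" for n and r :: "'n \<Rightarrow> int" using that unip_borel borel_SL by blast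
  obtain t :: "real \<Rightarrow> 'n cmat" where t: "\<And>\<tau>. t \<tau> \<in> torus p"
    "\<And>n. n \<in> unip down p \<Longrightarrow> ((\<lambda>\<tau>. t \<tau> ** n ** matrix_inv (t \<tau>)) \<longlongrightarrow> mat 1) at_top"
    using torus_contraction[OF p inj_down] by blast
  have "\<exists>\<xi>\<in>cspace {..<d}. \<forall>x\<in>A. pairing {..<d} \<xi> (case x of (n, b) \<Rightarrow> mat_act {..<d} (\<rho> (n ** b)) v) =
      (case x of (n, b) \<Rightarrow> wt p \<nu> b)"
  proof (rule functional_from_relations)
    fix m :: nat and c :: "nat \<Rightarrow> complex" and x :: "nat \<Rightarrow> 'n cmat \<times> 'n cmat"
    assume xA: "\<forall>j<m. x j \<in> A"
      and rel: "\<forall>i. (\<Sum>j<m. c j * (case x j of (n, b) \<Rightarrow> mat_act {..<d} (\<rho> (n ** b)) v) i) = 0"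
    define n where "n j = fst (x j)" for j
    define b where "b j = snd (x j)" for j
    have x: "x j = (n j, b j)" for j by (simp add: n_def b_def)
    have nb: "n j \<in> unip down p" "b j \<in> borel_grp up p" if "j < m" for j
      using xA that by (auto simp: A_def x)
    define a where "a j = c j * wt p \<nu> (b j)" for j
    have rel1: "(\<lambda>i. \<Sum>j<m. a j * mat_act {..<d} (\<rho> (n j)) v i) = (\<lambda>_. 0)"
    proof
      fix i
      have "(\<Sum>j<m. a j * mat_act {..<d} (\<rho> (n j)) v i) =
          (\<Sum>j<m. c j * (case x j of (n, b) \<Rightarrow> mat_act {..<d} (\<rho> (n ** b)) v) i)"
      proof (intro sum.cong HOL.refl)
        fix j assume "j \<in> {..<m}"
        then have j: "j < m" by simp
        show "a j * mat_act {..<d} (\<rho> (n j)) v i = c j * (case x j of (n, b) \<Rightarrow> mat_act {..<d} (\<rho> (n ** b)) v) i"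
          by (simp add: x a_def hwv_act_cell[OF SL[OF nb(1)[OF j]] nb(2)[OF j]])
      qed
      then show "(\<Sum>j<m. a j * mat_act {..<d} (\<rho> (n j)) v i) = 0" using rel by simp
    qed
    \<comment> \<open>Applying \<open>t \<tau>\<close> to the relation and letting its inverse act
      on \<open>v\<close> multiplies all terms by one and the same weight.\<close>
    have rel2: "(\<Sum>j<m. a j * mat_act {..<d} (\<rho> (t \<tau> ** n j ** matrix_inv (t \<tau>))) v i0) = 0" for \<tau>
    proof -
      have ts: "t \<tau> \<in> SL" "matrix_inv (t \<tau>) \<in> borel_grp up p"
        using borel_SL[OF torus_borel[OF p inj_up t(1)]] torus_borel[OF p inj_up torus_inverse_mem[OF p inj_up t(1)]] by blast+
      have "(\<Sum>j<m. a j * mat_act {..<d} (\<rho> (t \<tau> ** n j ** matrix_inv (t \<tau>))) v i0) =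
         (\<Sum>j<m. wt p \<nu> (matrix_inv (t \<tau>)) * (a j * mat_act {..<d} (\<rho> (t \<tau>)) (mat_act {..<d} (\<rho> (n j)) v) i0))"
      proof (intro sum.cong HOL.refl)
        fix j assume "j \<in> {..<m}"
        then have nS: "n j \<in> SL" using SL nb(1) by auto
        show "a j * mat_act {..<d} (\<rho> (t \<tau> ** n j ** matrix_inv (t \<tau>))) v i0 =
          wt p \<nu> (matrix_inv (t \<tau>)) * (a j * mat_act {..<d} (\<rho> (t \<tau>)) (mat_act {..<d} (\<rho> (n j)) v) i0)"
          by (simp add: hwv_act_cell[OF SL_mult[OF ts(1) nS] ts(2)] act_mult[OF R ts(1) nS])
      qed
      also have "\<dots> = wt p \<nu> (matrix_inv (t \<tau>)) *
          mat_act {..<d} (\<rho> (t \<tau>)) (\<lambda>i. \<Sum>j<m. a j * mat_act {..<d} (\<rho> (n j)) v i) i0"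
        by (simp add: mat_act_sum mat_act_scale sum_distrib_left)
      finally show ?thesis unfolding rel1 by (simp add: mat_act_zero)
    qed
    obtain q where q: "q \<in> polynomial_functions mat_coords"
      "\<And>g. g \<in> SL \<Longrightarrow> pairing {..<d} (unit_vec i0) (mat_act {..<d} (\<rho> g) v) = q g"
      using matrix_coefficient_polynomial[OF R] by metis
    then have q0: "mat_act {..<d} (\<rho> g) v i0 = q g" if "g \<in> SL" for g
      using that i0d by (simp add: pairing_unit_vec)
    \<comment> \<open>All conjugates of the \<open>n j\<close> tend to 1 together, so the relation
      at the coordinate \<open>i0\<close>, where \<open>v\<close> is nonzero, degenerates to a
      statement about the coefficients \<open>a j\<close> alone.\<close>
    have "((\<lambda>\<tau>. \<Sum>j<m. a j * q (t \<tau> ** n j ** matrix_inv (t \<tau>))) \<longlongrightarrow> (\<Sum>j<m. a j * q (mat 1))) at_top"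
    proof (intro tendsto_sum tendsto_mult tendsto_const)
      fix j assume "j \<in> {..<m}"
      then show "((\<lambda>\<tau>. q (t \<tau> ** n j ** matrix_inv (t \<tau>))) \<longlongrightarrow> q (mat 1)) at_top"
        using mat_coords_continuous[OF q(1), of UNIV] t(2)[OF nb(1)]
        by (intro isCont_tendsto_compose[where g = q]) (simp_all add: continuous_on_eq_continuous_at)
    qed
    moreover have "(\<Sum>j<m. a j * q (t \<tau> ** n j ** matrix_inv (t \<tau>))) = 0" for \<tau>
    proof -
      have "t \<tau> ** n j ** matrix_inv (t \<tau>) \<in> SL" if "j < m" for j
        using that SL[OF nb(1)] borel_SL[OF torus_borel[OF p inj_up t(1)]] by simp
      then show ?thesis using rel2[of \<tau>] by (simp add: q0)
    qed
    ultimately have "((\<lambda>\<tau>::real. 0) \<longlongrightarrow> (\<Sum>j<m. a j * q (mat 1))) at_top" by simp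
    then have "(\<Sum>j<m. a j * q (mat 1)) = 0"
      using tendsto_unique[OF _ tendsto_const] by (metis trivial_limit_at_top_linorder)
    moreover have "q (mat 1) = v i0" using q0[of "mat 1"] by (simp add: act_one[OF R hwv_cspace(1)])
    ultimately have "(\<Sum>j<m. a j) * v i0 = 0" by (simp add: sum_distrib_right)
    then have "(\<Sum>j<m. a j) = 0" using i0 by simp
    then show "(\<Sum>j<m. c j * (case x j of (n, b) \<Rightarrow> wt p \<nu> b)) = 0" by (simp add: x a_def)
  qed (auto split: prod.split)
  then obtain \<xi> where \<xi>: "\<xi> \<in> cspace {..<d}"
    "\<And>n b. n \<in> unip down p \<Longrightarrow> b \<in> borel_grp up p \<Longrightarrow> pairing {..<d} \<xi> (mat_act {..<d} (\<rho> (n ** b)) v) = wt p \<nu> b"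
    by (auto simp: A_def)
  obtain q where q: "q \<in> polynomial_functions mat_coords"
    "\<And>g. g \<in> SL \<Longrightarrow> pairing {..<d} \<xi> (mat_act {..<d} (\<rho> g) v) = q g"
    using matrix_coefficient_polynomial[OF R] by metis
  have "q g - minors p \<nu> g = 0" if "g \<in> SL" for g
  proof (rule big_cell_identity[OF p _ _ that, where f = "\<lambda>g. q g - minors p \<nu> g"])
    show "(\<lambda>g. q g - minors p \<nu> g) \<in> polynomial_functions mat_coords"
      by (intro polynomial_functions_diff q minors_polynomial)
    fix n b assume nb: "n \<in> unip down p" "b \<in> borel_grp up p"
    then have "n ** b \<in> SL" by (intro SL_mult SL borel_SL)
    then show "q (n ** b) - minors p \<nu> (n ** b) = 0"
      using q(2) \<xi>(2)[OF nb] by (simp add: minors_cell[OF p nb])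
  qed
  then show ?thesis using \<xi>(1) q(2) by (intro bexI[of _ \<xi>]) auto
qed

text \<open>\<open>minors\<close> is an eigenfunction under left multiplication by the lower
  triangular group. The translate of \<xi> and its multiple therefore have equal coefficients on the
  orbit of \<open>v\<close>, and the orbit separates covectors.\<close>

lemma dual_vector_borel:
  assumes irr: "irreducible_rep d \<rho>" and \<xi>: "\<xi> \<in> cspace {..<d}"
    and c: "\<And>g. g \<in> SL \<Longrightarrow> pairing {..<d} \<xi> (mat_act {..<d} (\<rho> g) v) = k * minors p \<nu> g"
    and b: "b \<in> borel_grp down p" and x: "x \<in> cspace {..<d}"
  shows "pairing {..<d} \<xi> (mat_act {..<d} (\<rho> b) x) = wt p \<nu> b * pairing {..<d} \<xi> x"
proof -
  let ?\<xi> = "mat_act {..<d} (contragredient \<rho> (matrix_inv b)) \<xi>"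
  have bS: "b \<in> SL" using b by (rule borel_SL)
  have "?\<xi> = (\<lambda>i. wt p \<nu> b * \<xi> i)"
  proof (rule coefficient_determines[OF irr _ _ hwv_cspace])
    show "(\<lambda>i. wt p \<nu> b * \<xi> i) \<in> cspace {..<d}" using \<xi> by (simp add: cspace_def)
    fix g :: "'n cmat" assume g: "g \<in> SL"
    have "pairing {..<d} ?\<xi> (mat_act {..<d} (\<rho> g) v) = pairing {..<d} \<xi> (mat_act {..<d} (\<rho> (b ** g)) v)"
      by (simp add: pairing_act[OF R bS, symmetric] act_mult[OF R bS g])
    also have "\<dots> = wt p \<nu> b * pairing {..<d} \<xi> (mat_act {..<d} (\<rho> g) v)"
      using c[of "b ** g"] c[OF g] bS g by (simp add: minors_mult_left[OF p b])
    finally show "pairing {..<d} ?\<xi> (mat_act {..<d} (\<rho> g) v) =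
        pairing {..<d} (\<lambda>i. wt p \<nu> b * \<xi> i) (mat_act {..<d} (\<rho> g) v)"
      by (simp add: pairing_scale)
  qed simp
  then show ?thesis by (simp add: pairing_act[OF R bS] pairing_scale)
qed

text \<open>The character \<open>c\<close> of the second line is unknown at first. Pairing with the
  dual covector is nonzero, since otherwise it would vanish on the whole big cell; this identifies
  \<open>c\<close> with the weight on the torus, and \<open>torus_limit\<close> makes
  \<open>c\<close> trivial on unipotent elements. Hence a stable line alone already has the right
  weight.\<close>

lemma stable_line_weight:
  assumes irr: "irreducible_rep d \<rho>" and v': "v' \<in> cspace {..<d}" "v' \<noteq> (\<lambda>_. 0)"
    and stable: "\<And>b. b \<in> borel_grp up p \<Longrightarrow> \<exists>c. mat_act {..<d} (\<rho> b) v' = (\<lambda>i. c * v' i)"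
  shows "is_hwv d \<rho> p \<nu> v'"
proof -
  obtain c where c: "\<And>b. b \<in> borel_grp up p \<Longrightarrow> mat_act {..<d} (\<rho> b) v' = (\<lambda>i. c b * v' i)"
    using stable by metis
  obtain \<xi> where \<xi>: "\<xi> \<in> cspace {..<d}"
    "\<And>g. g \<in> SL \<Longrightarrow> pairing {..<d} \<xi> (mat_act {..<d} (\<rho> g) v) = 1 * minors p \<nu> g"
    using dual_vector_exists by auto
  have \<xi>0: "\<xi> \<noteq> (\<lambda>_. 0)"
    using \<xi>(2)[of "mat 1"] minors_one[OF p] by (auto simp: pairing_def)
  have \<xi>b: "pairing {..<d} \<xi> (mat_act {..<d} (\<rho> b) x) = wt p \<nu> b * pairing {..<d} \<xi> x"
    if "b \<in> borel_grp down p" "x \<in> cspace {..<d}" for b x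
    by (rule dual_vector_borel[OF irr \<xi> that])
  obtain q where q: "q \<in> polynomial_functions mat_coords"
    "\<And>g. g \<in> SL \<Longrightarrow> pairing {..<d} \<xi> (mat_act {..<d} (\<rho> g) v') = q g"
    using matrix_coefficient_polynomial[OF R] by metis
  have act: "mat_act {..<d} (\<rho> (g ** b)) v' = (\<lambda>i. c b * mat_act {..<d} (\<rho> g) v' i)"
    if "g \<in> SL" "b \<in> borel_grp up p" for g b
    using that by (simp add: act_mult[OF R] borel_SL c mat_act_scale)
  have nz: "pairing {..<d} \<xi> v' \<noteq> 0"
  proof
    assume z: "pairing {..<d} \<xi> v' = 0"
    have "q g = 0" if "g \<in> SL" for g
    proof (rule big_cell_identity[OF p q(1) _ that])
      fix n b assume nb: "n \<in> unip down p" "b \<in> borel_grp up p"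
      then have S: "n \<in> SL" "b \<in> SL" using unip_borel borel_SL by blast+
      show "q (n ** b) = 0"
        using q(2)[of "n ** b"] S \<xi>b[OF unip_borel[OF nb(1)] v'(1)] z
        by (simp add: act[OF S(1) nb(2)] pairing_scale)
    qed
    then show False using coefficient_nondegenerate[OF irr \<xi>(1) v'(1)] q(2) \<xi>0 v'(2) by auto
  qed
  have ct: "c t = wt p \<nu> t" if "t \<in> torus p" for t
  proof -
    have "c t * pairing {..<d} \<xi> v' = wt p \<nu> t * pairing {..<d} \<xi> v'"
      using \<xi>b[OF torus_borel[OF p inj_down that] v'(1)] c[OF torus_borel[OF p inj_up that]]
      by (simp add: pairing_scale)
    then show ?thesis using nz by simp
  qed
  have cn: "c n = 1" if n: "n \<in> unip up p" for n
  proof -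
    have nS: "n \<in> SL" using n unip_borel borel_SL by blast
    have qb: "q b = c b * pairing {..<d} \<xi> v'" if "b \<in> borel_grp up p" for b
      using q(2)[OF borel_SL[OF that]] c[OF that] by (simp add: pairing_scale)
    have "q n = q (mat 1)"
    proof (rule torus_limit[OF p inj_up q(1) n])
      fix t assume t: "t \<in> torus p"
      have tb: "t \<in> borel_grp up p" "matrix_inv t \<in> borel_grp up p" "t \<in> SL"
        using torus_borel[OF p inj_up t] borel_inverse[OF p inj_up] borel_SL by blast+
      have S: "t ** n ** matrix_inv t \<in> SL" using tb(3) nS by simp
      have A: "mat_act {..<d} (\<rho> (t ** n ** matrix_inv t)) v' = (\<lambda>i. c (matrix_inv t) * (c n * (c t * v' i)))"
        using tb nS by (simp add: act[OF _ tb(2)] act[OF tb(3) unip_borel[OF n]] c)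
      have "q (t ** n ** matrix_inv t) = c (matrix_inv t) * (c n * (c t * pairing {..<d} \<xi> v'))"
        unfolding q(2)[OF S, symmetric] A pairing_scale ..
      also have "\<dots> = c (matrix_inv t) * c t * q n" by (simp add: qb[OF unip_borel[OF n]])
      also have "c (matrix_inv t) * c t = 1"
        by (simp add: ct t torus_inverse_mem[OF p inj_up] wt_inverse[OF p inj_up tb(1)])
      finally show "q (t ** n ** matrix_inv t) = q n" by simp
    qed
    moreover have "q (mat 1) = pairing {..<d} \<xi> v'" using q(2)[of "mat 1"] by (simp add: act_one[OF R v'(1)])
    ultimately show ?thesis using nz by (simp add: qb[OF unip_borel[OF n]])
  qed
  have "mat_act {..<d} (\<rho> b) v' = (\<lambda>i. wt p \<nu> b * v' i)" if b: "b \<in> borel_grp up p" for b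
  proof -
    obtain t n where tn: "t \<in> torus p" "n \<in> unip up p" "b = t ** n"
      using borel_decomp[OF p inj_up b] by blast
    have tb: "t \<in> borel_grp up p" using torus_borel[OF p inj_up tn(1)] .
    show ?thesis unfolding tn(3)
      using act[OF borel_SL[OF tb] unip_borel[OF tn(2)]] cn[OF tn(2)] ct[OF tn(1)] c[OF tb]
      by (simp add: wt_mult[OF p inj_up tb unip_borel[OF tn(2)]] wt_unip[OF p inj_up tn(2)])
  qed
  then show ?thesis using v' by (simp add: is_hwv_def)
qed

text \<open>Evaluation at 1, where the pairing is nonzero, shows that the unknown torus character of
  \<xi> cancels the weight of \<open>v\<close>. The coefficient is then torus invariant, so
  \<open>torus_limit\<close> makes it constant on the lower unipotent group, and the big cell does
  the rest.\<close>

lemma dual_line_coefficient: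
  assumes \<xi>: "\<xi> \<in> cspace {..<d}"
    and stable: "\<And>b. b \<in> borel_grp down p \<Longrightarrow> \<exists>c. mat_act {..<d} (contragredient \<rho> b) \<xi> = (\<lambda>i. c * \<xi> i)"
    and nz: "pairing {..<d} \<xi> v \<noteq> 0" and g: "g \<in> SL"
  shows "pairing {..<d} \<xi> (mat_act {..<d} (\<rho> g) v) = pairing {..<d} \<xi> v * minors p \<nu> g"
proof -
  have "\<exists>c. \<forall>x. pairing {..<d} \<xi> (mat_act {..<d} (\<rho> b) x) = c * pairing {..<d} \<xi> x" if b: "b \<in> borel_grp down p" for b
  proof -
    obtain c where c: "mat_act {..<d} (contragredient \<rho> (matrix_inv b)) \<xi> = (\<lambda>i. c * \<xi> i)"
      using stable[OF borel_inverse[OF p inj_down b]] by blast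
    have "pairing {..<d} \<xi> (mat_act {..<d} (\<rho> b) x) = c * pairing {..<d} \<xi> x" for x
      by (simp add: pairing_act[OF R borel_SL[OF b]] c pairing_scale)
    then show ?thesis by blast
  qed
  then obtain c where c: "\<And>b x. b \<in> borel_grp down p \<Longrightarrow>
      pairing {..<d} \<xi> (mat_act {..<d} (\<rho> b) x) = c b * pairing {..<d} \<xi> x" by metis
  obtain q where q: "q \<in> polynomial_functions mat_coords"
    "\<And>g. g \<in> SL \<Longrightarrow> pairing {..<d} \<xi> (mat_act {..<d} (\<rho> g) v) = q g"
    using matrix_coefficient_polynomial[OF R] by metis
  have q1: "q (mat 1) = pairing {..<d} \<xi> v" using q(2)[of "mat 1"] by (simp add: act_one[OF R hwv_cspace(1)])
  have qn: "q n = pairing {..<d} \<xi> v" if n: "n \<in> unip down p" for n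
  proof -
    have nS: "n \<in> SL" using n unip_borel borel_SL by blast
    have "q n = q (mat 1)"
    proof (rule torus_limit[OF p inj_down q(1) n])
      fix t assume t: "t \<in> torus p"
      have tb: "t \<in> borel_grp down p" "matrix_inv t \<in> borel_grp up p" "t \<in> borel_grp up p" "t \<in> SL"
        using torus_borel[OF p inj_up t] torus_borel[OF p inj_down t] borel_inverse[OF p inj_up] borel_SL by blast+
      have tr: "q (t ** m ** matrix_inv t) = wt p \<nu> (matrix_inv t) * c t * q m" if "m \<in> SL" for m
      proof -
        have "q (t ** m ** matrix_inv t) = pairing {..<d} \<xi> (mat_act {..<d} (\<rho> (t ** m ** matrix_inv t)) v)"
          using that tb(4) by (intro q(2)[symmetric]) simp
        also have "\<dots> = wt p \<nu> (matrix_inv t) * pairing {..<d} \<xi> (mat_act {..<d} (\<rho> t) (mat_act {..<d} (\<rho> m) v))"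
          using that tb(4) by (simp add: hwv_act_cell[OF _ tb(2)] pairing_scale act_mult[OF R tb(4) that])
        finally show ?thesis by (simp add: c[OF tb(1)] q(2)[OF that])
      qed
      have "q (mat 1) = wt p \<nu> (matrix_inv t) * c t * q (mat 1)"
        using tr[of "mat 1"] by (simp add: SL_inv[OF tb(4)])
      then have "wt p \<nu> (matrix_inv t) * c t = 1" using nz q1 by simp
      then show "q (t ** n ** matrix_inv t) = q n" using tr[OF nS] by simp
    qed
    then show ?thesis using q1 by simp
  qed
  have "q g - pairing {..<d} \<xi> v * minors p \<nu> g = 0"
  proof (rule big_cell_identity[OF p _ _ g, where f = "\<lambda>g. q g - pairing {..<d} \<xi> v * minors p \<nu> g"])
    show "(\<lambda>g. q g - pairing {..<d} \<xi> v * minors p \<nu> g) \<in> polynomial_functions mat_coords"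
      by (intro polynomial_functions_diff polynomial_functions_cmult q minors_polynomial)
    fix n b assume nb: "n \<in> unip down p" "b \<in> borel_grp up p"
    then have S: "n \<in> SL" "b \<in> SL" using unip_borel borel_SL by blast+
    have "q (n ** b) = wt p \<nu> b * q n"
      using q(2)[of "n ** b"] q(2)[OF S(1)] S by (simp add: hwv_act_cell[OF S(1) nb(2)] pairing_scale)
    then show "q (n ** b) - pairing {..<d} \<xi> v * minors p \<nu> (n ** b) = 0"
      by (simp add: qn[OF nb(1)] minors_cell[OF p nb])
  qed
  then show ?thesis using q(2)[OF g] by simp
qed

end

lemma irrep_frame_hwv:
  fixes p :: "('n::finite) cmat"
  assumes "irrep_of_highest_weight \<nu> d \<rho>" "complete_flag (frame_flag p)" "invertible p"
  shows "\<exists>v. is_hwv d \<rho> p \<nu> v"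
proof -
  obtain v where "v \<in> cspace {..<d}" "v \<noteq> (\<lambda>_. 0)"
    "\<forall>b\<in>flag_stab (frame_flag p). mat_act {..<d} (\<rho> b) v = (\<lambda>i. weight_char (frame_flag p) \<nu> b * v i)"
    using assms by (auto simp: irrep_of_highest_weight_def)
  then show ?thesis
    by (auto simp: is_hwv_def flag_stab_frame[OF assms(3)] weight_char_frame[OF assms(3)])
qed

lemma highest_weight_vector_is_hwv:
  fixes p :: "('n::finite) cmat"
  assumes \<nu>: "irrep_of_highest_weight \<nu> d \<rho>" and p: "complete_flag (frame_flag p)" "invertible p"
    and v: "highest_weight_vector d \<rho> (borel_grp up p) v"
  shows "is_hwv d \<rho> p \<nu> v"
proof -
  have irr: "irreducible_rep d \<rho>" using \<nu> by (simp add: irrep_of_highest_weight_def)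
  obtain v0 where "is_hwv d \<rho> p \<nu> v0" using irrep_frame_hwv[OF \<nu> p] by blast
  then show ?thesis
    using stable_line_weight[OF p(2) irreducible_rational[OF irr] _ irr] v
    by (auto simp: highest_weight_vector_def)
qed

subsection \<open>Equivariance of the symbol of the differential operators\<close>

lemma prod_derivative_at_ones:
  fixes f :: "'k \<Rightarrow> real \<Rightarrow> complex"
  assumes "finite S" "\<And>k. k \<in> S \<Longrightarrow> (f k has_vector_derivative f' k) (at t)" "\<And>k. k \<in> S \<Longrightarrow> f k t = 1"
  shows "((\<lambda>s. \<Prod>k\<in>S. f k s) has_vector_derivative (\<Sum>k\<in>S. f' k)) (at t)"
  using assms
proof (induction S rule: finite_induct)
  case (insert a S)
  then have "((\<lambda>s. f a s * (\<Prod>k\<in>S. f k s)) has_vector_derivative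
      f a t * (\<Sum>k\<in>S. f' k) + f' a * (\<Prod>k\<in>S. f k t)) (at t)"
    by (intro bounded_bilinear.has_vector_derivative[OF bounded_bilinear_mult]) auto
  then show ?case using insert by (simp add: add.commute)
qed simp

text \<open>At the identity every diagonal entry is 1, so the logarithmic derivatives of the factors
  add up to the linear form that \<open>weight_lie_frame\<close> attaches to the same
  weight.\<close>

lemma wt_derivative:
  fixes p :: "('n::finite) cmat"
  assumes p: "invertible p" and \<gamma>: "(\<gamma> has_vector_derivative X) (at t)" "\<gamma> t = mat 1"
  shows "((\<lambda>t. wt p \<nu> (\<gamma> t)) has_vector_derivative
    (\<Sum>i\<in>{1..<CARD('n)}. of_nat (\<nu> i) * (\<Sum>k | pos k < i. conj_from p X $ k $ k))) (at t)"
proof -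
  have e: "((\<lambda>t. conj_from p (\<gamma> t) $ k $ k) has_vector_derivative conj_from p X $ k $ k) (at t)" for k
  proof -
    have "((\<lambda>t. matrix_inv p ** \<gamma> t ** p) has_vector_derivative matrix_inv p ** X ** p) (at t)"
      using has_vector_derivative_mult[OF has_vector_derivative_mult[OF has_vector_derivative_const \<gamma>(1)]
          has_vector_derivative_const] by simp
    then show ?thesis unfolding conj_from_def by (intro has_vector_derivative_vec_nth)
  qed
  have one: "conj_from p (\<gamma> t) $ k $ k = 1" for k by (simp add: \<gamma>(2) conj_from_one[OF p] mat_entry)
  have pr: "((\<lambda>t. \<Prod>k | pos k < i. conj_from p (\<gamma> t) $ k $ k) has_vector_derivative
      (\<Sum>k | pos k < i. conj_from p X $ k $ k)) (at t)" for i
    by (intro prod_derivative_at_ones e one) simp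
  have pw: "((\<lambda>t. (\<Prod>k | pos k < i. conj_from p (\<gamma> t) $ k $ k) ^ m) has_vector_derivative
      of_nat m * (\<Sum>k | pos k < i. conj_from p X $ k $ k)) (at t)" for i m
    using prod_derivative_at_ones[OF finite_lessThan[of m] pr[of i]] by (simp add: one)
  show ?thesis unfolding wt_def by (intro prod_derivative_at_ones pw) (simp_all add: one)
qed

lemma upr_in_lie_algebra:
  fixes p :: "('n::finite) cmat"
  assumes p: "invertible p" and x: "upr up (conj_from p (sl_mat x))"
  shows "x \<in> lie_algebra_of (flag_stab (frame_flag p))"
proof -
  have "mexp (t *\<^sub>R sl_mat x) *v v \<in> frame_flag p i" if v: "v \<in> frame_flag p i" for t i v
  proof -
    have pw: "matpow (t *\<^sub>R sl_mat x) k *v v \<in> frame_flag p i" for k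
    proof (induction k)
      case (Suc k)
      have "upr up (conj_from p (t *\<^sub>R sl_mat x))"
        using x by (simp add: upr_def conj_from_def mm_entry scaleR_sum_right[symmetric])
      then show ?case using Suc upr_stabilizes_frame[OF p] by (simp add: matrix_vector_mul_assoc[symmetric])
    qed (use v in simp)
    have "(matrix_inv p *v (mexp (t *\<^sub>R sl_mat x) *v v)) $ k = 0" if k: "i \<le> pos k" for k
    proof -
      let ?f = "\<lambda>A :: 'n cmat. (matrix_inv p *v (A *v v)) $ k"
      have sc: "(r *\<^sub>R A) *v v = r *\<^sub>R (A *v v)" "A *v (r *\<^sub>R w) = r *\<^sub>R (A *v w)" for r w and A :: "'n cmat"
        by (simp_all add: vec_eq_iff mv_entry scaleR_sum_right)
      have "linear ?f"
        by (intro linearI) (simp_all add: matrix_vector_mult_add_rdistrib matrix_vector_right_distrib sc)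
      then have bl: "bounded_linear ?f" by (simp add: linear_conv_bounded_linear)
      have "(\<lambda>m. ?f ((1 / fact m) *\<^sub>R matpow (t *\<^sub>R sl_mat x) m)) sums ?f (mexp (t *\<^sub>R sl_mat x))"
        by (rule bounded_linear.sums[OF bl mexp_sums])
      moreover have "?f ((1 / fact m) *\<^sub>R matpow (t *\<^sub>R sl_mat x) m) = 0" for m
        using pw[of m] k by (simp add: sc frame_flag_def)
      ultimately have "(\<lambda>m. 0) sums ?f (mexp (t *\<^sub>R sl_mat x))" by simp
      then show ?thesis using sums_unique2 sums_zero by blast
    qed
    then show ?thesis by (simp add: frame_flag_def)
  qed
  then show ?thesis by (simp add: lie_algebra_of_def flag_stab_def mexp_sl)
qed

text \<open>The diagonal action of \<open>a\<close> on the tensor product of the dual of the first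
  representation with the second, in coordinates: component \<open>k\<close> of the translate of
  \<open>\<Sum>j. \<xi>\<^sub>j \<otimes> Y j\<close>. For
  \<open>Y j = Uact ds \<rho>s (y j) v\<close> it is the symbol of the operator with coefficients
  \<open>y\<close>.\<close>

definition twist :: "nat \<Rightarrow> ('n::finite) matrep \<Rightarrow> nat \<Rightarrow> 'n matrep \<Rightarrow> (nat \<Rightarrow> nat \<Rightarrow> complex) \<Rightarrow>
    'n cmat \<Rightarrow> nat \<Rightarrow> nat \<Rightarrow> complex" where
  "twist dm \<rho>m ds \<rho>s Y a k = (\<lambda>i. \<Sum>j<dm. \<rho>m (matrix_inv a) j k * mat_act {..<ds} (\<rho>s a) (Y j) i)"

context
  fixes dm ds :: nat and \<rho>m \<rho>s :: "('n::finite) matrep" and Y :: "nat \<Rightarrow> nat \<Rightarrow> complex"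
  assumes Rm: "rational_rep dm \<rho>m" and Rs: "rational_rep ds \<rho>s"
    and Y: "\<And>j. Y j \<in> cspace {..<ds}"
begin

lemma twist_mult:
  assumes a: "a \<in> SL" and b: "b \<in> SL" and k: "k < dm"
  shows "twist dm \<rho>m ds \<rho>s Y (a ** b) k =
    (\<lambda>i. \<Sum>l<dm. \<rho>m (matrix_inv a) l k * mat_act {..<ds} (\<rho>s a) (twist dm \<rho>m ds \<rho>s Y b l) i)"
proof
  fix i
  have "twist dm \<rho>m ds \<rho>s Y (a ** b) k i =
     (\<Sum>j<dm. \<Sum>l<dm. \<rho>m (matrix_inv a) l k * (\<rho>m (matrix_inv b) j l * mat_act {..<ds} (\<rho>s a) (mat_act {..<ds} (\<rho>s b) (Y j)) i))"
    using k by (simp add: twist_def matrix_inv_mult_SL a b rep_mult[OF Rm] act_mult[OF Rs] 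
        sum_distrib_left sum_distrib_right mult_ac)
  also have "\<dots> = (\<Sum>l<dm. \<Sum>j<dm. \<rho>m (matrix_inv a) l k * (\<rho>m (matrix_inv b) j l * mat_act {..<ds} (\<rho>s a) (mat_act {..<ds} (\<rho>s b) (Y j)) i))"
    by (rule sum.swap)
  also have "\<dots> = (\<Sum>l<dm. \<rho>m (matrix_inv a) l k * mat_act {..<ds} (\<rho>s a) (twist dm \<rho>m ds \<rho>s Y b l) i)"
    by (simp add: twist_def mat_act_sum mat_act_scale sum_distrib_left)
  finally show "twist dm \<rho>m ds \<rho>s Y (a ** b) k i =
    (\<Sum>l<dm. \<rho>m (matrix_inv a) l k * mat_act {..<ds} (\<rho>s a) (twist dm \<rho>m ds \<rho>s Y b l) i)" .
qed

lemma twist_one: "k < dm \<Longrightarrow> twist dm \<rho>m ds \<rho>s Y (mat 1) k = Y k"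
  by (auto simp: twist_def rep_one[OF Rm] act_one[OF Rs Y] if_distrib[of "\<lambda>x. x * _"] cong: if_cong)

lemma twist_derivative_at_one:
  assumes k: "k < dm" and \<delta>: "\<And>t. \<delta> t \<in> SL" "\<delta> t = mat 1" "(\<delta> has_vector_derivative sl_mat x) (at t)"
  shows "((\<lambda>s. twist dm \<rho>m ds \<rho>s Y (\<delta> s) k i) has_vector_derivative
    (\<Sum>j<dm. lie_rep (contragredient \<rho>m) x k j * Y j i) + mat_act {..<ds} (lie_rep \<rho>s x) (Y k) i) (at t)"
proof -
  have 1: "((\<lambda>s. \<rho>m (matrix_inv (\<delta> s)) j k) has_vector_derivative lie_rep (contragredient \<rho>m) x k j) (at t)"
    if "j < dm" for j
    using rder_curve[OF rational_rep_contragredient[OF Rm] k that \<delta>]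
    by (simp add: lie_rep_eq[OF rational_rep_contragredient[OF Rm] k that]) (simp add: contragredient_def)
  have 2: "((\<lambda>s. mat_act {..<ds} (\<rho>s (\<delta> s)) y i) has_vector_derivative mat_act {..<ds} (lie_rep \<rho>s x) y i) (at t)" for y
  proof (cases "i < ds")
    case True
    have "((\<lambda>s. \<Sum>l<ds. \<rho>s (\<delta> s) i l * y l) has_vector_derivative (\<Sum>l<ds. rder \<rho>s i l (sl_mat x) * y l)) (at t)"
      by (intro has_vector_derivative_sum has_vector_derivative_mult_left rder_curve[OF Rs True _ \<delta>]) auto
    then show ?thesis using True by (simp add: mat_act_in lie_rep_eq[OF Rs])
  qed (simp add: mat_act_def)
  have "((\<lambda>s. twist dm \<rho>m ds \<rho>s Y (\<delta> s) k i) has_vector_derivative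
    (\<Sum>j<dm. \<rho>m (matrix_inv (\<delta> t)) j k * mat_act {..<ds} (lie_rep \<rho>s x) (Y j) i +
       lie_rep (contragredient \<rho>m) x k j * mat_act {..<ds} (\<rho>s (\<delta> t)) (Y j) i)) (at t)"
    unfolding twist_def
    by (intro has_vector_derivative_sum bounded_bilinear.has_vector_derivative[OF bounded_bilinear_mult] 1 2) auto
  moreover have "(\<Sum>j<dm. \<rho>m (matrix_inv (\<delta> t)) j k * mat_act {..<ds} (lie_rep \<rho>s x) (Y j) i +
       lie_rep (contragredient \<rho>m) x k j * mat_act {..<ds} (\<rho>s (\<delta> t)) (Y j) i) =
    (\<Sum>j<dm. lie_rep (contragredient \<rho>m) x k j * Y j i) + mat_act {..<ds} (lie_rep \<rho>s x) (Y k) i"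
    using k by (simp add: \<delta>(2) sum.distrib act_one[OF Rs Y] rep_one[OF Rm] if_distrib[of "\<lambda>x. x * _"] cong: if_cong)
  ultimately show ?thesis by simp
qed

text \<open>\<open>twist_mult\<close> carries the derivative at \<open>t\<close> back to 1 along the
  curve \<open>matrix_inv (\<gamma> t) ** \<gamma> s\<close>, so each component satisfies Z' = c Z.
  Letting \<open>x\<close> depend on \<open>t\<close> admits curves that are not one-parameter
  subgroups.\<close>

lemma twist_along_curve:
  assumes k: "k < dm" and \<gamma>: "\<And>t. \<gamma> t \<in> SL" "\<gamma> 0 = mat 1"
    "\<And>t. (\<gamma> has_vector_derivative \<gamma> t ** sl_mat (x t)) (at t)"
    and eig: "\<And>t k i. k < dm \<Longrightarrow>
      (\<Sum>j<dm. lie_rep (contragredient \<rho>m) (x t) k j * Y j i) + mat_act {..<ds} (lie_rep \<rho>s (x t)) (Y k) i = c * Y k i"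
  shows "twist dm \<rho>m ds \<rho>s Y (\<gamma> 1) k i = exp c * Y k i"
proof -
  let ?Z = "\<lambda>t. twist dm \<rho>m ds \<rho>s Y (\<gamma> t) k i"
  have D: "(?Z has_vector_derivative c * ?Z t) (at t)" for t
  proof -
    let ?\<delta> = "\<lambda>s. matrix_inv (\<gamma> t) ** \<gamma> s"
    have \<delta>: "?\<delta> s \<in> SL" for s using \<gamma>(1) by simp
    have \<delta>1: "?\<delta> t = mat 1" using SL_inv[OF \<gamma>(1)] by simp
    have "(?\<delta> has_vector_derivative matrix_inv (\<gamma> t) ** (\<gamma> t ** sl_mat (x t))) (at t)"
      using has_vector_derivative_mult[OF has_vector_derivative_const \<gamma>(3)] by simp
    then have \<delta>': "(?\<delta> has_vector_derivative sl_mat (x t)) (at t)"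
      by (simp add: matrix_mul_assoc SL_inv[OF \<gamma>(1)])
    have E: "((\<lambda>s. twist dm \<rho>m ds \<rho>s Y (?\<delta> s) l m) has_vector_derivative c * Y l m) (at t)" if "l < dm" for l m
      using twist_derivative_at_one[OF that \<delta> \<delta>1 \<delta>', of m] eig[OF that] by simp
    have Zs: "?Z s = (\<Sum>l<dm. \<rho>m (matrix_inv (\<gamma> t)) l k *
        mat_act {..<ds} (\<rho>s (\<gamma> t)) (twist dm \<rho>m ds \<rho>s Y (?\<delta> s) l) i)" for s
    proof -
      have "\<gamma> t ** ?\<delta> s = \<gamma> s" by (simp add: matrix_mul_assoc SL_inv[OF \<gamma>(1)])
      then show ?thesis using twist_mult[OF \<gamma>(1) \<delta> k, of t s] by simp
    qed
    have A: "((\<lambda>s. mat_act {..<ds} M (twist dm \<rho>m ds \<rho>s Y (?\<delta> s) l) i) has_vector_derivative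
        mat_act {..<ds} M (\<lambda>m. c * Y l m) i) (at t)" if "l < dm" for l M
    proof (cases "i < ds")
      case True
      have "((\<lambda>s. \<Sum>m<ds. M i m * twist dm \<rho>m ds \<rho>s Y (?\<delta> s) l m) has_vector_derivative
         (\<Sum>m<ds. M i m * (c * Y l m))) (at t)"
        by (intro has_vector_derivative_sum has_vector_derivative_mult_right E that)
      then show ?thesis using True by (simp add: mat_act_in)
    qed (simp add: mat_act_def)
    have "(?Z has_vector_derivative (\<Sum>l<dm. \<rho>m (matrix_inv (\<gamma> t)) l k *
        mat_act {..<ds} (\<rho>s (\<gamma> t)) (\<lambda>m. c * Y l m) i)) (at t)"
      unfolding Zs by (intro has_vector_derivative_sum has_vector_derivative_mult_right A) auto
    moreover have "(\<Sum>l<dm. \<rho>m (matrix_inv (\<gamma> t)) l k * mat_act {..<ds} (\<rho>s (\<gamma> t)) (\<lambda>m. c * Y l m) i) = c * ?Z t"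
      by (simp add: twist_def mat_act_scale sum_distrib_left mult_ac)
    ultimately show ?thesis by simp
  qed
  have ex: "((\<lambda>t. exp (- (c * of_real t))) has_vector_derivative - c * exp (- (c * of_real t))) (at t)" for t
  proof -
    have "((\<lambda>z. exp (- (c * z))) has_field_derivative - c * exp (- (c * of_real t))) (at (of_real t))"
      by (auto intro!: derivative_eq_intros)
    from has_vector_derivative_real_field[OF this] show ?thesis by simp
  qed
  have "((\<lambda>t. exp (- (c * of_real t)) * ?Z t) has_vector_derivative 0) (at t)" for t
    using bounded_bilinear.has_vector_derivative[OF bounded_bilinear_mult ex D, of t] by (simp add: algebra_simps)
  then have "exp (- (c * of_real 1)) * ?Z 1 = exp (- (c * of_real 0)) * ?Z 0"
    using has_vector_derivative_zero_constant[OF convex_UNIV, of "\<lambda>t. exp (- (c * of_real t)) * ?Z t"]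
    by (metis UNIV_I)
  then have "exp (- c) * ?Z 1 = Y k i" using twist_one[OF k] \<gamma>(2) by simp
  then have "exp c * (exp (- c) * ?Z 1) = exp c * Y k i" by simp
  then show ?thesis by (simp add: mult.assoc[symmetric] exp_minus_inverse)
qed

end

lemma lie_rep_hwv:
  fixes p :: "('n::finite) cmat"
  assumes p: "invertible p" and R: "rational_rep d \<rho>" and v: "is_hwv d \<rho> p \<nu> v"
    and x: "x \<in> lie_algebra_of (borel_grp up p)"
  shows "mat_act {..<d} (lie_rep \<rho> x) v =
    (\<lambda>i. (\<Sum>i\<in>{1..<CARD('n)}. of_nat (\<nu> i) * (\<Sum>k | pos k < i. conj_from p (sl_mat x) $ k $ k)) * v i)"
    (is "_ = (\<lambda>i. ?c * v i)")
proof
  fix i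
  show "mat_act {..<d} (lie_rep \<rho> x) v i = ?c * v i"
  proof (cases "i < d")
    case True
    let ?E = "\<lambda>t. mexp (t *\<^sub>R sl_mat x)"
    have "((\<lambda>t. \<Sum>j<d. \<rho> (?E t) i j * v j) has_vector_derivative (\<Sum>j<d. rder \<rho> i j (sl_mat x) * v j)) (at 0)"
      by (intro has_vector_derivative_sum has_vector_derivative_mult_left
          rder_curve[OF R True] mexp_sl mexp_derivative_zero) auto
    moreover have "(\<Sum>j<d. \<rho> (?E t) i j * v j) = wt p \<nu> (?E t) * v i" for t
    proof -
      have "?E t \<in> borel_grp up p" using x by (simp add: lie_algebra_of_def)
      from hwv_borel[OF p R v this] have "mat_act {..<d} (\<rho> (?E t)) v i = wt p \<nu> (?E t) * v i" by simp
      then show ?thesis using True by (simp add: mat_act_in)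
    qed
    moreover have "((\<lambda>t. wt p \<nu> (?E t) * v i) has_vector_derivative ?c * v i) (at 0)"
      by (intro has_vector_derivative_mult_left wt_derivative[OF p mexp_derivative_zero]) simp
    ultimately have "(\<Sum>j<d. rder \<rho> i j (sl_mat x) * v j) = ?c * v i"
      using vector_derivative_unique_at by (metis (no_types, lifting) ext)
    then show ?thesis using True by (simp add: mat_act_in lie_rep_eq[OF R])
  next
    case False
    then show ?thesis using v by (simp add: mat_act_def is_hwv_def cspace_def)
  qed
qed

text \<open>Applied to \<open>v\<close>, semi-invariance modulo the left ideal says that
  \<open>\<Sum>j. \<xi>\<^sub>j \<otimes> y\<^sub>j v\<close> is killed by the nilradical and has
  weight \<kappa> = (\<kappa> + \<mu>) - \<mu> under the Cartan subalgebra. This infinitesimal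
  statement is integrated over the unipotent radical and the torus separately.\<close>

lemma symbol_borel_equivariant:
  fixes p :: "('n::finite) cmat" and y :: "nat \<Rightarrow> 'n Ug"
  assumes n: "CARD('n) \<ge> 2" and p: "invertible p" and F: "complete_flag (frame_flag p)"
    and Rm: "rational_rep dm \<rho>m" and Rs: "rational_rep ds \<rho>s"
    and v: "is_hwv ds \<rho>s p (\<lambda>i. \<kappa> i + \<mu> i) v"
    and y: "y \<in> semi_invariants dm \<rho>m \<mu> (flag_stab (frame_flag p)) {x. diagonal_mat (conj_from p (sl_mat x))}"
    and b: "b \<in> borel_grp up p" and k: "k < dm"
  shows "twist dm \<rho>m ds \<rho>s (\<lambda>j. Uact ds \<rho>s (y j) v) b k = (\<lambda>i. wt p \<kappa> b * Uact ds \<rho>s (y k) v i)"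
proof -
  let ?Y = "\<lambda>j. Uact ds \<rho>s (y j) v"
  let ?B = "flag_stab (frame_flag p)"
  let ?wl = "\<lambda>\<nu> A. \<Sum>i\<in>{1..<CARD('n)}. of_nat (\<nu> i) * (\<Sum>k | pos k < i. conj_from p A $ k $ k) :: complex"
  have vc: "v \<in> cspace {..<ds}" using v by (simp add: is_hwv_def)
  have Yc: "?Y j \<in> cspace {..<ds}" for j by (rule Uact_cspace[OF vc])
  have B: "?B = borel_grp up p" by (rule flag_stab_frame[OF p])
  have fl: "flag_of ?B = frame_flag p" by (rule flag_of_flag_stab[OF n F])
  note hw = lie_rep_hwv[OF p Rs v, unfolded B[symmetric]]
  have nil_kill: "mat_act {..<ds} (lie_rep \<rho>s x) v = (\<lambda>_. 0)" if x: "x \<in> nilradical ?B" for x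
  proof -
    have xl: "x \<in> lie_algebra_of ?B" and xn: "\<And>i w. w \<in> frame_flag p (Suc i) \<Longrightarrow> sl_mat x *v w \<in> frame_flag p i"
      using x by (auto simp: nilradical_def fl)
    have "conj_from p (sl_mat x) $ k $ k = 0" for k
    proof -
      have "p *v axis k 1 \<in> frame_flag p (Suc (pos k))" by (simp add: frame_vector_mem[OF p])
      from xn[OF this] have "(conj_from p (sl_mat x) *v axis k 1) $ k = 0"
        by (simp add: frame_flag_def conj_from_coords[OF p, of "sl_mat x"] mv_inverse[OF p])
      then show ?thesis by (simp add: mv_axis)
    qed
    then show ?thesis by (simp add: hw[OF xl])
  qed
  have strict_nil: "x \<in> nilradical ?B"
    if U: "upr up (conj_from p (sl_mat x))" "\<And>k. conj_from p (sl_mat x) $ k $ k = 0" for x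
  proof -
    have "sl_mat x *v w \<in> frame_flag p i" if w: "w \<in> frame_flag p (Suc i)" for i w
    proof -
      have "(conj_from p (sl_mat x) *v (matrix_inv p *v w)) $ l = 0" if l: "i \<le> pos l" for l
        unfolding mv_entry[of "conj_from p (sl_mat x)"]
      proof (intro sum.neutral ballI)
        fix m
        show "conj_from p (sl_mat x) $ l $ m * (matrix_inv p *v w) $ m = 0"
        proof (cases "i < pos m")
          case True
          then show ?thesis using w by (simp add: frame_flag_def)
        next
          case False
          then have "m = l \<or> pos m < pos l" using l by (metis le_neq_implies_less le_trans linorder_not_less pos_eq)
          then show ?thesis using U by (auto simp: upr_def up_def)
        qed
      qed
      then show ?thesis by (simp add: frame_flag_def conj_from_coords[OF p, of "sl_mat x"])
    qed
    then show ?thesis using upr_in_lie_algebra[OF p U(1)] by (simp add: nilradical_def fl)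
  qed
  \<comment> \<open>The second half of the commutator in \<open>tensor_lie_act\<close> reaches
    \<open>v\<close> through \<open>x\<close> first: it contributes the weight of \<open>v\<close>
    for diagonal \<open>x\<close> and nothing for nilpotent \<open>x\<close>.\<close>
  have eval: "(\<Sum>j<dm. lie_rep (contragredient \<rho>m) x k j * ?Y j i) + mat_act {..<ds} (lie_rep \<rho>s x) (?Y k) i -
      Uact ds \<rho>s (y k) (mat_act {..<ds} (lie_rep \<rho>s x) v) i + c * ?Y k i = 0"
    if "tensor_lie_act dm \<rho>m x y k + U_const c * y k \<in> left_ideal (nilradical ?B)" for x k c i
  proof -
    have "Uact ds \<rho>s (tensor_lie_act dm \<rho>m x y k + U_const c * y k) v = (\<lambda>_. 0)"
      by (rule Uact_left_ideal[OF Rs vc nil_kill that])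
    then have "Uact ds \<rho>s (tensor_lie_act dm \<rho>m x y k + U_const c * y k) v i = 0" by simp
    then show ?thesis
      by (simp add: tensor_lie_act_def Uact_plus[OF Rs vc] Uact_minus[OF Rs vc] Uact_sum[OF Rs vc]
          Uact_times[OF Rs vc] Uact_const[OF Rs Yc] Uact_gen[OF Rs Yc] Uact_gen[OF Rs vc] add_diff_eq)
  qed
  have Uact0: "Uact ds \<rho>s u (\<lambda>_. 0) = (\<lambda>_. 0)" for u
    unfolding Uact_def using uact_scale[of ds \<rho>s "rep_Ug u" 0 "\<lambda>_. 0"] by simp
  have nil_eig: "(\<Sum>j<dm. lie_rep (contragredient \<rho>m) x k j * ?Y j i) + mat_act {..<ds} (lie_rep \<rho>s x) (?Y k) i = 0 * ?Y k i"
    if x: "x \<in> nilradical ?B" and k: "k < dm" for x k i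
  proof -
    have "tensor_lie_act dm \<rho>m x y k \<in> left_ideal (nilradical ?B)"
      using y x k by (simp add: semi_invariants_def)
    moreover have "U_const 0 * y k = 0"
    proof -
      have "U_const 0 = (0 :: 'n Ug)" by (simp add: U_const.abs_eq zero_Ug.abs_eq)
      then show ?thesis by simp
    qed
    ultimately show ?thesis using eval[of x k 0 i] by (simp add: nil_kill[OF x] Uact0)
  qed
  have diag_eig: "(\<Sum>j<dm. lie_rep (contragredient \<rho>m) x k j * ?Y j i) + mat_act {..<ds} (lie_rep \<rho>s x) (?Y k) i =
      ?wl \<kappa> (sl_mat x) * ?Y k i"
    if x: "diagonal_mat (conj_from p (sl_mat x))" and k: "k < dm" for x k i
  proof -
    have U: "upr up (conj_from p (sl_mat x))" using x unfolding upr_def diagonal_mat_def by (metis less_irrefl)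
    have xl: "x \<in> lie_algebra_of ?B" by (rule upr_in_lie_algebra[OF p U])
    have "tensor_lie_act dm \<rho>m x y k + U_const (?wl \<mu> (sl_mat x)) * y k \<in> left_ideal (nilradical ?B)"
      using y x k unfolding weight_lie_frame[OF p U, symmetric] by (simp add: semi_invariants_def fl)
    have us: "Uact ds \<rho>s u (\<lambda>i. c * v i) = (\<lambda>i. c * Uact ds \<rho>s u v i)" for u c
      unfolding Uact_def by (rule uact_scale)
    from eval[OF \<open>tensor_lie_act dm \<rho>m x y k + _ \<in> _\<close>, of i, unfolded hw[OF xl] us]
    have "(\<Sum>j<dm. lie_rep (contragredient \<rho>m) x k j * ?Y j i) + mat_act {..<ds} (lie_rep \<rho>s x) (?Y k) i =
      ?wl (\<lambda>i. \<kappa> i + \<mu> i) (sl_mat x) * ?Y k i - ?wl \<mu> (sl_mat x) * ?Y k i"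
      by (simp add: algebra_simps)
    also have "?wl (\<lambda>i. \<kappa> i + \<mu> i) (sl_mat x) = ?wl \<kappa> (sl_mat x) + ?wl \<mu> (sl_mat x)"
      unfolding sum.distrib[symmetric] of_nat_add by (intro sum.cong HOL.refl) (simp add: ring_distribs)
    finally show ?thesis by (simp add: algebra_simps)
  qed
  have unip: "twist dm \<rho>m ds \<rho>s ?Y u k i = ?Y k i" if u: "u \<in> unip up p" and k: "k < dm" for u k i
  proof -
    \<comment> \<open>The straight line from 1 to \<open>u\<close> stays in the unipotent group, and
      its logarithmic derivative \<open>X t\<close> is strictly upper triangular, so no matrix
      logarithm is required.\<close>
    define S where "S = conj_from p u - mat 1"
    define N where "N t = mat 1 + t *\<^sub>R S" for t
    define \<gamma> where "\<gamma> t = conj_to p (N t)" for t :: real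
    have U: "upr up (conj_from p u)" "\<And>k. conj_from p u $ k $ k = 1" using u by (auto simp: unip_def borel_grp_def)
    have S: "upr up S" "\<And>k. S $ k $ k = 0" using U by (auto simp: S_def upr_def mat_def)
    have N: "upr up (N t)" "N t $ k $ k = 1" for t k using S by (auto simp: N_def upr_def mat_def)
    have "det (N t) = 1" for t using det_upr[OF inj_up N(1)] N(2) by simp
    then have \<gamma>SL: "\<gamma> t \<in> SL" for t by (simp add: \<gamma>_def SL_def det_conj_to[OF p])
    define X where "X t = matrix_inv (\<gamma> t) ** conj_to p S" for t
    have NX: "N t ** conj_from p (X t) = S" for t
    proof -
      have "conj_from p (\<gamma> t ** X t) = S"
        by (simp add: X_def matrix_mul_assoc SL_inv[OF \<gamma>SL] conj_from_to[OF p])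
      then show ?thesis by (simp add: conj_from_mult[OF p] \<gamma>_def conj_from_to[OF p])
    qed
    have X: "upr up (conj_from p (X t))" for t
      by (rule upr_solve[OF inj_up N(1)[of t]]) (simp_all add: N(2) NX S(1))
    have Xd: "conj_from p (X t) $ k $ k = 0" for t k
      using upr_mult_diag[OF inj_up N(1)[of t] X[of t], of k] by (simp add: NX N(2) S(2))
    have "trace (X t) = trace (conj_from p (X t))" for t
      using trace_mul_sym[of "matrix_inv p ** X t" p] matrix_inv_both[OF p]
      by (simp add: conj_from_def matrix_mul_assoc)
    then have "trace (X t) = 0" for t by (simp add: trace_def Xd)
    then have Xsl: "sl_mat (Abs_sl (X t)) = X t" for t by (simp add: Abs_sl_inverse)
    have "(N has_vector_derivative S) (at t)" for t
      unfolding N_def by (auto intro!: derivative_eq_intros simp: has_vector_derivative_def)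
    then have "(\<gamma> has_vector_derivative conj_to p S) (at t)" for t
      unfolding \<gamma>_def conj_to_def
      using has_vector_derivative_mult[OF has_vector_derivative_mult[OF has_vector_derivative_const]
          has_vector_derivative_const] by fastforce
    moreover have "conj_to p S = \<gamma> t ** sl_mat (Abs_sl (X t))" for t
      unfolding Xsl unfolding X_def by (simp add: matrix_mul_assoc SL_inv[OF \<gamma>SL])
    ultimately have \<gamma>': "(\<gamma> has_vector_derivative \<gamma> t ** sl_mat (Abs_sl (X t))) (at t)" for t by metis
    have "twist dm \<rho>m ds \<rho>s ?Y (\<gamma> 1) k i = exp 0 * ?Y k i"
    proof (rule twist_along_curve[OF Rm Rs Yc k \<gamma>SL _ \<gamma>'])
      show "\<gamma> 0 = mat 1" by (simp add: \<gamma>_def N_def conj_to_one[OF p])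
      fix t k i assume "k < dm"
      then show "(\<Sum>j<dm. lie_rep (contragredient \<rho>m) (Abs_sl (X t)) k j * ?Y j i) +
          mat_act {..<ds} (lie_rep \<rho>s (Abs_sl (X t))) (?Y k) i = 0 * ?Y k i"
        by (intro nil_eig strict_nil) (simp_all add: Xsl X Xd)
    qed
    moreover have "\<gamma> 1 = u" by (simp add: \<gamma>_def N_def S_def conj_to_from[OF p])
    ultimately show ?thesis by simp
  qed
  have tor: "twist dm \<rho>m ds \<rho>s ?Y t k i = wt p \<kappa> t * ?Y k i" if t: "t \<in> torus p" and k: "k < dm" for t k i
  proof -
    obtain e where e: "t = conj_to p (dmat e)" "(\<Prod>k\<in>UNIV. e k) = 1" using t by (auto simp: torus_def)
    have e0: "e k \<noteq> 0" for k using e(2) prod_zero[of UNIV e] by fastforce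
    define k0 :: 'n where "k0 = undefined"
    \<comment> \<open>A logarithm of the torus element with trace zero: the entry at
      \<open>k0\<close> is chosen to make the sum vanish, and it still exponentiates to
      \<open>e k0\<close> because the product of all \<open>e k\<close> is 1.\<close>
    define l where "l k = (if k = k0 then - (\<Sum>k\<in>UNIV - {k0}. Ln (e k)) else Ln (e k))" for k
    have suml: "(\<Sum>k\<in>UNIV. l k) = 0"
      using sum.remove[of UNIV k0 l] by (simp add: l_def)
    have expl: "exp (l k) = e k" for k
    proof (cases "k = k0")
      case True
      have "(\<Prod>k\<in>UNIV. e k) = e k0 * (\<Prod>k\<in>UNIV - {k0}. e k)" by (rule prod.remove) auto
      then have "e k0 * (\<Prod>k\<in>UNIV - {k0}. e k) = 1" using e(2) by simp
      moreover have "exp (l k0) = inverse (\<Prod>k\<in>UNIV - {k0}. e k)"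
        by (simp add: l_def exp_minus exp_sum e0)
      ultimately show ?thesis using True by (metis inverse_unique mult.commute)
    qed (simp add: l_def e0)
    define N where "N s = dmat (\<lambda>k. exp (of_real s * l k))" for s
    define \<gamma> where "\<gamma> s = conj_to p (N s)" for s :: real
    have \<gamma>SL: "\<gamma> s \<in> SL" for s
      by (simp add: \<gamma>_def N_def SL_def det_conj_to[OF p] det_dmat exp_sum[symmetric] sum_distrib_left[symmetric] suml)
    have "trace (conj_to p (dmat l)) = trace (dmat l)"
      using trace_mul_sym[of "p ** dmat l" "matrix_inv p"] matrix_inv_both[OF p]
      by (simp add: conj_to_def matrix_mul_assoc)
    also have "\<dots> = 0" by (simp add: trace_def dmat_def suml)
    finally have hd: "sl_mat (Abs_sl (conj_to p (dmat l))) = conj_to p (dmat l)" by (simp add: Abs_sl_inverse)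
    have "(N has_vector_derivative N s ** dmat l) (at s)" for s
    proof (intro has_vector_derivative_vec)
      fix i j
      have "((\<lambda>s. exp (of_real s * l i)) has_vector_derivative l i * exp (of_real s * l i)) (at s)"
      proof -
        have "((\<lambda>z. exp (z * l i)) has_field_derivative l i * exp (of_real s * l i)) (at (of_real s))"
          by (auto intro!: derivative_eq_intros)
        from has_vector_derivative_real_field[OF this] show ?thesis .
      qed
      then show "((\<lambda>t. N t $ i $ j) has_vector_derivative (N s ** dmat l) $ i $ j) (at s)"
        unfolding dmat_mult_entry by (cases "i = j") (simp_all add: N_def dmat_def mult.commute)
    qed
    then have "(\<gamma> has_vector_derivative conj_to p (N s ** dmat l)) (at s)" for s
      unfolding \<gamma>_def conj_to_def
      using has_vector_derivative_mult[OF has_vector_derivative_mult[OF has_vector_derivative_const]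
          has_vector_derivative_const] by fastforce
    moreover have "conj_to p (N s ** dmat l) = \<gamma> s ** sl_mat (Abs_sl (conj_to p (dmat l)))" for s
      by (simp add: hd conj_to_mult[OF p] \<gamma>_def)
    ultimately have \<gamma>': "(\<gamma> has_vector_derivative \<gamma> s ** sl_mat (Abs_sl (conj_to p (dmat l)))) (at s)" for s
      by metis
    have "twist dm \<rho>m ds \<rho>s ?Y (\<gamma> 1) k i = exp (?wl \<kappa> (conj_to p (dmat l))) * ?Y k i"
    proof (rule twist_along_curve[OF Rm Rs Yc k \<gamma>SL _ \<gamma>'])
      show "\<gamma> 0 = mat 1" by (simp add: \<gamma>_def N_def dmat_one conj_to_one[OF p])
      fix k i assume k: "k < dm"
      have "diagonal_mat (conj_from p (sl_mat (Abs_sl (conj_to p (dmat l)))))"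
        unfolding hd conj_from_to[OF p] by (simp add: diagonal_mat_def dmat_def)
      from diag_eig[OF this k, of i]
      show "(\<Sum>j<dm. lie_rep (contragredient \<rho>m) (Abs_sl (conj_to p (dmat l))) k j * ?Y j i) +
          mat_act {..<ds} (lie_rep \<rho>s (Abs_sl (conj_to p (dmat l)))) (?Y k) i = ?wl \<kappa> (conj_to p (dmat l)) * ?Y k i"
        unfolding hd .
    qed
    moreover have "\<gamma> 1 = t" by (simp add: \<gamma>_def N_def e(1) expl)
    moreover have "exp (?wl \<kappa> (conj_to p (dmat l))) = wt p \<kappa> t"
      by (simp add: wt_def e(1) conj_from_to[OF p] exp_sum dmat_def exp_of_nat_mult expl)
    ultimately show ?thesis by simp
  qed
  obtain t u where tu: "t \<in> torus p" "u \<in> unip up p" "b = t ** u"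
    using borel_decomp[OF p inj_up b] by blast
  have tb: "t \<in> borel_grp up p" using torus_borel[OF p inj_up tu(1)] .
  have S: "t \<in> SL" "u \<in> SL" using tb borel_SL unip_borel[OF tu(2)] by blast+
  show ?thesis
  proof
    fix i
    have "twist dm \<rho>m ds \<rho>s ?Y b k i =
        (\<Sum>l<dm. \<rho>m (matrix_inv t) l k * mat_act {..<ds} (\<rho>s t) (twist dm \<rho>m ds \<rho>s ?Y u l) i)"
      unfolding tu(3) twist_mult[OF Rm Rs Yc S k] ..
    also have "\<dots> = (\<Sum>l<dm. \<rho>m (matrix_inv t) l k * mat_act {..<ds} (\<rho>s t) (?Y l) i)"
    proof (intro sum.cong HOL.refl)
      fix l assume "l \<in> {..<dm}"
      then have "twist dm \<rho>m ds \<rho>s ?Y u l = ?Y l" using unip[OF tu(2)] by auto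
      then show "\<rho>m (matrix_inv t) l k * mat_act {..<ds} (\<rho>s t) (twist dm \<rho>m ds \<rho>s ?Y u l) i =
        \<rho>m (matrix_inv t) l k * mat_act {..<ds} (\<rho>s t) (?Y l) i" by simp
    qed
    also have "\<dots> = twist dm \<rho>m ds \<rho>s ?Y t k i" by (simp add: twist_def)
    also have "\<dots> = wt p \<kappa> b * ?Y k i"
      unfolding tor[OF tu(1) k] tu(3) wt_mult[OF p inj_up tb unip_borel[OF tu(2)]] wt_unip[OF p inj_up tu(2)] by simp
    finally show "twist dm \<rho>m ds \<rho>s ?Y b k i = wt p \<kappa> b * ?Y k i" .
  qed
qed

text \<open>Both sides are \<open>weight_char\<close> of the common flag, which is
  intrinsic.\<close>

lemma wt_frame_change:
  fixes p q :: "('n::finite) cmat"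
  assumes p: "invertible p" and q: "invertible q" and eq: "frame_flag p = frame_flag q"
    and b: "b \<in> borel_grp up p"
  shows "b \<in> borel_grp up q" "wt p \<nu> b = wt q \<nu> b"
proof -
  show bq: "b \<in> borel_grp up q" using b flag_stab_frame[OF p] flag_stab_frame[OF q] eq by simp
  show "wt p \<nu> b = wt q \<nu> b"
    using weight_char_frame[OF p b] weight_char_frame[OF q bq] eq by simp
qed

lemma is_hwv_frame_change:
  fixes p q :: "('n::finite) cmat"
  assumes p: "invertible p" and q: "invertible q" and eq: "frame_flag p = frame_flag q"
    and v: "is_hwv d \<rho> p \<nu> v"
  shows "is_hwv d \<rho> q \<nu> v"
  using v wt_frame_change[OF q p eq[symmetric]] by (auto simp: is_hwv_def)

text \<open>The \<open>B\<close>-equivariant symbol pairs with the \<open>B'\<close>-highest vector of \<open>V\<^sub>\<sigma>\<^sup>*\<close> to a function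
  on the big cell that is forced, by weights, to be a product of the two corresponding functions for
  \<open>\<mu>\<close> and \<open>\<kappa>\<close>, where \<open>\<sigma> = \<kappa> + \<mu>\<close>.\<close>

lemma symbol_factorization:
  fixes p :: "('n::finite) cmat" and \<kappa> \<mu> :: weight
  assumes p: "invertible p"
    and irr: "irreducible_rep dm \<rho>m" "irreducible_rep ds \<rho>s" "rational_rep dl \<rho>l"
    and vm: "is_hwv dm \<rho>m p \<mu> vm" and vs: "is_hwv ds \<rho>s p (\<lambda>i. \<kappa> i + \<mu> i) vs"
    and \<xi>m: "\<xi>m \<in> cspace {..<dm}"
      "\<And>g. g \<in> SL \<Longrightarrow> pairing {..<dm} \<xi>m (mat_act {..<dm} (\<rho>m g) vm) = km * minors p \<mu> g" "km \<noteq> 0"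
    and \<xi>s: "\<xi>s \<in> cspace {..<ds}"
      "\<And>g. g \<in> SL \<Longrightarrow> pairing {..<ds} \<xi>s (mat_act {..<ds} (\<rho>s g) vs) = ks * minors p (\<lambda>i. \<kappa> i + \<mu> i) g"
    and \<xi>l: "\<And>g. g \<in> SL \<Longrightarrow> pairing {..<dl} \<xi>l (mat_act {..<dl} (\<rho>l g) vl) = kl * minors p \<kappa> g" "kl \<noteq> 0"
    and Y: "\<And>j. Y j \<in> cspace {..<ds}"
    and eqv: "\<And>b k. b \<in> borel_grp up p \<Longrightarrow> k < dm \<Longrightarrow> twist dm \<rho>m ds \<rho>s Y b k = (\<lambda>i. wt p \<kappa> b * Y k i)"
  shows "\<exists>c. \<forall>h\<in>SL. \<forall>a\<in>SL. \<forall>k<dm.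
    pairing {..<ds} (mat_act {..<ds} (contragredient \<rho>s h) \<xi>s) (twist dm \<rho>m ds \<rho>s Y a k) =
    c * mat_act {..<dm} (contragredient \<rho>m h) \<xi>m k *
      pairing {..<dl} (mat_act {..<dl} (contragredient \<rho>l h) \<xi>l) (mat_act {..<dl} (\<rho>l a) vl)"
proof -
  have Rm: "rational_rep dm \<rho>m" and Rs: "rational_rep ds \<rho>s"
    using irr irreducible_rational by blast+
  note Rl = irr(3)
  let ?\<Theta> = "twist dm \<rho>m ds \<rho>s Y"
  have \<Theta>c: "?\<Theta> a k \<in> cspace {..<ds}" for a k
    by (auto simp: twist_def cspace_def mat_act_def)
  have \<xi>sb: "pairing {..<ds} \<xi>s (mat_act {..<ds} (\<rho>s b) x) = wt p (\<lambda>i. \<kappa> i + \<mu> i) b * pairing {..<ds} \<xi>s x"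
    if "b \<in> borel_grp down p" "x \<in> cspace {..<ds}" for b x
    by (rule dual_vector_borel[OF p Rs vs irr(2) \<xi>s that])
  have \<xi>mb: "pairing {..<dm} \<xi>m (mat_act {..<dm} (\<rho>m b) x) = wt p \<mu> b * pairing {..<dm} \<xi>m x"
    if "b \<in> borel_grp down p" "x \<in> cspace {..<dm}" for b x
    by (rule dual_vector_borel[OF p Rm vm irr(1) \<xi>m(1,2) that])
  have vmc: "vm \<in> cspace {..<dm}" "vm \<noteq> (\<lambda>_. 0)" using hwv_cspace[OF p Rm vm] by blast+
  \<comment> \<open>The pairing of \<xi>s with the symbol at 1, as a covector on V_\<mu>.
    Equivariance of the symbol under \<kappa> and of \<xi>s under \<kappa> + \<mu> leaves it with
    the torus behaviour of \<xi>m.\<close>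
  define \<kappa>0 where "\<kappa>0 = (\<lambda>k. if k < dm then pairing {..<ds} \<xi>s (Y k) else 0)"
  have \<kappa>0c: "\<kappa>0 \<in> cspace {..<dm}" by (simp add: \<kappa>0_def cspace_def)
  have \<kappa>0t: "pairing {..<dm} \<kappa>0 (mat_act {..<dm} (\<rho>m t) x) = wt p \<mu> t * pairing {..<dm} \<kappa>0 x"
    if t: "t \<in> torus p" for t x
  proof -
    define s where "s = matrix_inv t"
    have tb: "t \<in> borel_grp up p" "t \<in> borel_grp down p" using t torus_borel[OF p] inj_up inj_down by blast+
    have tS: "t \<in> SL" using tb borel_SL by blast
    have sT: "s \<in> torus p" unfolding s_def by (rule torus_inverse_mem[OF p inj_up t])
    have sb: "s \<in> borel_grp up p" "s \<in> borel_grp down p" using sT torus_borel[OF p] inj_up inj_down by blast+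
    have st: "matrix_inv s = t" unfolding s_def by (rule matrix_inv_inv_SL[OF tS])
    have ws: "wt p \<nu> s * wt p \<nu> t = 1" for \<nu> unfolding s_def by (rule wt_inverse[OF p inj_up tb(1)])
    have "(\<Sum>j<dm. \<rho>m t j k * \<kappa>0 j) = wt p \<mu> t * \<kappa>0 k" if k: "k < dm" for k
    proof -
      have "pairing {..<ds} \<xi>s (?\<Theta> s k) = (\<Sum>j<dm. \<rho>m t j k * pairing {..<ds} \<xi>s (mat_act {..<ds} (\<rho>s s) (Y j)))"
        unfolding twist_def st pairing_sum pairing_scale ..
      also have "\<dots> = wt p (\<lambda>i. \<kappa> i + \<mu> i) s * (\<Sum>j<dm. \<rho>m t j k * \<kappa>0 j)"
        by (simp add: \<xi>sb[OF sb(2) Y] \<kappa>0_def sum_distrib_left mult_ac)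
      finally have "wt p \<kappa> s * \<kappa>0 k = wt p \<kappa> s * (wt p \<mu> s * (\<Sum>j<dm. \<rho>m t j k * \<kappa>0 j))"
        using k by (simp add: eqv[OF sb(1) k] pairing_scale \<kappa>0_def wt_add mult.assoc)
      moreover have "wt p \<kappa> s \<noteq> 0" using ws[of \<kappa>] by auto
      ultimately have "\<kappa>0 k = wt p \<mu> s * (\<Sum>j<dm. \<rho>m t j k * \<kappa>0 j)" by simp
      then have "wt p \<mu> t * \<kappa>0 k = (wt p \<mu> s * wt p \<mu> t) * (\<Sum>j<dm. \<rho>m t j k * \<kappa>0 j)" by simp
      then show ?thesis by (simp add: ws)
    qed
    then have "mat_act {..<dm} (\<lambda>j i. \<rho>m t i j) \<kappa>0 = (\<lambda>k. wt p \<mu> t * \<kappa>0 k)"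
      using \<kappa>0c by (auto simp: mat_act_def cspace_def)
    moreover have "pairing {..<dm} \<kappa>0 (mat_act {..<dm} (\<rho>m t) x) =
        pairing {..<dm} (mat_act {..<dm} (\<lambda>j i. \<rho>m t i j) \<kappa>0) x"
      by (rule pairing_mat_act_transpose) simp
    ultimately show ?thesis by (simp add: pairing_scale)
  qed
  \<comment> \<open>Chosen so that \<open>y\<close> annihilates \<open>vm\<close>. Having the torus
    behaviour of \<xi>m, \<open>y\<close> gives a coefficient on the orbit of \<open>vm\<close> that
    is constant on the lower unipotent group, hence zero; this is multiplicity one of the extremal
    weight.\<close>
  define c0 where "c0 = pairing {..<dm} \<kappa>0 vm / km"
  define y where "y = (\<lambda>k. \<kappa>0 k + (- c0) * \<xi>m k)"
  have yc: "y \<in> cspace {..<dm}" using \<kappa>0c \<xi>m(1) by (simp add: y_def cspace_def)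
  have \<xi>v: "pairing {..<dm} \<xi>m vm = km"
    using \<xi>m(2)[of "mat 1"] by (simp add: act_one[OF Rm vmc(1)] minors_one[OF p])
  have yv: "pairing {..<dm} y vm = 0"
    unfolding y_def pairing_add pairing_scale \<xi>v using \<xi>m(3) by (simp add: c0_def)
  have yt: "pairing {..<dm} y (mat_act {..<dm} (\<rho>m t) x) = wt p \<mu> t * pairing {..<dm} y x"
    if "t \<in> torus p" "x \<in> cspace {..<dm}" for t x
    unfolding y_def pairing_add pairing_scale
    using \<kappa>0t[OF that(1)] \<xi>mb[OF torus_borel[OF p inj_down that(1)] that(2)] by (simp add: algebra_simps)
  obtain f where f: "f \<in> polynomial_functions mat_coords"
    "\<And>g. g \<in> SL \<Longrightarrow> pairing {..<dm} y (mat_act {..<dm} (\<rho>m g) vm) = f g"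
    using matrix_coefficient_polynomial[OF Rm] by metis
  have fn: "f n = 0" if n: "n \<in> unip down p" for n
  proof -
    have nS: "n \<in> SL" using n unip_borel borel_SL by blast
    have "f n = f (mat 1)"
    proof (rule torus_limit[OF p inj_down f(1) n])
      fix t assume t: "t \<in> torus p"
      have tb: "matrix_inv t \<in> borel_grp up p" "t \<in> SL" "t \<in> borel_grp up p"
        using torus_borel[OF p inj_up t] borel_inverse[OF p inj_up] borel_SL by blast+
      have "f (t ** n ** matrix_inv t) = pairing {..<dm} y (mat_act {..<dm} (\<rho>m (t ** n ** matrix_inv t)) vm)"
        using tb(2) nS by (intro f(2)[symmetric]) simp
      also have "\<dots> = wt p \<mu> (matrix_inv t) * (wt p \<mu> t * f n)"
        unfolding hwv_act_cell[OF p Rm vm SL_mult[OF tb(2) nS] tb(1)] pairing_scale act_mult[OF Rm tb(2) nS]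
        by (simp add: yt[OF t] f(2)[OF nS])
      also have "\<dots> = (wt p \<mu> (matrix_inv t) * wt p \<mu> t) * f n" by simp
      finally show "f (t ** n ** matrix_inv t) = f n" by (simp add: wt_inverse[OF p inj_up tb(3)])
    qed
    also have "\<dots> = 0" using f(2)[of "mat 1"] yv by (simp add: act_one[OF Rm vmc(1)])
    finally show ?thesis .
  qed
  have "f g = 0" if "g \<in> SL" for g
  proof (rule big_cell_identity[OF p f(1) _ that])
    fix n b assume nb: "n \<in> unip down p" "b \<in> borel_grp up p"
    then have S: "n \<in> SL" "b \<in> SL" using unip_borel borel_SL by blast+
    have "f (n ** b) = wt p \<mu> b * f n"
      unfolding f(2)[OF SL_mult[OF S], symmetric] hwv_act_cell[OF p Rm vm S(1) nb(2)] pairing_scale f(2)[OF S(1)] ..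
    then show "f (n ** b) = 0" by (simp add: fn[OF nb(1)])
  qed
  then have "y = (\<lambda>_. 0) \<or> vm = (\<lambda>_. 0)"
    by (intro coefficient_nondegenerate[OF irr(1) yc vmc(1)]) (simp add: f(2))
  then have \<kappa>0: "\<kappa>0 k = c0 * \<xi>m k" for k using vmc(2) by (auto simp: y_def fun_eq_iff)
  have \<Theta>left: "mat_act {..<ds} (\<rho>s (matrix_inv h)) (?\<Theta> a k) =
      (\<lambda>i. \<Sum>l<dm. \<rho>m (matrix_inv h) l k * ?\<Theta> (matrix_inv h ** a) l i)"
    if h: "h \<in> SL" and a: "a \<in> SL" and k: "k < dm" for h a k
  proof -
    have ha: "h ** (matrix_inv h ** a) = a" by (simp add: matrix_mul_assoc SL_inv[OF h])
    have "?\<Theta> (h ** (matrix_inv h ** a)) k = (\<lambda>i. \<Sum>l<dm. \<rho>m (matrix_inv h) l k *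
        mat_act {..<ds} (\<rho>s h) (?\<Theta> (matrix_inv h ** a) l) i)"
      by (rule twist_mult[OF Rm Rs Y h _ k]) (simp add: h a)
    then have 1: "?\<Theta> a k = (\<lambda>i. \<Sum>l<dm. \<rho>m (matrix_inv h) l k *
        mat_act {..<ds} (\<rho>s h) (?\<Theta> (matrix_inv h ** a) l) i)" unfolding ha .
    show ?thesis
      unfolding 1 mat_act_sum mat_act_scale act_inverse_cancel[OF Rs h \<Theta>c] ..
  qed
  define \<Psi> where "\<Psi> a k = pairing {..<ds} \<xi>s (?\<Theta> a k)" for a k
  \<comment> \<open>On the big cell \<open>b\<close> contributes its weight by \<open>eqv\<close>.
    The factor \<open>n\<close> disappears because \<xi>s and \<xi>m are both fixed by the lower
    unipotent group, and what is left is the value at 1 computed above.\<close>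
  have \<Psi>: "\<Psi> a k = c0 * \<xi>m k * minors p \<kappa> a" if a: "a \<in> SL" and k: "k < dm" for a k
  proof -
    obtain q where q: "\<And>j. j < dm \<Longrightarrow> q j \<in> polynomial_functions mat_coords"
      "\<And>j g. j < dm \<Longrightarrow> g \<in> SL \<Longrightarrow> contragredient \<rho>m g k j = q j g"
      using rep_polynomial[OF rational_rep_contragredient[OF Rm] k] by metis
    have "\<forall>j. \<exists>w. w \<in> polynomial_functions mat_coords \<and>
        (\<forall>g\<in>SL. pairing {..<ds} \<xi>s (mat_act {..<ds} (\<rho>s g) (Y j)) = w g)"
      using matrix_coefficient_polynomial[OF Rs] by blast
    from choice[OF this] obtain w where w: "\<And>j. w j \<in> polynomial_functions mat_coords"
      "\<And>j g. g \<in> SL \<Longrightarrow> pairing {..<ds} \<xi>s (mat_act {..<ds} (\<rho>s g) (Y j)) = w j g"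
      by blast
    have \<Psi>q: "\<Psi> g k = (\<Sum>j<dm. q j g * w j g)" if "g \<in> SL" for g
      unfolding \<Psi>_def twist_def pairing_sum pairing_scale w(2)[OF that]
      by (intro sum.cong HOL.refl) (use that q(2) in \<open>auto simp: contragredient_def\<close>)
    have "(\<Sum>j<dm. q j a * w j a) - c0 * \<xi>m k * minors p \<kappa> a = 0"
    proof (rule big_cell_identity[OF p _ _ a, where f = "\<lambda>a. (\<Sum>j<dm. q j a * w j a) - c0 * \<xi>m k * minors p \<kappa> a"])
      show "(\<lambda>a. (\<Sum>j<dm. q j a * w j a) - c0 * \<xi>m k * minors p \<kappa> a) \<in> polynomial_functions mat_coords"
        by (intro polynomial_functions_diff polynomial_functions_sum polynomial_functions.mult
            polynomial_functions_cmult minors_polynomial) (auto intro: q w)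
      fix n b assume nb: "n \<in> unip down p" "b \<in> borel_grp up p"
      then have S: "n \<in> SL" "b \<in> SL" using unip_borel borel_SL by blast+
      have nd: "matrix_inv n \<in> borel_grp down p" by (rule borel_inverse[OF p inj_down unip_borel[OF nb(1)]])
      have wn: "wt p \<nu> (matrix_inv n) = 1" for \<nu>
        using wt_inverse[OF p inj_down unip_borel[OF nb(1)], of \<nu>] wt_unip[OF p inj_down nb(1)] by simp
      have \<Theta>b: "?\<Theta> (n ** b) k = (\<lambda>i. wt p \<kappa> b * ?\<Theta> n k i)"
      proof -
        have "?\<Theta> (n ** b) k = (\<lambda>i. \<Sum>l<dm. \<rho>m (matrix_inv n) l k *
            mat_act {..<ds} (\<rho>s n) (\<lambda>i. wt p \<kappa> b * Y l i) i)"
          unfolding twist_mult[OF Rm Rs Y S k] by (intro ext sum.cong HOL.refl) (simp add: eqv[OF nb(2)])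
        then show ?thesis unfolding mat_act_scale
          by (simp add: twist_def[of _ _ _ _ _ n] sum_distrib_left mult_ac)
      qed
      have "\<Psi> n k = pairing {..<ds} \<xi>s (mat_act {..<ds} (\<rho>s (matrix_inv n)) (?\<Theta> n k))"
        unfolding \<xi>sb[OF nd \<Theta>c] wn by (simp add: \<Psi>_def)
      also have "\<dots> = (\<Sum>l<dm. \<rho>m (matrix_inv n) l k * pairing {..<ds} \<xi>s (?\<Theta> (matrix_inv n ** n) l))"
        unfolding \<Theta>left[OF S(1) S(1) k] pairing_sum pairing_scale ..
      also have "\<dots> = (\<Sum>l<dm. \<rho>m (matrix_inv n) l k * \<kappa>0 l)"
        by (intro sum.cong HOL.refl) (simp add: SL_inv[OF S(1)] twist_one[OF Rm Rs Y] \<kappa>0_def)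
      also have "\<dots> = c0 * pairing {..<dm} \<xi>m (mat_act {..<dm} (\<rho>m (matrix_inv n)) (unit_vec k))"
        using k by (simp add: \<kappa>0 pairing_mat_act unit_vec_def sum_distrib_left if_distrib[of "\<lambda>x. _ * x"] mult_ac cong: if_cong)
      also have "\<dots> = c0 * \<xi>m k"
        unfolding \<xi>mb[OF nd unit_vec_cspace[OF k]] wn by (simp add: pairing_unit_vec k)
      finally have "\<Psi> (n ** b) k = wt p \<kappa> b * (c0 * \<xi>m k)"
        unfolding \<Psi>_def \<Theta>b pairing_scale by simp
      then show "(\<Sum>j<dm. q j (n ** b) * w j (n ** b)) - c0 * \<xi>m k * minors p \<kappa> (n ** b) = 0"
        using \<Psi>q[OF SL_mult[OF S]] by (simp add: minors_cell[OF p nb])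
    qed
    then show ?thesis using \<Psi>q[OF a] by simp
  qed
  show ?thesis
  proof (intro exI[of _ "c0 / kl"] ballI allI impI)
    fix h a :: "'n cmat" and k assume h: "h \<in> SL" and a: "a \<in> SL" and k: "k < dm"
    have ha: "matrix_inv h ** a \<in> SL" using h a by simp
    have "pairing {..<ds} (mat_act {..<ds} (contragredient \<rho>s h) \<xi>s) (?\<Theta> a k) =
        (\<Sum>l<dm. \<rho>m (matrix_inv h) l k * \<Psi> (matrix_inv h ** a) l)"
      unfolding pairing_contragredient[OF Rs h] \<Theta>left[OF h a k] pairing_sum pairing_scale \<Psi>_def ..
    also have "\<dots> = c0 * mat_act {..<dm} (contragredient \<rho>m h) \<xi>m k * minors p \<kappa> (matrix_inv h ** a)"
      using k by (simp add: \<Psi>[OF ha] mat_act_in contragredient_def sum_distrib_left sum_distrib_right mult_ac)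
    also have "minors p \<kappa> (matrix_inv h ** a) =
        pairing {..<dl} (mat_act {..<dl} (contragredient \<rho>l h) \<xi>l) (mat_act {..<dl} (\<rho>l a) vl) / kl"
      unfolding pairing_contragredient[OF Rl h]
      using \<xi>l(1)[OF ha] \<xi>l(2) h a by (simp add: act_mult[OF Rl])
    finally show "pairing {..<ds} (mat_act {..<ds} (contragredient \<rho>s h) \<xi>s) (?\<Theta> a k) =
      c0 / kl * mat_act {..<dm} (contragredient \<rho>m h) \<xi>m k *
      pairing {..<dl} (mat_act {..<dl} (contragredient \<rho>l h) \<xi>l) (mat_act {..<dl} (\<rho>l a) vl)" by simp
  qed
qed

subsection \<open>Symmetric tensors as polynomials\<close>

definition lprod :: "complex^'n::finite \<Rightarrow> 'n list \<Rightarrow> complex" where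
  "lprod \<gamma> xs = prod_list (map (\<lambda>k. \<gamma> $ k) xs)"

definition dotp :: "complex^'n::finite \<Rightarrow> complex^'n \<Rightarrow> complex" where
  "dotp \<eta> x = (\<Sum>k\<in>UNIV. \<eta> $ k * x $ k)"

text \<open>The homogeneous polynomial of a tensor, obtained by inserting the same vector into all
  \<open>l\<close> slots.\<close>

definition tpoly :: "nat \<Rightarrow> ('n::finite list \<Rightarrow> complex) \<Rightarrow> complex^'n \<Rightarrow> complex" where
  "tpoly l W \<gamma> = (\<Sum>xs | length xs = l. W xs * lprod \<gamma> xs)"

definition symmetric_coeffs :: "('n list \<Rightarrow> complex) \<Rightarrow> bool" where
  "symmetric_coeffs W \<longleftrightarrow> (\<forall>xs ys. mset xs = mset ys \<longrightarrow> W xs = W ys)"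

lemma lprod_simps [simp]: "lprod \<gamma> [] = 1" "lprod \<gamma> (a # xs) = \<gamma> $ a * lprod \<gamma> xs"
  by (simp_all add: lprod_def)

lemma lprod_scale: "lprod (c *s \<gamma>) xs = c ^ length xs * lprod \<gamma> xs"
  by (induction xs) (simp_all add: mult_ac)

lemma lprod_mset: "mset xs = mset ys \<Longrightarrow> lprod \<gamma> xs = lprod \<gamma> ys"
  unfolding lprod_def by (metis mset_map prod_mset_prod_list)

lemma finite_lists [simp]: "finite {xs :: 'n::finite list. length xs = l}"
  using finite_lists_length_eq[of "UNIV :: 'n set" l] by simp

lemma sum_lists_Suc:
  "(\<Sum>xs | length xs = Suc l. f xs) = (\<Sum>a\<in>UNIV. \<Sum>xs | length xs = l. f ((a::'n::finite) # xs))"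
proof -
  have "{xs :: 'n list. length xs = Suc l} = (\<lambda>(a, xs). a # xs) ` (UNIV \<times> {xs. length xs = l})"
    by (auto simp: length_Suc_conv image_iff)
  then have "(\<Sum>xs | length xs = Suc l. f xs) = (\<Sum>(a, xs)\<in>UNIV \<times> {xs. length xs = l}. f (a # xs))"
    by (simp add: sum.reindex inj_on_def case_prod_unfold)
  then show ?thesis by (simp add: sum.cartesian_product)
qed

lemma tpoly_0 [simp]: "tpoly 0 W \<gamma> = W []"
proof -
  have "{xs :: 'n list. length xs = 0} = {[]}" by auto
  then show ?thesis by (simp add: tpoly_def)
qed

lemma tpoly_Suc: "tpoly (Suc l) W \<gamma> = (\<Sum>a\<in>UNIV. \<gamma> $ a * tpoly l (\<lambda>zs. W (a # zs)) \<gamma>)"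
  unfolding tpoly_def sum_lists_Suc by (simp add: sum_distrib_left mult_ac)

lemma tpoly_scale: "tpoly l W (c *s \<gamma>) = c ^ l * tpoly l W \<gamma>"
  by (simp add: tpoly_def lprod_scale sum_distrib_left mult_ac)

lemma tpoly_power: "tpoly l (lprod \<eta>) x = dotp \<eta> x ^ l"
proof (induction l)
  case (Suc l)
  have "tpoly l (\<lambda>zs. lprod \<eta> (a # zs)) x = \<eta> $ a * tpoly l (lprod \<eta>) x" for a
    by (simp add: tpoly_def sum_distrib_left mult_ac)
  then show ?case by (simp add: tpoly_Suc Suc dotp_def sum_distrib_right mult_ac)
qed simp

lemma tpoly_polynomial: "tpoly l W \<in> polynomial_functions vec_coords"
  unfolding tpoly_def[abs_def] lprod_def
  by (intro polynomial_functions_sum polynomial_functions_cmult polynomial_functions_prod_list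
      polynomial_functions.coord) (auto simp: vec_coords_def)

lemma symmetric_coeffs_Cons: "symmetric_coeffs W \<Longrightarrow> symmetric_coeffs (\<lambda>zs. W (a # zs))"
  by (simp add: symmetric_coeffs_def)

text \<open>Symmetry lets the differentiated slot be moved to the front, so each of the
  \<open>Suc l\<close> slots contributes equally; the induction splits off the first slot.\<close>

lemma tpoly_has_derivative:
  assumes "symmetric_coeffs W"
  shows "((\<lambda>z. tpoly (Suc l) W (x + axis k z)) has_field_derivative
    of_nat (Suc l) * tpoly l (\<lambda>zs. W (k # zs)) (x + axis k z)) (at z)"
  using assms
proof (induction l arbitrary: W)
  case 0
  have "(\<Sum>a\<in>UNIV. (if a = k then 1 else 0) * W [a]) = W [k]"
    by (simp add: if_distrib[of "\<lambda>x. x * _"] cong: if_cong)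
  moreover have "((\<lambda>z. \<Sum>a\<in>UNIV. (x + axis k z) $ a * W [a]) has_field_derivative
      (\<Sum>a\<in>UNIV. (if a = k then 1 else 0) * W [a])) (at z)"
  proof (intro DERIV_sum DERIV_cmult_right)
    fix a
    show "((\<lambda>z. (x + axis k z) $ a) has_field_derivative (if a = k then 1 else 0)) (at z)"
      by (cases "a = k") (auto simp: axis_def intro!: derivative_eq_intros)
  qed
  ultimately show ?case by (simp add: tpoly_Suc)
next
  case (Suc l)
  let ?y = "x + axis k z"
  have e: "((\<lambda>z. (x + axis k z) $ a) has_field_derivative (if a = k then 1 else 0)) (at z)" for a
    by (cases "a = k") (auto simp: axis_def intro!: derivative_eq_intros)
  have IH: "((\<lambda>z. tpoly (Suc l) (\<lambda>zs. W (a # zs)) (x + axis k z)) has_field_derivative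
      of_nat (Suc l) * tpoly l (\<lambda>zs. W (k # a # zs)) ?y) (at z)" for a
  proof -
    have "W (a # k # zs) = W (k # a # zs)" for zs
      using Suc.prems by (auto simp: symmetric_coeffs_def)
    then show ?thesis using Suc.IH[OF symmetric_coeffs_Cons[OF Suc.prems, of a]] by simp
  qed
  have "((\<lambda>z. \<Sum>a\<in>UNIV. (x + axis k z) $ a * tpoly (Suc l) (\<lambda>zs. W (a # zs)) (x + axis k z)) has_field_derivative
      (\<Sum>a\<in>UNIV. (if a = k then 1 else 0) * tpoly (Suc l) (\<lambda>zs. W (a # zs)) ?y +
        (of_nat (Suc l) * tpoly l (\<lambda>zs. W (k # a # zs)) ?y) * ?y $ a)) (at z)"
    by (intro DERIV_sum DERIV_mult e IH)
  moreover have "(\<Sum>a\<in>UNIV. (if a = k then 1 else 0) * tpoly (Suc l) (\<lambda>zs. W (a # zs)) ?y +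
        (of_nat (Suc l) * tpoly l (\<lambda>zs. W (k # a # zs)) ?y) * ?y $ a) =
      of_nat (Suc (Suc l)) * tpoly (Suc l) (\<lambda>zs. W (k # zs)) ?y"
  proof -
    have "(\<Sum>a\<in>UNIV. (if a = k then 1 else 0) * tpoly (Suc l) (\<lambda>zs. W (a # zs)) ?y) =
        tpoly (Suc l) (\<lambda>zs. W (k # zs)) ?y"
      by (simp add: if_distrib[of "\<lambda>x. x * _"] cong: if_cong)
    moreover have "(\<Sum>a\<in>UNIV. (of_nat (Suc l) * tpoly l (\<lambda>zs. W (k # a # zs)) ?y) * ?y $ a) =
        of_nat (Suc l) * tpoly (Suc l) (\<lambda>zs. W (k # zs)) ?y"
      by (simp add: tpoly_Suc[of l] sum_distrib_left mult_ac del: of_nat_Suc)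
    ultimately show ?thesis by (simp add: sum.distrib algebra_simps)
  qed
  ultimately show ?case by (simp only: tpoly_Suc[of "Suc l" W])
qed

lemma partial_deriv_tpoly:
  assumes "symmetric_coeffs W"
  shows "partial_deriv k (\<lambda>x. c * tpoly (Suc l) W x) = (\<lambda>x. c * of_nat (Suc l) * tpoly l (\<lambda>zs. W (k # zs)) x)"
proof
  fix x
  have "((\<lambda>z. c * tpoly (Suc l) W (x + axis k z)) has_field_derivative
    c * (of_nat (Suc l) * tpoly l (\<lambda>zs. W (k # zs)) (x + axis k 0))) (at 0)"
    by (intro DERIV_cmult tpoly_has_derivative assms)
  moreover have "axis k 0 = (0 :: complex^'a)" by (simp add: axis_def vec_eq_iff)
  ultimately show "partial_deriv k (\<lambda>x. c * tpoly (Suc l) W x) x = c * of_nat (Suc l) * tpoly l (\<lambda>zs. W (k # zs)) x"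
    unfolding partial_deriv_def by (simp add: DERIV_imp_deriv mult.assoc)
qed

lemma iterated_partial_deriv_tpoly:
  assumes "symmetric_coeffs W"
  shows "foldr partial_deriv xs (\<lambda>x. c * tpoly (length xs + l) W x) =
    (\<lambda>x. c * (fact (length xs + l) / fact l) * tpoly l (\<lambda>zs. W (xs @ zs)) x)"
proof (induction xs arbitrary: l)
  case (Cons a xs)
  have sym: "symmetric_coeffs (\<lambda>zs. W (xs @ zs))" using assms by (simp add: symmetric_coeffs_def)
  have "W (xs @ a # zs) = W ((a # xs) @ zs)" for zs
    using assms by (auto simp: symmetric_coeffs_def)
  then have W: "(\<lambda>zs. W (xs @ a # zs)) = (\<lambda>zs. W ((a # xs) @ zs))" by blast
  have "foldr partial_deriv (a # xs) (\<lambda>x. c * tpoly (length (a # xs) + l) W x) =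
      partial_deriv a (foldr partial_deriv xs (\<lambda>x. c * tpoly (length xs + Suc l) W x))" by simp
  also have "\<dots> = (\<lambda>x. c * (fact (length xs + Suc l) / fact (Suc l)) * of_nat (Suc l) * tpoly l (\<lambda>zs. W (xs @ a # zs)) x)"
    unfolding Cons.IH partial_deriv_tpoly[OF sym] ..
  also have "\<dots> = (\<lambda>x. c * (fact (length (a # xs) + l) / fact l) * tpoly l (\<lambda>zs. W ((a # xs) @ zs)) x)"
    unfolding W by (simp add: field_simps del: of_nat_Suc)
  finally show ?case .
qed simp

text \<open>Differentiating once for every entry of \<open>xs\<close> recovers the coefficient at
  \<open>xs\<close> up to the factor \<open>fact l\<close>.\<close>

lemma tpoly_eq_0_iff:
  assumes W: "symmetric_coeffs W" and zero: "\<And>x. tpoly l W x = 0" and xs: "length xs = l"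
  shows "W xs = 0"
proof -
  have "foldr partial_deriv ys (\<lambda>_ :: complex^'a. 0) = (\<lambda>_. 0)" for ys
    by (induction ys) (simp_all add: partial_deriv_def)
  moreover have "(\<lambda>x. 1 * tpoly (length xs + 0) W x) = (\<lambda>_. 0)" using zero xs by simp
  ultimately have "(\<lambda>x. 1 * (fact (length xs + 0) / fact 0) * tpoly 0 (\<lambda>zs. W (xs @ zs)) (x :: complex^'a)) = (\<lambda>_. 0)"
    using iterated_partial_deriv_tpoly[OF W, of xs 1 0] by simp
  then have "fact (length xs) * W xs = 0" by (simp add: fun_eq_iff)
  then show ?thesis by simp
qed

subsection \<open>Transitivity on nonzero vectors and sections of \<open>O(l)\<close>\<close>

text \<open>A linear map between frames through \<open>e\<close> and \<open>x\<close> has some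
  nonzero determinant, which is corrected by rescaling a second frame vector; dimension at least 2
  supplies that vector.\<close>

lemma SL_transitive:
  fixes e x :: "complex^'n::finite"
  assumes n: "CARD('n) \<ge> 2" and e: "e \<noteq> 0" and x: "x \<noteq> 0"
  shows "\<exists>g\<in>SL. g *v e = x"
proof -
  fix k :: 'n
  obtain p where p: "invertible p" "p *v axis k 1 = e" using frame_with_vector[OF e] by blast
  obtain q where q: "invertible q" "q *v axis k 1 = x" using frame_with_vector[OF x] by blast
  obtain b where b: "b \<noteq> k"
  proof (rule ccontr)
    assume "\<not> thesis"
    then have "(UNIV :: 'n set) = {k}" using that by auto
    then have "CARD('n) = card {k}" by simp
    then show False using n by simp
  qed
  define d where "d j = (if j = b then det p / det q else 1)" for j
  have "(\<Prod>j\<in>UNIV. d j) = (\<Prod>j\<in>{b}. d j)" by (rule prod.mono_neutral_right) (auto simp: d_def)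
  then have "det (dmat d) = det p / det q" by (simp add: det_dmat d_def)
  moreover have "det q \<noteq> 0" using q(1) by (simp add: invertible_det_nz)
  ultimately have "det (q ** dmat d ** matrix_inv p) = 1"
    using det_matrix_inv[OF p(1)] by (simp add: det_mul mult.commute)
  moreover have "(q ** dmat d ** matrix_inv p) *v e = x"
  proof -
    have "dmat d *v axis k 1 = axis k 1" using b by (auto simp: vec_eq_iff mv_dmat axis_def d_def)
    then show ?thesis
      by (simp add: p(2)[symmetric] matrix_vector_mul_assoc[symmetric] mv_inverse[OF p(1)] q(2))
  qed
  ultimately show ?thesis by (auto simp: SL_def)
qed

lemma polynomial_zero_at_origin:
  assumes q: "q \<in> polynomial_functions vec_coords" and zero: "\<And>x. x \<noteq> 0 \<Longrightarrow> q x = 0"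
  shows "q (x :: complex^'n::finite) = 0"
proof (cases "x = 0")
  case True
  fix k :: 'n
  have "continuous_on UNIV q"
    by (rule polynomial_functions_continuous[OF q]) (auto simp: vec_coords_def intro!: continuous_intros)
  moreover have "((\<lambda>t. axis k (of_real t)) \<longlongrightarrow> (0 :: complex^'n)) (at_right 0)"
  proof (rule vec_tendstoI)
    fix i
    have "((\<lambda>t. of_real t :: complex) \<longlongrightarrow> of_real 0) (at_right 0)" by (intro tendsto_intros)
    then show "((\<lambda>t. axis k (of_real t) $ i) \<longlongrightarrow> (0 :: complex^'n) $ i) (at_right 0)"
      by (cases "i = k") (simp_all add: axis_def)
  qed
  ultimately have "((\<lambda>t. q (axis k (of_real t))) \<longlongrightarrow> q 0) (at_right 0)"
    by (intro isCont_tendsto_compose[where g = q]) (simp_all add: continuous_on_eq_continuous_at)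
  moreover have "\<forall>\<^sub>F t in at_right 0. q (axis k (of_real t)) = 0"
    unfolding eventually_at_right_field
    by (intro exI[of _ 1]) (auto intro!: zero simp: axis_eq_0_iff)
  ultimately have "((\<lambda>t::real. 0) \<longlongrightarrow> q 0) (at_right 0)"
    using Lim_transform_eventually by fastforce
  then have "q 0 = 0" using tendsto_unique[OF _ tendsto_const] by (metis trivial_limit_at_right_real)
  then show ?thesis using True by simp
qed (use zero in simp)

text \<open>The nonzero vectors form one orbit and the origin follows by continuity, so the
  description in \<open>section_poly\<close> has a unique solution.\<close>

lemma section_poly_eq:
  fixes e :: "complex^'n::finite"
  assumes n: "CARD('n) \<ge> 2" and e: "e \<noteq> 0" and q: "q \<in> polynomial_functions vec_coords"
    and \<phi>: "\<And>g. g \<in> SL \<Longrightarrow> \<phi> g = q (g *v e)"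
  shows "section_poly e \<phi> = q"
  unfolding section_poly_def
proof (rule the_equality)
  fix q' assume q': "q' \<in> polynomial_functions vec_coords \<and> (\<forall>g\<in>SL. \<phi> g = q' (g *v e))"
  have "q' x - q x = 0" for x
  proof (rule polynomial_zero_at_origin[where q = "\<lambda>x. q' x - q x"])
    show "(\<lambda>x. q' x - q x) \<in> polynomial_functions vec_coords"
      using q q' by (intro polynomial_functions_diff) auto
    fix x :: "complex^'n" assume "x \<noteq> 0"
    then obtain g where "g \<in> SL" "g *v e = x" using SL_transitive[OF n e] by blast
    then show "q' x - q x = 0" using q' \<phi> by force
  qed
  then show "q' = q" by (auto simp: fun_eq_iff)
qed (use q \<phi> in blast)

lemma proj_operator_tpoly:
  fixes e :: "complex^'n::finite"
  assumes n: "CARD('n) \<ge> 2" and e: "e \<noteq> 0" and W: "symmetric_coeffs W"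
  shows "proj_operator e m u (\<lambda>c. tpoly (m + l) W (c *v (\<tau> *s e))) g =
    (\<Sum>xs | length xs = m. u xs * (\<tau> ^ (m + l) * (fact (m + l) / fact l) * tpoly l (\<lambda>zs. W (xs @ zs)) (g *v e)))"
proof -
  have "section_poly e (\<lambda>c. tpoly (m + l) W (c *v (\<tau> *s e))) = (\<lambda>x. \<tau> ^ (m + l) * tpoly (m + l) W x)"
    by (rule section_poly_eq[OF n e]) (auto simp: mv_scale tpoly_scale intro: polynomial_functions_cmult tpoly_polynomial)
  moreover have "foldr partial_deriv xs (\<lambda>x. \<tau> ^ (m + l) * tpoly (m + l) W x) (g *v e) =
    \<tau> ^ (m + l) * (fact (m + l) / fact l) * tpoly l (\<lambda>zs. W (xs @ zs)) (g *v e)" if "length xs = m" for xs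
    using iterated_partial_deriv_tpoly[OF W, of xs "\<tau> ^ (m + l)" l] that by simp
  ultimately show ?thesis unfolding proj_operator_def by simp
qed

subsection \<open>The triple tensor product\<close>

lemma V_pairing_sum:
  "V_pairing d (l1, l2, l) w t = (\<Sum>i<d l1. \<Sum>j<d l2. \<Sum>xs | length xs = l. w (i, j, xs) * t (i, j, xs :: 'n::finite list))"
  by (simp add: V_pairing_def pairing_def idx_def sum.cartesian_product')

lemma V_pairing_commute: "V_pairing d lam w t = V_pairing d lam t w"
  by (simp add: V_pairing_def pairing_def mult.commute)

lemma V_pairing_linear:
  "V_pairing d lam (\<lambda>I. \<Sum>j\<in>J. a j * f j I) t = (\<Sum>j\<in>J. a j * V_pairing d lam (f j) t)"
  "V_pairing d lam t (\<lambda>I. \<Sum>j\<in>J. a j * f j I) = (\<Sum>j\<in>J. a j * V_pairing d lam t (f j))"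
  by (simp_all add: V_pairing_def pairing_sum pairing_scale)

lemma V_pairing_pure:
  "V_pairing d (l1, l2, l) w (pure_tensor l \<alpha> \<beta> \<gamma>) =
    (\<Sum>i<d l1. \<Sum>j<d l2. \<Sum>xs | length xs = l. w (i, j, xs) * (\<alpha> i * \<beta> j * lprod \<gamma> xs))"
  unfolding V_pairing_sum by (intro sum.cong HOL.refl) (simp add: pure_tensor_def lprod_def)

lemma sum3_product:
  fixes A :: "'i \<Rightarrow> complex"
  shows "(\<Sum>i\<in>I. \<Sum>j\<in>J. \<Sum>x\<in>X. A i * (B j * C x)) = (\<Sum>i\<in>I. A i) * ((\<Sum>j\<in>J. B j) * (\<Sum>x\<in>X. C x))"
  by (simp add: sum_distrib_left[symmetric] sum_distrib_right[symmetric])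

lemma V_pairing_pure_pure:
  "V_pairing d (l1, l2, l) (pure_tensor l \<xi>1 \<xi>2 \<eta>) (pure_tensor l \<alpha> \<beta> \<gamma>) =
    pairing {..<d l1} \<xi>1 \<alpha> * pairing {..<d l2} \<xi>2 \<beta> * dotp \<eta> \<gamma> ^ l"
proof -
  have "V_pairing d (l1, l2, l) (pure_tensor l \<xi>1 \<xi>2 \<eta>) (pure_tensor l \<alpha> \<beta> \<gamma>) =
     (\<Sum>i<d l1. \<Sum>j<d l2. \<Sum>xs | length xs = l. (\<xi>1 i * \<alpha> i) * ((\<xi>2 j * \<beta> j) * (lprod \<eta> xs * lprod \<gamma> xs)))"
    unfolding V_pairing_pure by (intro sum.cong HOL.refl) (simp add: pure_tensor_def lprod_def)
  also have "\<dots> = pairing {..<d l1} \<xi>1 \<alpha> * (pairing {..<d l2} \<xi>2 \<beta> * tpoly l (lprod \<eta>) \<gamma>)"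
    unfolding sum3_product by (simp add: pairing_def tpoly_def)
  finally show ?thesis by (simp add: tpoly_power)
qed

lemma prod_matrix_lists:
  "(\<Sum>ys | length ys = length xs. (\<Prod>k<length xs. A $ (xs ! k) $ (ys ! k)) * lprod \<gamma> ys) =
    lprod ((A :: ('n::finite) cmat) *v \<gamma>) xs"
proof (induction xs)
  case Nil
  have "{ys :: 'n list. length ys = 0} = {[]}" by auto
  then show ?case by simp
next
  case (Cons x xs)
  have "(\<Sum>ys | length ys = length (x # xs). (\<Prod>k<length (x # xs). A $ ((x # xs) ! k) $ (ys ! k)) * lprod \<gamma> ys) =
    (\<Sum>a\<in>UNIV. \<Sum>ys | length ys = length xs. (A $ x $ a * \<gamma> $ a) * ((\<Prod>k<length xs. A $ (xs ! k) $ (ys ! k)) * lprod \<gamma> ys))"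
    unfolding length_Cons sum_lists_Suc
    by (intro sum.cong HOL.refl) (simp add: prod.lessThan_Suc_shift mult_ac del: prod.lessThan_Suc)
  also have "\<dots> = (\<Sum>a\<in>UNIV. A $ x $ a * \<gamma> $ a) * lprod (A *v \<gamma>) xs"
    by (simp add: Cons.IH sum_distrib_left[symmetric] sum_distrib_right)
  finally show ?case by (simp add: mv_entry)
qed

lemma kron_act_pure:
  "mat_act (idx d (l1, l2, l)) (kron A1 A2 A3) (pure_tensor l \<alpha> \<beta> \<gamma>) =
    pure_tensor l (mat_act {..<d l1} A1 \<alpha>) (mat_act {..<d l2} A2 \<beta>) (A3 *v \<gamma>)"
proof
  fix I :: "nat \<times> nat \<times> 'a list"
  obtain i j xs where I: "I = (i, j, xs)" by (metis prod_cases3)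
  show "mat_act (idx d (l1, l2, l)) (kron A1 A2 A3) (pure_tensor l \<alpha> \<beta> \<gamma>) I =
    pure_tensor l (mat_act {..<d l1} A1 \<alpha>) (mat_act {..<d l2} A2 \<beta>) (A3 *v \<gamma>) I"
  proof (cases "I \<in> idx d (l1, l2, l)")
    case True
    then have ij: "i < d l1" "j < d l2" "length xs = l" by (auto simp: I idx_def)
    have "mat_act (idx d (l1, l2, l)) (kron A1 A2 A3) (pure_tensor l \<alpha> \<beta> \<gamma>) I =
        V_pairing d (l1, l2, l) (kron A1 A2 A3 I) (pure_tensor l \<alpha> \<beta> \<gamma>)"
      using True by (simp add: mat_act_in V_pairing_def pairing_def)
    also have "\<dots> = (\<Sum>i'<d l1. \<Sum>j'<d l2. \<Sum>ys | length ys = l. (A1 i i' * \<alpha> i') *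
        ((A2 j j' * \<beta> j') * ((\<Prod>k<length xs. A3 $ (xs ! k) $ (ys ! k)) * lprod \<gamma> ys)))"
      unfolding V_pairing_pure by (intro sum.cong HOL.refl) (simp add: I kron_def)
    also have "\<dots> = (\<Sum>i'<d l1. A1 i i' * \<alpha> i') * ((\<Sum>j'<d l2. A2 j j' * \<beta> j') *
        (\<Sum>ys | length ys = l. (\<Prod>k<length xs. A3 $ (xs ! k) $ (ys ! k)) * lprod \<gamma> ys))"
      by (rule sum3_product)
    also have "\<dots> = pure_tensor l (mat_act {..<d l1} A1 \<alpha>) (mat_act {..<d l2} A2 \<beta>) (A3 *v \<gamma>) I"
      using ij prod_matrix_lists[where xs = xs and A = A3 and \<gamma> = \<gamma>] by (simp add: I pure_tensor_def mat_act_in lprod_def)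
    finally show ?thesis .
  next
    case False
    then show ?thesis by (auto simp: I idx_def mat_act_def pure_tensor_def)
  qed
qed

lemma V_act_pure:
  "V_act d \<rho> (l1, l2, l) (g1, g2, g3) (pure_tensor l \<alpha> \<beta> \<gamma>) =
    pure_tensor l (mat_act {..<d l1} (\<rho> l1 g1) \<alpha>) (mat_act {..<d l2} (\<rho> l2 g2) \<beta>) (g3 *v \<gamma>)"
  by (simp add: V_act_def kron_act_pure)

lemma V_coact_pure:
  "V_coact d \<rho> (l1, l2, l) (g1, g2, g3) (pure_tensor l \<alpha> \<beta> \<gamma>) =
    pure_tensor l (mat_act {..<d l1} (contragredient (\<rho> l1) g1) \<alpha>)
      (mat_act {..<d l2} (contragredient (\<rho> l2) g2) \<beta>) (transpose (matrix_inv g3) *v \<gamma>)"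
  unfolding V_coact_def by (simp add: kron_act_pure del: transpose_matrix_vector)

definition inv3 :: "('n::finite) cmat \<times> 'n cmat \<times> 'n cmat \<Rightarrow> 'n cmat \<times> 'n cmat \<times> 'n cmat" where
  "inv3 = (\<lambda>(a, b, c). (matrix_inv a, matrix_inv b, matrix_inv c))"

definition mult3 :: "('n::finite) cmat \<times> 'n cmat \<times> 'n cmat \<Rightarrow> 'n cmat \<times> 'n cmat \<times> 'n cmat \<Rightarrow> 'n cmat \<times> 'n cmat \<times> 'n cmat" where
  "mult3 = (\<lambda>(a, b, c) (a', b', c'). (a ** a', b ** b', c ** c'))"

lemma inv3_G3: "g \<in> G3 \<Longrightarrow> inv3 g \<in> G3" by (auto simp: G3_def inv3_def)
lemma mult3_G3: "g \<in> G3 \<Longrightarrow> h \<in> G3 \<Longrightarrow> mult3 g h \<in> G3" by (auto simp: G3_def mult3_def)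
lemma one_G3: "(mat 1, mat 1, mat 1) \<in> G3" by (simp add: G3_def)

lemma kron_transpose:
  assumes "I \<in> idx d lam" "J \<in> idx d lam"
  shows "kron (\<lambda>i j. A1 j i) (\<lambda>i j. A2 j i) (transpose A3) J I = kron A1 A2 A3 I J"
  using assms by (auto simp: kron_def idx_def transpose_def split: prod.splits)

lemma V_pairing_V_act_transpose:
  "V_pairing d (l1, l2, l) (V_act d \<rho> (l1, l2, l) (g1, g2, g3) t) w =
    V_pairing d (l1, l2, l) t (mat_act (idx d (l1, l2, l))
      (kron (\<lambda>i j. \<rho> l1 g1 j i) (\<lambda>i j. \<rho> l2 g2 j i) (transpose g3)) w)"
  unfolding V_pairing_commute[of _ _ _ w] V_pairing_commute[of _ _ t] unfolding V_pairing_def V_act_def prod.case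
  by (rule pairing_mat_act_transpose) (rule kron_transpose)

lemma V_pairing_V_coact:
  assumes "g \<in> G3"
  shows "V_pairing d lam (V_coact d \<rho> lam g w) t = V_pairing d lam w (V_act d \<rho> lam (inv3 g) t)"
proof -
  obtain l1 l2 l where lam: "lam = (l1, l2, l)" by (metis prod_cases3)
  obtain g1 g2 g3 where g: "g = (g1, g2, g3)" by (metis prod_cases3)
  have "contragredient (\<rho> l1) g1 = (\<lambda>i j. \<rho> l1 (matrix_inv g1) j i)"
    "contragredient (\<rho> l2) g2 = (\<lambda>i j. \<rho> l2 (matrix_inv g2) j i)"
    by (auto simp: contragredient_def)
  then have "V_pairing d lam w (V_act d \<rho> lam (inv3 g) t) =
      V_pairing d lam t (V_coact d \<rho> lam g w)"
    unfolding lam g inv3_def prod.case V_pairing_commute[of _ _ w] V_pairing_V_act_transpose V_coact_def by simp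
  then show ?thesis by (simp add: V_pairing_commute)
qed

subsection \<open>The operator on matrix coefficients\<close>

lemma on_flag_operator_coefficient:
  assumes R: "rational_rep ds \<rho>s" and i: "i < dm" and b: "b \<in> SL"
    and \<psi>: "\<And>b. b \<in> SL \<Longrightarrow> \<psi> b = pairing {..<ds} \<omega> (mat_act {..<ds} (\<rho>s b) v)"
  shows "flag_operator dm \<rho>m y (unit_vec i) \<psi> b =
    pairing {..<ds} \<omega> (twist dm \<rho>m ds \<rho>s (\<lambda>j. Uact ds \<rho>s (y j) v) b i)"
proof -
  have "mat_act {..<dm} (\<rho>m (matrix_inv b)) (unit_vec i) j = \<rho>m (matrix_inv b) j i" if "j < dm" for j
    using that i by (simp add: mat_act_in unit_vec_def if_distrib[of "\<lambda>x. _ * x"] cong: if_cong)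
  then show ?thesis
    unfolding flag_operator_def twist_def pairing_sum pairing_scale
    by (intro sum.cong HOL.refl) (simp add: R_op_matrix_coefficient[OF R \<psi> b])
qed

text \<open>The flag factors act by twisting their vectors, and the projective factor splits the
  \<open>m + l\<close> symmetric slots into \<open>m\<close> contracted with \<open>u\<close> and
  \<open>l\<close> that stay. The quotient of factorials comes from differentiation; the power of
  \<tau> arises because the section is built on \<open>\<tau> *s e\<close> and the operator on
  \<open>e\<close>.\<close>

lemma V_operator_coefficient:
  fixes e :: "complex^'n::finite" and \<mu>1 \<mu>2 s1 s2 :: weight
  assumes n: "CARD('n) \<ge> 2" and e: "e \<noteq> 0"
    and R1: "rational_rep (d s1) (\<rho> s1)" and R2: "rational_rep (d s2) (\<rho> s2)"
    and w: "w \<in> V_space d (s1, s2, m + l)"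
    and g: "a \<in> SL" "b \<in> SL" "c \<in> SL"
  shows "V_operator d \<rho> p1 p2 e (\<mu>1, \<mu>2, m) u
      (V_section d \<rho> (s1, s2, m + l) w (pure_tensor (m + l) v1 v2 (\<tau> *s e))) (a, b, c) =
    (\<Sum>i<d \<mu>1. \<Sum>j<d \<mu>2. \<Sum>xs | length xs = m. u (i, j, xs) *
      (\<tau> ^ (m + l) * (fact (m + l) / fact l) *
        (\<Sum>i'<d s1. \<Sum>j'<d s2. \<Sum>zs | length zs = l. w (i', j', xs @ zs) *
          (twist (d \<mu>1) (\<rho> \<mu>1) (d s1) (\<rho> s1) (\<lambda>k. Uact (d s1) (\<rho> s1) (p1 k) v1) a i i' *
           twist (d \<mu>2) (\<rho> \<mu>2) (d s2) (\<rho> s2) (\<lambda>k. Uact (d s2) (\<rho> s2) (p2 k) v2) b j j' *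
           lprod (c *v e) zs))))"
proof -
  let ?\<phi> = "V_section d \<rho> (s1, s2, m + l) w (pure_tensor (m + l) v1 v2 (\<tau> *s e))"
  let ?K = "\<tau> ^ (m + l) * (fact (m + l) / fact l) :: complex"
  let ?A = "\<lambda>a. mat_act {..<d s1} (\<rho> s1 a) v1" and ?B = "\<lambda>b. mat_act {..<d s2} (\<rho> s2 b) v2"
  let ?T1 = "\<lambda>a i. twist (d \<mu>1) (\<rho> \<mu>1) (d s1) (\<rho> s1) (\<lambda>k. Uact (d s1) (\<rho> s1) (p1 k) v1) a i"
  let ?T2 = "\<lambda>b j. twist (d \<mu>2) (\<rho> \<mu>2) (d s2) (\<rho> s2) (\<lambda>k. Uact (d s2) (\<rho> s2) (p2 k) v2) b j"
  define W where "W \<alpha> \<beta> xs = (\<Sum>i'<d s1. \<Sum>j'<d s2. w (i', j', xs) * (\<alpha> i' * \<beta> j'))" for \<alpha> \<beta> and xs :: "'n list"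
  have sym: "symmetric_coeffs (W \<alpha> \<beta>)" for \<alpha> \<beta>
    unfolding symmetric_coeffs_def W_def
  proof (intro allI impI sum.cong HOL.refl)
    fix xs ys :: "'n list" and i j assume "mset xs = mset ys"
    then have "w (i, j, xs) = w (i, j, ys)" using w unfolding V_space_def by blast
    then show "w (i, j, xs) * (\<alpha> i * \<beta> j) = w (i, j, ys) * (\<alpha> i * \<beta> j)" by simp
  qed
  have swap3: "(\<Sum>i<D1. \<Sum>j<D2. \<Sum>x\<in>X. f i j x) = (\<Sum>x\<in>X. \<Sum>i<D1. \<Sum>j<D2. f i j x)"
    for D1 D2 :: nat and X and f :: "nat \<Rightarrow> nat \<Rightarrow> 'n list \<Rightarrow> complex"
  proof -
    have "(\<Sum>i<D1. \<Sum>j<D2. \<Sum>x\<in>X. f i j x) = (\<Sum>i<D1. \<Sum>x\<in>X. \<Sum>j<D2. f i j x)"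
      by (rule sum.cong[OF HOL.refl], rule sum.swap)
    then show ?thesis using sum.swap by (rule HOL.trans)
  qed
  have \<phi>: "?\<phi> (a, b, c) = tpoly (m + l) (W (?A a) (?B b)) (c *v (\<tau> *s e))" for a b c
    unfolding V_section_def V_act_pure V_pairing_pure swap3 tpoly_def W_def
    by (intro sum.cong HOL.refl) (simp add: sum_distrib_right mult.assoc)
  define Z where "Z u c \<alpha> \<beta> = (\<Sum>xs | length xs = m. u xs * (?K * tpoly l (\<lambda>zs. W \<alpha> \<beta> (xs @ zs)) (c *v e)))" for u c \<alpha> \<beta>
  have trd: "on_trd3 (proj_operator e m u) ?\<phi> (a, b, c) = Z u c (?A a) (?B b)" for u a b c
    unfolding on_trd3_def prod.case \<phi> Z_def by (rule proj_operator_tpoly[OF n e sym])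
  define Cf where "Cf u c i' j' = (\<Sum>xs | length xs = m. u xs * (?K *
      (\<Sum>zs | length zs = l. w (i', j', xs @ zs) * lprod (c *v e) zs)))" for u c i' j'
  have Zlin: "Z u c \<alpha> \<beta> = (\<Sum>i'<d s1. \<Sum>j'<d s2. Cf u c i' j' * (\<alpha> i' * \<beta> j'))" for u c \<alpha> \<beta>
  proof -
    define S where "S i' j' xs = (\<Sum>zs | length zs = l. w (i', j', xs @ zs) * lprod (c *v e) zs)" for i' j' xs
    have "tpoly l (\<lambda>zs. W \<alpha> \<beta> (xs @ zs)) (c *v e) = (\<Sum>i'<d s1. \<Sum>j'<d s2. S i' j' xs * (\<alpha> i' * \<beta> j'))" for xs
      unfolding tpoly_def W_def S_def sum_distrib_right swap3 by (intro sum.cong HOL.refl) (simp add: mult_ac)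
    then have "Z u c \<alpha> \<beta> = (\<Sum>xs | length xs = m. \<Sum>i'<d s1. \<Sum>j'<d s2. u xs * (?K * S i' j' xs) * (\<alpha> i' * \<beta> j'))"
      unfolding Z_def by (simp add: sum_distrib_left mult.assoc)
    then show ?thesis unfolding swap3[symmetric] S_def[symmetric] Cf_def by (simp add: sum_distrib_right)
  qed
  \<comment> \<open>After the third factor has acted, the function is bilinear in the orbit vectors
    of the first two. Freezing one of these vectors exhibits it as a matrix coefficient in the
    other, which is the form needed by the next flag operator.\<close>
  define \<omega>2 where "\<omega>2 u c \<alpha> j' = (\<Sum>i'<d s1. Cf u c i' j' * \<alpha> i')" for u c \<alpha> j'
  define \<omega>1 where "\<omega>1 u c \<beta> i' = (\<Sum>j'<d s2. Cf u c i' j' * \<beta> j')" for u c \<beta> i'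
  have Z1: "Z u c \<alpha> \<beta> = pairing {..<d s1} (\<omega>1 u c \<beta>) \<alpha>" for u c \<alpha> \<beta>
    unfolding Zlin \<omega>1_def pairing_def by (simp add: sum_distrib_left sum_distrib_right mult_ac)
  have Z2: "Z u c \<alpha> \<beta> = pairing {..<d s2} (\<omega>2 u c \<alpha>) \<beta>" for u c \<alpha> \<beta>
    unfolding Zlin \<omega>2_def pairing_def
    by (subst sum.swap) (simp add: sum_distrib_left sum_distrib_right mult_ac)
  have snd: "on_snd3 (flag_operator (d \<mu>2) (\<rho> \<mu>2) p2 (unit_vec j)) (on_trd3 (proj_operator e m u) ?\<phi>) (a, b, c) =
      Z u c (?A a) (?T2 b j)" if "j < d \<mu>2" "b \<in> SL" for j u a b c
    unfolding on_snd3_def prod.case trd Z2 by (rule on_flag_operator_coefficient[OF R2 that]) (rule HOL.refl)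
  have fst: "on_fst3 (flag_operator (d \<mu>1) (\<rho> \<mu>1) p1 (unit_vec i))
      (on_snd3 (flag_operator (d \<mu>2) (\<rho> \<mu>2) p2 (unit_vec j)) (on_trd3 (proj_operator e m u) ?\<phi>)) (a, b, c) =
      Z u c (?T1 a i) (?T2 b j)" if "i < d \<mu>1" "j < d \<mu>2" "a \<in> SL" "b \<in> SL" for i j u a b c
    unfolding on_fst3_def prod.case snd[OF that(2,4)] Z1
    by (rule on_flag_operator_coefficient[OF R1 that(1,3)]) (rule HOL.refl)
  have Zexp: "Z u c \<alpha> \<beta> = (\<Sum>xs | length xs = m. u xs * (?K *
      (\<Sum>i'<d s1. \<Sum>j'<d s2. \<Sum>zs | length zs = l. w (i', j', xs @ zs) * (\<alpha> i' * \<beta> j' * lprod (c *v e) zs))))" for u c \<alpha> \<beta>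
    unfolding Z_def tpoly_def W_def swap3 sum_distrib_right by (simp only: mult.assoc)
  show ?thesis
    unfolding V_operator_def prod.case
  proof (rule sum.cong[OF HOL.refl], rule sum.cong[OF HOL.refl])
    fix i j assume "i \<in> {..<d \<mu>1}" "j \<in> {..<d \<mu>2}"
    then show "on_fst3 (flag_operator (d \<mu>1) (\<rho> \<mu>1) p1 (unit_vec i))
      (on_snd3 (flag_operator (d \<mu>2) (\<rho> \<mu>2) p2 (unit_vec j)) (on_trd3 (proj_operator e m (\<lambda>xs. u (i, j, xs))) ?\<phi>)) (a, b, c) =
      (\<Sum>xs | length xs = m. u (i, j, xs) * (?K * (\<Sum>i'<d s1. \<Sum>j'<d s2. \<Sum>zs | length zs = l.
        w (i', j', xs @ zs) * (?T1 a i i' * ?T2 b j j' * lprod (c *v e) zs))))"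
      using g by (simp only: fst Zexp lessThan_iff)
  qed
qed

subsection \<open>Separation and spanning by orbits of pure tensors\<close>

definition separating :: "nat \<Rightarrow> (nat \<Rightarrow> complex) set \<Rightarrow> bool" where
  "separating d A \<longleftrightarrow> (\<forall>x\<in>cspace {..<d}. (\<forall>\<alpha>\<in>A. pairing {..<d} x \<alpha> = 0) \<longrightarrow> x = (\<lambda>_. 0))"

lemma separating_orbit:
  assumes irr: "irreducible_rep d \<rho>" and v: "v \<in> cspace {..<d}" "v \<noteq> (\<lambda>_. 0)"
  shows "separating d {mat_act {..<d} (\<rho> g) v | g. g \<in> SL}"
  unfolding separating_def using coefficient_nondegenerate[OF irr _ v(1)] v(2) by blast

lemma pairing_commute: "pairing I w v = pairing I v w"
  by (simp add: pairing_def mult.commute)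

lemma separating_dual_orbit:
  assumes irr: "irreducible_rep d \<rho>" and v: "v \<in> cspace {..<d}" "v \<noteq> (\<lambda>_. 0)"
  shows "separating d {mat_act {..<d} (contragredient \<rho> g) v | g. g \<in> SL}"
  unfolding separating_def
proof (intro ballI impI)
  fix x assume x: "x \<in> cspace {..<d}"
    and z: "\<forall>\<alpha>\<in>{mat_act {..<d} (contragredient \<rho> g) v | g. g \<in> SL}. pairing {..<d} x \<alpha> = 0"
  note R = irreducible_rational[OF irr]
  have "pairing {..<d} v (mat_act {..<d} (\<rho> g) x) = 0" if "g \<in> SL" for g
  proof -
    have "pairing {..<d} x (mat_act {..<d} (contragredient \<rho> (matrix_inv g)) v) = 0"
      by (rule z[rule_format]) (use SL_inverse[OF that] in blast)
    then show ?thesis using that by (simp add: pairing_act[OF R] pairing_commute[of _ x])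
  qed
  then show "x = (\<lambda>_. 0)" using coefficient_nondegenerate[OF irr v(1) x] v(2) by blast
qed

lemma V_space_symmetric: "t \<in> V_space d lam \<Longrightarrow> symmetric_coeffs (\<lambda>xs. t (i, j, xs))"
  unfolding V_space_def symmetric_coeffs_def by blast

lemma V_space_cspace: "t \<in> V_space d lam \<Longrightarrow> t \<in> cspace (idx d lam)"
  unfolding V_space_def by blast

text \<open>For fixed \<gamma> the two flag factors are contracted one after the other. What remains
  is a symmetric tensor whose polynomial vanishes at all nonzero vectors, hence identically.\<close>

lemma tensor_separating:
  fixes t :: "('n::finite) tensor"
  assumes A: "separating (d l1) A1" "separating (d l2) A2"
    and t: "t \<in> V_space d (l1, l2, l)"
    and z: "\<And>\<alpha> \<beta> \<gamma>. \<alpha> \<in> A1 \<Longrightarrow> \<beta> \<in> A2 \<Longrightarrow> \<gamma> \<noteq> 0 \<Longrightarrow> V_pairing d (l1, l2, l) t (pure_tensor l \<alpha> \<beta> \<gamma>) = 0"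
  shows "t = (\<lambda>_. 0)"
proof -
  have tp: "tpoly l (\<lambda>xs. t (i, j, xs)) \<gamma> = 0" if \<gamma>: "\<gamma> \<noteq> 0" and ij: "i < d l1" "j < d l2" for i j \<gamma>
  proof -
    define T where "T i j = tpoly l (\<lambda>xs. t (i, j, xs)) \<gamma>" for i j
    have T: "V_pairing d (l1, l2, l) t (pure_tensor l \<alpha> \<beta> \<gamma>) = (\<Sum>i<d l1. \<Sum>j<d l2. T i j * \<beta> j * \<alpha> i)" for \<alpha> \<beta>
      unfolding V_pairing_pure T_def tpoly_def
      by (intro sum.cong HOL.refl) (simp add: sum_distrib_left sum_distrib_right mult_ac)
    have 1: "(\<Sum>j<d l2. T i j * \<beta> j) = 0" if "i < d l1" "\<beta> \<in> A2" for i \<beta>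
    proof -
      define x where "x i = (if i < d l1 then \<Sum>j<d l2. T i j * \<beta> j else 0)" for i
      have "pairing {..<d l1} x \<alpha> = V_pairing d (l1, l2, l) t (pure_tensor l \<alpha> \<beta> \<gamma>)" for \<alpha>
        unfolding T pairing_def x_def by (simp add: sum_distrib_right)
      then have "\<forall>\<alpha>\<in>A1. pairing {..<d l1} x \<alpha> = 0" using z[OF _ that(2) \<gamma>] by simp
      moreover have "x \<in> cspace {..<d l1}" by (simp add: x_def cspace_def)
      ultimately have "x = (\<lambda>_. 0)" using A(1) by (simp add: separating_def)
      then show ?thesis using that(1) by (auto simp: x_def fun_eq_iff dest: spec[of _ i])
    qed
    define y where "y j = (if j < d l2 then T i j else 0)" for j
    have "\<forall>\<beta>\<in>A2. pairing {..<d l2} y \<beta> = 0"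
      using 1[OF ij(1)] by (simp add: pairing_def y_def)
    moreover have "y \<in> cspace {..<d l2}" by (simp add: y_def cspace_def)
    ultimately have "y = (\<lambda>_. 0)" using A(2) by (simp add: separating_def)
    then have "y j = 0" by simp
    then show ?thesis using ij(2) by (simp add: y_def T_def)
  qed
  show ?thesis
  proof
    fix I :: "nat \<times> nat \<times> 'n list"
    obtain i j xs where I: "I = (i, j, xs)" by (metis prod_cases3)
    show "t I = 0"
    proof (cases "I \<in> idx d (l1, l2, l)")
      case True
      then have ij: "i < d l1" "j < d l2" "length xs = l" by (auto simp: I idx_def)
      have "tpoly l (\<lambda>xs. t (i, j, xs)) \<gamma> = 0" for \<gamma>
        using polynomial_zero_at_origin[OF tpoly_polynomial] tp[OF _ ij(1,2)] by blast
      from tpoly_eq_0_iff[OF V_space_symmetric[OF t] this ij(3)] show ?thesis by (simp add: I)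
    next
      case False
      then show ?thesis by (rule cspace_zero_outside[OF V_space_cspace[OF t]])
    qed
  qed
qed

lemma pure_tensor_V_space:
  fixes \<gamma> :: "complex^'n::finite"
  assumes "\<alpha> \<in> cspace {..<d l1}" "\<beta> \<in> cspace {..<d l2}"
  shows "pure_tensor l \<alpha> \<beta> \<gamma> \<in> V_space d (l1, l2, l)"
proof -
  have "pure_tensor l \<alpha> \<beta> \<gamma> (i, j, xs) = pure_tensor l \<alpha> \<beta> \<gamma> (i, j, ys)" if "mset xs = mset ys" for i j xs ys
    using lprod_mset[OF that, of \<gamma>] mset_eq_length[OF that] by (simp add: pure_tensor_def lprod_def)
  moreover have "pure_tensor l \<alpha> \<beta> \<gamma> \<in> cspace (idx d (l1, l2, l))"
    using assms by (auto simp: cspace_def idx_def pure_tensor_def)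
  ultimately show ?thesis unfolding V_space_def by blast
qed

text \<open>Averaging over permutations of the last index.\<close>

lemma symmetrization_exists:
  fixes x :: "('n::finite) tensor"
  assumes x: "x \<in> cspace (idx d (l1, l2, l))"
  shows "\<exists>x'\<in>V_space d (l1, l2, l). \<forall>u\<in>V_space d (l1, l2, l). V_pairing d (l1, l2, l) u x' = V_pairing d (l1, l2, l) u x"
proof -
  define C where "C xs = {ys :: 'n list. mset ys = mset xs}" for xs
  have C: "finite (C xs)" "C xs \<noteq> {}" for xs
  proof -
    have "C xs \<subseteq> {ys. length ys = length xs}" by (auto simp: C_def dest: mset_eq_length)
    then show "finite (C xs)" by (rule finite_subset) simp
  qed (auto simp: C_def)
  have Ceq: "C ys = C xs" if "mset ys = mset xs" for xs ys using that by (simp add: C_def)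
  define x' where "x' = (\<lambda>(i, j, xs). (\<Sum>ys\<in>C xs. x (i, j, ys)) / of_nat (card (C xs)))"
  have "x' (i, j, xs) = x' (i, j, ys)" if "mset xs = mset ys" for i j xs ys
    unfolding x'_def using Ceq[OF that] by simp
  moreover have "x' (i, j, xs) = 0" if outside: "(i, j, xs) \<notin> idx d (l1, l2, l)" for i j xs
  proof -
    have "x (i, j, ys) = 0" if ys: "ys \<in> C xs" for ys
    proof -
      have "length ys = length xs" using ys mset_eq_length unfolding C_def by blast
      then have "(i, j, ys) \<notin> idx d (l1, l2, l)" using outside by (auto simp: idx_def)
      then show ?thesis using x by (simp add: cspace_def)
    qed
    then show ?thesis by (simp add: x'_def)
  qed
  ultimately have "x' \<in> V_space d (l1, l2, l)" unfolding V_space_def cspace_def by fast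
  moreover have "V_pairing d (l1, l2, l) u x' = V_pairing d (l1, l2, l) u x" if u: "u \<in> V_space d (l1, l2, l)" for u
  proof -
    have "(\<Sum>xs | length xs = l. u (i, j, xs) * x' (i, j, xs)) = (\<Sum>xs | length xs = l. u (i, j, xs) * x (i, j, xs))" for i j
    proof -
      let ?L = "{xs :: 'n list. length xs = l}"
      \<comment> \<open>On a class of lists with equal multiset both \<open>u\<close> and the class
        size are constant, so the summand can be expressed through \<open>ys\<close> alone. After
        the exchange of sums, summing over \<open>xs\<close> merely counts the class.\<close>
      let ?g = "\<lambda>xs ys. u (i, j, ys) * x (i, j, ys) / of_nat (card (C ys))"
      have "(\<Sum>xs\<in>?L. u (i, j, xs) * x' (i, j, xs)) = (\<Sum>xs\<in>?L. \<Sum>ys\<in>{ys \<in> ?L. mset ys = mset xs}. ?g xs ys)"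
      proof (intro sum.cong HOL.refl)
        fix xs assume xs: "xs \<in> ?L"
        have "{ys \<in> ?L. mset ys = mset xs} = C xs"
          using xs by (auto simp: C_def dest: mset_eq_length)
        moreover have "?g xs ys = u (i, j, xs) * x (i, j, ys) / of_nat (card (C xs))" if "ys \<in> C xs" for ys
        proof -
          have m: "mset ys = mset xs" using that by (simp add: C_def)
          then have "u (i, j, ys) = u (i, j, xs)" using u unfolding V_space_def by blast
          then show ?thesis using Ceq[OF m] by simp
        qed
        ultimately show "u (i, j, xs) * x' (i, j, xs) = (\<Sum>ys\<in>{ys \<in> ?L. mset ys = mset xs}. ?g xs ys)"
          by (simp add: x'_def sum_distrib_left sum_divide_distrib)
      qed
      also have "\<dots> = (\<Sum>ys\<in>?L. \<Sum>xs\<in>{xs \<in> ?L. mset ys = mset xs}. ?g xs ys)"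
        by (rule sum.swap_restrict) simp_all
      also have "\<dots> = (\<Sum>ys\<in>?L. u (i, j, ys) * x (i, j, ys))"
      proof (intro sum.cong HOL.refl)
        fix ys assume ys: "ys \<in> ?L"
        have "{xs \<in> ?L. mset ys = mset xs} = C ys"
          using ys by (auto simp: C_def dest: mset_eq_length)
        then show "(\<Sum>xs\<in>{xs \<in> ?L. mset ys = mset xs}. ?g xs ys) = u (i, j, ys) * x (i, j, ys)"
          using C[of ys] by simp
      qed
      finally show ?thesis .
    qed
    then show ?thesis unfolding V_pairing_sum by simp
  qed
  ultimately show ?thesis by blast
qed

lemma finite_idx: "finite (idx d lam :: (nat \<times> nat \<times> 'n::finite list) set)"
  by (auto simp: idx_def split: prod.split)

text \<open>Separation yields a functional on the full coordinate space; symmetrizing it does not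
  change its pairing with symmetric tensors, and only then does \<open>sep\<close> apply.\<close>

lemma V_space_spanned:
  fixes S :: "('n::finite) tensor set"
  assumes S: "S \<subseteq> V_space d (l1, l2, l)"
    and sep: "\<And>t. t \<in> V_space d (l1, l2, l) \<Longrightarrow> (\<forall>s\<in>S. V_pairing d (l1, l2, l) s t = 0) \<Longrightarrow> t = (\<lambda>_. 0)"
    and w: "w \<in> V_space d (l1, l2, l)"
  shows "w \<in> cspan S"
proof (rule ccontr)
  assume "w \<notin> cspan S"
  moreover have "S \<subseteq> cspace (idx d (l1, l2, l))" "w \<in> cspace (idx d (l1, l2, l))"
    using S w by (auto simp: V_space_def)
  ultimately obtain x where x: "x \<in> cspace (idx d (l1, l2, l))"
    "\<forall>s\<in>S. V_pairing d (l1, l2, l) s x = 0" "V_pairing d (l1, l2, l) w x \<noteq> 0"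
    using separation[OF finite_idx] unfolding V_pairing_def by blast
  obtain x' where x': "x' \<in> V_space d (l1, l2, l)"
    "\<forall>u\<in>V_space d (l1, l2, l). V_pairing d (l1, l2, l) u x' = V_pairing d (l1, l2, l) u x"
    using symmetrization_exists[OF x(1)] by blast
  have "x' = (\<lambda>_. 0)" using x(2) x'(2) S by (intro sep[OF x'(1)]) auto
  then have "V_pairing d (l1, l2, l) w x' = 0" by (simp add: V_pairing_def pairing_def)
  then show False using x(3) x'(2)[rule_format, OF w] by simp
qed

lemma transpose_inverse_surj:
  assumes "x \<noteq> 0" "e \<noteq> 0" "CARD('n::finite) \<ge> 2"
  shows "\<exists>g\<in>SL. transpose (matrix_inv g) *v e = (x :: complex^'n)"
proof -
  obtain g where g: "g \<in> SL" "g *v e = x" using SL_transitive[OF assms(3,2,1)] by blast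
  have "transpose (matrix_inv (transpose (matrix_inv g))) = g"
    using g(1) by (simp add: inverse_transpose_SL matrix_inv_inv_SL)
  then show ?thesis using g by (intro bexI[of _ "transpose (matrix_inv g)"]) (simp_all add: transpose_SL del: transpose_matrix_vector)
qed

context
  fixes d :: "weight \<Rightarrow> nat" and \<rho> :: "weight \<Rightarrow> ('n::finite) matrep" and l1 l2 :: weight and l :: nat
  assumes n: "CARD('n) \<ge> 2" and irr: "irreducible_rep (d l1) (\<rho> l1)" "irreducible_rep (d l2) (\<rho> l2)"
begin

lemma V_separated_by_orbit:
  assumes v: "\<alpha> \<in> cspace {..<d l1}" "\<alpha> \<noteq> (\<lambda>_. 0)" "\<beta> \<in> cspace {..<d l2}" "\<beta> \<noteq> (\<lambda>_. 0)" "e \<noteq> 0"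
    and t: "t \<in> V_space d (l1, l2, l)"
    and z: "\<And>g. g \<in> G3 \<Longrightarrow> V_pairing d (l1, l2, l) t (V_act d \<rho> (l1, l2, l) g (pure_tensor l \<alpha> \<beta> e)) = 0"
  shows "t = (\<lambda>_. 0)"
proof (rule tensor_separating[OF separating_orbit[OF irr(1) v(1,2)] separating_orbit[OF irr(2) v(3,4)] t])
  fix \<alpha>' \<beta>' \<gamma> assume "\<alpha>' \<in> {mat_act {..<d l1} (\<rho> l1 g) \<alpha> | g. g \<in> SL}"
    "\<beta>' \<in> {mat_act {..<d l2} (\<rho> l2 g) \<beta> | g. g \<in> SL}" "\<gamma> \<noteq> (0 :: complex^'n)"
  then obtain g1 g2 g3 where g: "g1 \<in> SL" "g2 \<in> SL" "g3 \<in> SL" "\<alpha>' = mat_act {..<d l1} (\<rho> l1 g1) \<alpha>"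
    "\<beta>' = mat_act {..<d l2} (\<rho> l2 g2) \<beta>" "\<gamma> = g3 *v e"
    using SL_transitive[OF n v(5)] by blast
  then have "(g1, g2, g3) \<in> G3" by (simp add: G3_def)
  from z[OF this] show "V_pairing d (l1, l2, l) t (pure_tensor l \<alpha>' \<beta>' \<gamma>) = 0" by (simp add: V_act_pure g)
qed

lemma V_separated_by_coorbit:
  assumes v: "\<alpha> \<in> cspace {..<d l1}" "\<alpha> \<noteq> (\<lambda>_. 0)" "\<beta> \<in> cspace {..<d l2}" "\<beta> \<noteq> (\<lambda>_. 0)" "e \<noteq> 0"
    and t: "t \<in> V_space d (l1, l2, l)"
    and z: "\<And>g. g \<in> G3 \<Longrightarrow> V_pairing d (l1, l2, l) (V_coact d \<rho> (l1, l2, l) g (pure_tensor l \<alpha> \<beta> e)) t = 0"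
  shows "t = (\<lambda>_. 0)"
proof (rule tensor_separating[OF separating_dual_orbit[OF irr(1) v(1,2)] separating_dual_orbit[OF irr(2) v(3,4)] t])
  fix \<alpha>' \<beta>' \<gamma> assume "\<alpha>' \<in> {mat_act {..<d l1} (contragredient (\<rho> l1) g) \<alpha> | g. g \<in> SL}"
    "\<beta>' \<in> {mat_act {..<d l2} (contragredient (\<rho> l2) g) \<beta> | g. g \<in> SL}" "\<gamma> \<noteq> (0 :: complex^'n)"
  then obtain g1 g2 g3 where g: "g1 \<in> SL" "g2 \<in> SL" "g3 \<in> SL" "\<alpha>' = mat_act {..<d l1} (contragredient (\<rho> l1) g1) \<alpha>"
    "\<beta>' = mat_act {..<d l2} (contragredient (\<rho> l2) g2) \<beta>" "\<gamma> = transpose (matrix_inv g3) *v e"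
    using transpose_inverse_surj[OF _ v(5) n] by (smt (verit) mem_Collect_eq)
  then have "(g1, g2, g3) \<in> G3" by (simp add: G3_def)
  from z[OF this] show "V_pairing d (l1, l2, l) t (pure_tensor l \<alpha>' \<beta>' \<gamma>) = 0"
    by (simp add: V_coact_pure g V_pairing_commute[of _ _ t] del: transpose_matrix_vector)
qed

text \<open>By duality from separation. It supplies the expansions of invariant covectors into
  translates of an extremal one, with a fresh choice of points for each covector.\<close>

lemma V_spanned_by_coorbit:
  assumes v: "\<alpha> \<in> cspace {..<d l1}" "\<alpha> \<noteq> (\<lambda>_. 0)" "\<beta> \<in> cspace {..<d l2}" "\<beta> \<noteq> (\<lambda>_. 0)" "e \<noteq> 0"
    and w: "w \<in> V_space d (l1, l2, l)"
  shows "\<exists>(m::nat) a h. (\<forall>j<m. h j \<in> G3) \<and>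
    w = (\<lambda>I. \<Sum>j<m. a j * V_coact d \<rho> (l1, l2, l) (h j) (pure_tensor l \<alpha> \<beta> e) I)"
proof -
  let ?f = "\<lambda>g. V_coact d \<rho> (l1, l2, l) g (pure_tensor l \<alpha> \<beta> e)"
  have "w \<in> cspan (?f ` G3)"
  proof (rule V_space_spanned[OF _ _ w])
    show "?f ` G3 \<subseteq> V_space d (l1, l2, l)"
      by (auto simp: V_coact_pure intro!: pure_tensor_V_space simp del: transpose_matrix_vector)
    show "t = (\<lambda>_. 0)" if "t \<in> V_space d (l1, l2, l)" "\<forall>s\<in>?f ` G3. V_pairing d (l1, l2, l) s t = 0" for t
      using that by (intro V_separated_by_coorbit[OF v that(1)]) blast
  qed
  then show ?thesis by (rule cspan_sum_indexed)
qed

lemma V_act_mult3: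
  assumes "g \<in> G3" "h \<in> G3"
  shows "V_act d \<rho> (l1, l2, l) g (V_act d \<rho> (l1, l2, l) h (pure_tensor l \<alpha> \<beta> \<gamma>)) =
    V_act d \<rho> (l1, l2, l) (mult3 g h) (pure_tensor l \<alpha> \<beta> \<gamma>)"
  using assms by (auto simp: G3_def mult3_def V_act_pure act_mult[OF irreducible_rational[OF irr(1)]]
      act_mult[OF irreducible_rational[OF irr(2)]] matrix_vector_mul_assoc)

lemma V_coact_mult3:
  assumes "g \<in> G3" "h \<in> G3"
  shows "V_coact d \<rho> (l1, l2, l) g (V_coact d \<rho> (l1, l2, l) h (pure_tensor l \<alpha> \<beta> \<gamma>)) =
    V_coact d \<rho> (l1, l2, l) (mult3 g h) (pure_tensor l \<alpha> \<beta> \<gamma>)"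
proof -
  note R = rational_rep_contragredient[OF irreducible_rational[OF irr(1)]]
    rational_rep_contragredient[OF irreducible_rational[OF irr(2)]]
  show ?thesis using assms
    by (auto simp: G3_def mult3_def V_coact_pure act_mult[OF R(1)] act_mult[OF R(2)]
        matrix_vector_mul_assoc matrix_inv_mult_SL matrix_transpose_mul simp del: transpose_matrix_vector)
qed

lemma coinvariant_pairing:
  assumes w: "V_coinvariant d \<rho> (l1, l2, l) w" and k: "k \<in> SL" and g: "g \<in> G3"
  shows "V_pairing d (l1, l2, l) w (V_act d \<rho> (l1, l2, l) (mult3 (k, k, k) g) (pure_tensor l \<alpha> \<beta> \<gamma>)) =
    V_pairing d (l1, l2, l) w (V_act d \<rho> (l1, l2, l) g (pure_tensor l \<alpha> \<beta> \<gamma>))"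
proof -
  let ?k = "(k, k, k)"
  have kG: "?k \<in> G3" using k by (simp add: G3_def)
  have "mult3 (inv3 ?k) (mult3 ?k g) = g"
    using k by (auto simp: mult3_def inv3_def matrix_mul_assoc SL_inv split: prod.split)
  then have "V_pairing d (l1, l2, l) (V_coact d \<rho> (l1, l2, l) ?k w) (V_act d \<rho> (l1, l2, l) (mult3 ?k g) (pure_tensor l \<alpha> \<beta> \<gamma>)) =
      V_pairing d (l1, l2, l) w (V_act d \<rho> (l1, l2, l) g (pure_tensor l \<alpha> \<beta> \<gamma>))"
    by (simp add: V_pairing_V_coact[OF kG] V_act_mult3 kG g inv3_G3 mult3_G3)
  moreover have "V_coact d \<rho> (l1, l2, l) ?k w = w" using w k by (simp add: V_coinvariant_def)
  ultimately show ?thesis by simp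
qed

lemma invariant_copairing:
  assumes u: "V_invariant d \<rho> (l1, l2, l) u" and k: "k \<in> SL" and g: "g \<in> G3"
  shows "V_pairing d (l1, l2, l) (V_coact d \<rho> (l1, l2, l) (mult3 (k, k, k) g) (pure_tensor l \<alpha> \<beta> \<gamma>)) u =
    V_pairing d (l1, l2, l) (V_coact d \<rho> (l1, l2, l) g (pure_tensor l \<alpha> \<beta> \<gamma>)) u"
proof -
  let ?k = "(k, k, k)"
  have kG: "?k \<in> G3" using k by (simp add: G3_def)
  have "V_act d \<rho> (l1, l2, l) (inv3 ?k) u = u" using u k by (simp add: V_invariant_def inv3_def)
  then show ?thesis by (simp add: V_coact_mult3[OF kG g, symmetric] V_pairing_V_coact[OF kG])
qed

end

lemma V_act_sum:
  "V_act d \<rho> lam g (\<lambda>I. \<Sum>j\<in>J. a j * t j I) = (\<lambda>I. \<Sum>j\<in>J. a j * V_act d \<rho> lam g (t j) I)"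
  unfolding V_act_def by (auto simp: mat_act_sum mat_act_scale split: prod.split)

lemma V_coact_sum:
  "V_coact d \<rho> lam g (\<lambda>I. \<Sum>j\<in>J. a j * t j I) = (\<lambda>I. \<Sum>j\<in>J. a j * V_coact d \<rho> lam g (t j) I)"
  unfolding V_coact_def by (auto simp: mat_act_sum mat_act_scale split: prod.split)

lemma V_space_sum:
  "(\<And>j. j \<in> J \<Longrightarrow> t j \<in> V_space d lam) \<Longrightarrow> (\<lambda>I. \<Sum>j\<in>J. a j * t j I) \<in> V_space d lam"
proof -
  assume t: "\<And>j. j \<in> J \<Longrightarrow> t j \<in> V_space d lam"
  have "(\<Sum>k\<in>J. a k * t k (i, j, xs)) = (\<Sum>k\<in>J. a k * t k (i, j, ys))" if "mset xs = mset ys" for i j xs ys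
  proof (intro sum.cong HOL.refl)
    fix k assume "k \<in> J"
    then have "t k (i, j, xs) = t k (i, j, ys)" using t that unfolding V_space_def by blast
    then show "a k * t k (i, j, xs) = a k * t k (i, j, ys)" by simp
  qed
  moreover have "(\<Sum>k\<in>J. a k * t k I) = 0" if "I \<notin> idx d lam" for I
    using cspace_zero_outside[OF V_space_cspace[OF t] that] by (intro sum.neutral) simp
  ultimately show ?thesis unfolding V_space_def cspace_def by blast
qed

subsection \<open>Positive kernels\<close>

text \<open>A Gram kernel with finitely many features. The index type is fixed to \<open>nat\<close>
  so that the existential stays within one type; \<open>pos_kernelI\<close> transfers any finite
  index set.\<close>

definition pos_kernel :: "'g set \<Rightarrow> ('g \<Rightarrow> 'g \<Rightarrow> complex) \<Rightarrow> bool" where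
  "pos_kernel A K \<longleftrightarrow> (\<exists>(S :: nat set) \<Phi>. finite S \<and>
     (\<forall>g\<in>A. \<forall>h\<in>A. K h g = (\<Sum>s\<in>S. \<Phi> s g * cnj (\<Phi> s h))))"

lemma pos_kernelI:
  fixes S :: "'s set"
  assumes "finite S" and K: "\<And>g h. g \<in> A \<Longrightarrow> h \<in> A \<Longrightarrow> K h g = (\<Sum>s\<in>S. \<Phi> s g * cnj (\<Phi> s h))"
  shows "pos_kernel A K"
proof -
  obtain f :: "'s \<Rightarrow> nat" where f: "inj_on f S"
    using finite_imp_inj_to_nat_seg[OF assms(1)] by blast
  have "K h g = (\<Sum>s\<in>f ` S. \<Phi> (the_inv_into S f s) g * cnj (\<Phi> (the_inv_into S f s) h))"
    if "g \<in> A" "h \<in> A" for g h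
    using K[OF that] f by (simp add: sum.reindex the_inv_into_f_f)
  then show ?thesis unfolding pos_kernel_def
    by (intro exI[of _ "f ` S"] exI[of _ "\<lambda>s. \<Phi> (the_inv_into S f s)"]) (use assms(1) in simp)
qed

lemma pos_kernel_mult:
  assumes "pos_kernel A K" "pos_kernel A L"
  shows "pos_kernel A (\<lambda>h g. K h g * L h g)"
proof -
  obtain S :: "nat set" and \<Phi> where S: "finite S" "\<And>g h. g \<in> A \<Longrightarrow> h \<in> A \<Longrightarrow> K h g = (\<Sum>s\<in>S. \<Phi> s g * cnj (\<Phi> s h))"
    using assms(1) unfolding pos_kernel_def by blast
  obtain T :: "nat set" and \<Psi> where T: "finite T" "\<And>g h. g \<in> A \<Longrightarrow> h \<in> A \<Longrightarrow> L h g = (\<Sum>s\<in>T. \<Psi> s g * cnj (\<Psi> s h))"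
    using assms(2) unfolding pos_kernel_def by blast
  show ?thesis
  proof (rule pos_kernelI[where S = "S \<times> T" and \<Phi> = "\<lambda>(s, t) g. \<Phi> s g * \<Psi> t g"])
    show "K h g * L h g = (\<Sum>s\<in>S \<times> T. (case s of (s, t) \<Rightarrow> \<lambda>g. \<Phi> s g * \<Psi> t g) g *
        cnj ((case s of (s, t) \<Rightarrow> \<lambda>g. \<Phi> s g * \<Psi> t g) h))" if "g \<in> A" "h \<in> A" for g h
      unfolding S(2)[OF that] T(2)[OF that] sum_product sum.cartesian_product
      by (intro sum.cong HOL.refl) (auto simp: mult_ac)
  qed (use S(1) T(1) in simp)
qed

lemma pos_kernel_one: "pos_kernel A (\<lambda>h g. 1)"
  by (rule pos_kernelI[where S = "{0::nat}" and \<Phi> = "\<lambda>_ _. 1"]) simp_all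

lemma pos_kernel_power: "pos_kernel A K \<Longrightarrow> pos_kernel A (\<lambda>h g. K h g ^ m)"
  by (induction m) (simp_all add: pos_kernel_one pos_kernel_mult)

lemma pos_kernel_prod:
  "finite I \<Longrightarrow> (\<And>i. i \<in> I \<Longrightarrow> pos_kernel A (K i)) \<Longrightarrow> pos_kernel A (\<lambda>h g. \<Prod>i\<in>I. K i h g)"
  by (induction I rule: finite_induct) (simp_all add: pos_kernel_one pos_kernel_mult)

lemma pos_kernel_pullback:
  "pos_kernel B K \<Longrightarrow> (\<And>g. g \<in> A \<Longrightarrow> \<pi> g \<in> B) \<Longrightarrow> pos_kernel A (\<lambda>h g. K (\<pi> h) (\<pi> g))"
proof -
  assume K: "pos_kernel B K" and \<pi>: "\<And>g. g \<in> A \<Longrightarrow> \<pi> g \<in> B"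
  obtain S :: "nat set" and \<Phi> where "finite S" "\<And>g h. g \<in> B \<Longrightarrow> h \<in> B \<Longrightarrow> K h g = (\<Sum>s\<in>S. \<Phi> s g * cnj (\<Phi> s h))"
    using K unfolding pos_kernel_def by blast
  then show ?thesis using \<pi> by (intro pos_kernelI[where S = S and \<Phi> = "\<lambda>s g. \<Phi> s (\<pi> g)"]) auto
qed

lemma pos_kernel_hermitian:
  assumes "pos_kernel A K" "g \<in> A" "h \<in> A" shows "K g h = cnj (K h g)"
proof -
  obtain S :: "nat set" and \<Phi> where "\<And>g h. g \<in> A \<Longrightarrow> h \<in> A \<Longrightarrow> K h g = (\<Sum>s\<in>S. \<Phi> s g * cnj (\<Phi> s h))"
    using assms(1) unfolding pos_kernel_def by blast
  then show ?thesis using assms(2,3) by (simp add: mult.commute)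
qed

lemma sum_mult_cnj_zero:
  assumes "finite S" "(\<Sum>s\<in>S. y s * cnj (y s)) = 0" "s \<in> S"
  shows "y s = (0::complex)"
proof -
  have "(\<Sum>s\<in>S. y s * cnj (y s)) = of_real (\<Sum>s\<in>S. (cmod (y s))\<^sup>2)"
    by (simp only: of_real_sum complex_norm_square)
  then have "complex_of_real (\<Sum>s\<in>S. (cmod (y s))\<^sup>2) = 0" using assms(2) by (simp only:)
  then have "(\<Sum>s\<in>S. (cmod (y s))\<^sup>2) = 0" by (simp only: of_real_eq_0_iff)
  then have "(cmod (y s))\<^sup>2 = 0" using assms(1,3) sum_nonneg_eq_0_iff[of S "\<lambda>s. (cmod (y s))\<^sup>2"] by simp
  then show ?thesis by simp
qed

text \<open>The degenerate case of Cauchy-Schwarz: the hermitian form is the sum of squared moduli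
  of the combined features \<open>y s\<close>, so it vanishes only if they all do.\<close>

lemma pos_kernel_null:
  assumes K: "pos_kernel A K" and g: "\<And>i. i \<in> I \<Longrightarrow> g i \<in> A"
    and z: "(\<Sum>j\<in>I. \<Sum>i\<in>I. cnj (c j) * c i * K (g j) (g i)) = 0"
  shows "\<And>h. h \<in> A \<Longrightarrow> (\<Sum>i\<in>I. c i * K h (g i)) = 0"
proof -
  fix h assume h: "h \<in> A"
  obtain S :: "nat set" and \<Phi> where S: "finite S" "\<And>g h. g \<in> A \<Longrightarrow> h \<in> A \<Longrightarrow> K h g = (\<Sum>s\<in>S. \<Phi> s g * cnj (\<Phi> s h))"
    using K unfolding pos_kernel_def by blast
  define y where "y s = (\<Sum>i\<in>I. c i * \<Phi> s (g i))" for s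
  have e: "(\<Sum>i\<in>I. c i * K h (g i)) = (\<Sum>s\<in>S. y s * cnj (\<Phi> s h))" if "h \<in> A" for h
  proof -
    have "(\<Sum>i\<in>I. c i * K h (g i)) = (\<Sum>i\<in>I. \<Sum>s\<in>S. c i * \<Phi> s (g i) * cnj (\<Phi> s h))"
      by (intro sum.cong HOL.refl) (simp add: S(2)[OF g that] sum_distrib_left mult.assoc)
    also have "\<dots> = (\<Sum>s\<in>S. \<Sum>i\<in>I. c i * \<Phi> s (g i) * cnj (\<Phi> s h))" by (rule sum.swap)
    finally show ?thesis by (simp add: y_def sum_distrib_right)
  qed
  have "(\<Sum>j\<in>I. \<Sum>i\<in>I. cnj (c j) * c i * K (g j) (g i)) = (\<Sum>j\<in>I. cnj (c j) * (\<Sum>s\<in>S. y s * cnj (\<Phi> s (g j))))"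
    by (intro sum.cong HOL.refl) (simp add: e[OF g, symmetric] sum_distrib_left mult.assoc)
  also have "\<dots> = (\<Sum>j\<in>I. \<Sum>s\<in>S. y s * (cnj (c j) * cnj (\<Phi> s (g j))))"
    by (simp add: sum_distrib_left mult_ac)
  also have "\<dots> = (\<Sum>s\<in>S. \<Sum>j\<in>I. y s * (cnj (c j) * cnj (\<Phi> s (g j))))" by (rule sum.swap)
  also have "\<dots> = (\<Sum>s\<in>S. y s * cnj (y s))" by (simp add: y_def sum_distrib_left)
  finally have "(\<Sum>s\<in>S. y s * cnj (y s)) = 0" using z by simp
  then have "y s = 0" if "s \<in> S" for s using sum_mult_cnj_zero[OF S(1) _ that] by blast
  then show "(\<Sum>i\<in>I. c i * K h (g i)) = 0" using e[OF h] by simp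
qed

section \<open>Positivity of leading minors in unitary frames\<close>

definition adj :: "('n::finite) cmat \<Rightarrow> 'n cmat" where
  "adj M = (\<chi> i j. cnj (M $ j $ i))"

lemma adj_mult: "adj (A ** B) = adj B ** adj A"
  by (simp add: adj_def vec_eq_iff mm_entry mult.commute)

lemma adj_adj [simp]: "adj (adj M) = M" by (simp add: adj_def vec_eq_iff)

lemma det_adj: "det (adj M) = cnj (det M)"
proof -
  have "det (adj M) = det (transpose (adj M))" by simp
  also have "\<dots> = cnj (det M)" by (simp add: det_def adj_def transpose_def)
  finally show ?thesis .
qed

lemma adj_SL [simp]: "M \<in> SL \<Longrightarrow> adj M \<in> SL" by (simp add: SL_def det_adj)

text \<open>Cauchy-Binet summed over all maps \<open>f\<close> rather than increasing ones: maps
  that are not injective give zero and every other row set is counted once per ordering, whence the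
  factorial. The proof averages the multilinear expansion over the permutations of the rows.\<close>

lemma cauchy_binet_kernel:
  fixes R S :: "'k::finite \<Rightarrow> 'n::finite \<Rightarrow> complex"
  shows "det (\<chi> a b. \<Sum>k\<in>UNIV. cnj (S k a) * R k b) =
    (\<Sum>f\<in>(UNIV :: ('n \<Rightarrow> 'k) set). det (\<chi> a b. R (f a) b) * cnj (det (\<chi> a b. S (f a) b))) / fact CARD('n)"
proof -
  let ?P = "{\<sigma> :: 'n \<Rightarrow> 'n. \<sigma> permutes UNIV}"
  have fin: "finite ?P" by (simp add: finite_permutations)
  define D where "D R f = det (\<chi> a b. R (f a) b)" for R :: "'k \<Rightarrow> 'n \<Rightarrow> complex" and f :: "'n \<Rightarrow> 'k"
  have PiE: "(PiE UNIV (\<lambda>_. UNIV) :: ('n \<Rightarrow> 'k) set) = UNIV" by (auto simp: PiE_def)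
  have expand: "det (\<chi> a b. \<Sum>k\<in>UNIV. cnj (S k a) * R k b) = (\<Sum>f\<in>UNIV. (\<Prod>a\<in>UNIV. cnj (S (f a) a)) * D R f)"
  proof -
    have "det (\<chi> a b. \<Sum>k\<in>UNIV. cnj (S k a) * R k b) =
        (\<Sum>\<sigma>\<in>?P. of_int (sign \<sigma>) * (\<Sum>f\<in>UNIV. \<Prod>a\<in>UNIV. cnj (S (f a) a) * R (f a) (\<sigma> a)))"
      unfolding det_def by (simp add: prod_sum_PiE PiE)
    also have "\<dots> = (\<Sum>\<sigma>\<in>?P. \<Sum>f\<in>UNIV. (\<Prod>a\<in>UNIV. cnj (S (f a) a)) * (of_int (sign \<sigma>) * (\<Prod>a\<in>UNIV. R (f a) (\<sigma> a))))"
      by (simp add: prod.distrib sum_distrib_left mult_ac)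
    also have "\<dots> = (\<Sum>f\<in>UNIV. \<Sum>\<sigma>\<in>?P. (\<Prod>a\<in>UNIV. cnj (S (f a) a)) * (of_int (sign \<sigma>) * (\<Prod>a\<in>UNIV. R (f a) (\<sigma> a))))"
      by (rule sum.swap)
    finally show ?thesis by (simp add: D_def det_def sum_distrib_left)
  qed
  have perm: "(\<Sum>f\<in>UNIV. (\<Prod>a\<in>UNIV. cnj (S (f a) a)) * D R f) =
      (\<Sum>f\<in>UNIV. of_int (sign \<sigma>) * (\<Prod>a\<in>UNIV. cnj (S (f (\<sigma> a)) a)) * D R f)" if \<sigma>: "\<sigma> \<in> ?P" for \<sigma>
  proof -
    have "bij (\<lambda>f :: 'n \<Rightarrow> 'k. f \<circ> \<sigma>)"
      using \<sigma> by (intro o_bij[of "\<lambda>f. f \<circ> inv \<sigma>"]) (auto simp: fun_eq_iff permutes_inverses)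
    then have "(\<Sum>f\<in>UNIV. (\<Prod>a\<in>UNIV. cnj (S (f a) a)) * D R f) =
        (\<Sum>f\<in>UNIV. (\<Prod>a\<in>UNIV. cnj (S ((f \<circ> \<sigma>) a) a)) * D R (f \<circ> \<sigma>))"
      by (rule sum.reindex_bij_betw[symmetric])
    moreover have "D R (f \<circ> \<sigma>) = of_int (sign \<sigma>) * D R f" for f
      using det_permute_rows[of \<sigma> "\<chi> a b. R (f a) b"] \<sigma> by (simp add: D_def)
    ultimately show ?thesis by (simp add: mult_ac)
  qed
  have "of_nat (card ?P) * (\<Sum>f\<in>UNIV. (\<Prod>a\<in>UNIV. cnj (S (f a) a)) * D R f) =
      (\<Sum>\<sigma>\<in>?P. \<Sum>f\<in>UNIV. of_int (sign \<sigma>) * (\<Prod>a\<in>UNIV. cnj (S (f (\<sigma> a)) a)) * D R f)"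
    by (simp add: perm[symmetric])
  also have "\<dots> = (\<Sum>f\<in>UNIV. \<Sum>\<sigma>\<in>?P. of_int (sign \<sigma>) * (\<Prod>a\<in>UNIV. cnj (S (f (\<sigma> a)) a)) * D R f)"
    by (rule sum.swap)
  also have "\<dots> = (\<Sum>f\<in>UNIV. D R f * cnj (D S f))"
  proof (intro sum.cong HOL.refl)
    fix f :: "'n \<Rightarrow> 'k"
    have "D S f = det (transpose (\<chi> a b. S (f a) b))" by (simp add: D_def)
    also have "\<dots> = (\<Sum>\<sigma>\<in>?P. of_int (sign \<sigma>) * (\<Prod>a\<in>UNIV. S (f (\<sigma> a)) a))"
      unfolding det_def by (simp add: transpose_def)
    finally show "(\<Sum>\<sigma>\<in>?P. of_int (sign \<sigma>) * (\<Prod>a\<in>UNIV. cnj (S (f (\<sigma> a)) a)) * D R f) = D R f * cnj (D S f)"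
      by (simp add: sum_distrib_left mult_ac)
  qed
  finally have "fact CARD('n) * (\<Sum>f\<in>UNIV. (\<Prod>a\<in>UNIV. cnj (S (f a) a)) * D R f) = (\<Sum>f\<in>UNIV. D R f * cnj (D S f))"
    by (simp add: card_permutations)
  then show ?thesis unfolding expand by (simp add: D_def field_simps)
qed

text \<open>In a unitary frame \<open>conj_from p (adj h ** g)\<close> equals
  \<open>adj (h ** p) ** (g ** p)\<close>, so its leading block is a Gram matrix of truncated
  columns, and Cauchy-Binet turns the determinant into a sum of features.\<close>

lemma pos_kernel_block:
  fixes p :: "('n::finite) cmat"
  assumes o: "adj p ** p = mat 1"
  shows "pos_kernel UNIV (\<lambda>h g. det (block i (conj_from p (adj h ** g))))"
proof -
  have inv: "matrix_inv p = adj p" by (rule matrix_inv_eqI(1)) (use o matrix_left_right_inverse in blast)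
  \<comment> \<open>The rows \<open>Inl\<close> carry the first \<open>i\<close> columns of
    \<open>g ** p\<close>; the rows \<open>Inr\<close> add the identity padding of
    \<open>block\<close>, independently of \<open>g\<close>.\<close>
  define R :: "'n cmat \<Rightarrow> 'n + 'n \<Rightarrow> 'n \<Rightarrow> complex"
    where "R g = (\<lambda>k b. case k of Inl a \<Rightarrow> if pos b < i then (g ** p) $ a $ b else 0
      | Inr a \<Rightarrow> if a = b \<and> \<not> pos b < i then 1 else 0)" for g
  have "block i (conj_from p (adj h ** g)) = (\<chi> a b. \<Sum>k\<in>UNIV. cnj (R h k a) * R g k b)" for g h
  proof -
    have "(\<Sum>k\<in>UNIV. cnj (R h k a) * R g k b) = block i (conj_from p (adj h ** g)) $ a $ b" for a b
    proof -
      have "conj_from p (adj h ** g) = adj (h ** p) ** (g ** p)"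
        by (simp add: conj_from_def inv adj_mult matrix_mul_assoc)
      then have c: "conj_from p (adj h ** g) $ a $ b = (\<Sum>k\<in>UNIV. cnj ((h ** p) $ k $ a) * (g ** p) $ k $ b)"
        by (simp add: mm_entry[of "adj (h ** p)"]) (simp add: adj_def)
      have "(\<Sum>k\<in>UNIV. cnj (R h k a) * R g k b) =
          (\<Sum>k\<in>UNIV. cnj (R h (Inl k) a) * R g (Inl k) b) + (\<Sum>k\<in>UNIV. cnj (R h (Inr k) a) * R g (Inr k) b)"
        unfolding UNIV_Plus_UNIV[symmetric] by (subst sum.Plus) auto
      moreover have "(\<Sum>k\<in>UNIV. cnj (R h (Inl k) a) * R g (Inl k) b) =
          (if pos a < i \<and> pos b < i then conj_from p (adj h ** g) $ a $ b else 0)"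
        by (cases "pos a < i"; cases "pos b < i") (simp_all add: R_def c)
      moreover have "(\<Sum>k\<in>UNIV. cnj (R h (Inr k) a) * R g (Inr k) b) =
          (if a = b \<and> \<not> pos a < i then 1 else 0)"
      proof -
        have "(\<Sum>k\<in>UNIV. cnj (R h (Inr k) a) * R g (Inr k) b) =
            (\<Sum>k\<in>UNIV. if k = a then (if a = b \<and> \<not> pos a < i then 1 else 0) else 0)"
          by (intro sum.cong HOL.refl) (auto simp: R_def)
        then show ?thesis by simp
      qed
      ultimately show ?thesis by (auto simp: block_def)
    qed
    then show ?thesis by (simp add: vec_eq_iff)
  qed
  then have e: "det (block i (conj_from p (adj h ** g))) =
      (\<Sum>f\<in>(UNIV :: ('n \<Rightarrow> 'n + 'n) set). det (\<chi> a b. R g (f a) b) * cnj (det (\<chi> a b. R h (f a) b))) / fact CARD('n)" for g h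
    by (simp only: cauchy_binet_kernel)
  \<comment> \<open>The factor 1 / n! is divided evenly between a feature and the conjugate
    feature.\<close>
  define s where "s = complex_of_real (sqrt (1 / fact CARD('n)))"
  have s: "s * cnj s = 1 / fact CARD('n)"
    by (simp add: s_def of_real_mult[symmetric] del: of_real_mult)
  have fin: "finite (UNIV :: ('n \<Rightarrow> 'n + 'n) set)" by simp
  show ?thesis
  proof (rule pos_kernelI[OF fin, where \<Phi> = "\<lambda>f g. s * det (\<chi> a b. R g (f a) b)"])
    fix g h :: "'n cmat"
    have "(\<Sum>f\<in>(UNIV :: ('n \<Rightarrow> 'n + 'n) set). s * det (\<chi> a b. R g (f a) b) * cnj (s * det (\<chi> a b. R h (f a) b))) =
      (s * cnj s) * (\<Sum>f\<in>(UNIV :: ('n \<Rightarrow> 'n + 'n) set). det (\<chi> a b. R g (f a) b) * cnj (det (\<chi> a b. R h (f a) b)))"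
      by (simp add: sum_distrib_left mult_ac)
    then show "det (block i (conj_from p (adj h ** g))) =
      (\<Sum>f\<in>(UNIV :: ('n \<Rightarrow> 'n + 'n) set). s * det (\<chi> a b. R g (f a) b) * cnj (s * det (\<chi> a b. R h (f a) b)))"
      unfolding e s by simp
  qed
qed

lemma pos_kernel_minors:
  fixes p :: "('n::finite) cmat"
  assumes "adj p ** p = mat 1"
  shows "pos_kernel UNIV (\<lambda>h g. minors p \<nu> (adj h ** g))"
  unfolding minors_def by (intro pos_kernel_prod pos_kernel_power pos_kernel_block assms) simp

definition cnjv :: "complex^'n::finite \<Rightarrow> complex^'n" where
  "cnjv e = (\<chi> k. cnj (e $ k))"

lemma dotp_adj: "dotp (cnjv e) ((adj h ** g) *v e) = (\<Sum>k\<in>UNIV. (g *v e) $ k * cnj ((h *v e) $ k))"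
proof -
  have "dotp (cnjv e) ((adj h ** g) *v e) = (\<Sum>i\<in>UNIV. \<Sum>k\<in>UNIV. cnj (e $ i) * (cnj (h $ k $ i) * (g *v e) $ k))"
    by (simp add: dotp_def cnjv_def matrix_vector_mul_assoc[symmetric] mv_entry[of "adj h"])
      (simp add: adj_def sum_distrib_left)
  also have "\<dots> = (\<Sum>k\<in>UNIV. \<Sum>i\<in>UNIV. cnj (e $ i) * (cnj (h $ k $ i) * (g *v e) $ k))" by (rule sum.swap)
  also have "\<dots> = (\<Sum>k\<in>UNIV. (g *v e) $ k * cnj ((h *v e) $ k))"
    by (simp add: mv_entry[of h] sum_distrib_left mult_ac)
  finally show ?thesis .
qed

lemma pos_kernel_dotp: "pos_kernel UNIV (\<lambda>h g. dotp (cnjv e) ((adj h ** g) *v e))"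
  by (rule pos_kernelI[where S = UNIV and \<Phi> = "\<lambda>k g. (g *v e) $ k"]) (simp_all add: dotp_adj)

subsection \<open>Orthonormal frames\<close>

text \<open>Gram-Schmidt along the flag: vector \<open>k\<close> is the normalized component,
  orthogonal to step \<open>pos k\<close>, of a vector new at the next step.\<close>

lemma orthonormal_frame:
  fixes F :: "nat \<Rightarrow> (complex^'n::finite) set"
  assumes F: "complete_flag F"
  shows "\<exists>p. adj p ** p = mat 1 \<and> invertible p \<and> F = frame_flag p"
proof -
  have sub: "vec.subspace (F i)" for i using F by (auto simp: complete_flag_def)
  define hm where "hm x y = (\<Sum>k\<in>UNIV. x $ k * cnj (y $ k))" for x y :: "complex^'n"
  have hm_scale: "hm x (c *s y) = cnj c * hm x y" "hm (c *s x) y = c * hm x y" for x y c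
    by (simp_all add: hm_def sum_distrib_left mult_ac)
  have inner: "inner x y = Re (hm x y)" for x y
    by (simp add: hm_def inner_vec_def inner_complex_def)
  have hm_cnj: "hm y x = cnj (hm x y)" for x y by (simp add: hm_def mult.commute)
  have hm_self: "hm x x = of_real ((norm x)\<^sup>2)" for x
  proof -
    have "Im (hm x x) = 0" by (simp add: hm_def)
    moreover have "Re (hm x x) = (norm x)\<^sup>2" by (simp add: inner[symmetric] power2_norm_eq_inner)
    ultimately show ?thesis by (simp add: complex_eq_iff)
  qed
  have "\<exists>z. z \<in> F (Suc (pos k)) \<and> z \<notin> F (pos k) \<and> hm z z = 1 \<and> (\<forall>w\<in>F (pos k). hm z w = 0)" for k :: 'n
  proof -
    obtain x where x: "x \<in> F (Suc (pos k))" "x \<notin> F (pos k)"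
      using complete_flag_strict[OF F pos_less] by blast
    have span: "span (F (pos k)) = F (pos k)"
    proof -
      have "subspace (F (pos k))"
        unfolding subspace_def
      proof (intro conjI ballI allI)
        fix c :: real and x assume "x \<in> F (pos k)"
        then have "of_real c *s x \<in> F (pos k)" by (rule vec.subspace_scale[OF sub])
        moreover have "of_real c *s x = c *\<^sub>R x" by (simp add: vec_eq_iff scaleR_conv_of_real[where 'a = complex])
        ultimately show "c *\<^sub>R x \<in> F (pos k)" by simp
      qed (auto intro: vec.subspace_0[OF sub] vec.subspace_add[OF sub])
      then show ?thesis by (simp add: span_eq_iff)
    qed
    obtain y z where yz: "y \<in> F (pos k)" "\<And>w. w \<in> F (pos k) \<Longrightarrow> orthogonal z w" "x = y + z"
      using orthogonal_subspace_decomp_exists[of "F (pos k)" x] unfolding span by blast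
    \<comment> \<open>The orthogonal decomposition refers to the real inner product. Since the step
      is a complex subspace, orthogonality to \<open>\<i> *s w\<close> as well as to
      \<open>w\<close> kills the imaginary part of the hermitian product too.\<close>
    have z0: "hm z w = 0" if w: "w \<in> F (pos k)" for w
    proof -
      have "\<i> *s w \<in> F (pos k)" using w by (rule vec.subspace_scale[OF sub])
      then have "Re (hm z (\<i> *s w)) = 0" "Re (hm z w) = 0"
        using yz(2) w by (auto simp: orthogonal_def inner)
      then show ?thesis by (simp add: hm_scale complex_eq_iff)
    qed
    have zF: "z \<notin> F (pos k)" using x(2) yz(1,3) vec.subspace_add[OF sub] by blast
    then have "z \<noteq> 0" using vec.subspace_0[OF sub] by blast
    have "F (pos k) \<subseteq> F (Suc (pos k))" by (rule complete_flag_mono[OF F]) simp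
    then have "x - y \<in> F (Suc (pos k))" using x(1) yz(1) by (intro vec.subspace_diff[OF sub]) auto
    then have zS: "z \<in> F (Suc (pos k))" using yz(3) by simp
    define c where "c = complex_of_real (1 / norm z)"
    have c: "c \<noteq> 0" using \<open>z \<noteq> 0\<close> by (simp add: c_def)
    have "c *s z \<in> F (Suc (pos k))" by (rule vec.subspace_scale[OF sub zS])
    moreover have "c *s z \<notin> F (pos k)"
    proof
      assume "c *s z \<in> F (pos k)"
      from vec.subspace_scale[OF sub this, of "inverse c"] have "z \<in> F (pos k)" using c by simp
      then show False using zF by simp
    qed
    moreover have "hm (c *s z) (c *s z) = 1"
      unfolding hm_scale unfolding hm_self c_def using \<open>z \<noteq> 0\<close> by (simp add: power2_eq_square)
    ultimately show ?thesis using z0 by (intro exI[of _ "c *s z"]) (simp add: hm_scale)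
  qed
  then obtain f where f: "\<And>k::'n. f k \<in> F (Suc (pos k))" "\<And>k. f k \<notin> F (pos k)"
    "\<And>k. hm (f k) (f k) = 1" "\<And>k w. w \<in> F (pos k) \<Longrightarrow> hm (f k) w = 0" by metis
  define p where "p = (\<chi> i k. f k $ i)"
  have p: "invertible p" "F = frame_flag p"
    using frame_of_adapted_vectors[OF F f(1,2)] by (simp_all add: p_def)
  have orth: "hm (f a) (f b) = (if a = b then 1 else 0)" for a b
  proof -
    have lt: "hm (f a) (f b) = 0" if "pos b < pos a" for a b
    proof -
      have "F (Suc (pos b)) \<subseteq> F (pos a)" using that by (intro complete_flag_mono[OF F]) simp
      then show ?thesis using f(1)[of b] f(4) by blast
    qed
    show ?thesis
    proof (cases "a = b")
      case False
      then have "pos a < pos b \<or> pos b < pos a" by (metis linorder_neqE_nat pos_eq)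
      then have "hm (f a) (f b) = 0"
      proof
        assume "pos a < pos b"
        then have "hm (f b) (f a) = 0" by (rule lt)
        then show ?thesis by (subst hm_cnj) simp
      qed (rule lt)
      then show ?thesis using False by simp
    qed (simp add: f(3))
  qed
  have "(adj p ** p) $ a $ b = mat 1 $ a $ b" for a b
    using orth[of b a] by (simp add: mm_entry adj_def p_def hm_def mat_def mult.commute)
  then have "adj p ** p = mat 1" by (simp add: vec_eq_iff)
  then show ?thesis using p by blast
qed

subsection \<open>Consequences of positivity for invariants\<close>

lemma V_act_zero: "V_act d \<rho> lam g (\<lambda>_. 0) = (\<lambda>_. 0)"
  by (cases lam; cases g) (simp add: V_act_def mat_act_zero)

definition star3 :: "('n::finite) cmat \<times> 'n cmat \<times> 'n cmat \<Rightarrow> 'n cmat \<times> 'n cmat \<times> 'n cmat" where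
  "star3 = (\<lambda>(a, b, c). (adj a, adj b, adj c))"

lemma star3_G3: "g \<in> G3 \<Longrightarrow> star3 g \<in> G3" by (auto simp: G3_def star3_def)
lemma star3_star3 [simp]: "star3 (star3 g) = g" by (simp add: star3_def split: prod.split)

text \<open>The extremal matrix coefficient of V_\<lambda> in the frames \<open>o1\<close> and
  \<open>o2\<close>, with the conjugate of \<open>e\<close> as covector so that the associated
  kernel is positive. Its multiplicativity in \<lambda> is visible from the formula.\<close>

definition psi :: "('n::finite) cmat \<Rightarrow> 'n cmat \<Rightarrow> complex^'n \<Rightarrow> weight3 \<Rightarrow> 'n cmat \<times> 'n cmat \<times> 'n cmat \<Rightarrow> complex" where
  "psi o1 o2 e = (\<lambda>(l1, l2, l) (g1, g2, g3). minors o1 l1 g1 * minors o2 l2 g2 * dotp (cnjv e) (g3 *v e) ^ l)"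

lemma psi_wplus: "psi o1 o2 e (lam \<oplus>\<^sub>w mu) g = psi o1 o2 e lam g * psi o1 o2 e mu g"
  by (auto simp: psi_def wplus_def minors_add power_add split: prod.split)

lemma pos_kernel_psi:
  fixes o1 o2 :: "('n::finite) cmat"
  assumes "adj o1 ** o1 = mat 1" "adj o2 ** o2 = mat 1"
  shows "pos_kernel UNIV (\<lambda>h g. psi o1 o2 e lam (mult3 (star3 h) g))"
proof -
  obtain l1 l2 l where lam: "lam = (l1, l2, l)" by (metis prod_cases3)
  have "pos_kernel UNIV (\<lambda>h g. minors o1 l1 (adj (fst h) ** fst g) *
      minors o2 l2 (adj (fst (snd h)) ** fst (snd g)) *
      dotp (cnjv e) ((adj (snd (snd h)) ** snd (snd g)) *v e) ^ l)"
    by (intro pos_kernel_mult pos_kernel_power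
        pos_kernel_pullback[OF pos_kernel_minors[OF assms(1)], where \<pi> = fst]
        pos_kernel_pullback[OF pos_kernel_minors[OF assms(2)], where \<pi> = "\<lambda>g. fst (snd g)"]
        pos_kernel_pullback[OF pos_kernel_dotp, where \<pi> = "\<lambda>g. snd (snd g)"]) simp_all
  then show ?thesis by (simp add: lam psi_def mult3_def star3_def case_prod_unfold)
qed

context
  fixes d :: "weight \<Rightarrow> nat" and \<rho> :: "weight \<Rightarrow> ('n::finite) matrep" and l1 l2 :: weight and l :: nat
    and o1 o2 :: "'n cmat" and v1 v2 :: "nat \<Rightarrow> complex" and e :: "complex^'n"
  assumes n: "CARD('n) \<ge> 2" and irr: "irreducible_rep (d l1) (\<rho> l1)" "irreducible_rep (d l2) (\<rho> l2)"
    and o: "adj o1 ** o1 = mat 1" "invertible o1" "adj o2 ** o2 = mat 1" "invertible o2"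
    and v: "is_hwv (d l1) (\<rho> l1) o1 l1 v1" "is_hwv (d l2) (\<rho> l2) o2 l2 v2" and e: "e \<noteq> 0"
begin

lemmas V_separated_by_orbit_inst = V_separated_by_orbit[where d = d and \<rho> = \<rho> and ?l1.0 = l1 and ?l2.0 = l2 and l = l, OF n irr]
lemmas V_separated_by_coorbit_inst = V_separated_by_coorbit[where d = d and \<rho> = \<rho> and ?l1.0 = l1 and ?l2.0 = l2 and l = l, OF n irr]
lemmas V_spanned_by_coorbit_inst = V_spanned_by_coorbit[where d = d and \<rho> = \<rho> and ?l1.0 = l1 and ?l2.0 = l2 and l = l, OF n irr]
lemmas V_act_mult3_inst = V_act_mult3[where d = d and \<rho> = \<rho> and ?l1.0 = l1 and ?l2.0 = l2 and l = l, OF n irr]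

abbreviation (input) "Lam \<equiv> (l1, l2, l)"
abbreviation (input) "Vv \<equiv> pure_tensor l v1 v2 e"

lemma psi_dual_exists:
  "\<exists>\<xi>1 \<xi>2. \<xi>1 \<in> cspace {..<d l1} \<and> \<xi>1 \<noteq> (\<lambda>_. 0) \<and> \<xi>2 \<in> cspace {..<d l2} \<and> \<xi>2 \<noteq> (\<lambda>_. 0) \<and> cnjv e \<noteq> 0 \<and>
    (\<forall>g\<in>G3. V_pairing d Lam (pure_tensor l \<xi>1 \<xi>2 (cnjv e)) (V_act d \<rho> Lam g Vv) = psi o1 o2 e Lam g)"
proof -
  note R = irreducible_rational[OF irr(1)] irreducible_rational[OF irr(2)]
  obtain \<xi>1 where \<xi>1: "\<xi>1 \<in> cspace {..<d l1}"
    "\<And>g. g \<in> SL \<Longrightarrow> pairing {..<d l1} \<xi>1 (mat_act {..<d l1} (\<rho> l1 g) v1) = minors o1 l1 g"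
    using dual_vector_exists[OF o(2) R(1) v(1)] by blast
  obtain \<xi>2 where \<xi>2: "\<xi>2 \<in> cspace {..<d l2}"
    "\<And>g. g \<in> SL \<Longrightarrow> pairing {..<d l2} \<xi>2 (mat_act {..<d l2} (\<rho> l2 g) v2) = minors o2 l2 g"
    using dual_vector_exists[OF o(4) R(2) v(2)] by blast
  have "\<xi>1 \<noteq> (\<lambda>_. 0)" using \<xi>1(2)[of "mat 1"] minors_one[OF o(2)] by (auto simp: pairing_def)
  moreover have "\<xi>2 \<noteq> (\<lambda>_. 0)" using \<xi>2(2)[of "mat 1"] minors_one[OF o(4)] by (auto simp: pairing_def)
  moreover have "cnjv e \<noteq> 0" using e by (auto simp: cnjv_def vec_eq_iff)
  moreover have "V_pairing d Lam (pure_tensor l \<xi>1 \<xi>2 (cnjv e)) (V_act d \<rho> Lam g Vv) = psi o1 o2 e Lam g"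
    if "g \<in> G3" for g
    using that by (auto simp: G3_def V_act_pure V_pairing_pure_pure \<xi>1(2) \<xi>2(2) psi_def)
  ultimately show ?thesis using \<xi>1(1) \<xi>2(1) by blast
qed

lemma hwv_tensor_factors: "v1 \<in> cspace {..<d l1}" "v1 \<noteq> (\<lambda>_. 0)" "v2 \<in> cspace {..<d l2}" "v2 \<noteq> (\<lambda>_. 0)"
  using v by (auto simp: is_hwv_def)

text \<open>Translating the covector by \<open>h\<close> amounts to multiplying the argument by
  \<open>inv3 h\<close>, which is the star of \<open>k = star3 (inv3 h)\<close>. Sections are thus
  combinations of kernel functions, as in a reproducing kernel space.\<close>

lemma section_as_kernel_sum:
  assumes w: "w \<in> V_space d Lam"
  shows "\<exists>(m::nat) a k. (\<forall>j<m. k j \<in> G3) \<and>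
    (\<forall>g\<in>G3. V_section d \<rho> Lam w Vv g = (\<Sum>j<m. a j * psi o1 o2 e Lam (mult3 (star3 (k j)) g)))"
proof -
  obtain \<xi>1 \<xi>2 where \<xi>: "\<xi>1 \<in> cspace {..<d l1}" "\<xi>1 \<noteq> (\<lambda>_. 0)" "\<xi>2 \<in> cspace {..<d l2}" "\<xi>2 \<noteq> (\<lambda>_. 0)" "cnjv e \<noteq> 0"
    "\<And>g. g \<in> G3 \<Longrightarrow> V_pairing d Lam (pure_tensor l \<xi>1 \<xi>2 (cnjv e)) (V_act d \<rho> Lam g Vv) = psi o1 o2 e Lam g"
    using psi_dual_exists by blast
  let ?\<Xi> = "pure_tensor l \<xi>1 \<xi>2 (cnjv e)"
  obtain m :: nat and a h where h: "\<forall>j<m. h j \<in> G3" "w = (\<lambda>I. \<Sum>j<m. a j * V_coact d \<rho> Lam (h j) ?\<Xi> I)"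
    using V_spanned_by_coorbit_inst[OF \<xi>(1-5) w] by blast
  define k where "k j = star3 (inv3 (h j))" for j
  have "V_section d \<rho> Lam w Vv g = (\<Sum>j<m. a j * psi o1 o2 e Lam (mult3 (star3 (k j)) g))" if g: "g \<in> G3" for g
  proof -
    have "V_section d \<rho> Lam w Vv g = (\<Sum>j<m. a j * V_pairing d Lam (V_coact d \<rho> Lam (h j) ?\<Xi>) (V_act d \<rho> Lam g Vv))"
      unfolding V_section_def h(2) V_pairing_linear ..
    also have "\<dots> = (\<Sum>j<m. a j * psi o1 o2 e Lam (mult3 (star3 (k j)) g))"
    proof (intro sum.cong HOL.refl)
      fix j assume "j \<in> {..<m}"
      then have hj: "h j \<in> G3" using h(1) by simp
      show "a j * V_pairing d Lam (V_coact d \<rho> Lam (h j) ?\<Xi>) (V_act d \<rho> Lam g Vv) =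
          a j * psi o1 o2 e Lam (mult3 (star3 (k j)) g)"
        unfolding V_pairing_V_coact[OF hj] V_act_mult3_inst[OF inv3_G3[OF hj] g]
        by (simp add: \<xi>(6) mult3_G3 inv3_G3 hj g k_def)
    qed
    finally show ?thesis .
  qed
  moreover have "k j \<in> G3" if "j < m" for j using h(1) that by (simp add: k_def star3_G3 inv3_G3)
  ultimately show ?thesis by blast
qed

lemma coinvariant_section:
  assumes w: "V_coinvariant d \<rho> Lam w" and k: "k \<in> SL" and g: "g \<in> G3"
  shows "V_section d \<rho> Lam w Vv (mult3 (k, k, k) g) = V_section d \<rho> Lam w Vv g"
  unfolding V_section_def
  by (rule coinvariant_pairing[where d = d and \<rho> = \<rho> and ?l1.0 = l1 and ?l2.0 = l2 and l = l, OF n irr w k g])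

text \<open>If the section of \<open>w\<close> is the sum of a_j K(k_j, -), the same points with
  conjugate coefficients give the antilinear partner \<open>u\<close> of \<open>w\<close>. Then <w,
  u> is the squared norm of the section in the kernel space, so it could vanish only together with
  the section, whose value at 1 is nonzero.\<close>

lemma invariant_pairing_nonzero:
  assumes w: "V_coinvariant d \<rho> Lam w" and nz: "V_pairing d Lam w Vv \<noteq> 0"
  shows "\<exists>u. V_invariant d \<rho> Lam u \<and> V_pairing d Lam w u \<noteq> 0"
proof -
  obtain \<xi>1 \<xi>2 where \<xi>: "\<xi>1 \<in> cspace {..<d l1}" "\<xi>1 \<noteq> (\<lambda>_. 0)" "\<xi>2 \<in> cspace {..<d l2}" "\<xi>2 \<noteq> (\<lambda>_. 0)" "cnjv e \<noteq> 0"
    "\<And>g. g \<in> G3 \<Longrightarrow> V_pairing d Lam (pure_tensor l \<xi>1 \<xi>2 (cnjv e)) (V_act d \<rho> Lam g Vv) = psi o1 o2 e Lam g"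
    using psi_dual_exists by blast
  let ?\<Xi> = "pure_tensor l \<xi>1 \<xi>2 (cnjv e)"
  let ?K = "\<lambda>h g. psi o1 o2 e Lam (mult3 (star3 h) g)"
  have K: "pos_kernel UNIV ?K" by (rule pos_kernel_psi[OF o(1,3)])
  have wV: "w \<in> V_space d Lam" using w by (simp add: V_coinvariant_def)
  obtain m :: nat and a k where k: "\<forall>j<m. k j \<in> G3"
    "\<And>g. g \<in> G3 \<Longrightarrow> V_section d \<rho> Lam w Vv g = (\<Sum>j<m. a j * ?K (k j) g)"
    using section_as_kernel_sum[OF wV] by blast
  let ?f = "V_section d \<rho> Lam w Vv"
  define u where "u = (\<lambda>I. \<Sum>j<m. cnj (a j) * V_act d \<rho> Lam (k j) Vv I)"
  have actV: "V_act d \<rho> Lam g Vv \<in> V_space d Lam" for g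
    by (cases g) (auto simp: V_act_pure intro!: pure_tensor_V_space)
  have uV: "u \<in> V_space d Lam" unfolding u_def by (intro V_space_sum actV)
  have act_u: "V_act d \<rho> Lam g u = (\<lambda>I. \<Sum>j<m. cnj (a j) * V_act d \<rho> Lam (mult3 g (k j)) Vv I)" if "g \<in> G3" for g
    unfolding u_def V_act_sum using k(1) that
    by (intro ext sum.cong HOL.refl) (simp add: V_act_mult3_inst)
  \<comment> \<open>Hermitian symmetry of the kernel exchanges the two arguments, so the
    coefficients of \<open>u\<close> are the conjugates of the values of the section.\<close>
  have pair_u: "V_pairing d Lam ?\<Xi> (V_act d \<rho> Lam (star3 g) u) = cnj (?f g)" if g: "g \<in> G3" for g
  proof -
    have "V_pairing d Lam ?\<Xi> (V_act d \<rho> Lam (star3 g) u) = (\<Sum>j<m. cnj (a j) * ?K g (k j))"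
      unfolding act_u[OF star3_G3[OF g]] V_pairing_linear
      by (intro sum.cong HOL.refl) (use k(1) in \<open>simp add: \<xi>(6) mult3_G3 star3_G3 g\<close>)
    also have "\<dots> = cnj (?f g)"
      unfolding k(2)[OF g] by (simp add: pos_kernel_hermitian[OF K, of g])
    finally show ?thesis .
  qed
  have "V_act d \<rho> Lam (x, x, x) u = u" if x: "x \<in> SL" for x
  proof -
    let ?x = "(x, x, x)"
    have xG: "?x \<in> G3" using x by (simp add: G3_def)
    define D where "D = (\<lambda>I. V_act d \<rho> Lam ?x u I + (- 1) * u I)"
    have axV: "V_act d \<rho> Lam ?x u \<in> V_space d Lam"
      unfolding act_u[OF xG] by (intro V_space_sum actV)
    have DV: "D \<in> V_space d Lam"
      using V_space_sum[of "{0, 1::nat}" "\<lambda>j. if j = 0 then V_act d \<rho> Lam ?x u else u" d Lam "\<lambda>j. if j = 0 then 1 else - 1"]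
        axV uV by (simp add: D_def)
    have "D = (\<lambda>_. 0)"
    proof (rule V_separated_by_coorbit_inst[OF \<xi>(1-5) DV])
      fix h :: "'n cmat \<times> 'n cmat \<times> 'n cmat" assume h: "h \<in> G3"
      define g where "g = star3 (inv3 h)"
      have g: "g \<in> G3" "star3 g = inv3 h" using h by (simp_all add: g_def star3_G3 inv3_G3)
      \<comment> \<open>The adjoint turns right multiplication by \<open>x\<close> into left
        multiplication by \<open>adj x\<close>, which is again in \<open>SL\<close>; invariance of
        \<open>u\<close> thus comes from invariance of the section under
        \<open>adj x\<close>.\<close>
      have sx: "star3 (mult3 (adj x, adj x, adj x) g) = mult3 (star3 g) ?x"
        by (simp add: star3_def mult3_def adj_mult split: prod.split)
      have "V_pairing d Lam (V_coact d \<rho> Lam h ?\<Xi>) D =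
          V_pairing d Lam (V_coact d \<rho> Lam h ?\<Xi>) (V_act d \<rho> Lam ?x u) - V_pairing d Lam (V_coact d \<rho> Lam h ?\<Xi>) u"
        unfolding D_def V_pairing_def pairing_add pairing_scale by simp
      also have "V_pairing d Lam (V_coact d \<rho> Lam h ?\<Xi>) u = cnj (?f g)"
        unfolding V_pairing_V_coact[OF h] g(2)[symmetric] by (rule pair_u[OF g(1)])
      also have "V_pairing d Lam (V_coact d \<rho> Lam h ?\<Xi>) (V_act d \<rho> Lam ?x u) =
          V_pairing d Lam ?\<Xi> (V_act d \<rho> Lam (mult3 (star3 g) ?x) u)"
      proof -
        have "V_act d \<rho> Lam (star3 g) (V_act d \<rho> Lam ?x u) = V_act d \<rho> Lam (mult3 (star3 g) ?x) u"
        proof -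
          have m3: "mult3 (star3 g) (mult3 ?x y) = mult3 (mult3 (star3 g) ?x) y" for y
            by (simp add: mult3_def matrix_mul_assoc split: prod.split)
          show ?thesis
            unfolding act_u[OF xG] act_u[OF mult3_G3[OF star3_G3[OF g(1)] xG]] V_act_sum
            using k(1) by (intro ext sum.cong HOL.refl)
              (simp add: V_act_mult3_inst[OF star3_G3[OF g(1)] mult3_G3[OF xG]] m3)
        qed
        then show ?thesis unfolding V_pairing_V_coact[OF h] g(2)[symmetric] by simp
      qed
      also have "\<dots> = cnj (?f (mult3 (adj x, adj x, adj x) g))"
        unfolding sx[symmetric] using x g(1) by (intro pair_u mult3_G3) (simp_all add: G3_def)
      also have "\<dots> = cnj (?f g)" by (simp add: coinvariant_section[OF w adj_SL[OF x] g(1)])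
      finally show "V_pairing d Lam (V_coact d \<rho> Lam h ?\<Xi>) D = 0" by simp
    qed
    then show ?thesis by (auto simp: D_def fun_eq_iff)
  qed
  then have inv: "V_invariant d \<rho> Lam u" using uV by (simp add: V_invariant_def)
  have "V_pairing d Lam w u \<noteq> 0"
  proof
    assume z: "V_pairing d Lam w u = 0"
    have "V_pairing d Lam w u = (\<Sum>j<m. cnj (a j) * ?f (k j))"
      unfolding u_def V_pairing_linear V_section_def ..
    also have "\<dots> = (\<Sum>j<m. \<Sum>i<m. cnj (a j) * a i * ?K (k i) (k j))"
      using k by (intro sum.cong HOL.refl) (simp add: sum_distrib_left mult.assoc)
    \<comment> \<open>This is the hermitian form of the kernel at the coefficients
      \<open>cnj (a j)\<close>, with the two summation indices exchanged.\<close>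
    finally have z': "(\<Sum>j<m. \<Sum>i<m. cnj (a j) * a i * ?K (k i) (k j)) = 0" using z by simp
    have "(\<Sum>j<m. \<Sum>i<m. cnj (cnj (a j)) * cnj (a i) * ?K (k j) (k i)) = 0"
    proof -
      have "(\<Sum>j<m. \<Sum>i<m. cnj (cnj (a j)) * cnj (a i) * ?K (k j) (k i)) =
          (\<Sum>i<m. \<Sum>j<m. cnj (a i) * a j * ?K (k j) (k i))"
        by (subst sum.swap) (simp add: mult_ac)
      then show ?thesis using z' by simp
    qed
    from pos_kernel_null[OF K _ this, of "(mat 1, mat 1, mat 1)"]
    have "(\<Sum>i<m. cnj (a i) * ?K (mat 1, mat 1, mat 1) (k i)) = 0" by simp
    then have "cnj (\<Sum>i<m. cnj (a i) * ?K (mat 1, mat 1, mat 1) (k i)) = 0" by simp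
    then have "(\<Sum>i<m. a i * ?K (k i) (mat 1, mat 1, mat 1)) = 0"
      by (simp add: pos_kernel_hermitian[OF K, of "(mat 1, mat 1, mat 1)"])
    then have "?f (mat 1, mat 1, mat 1) = 0" using k(2)[OF one_G3] by simp
    moreover have "V_act d \<rho> Lam (mat 1, mat 1, mat 1) Vv = Vv"
      using hwv_tensor_factors by (simp add: V_act_pure act_one[OF irreducible_rational[OF irr(1)]]
          act_one[OF irreducible_rational[OF irr(2)]])
    ultimately show False using nz by (simp add: V_section_def)
  qed
  then show ?thesis using inv by blast
qed

text \<open>The positive kernel identifies the span of the orbit of the highest weight vector with its
  image (the Cartan component) in the tensor product of the two smaller representations.\<close>

lemma coinvariant_from_function:
  assumes K: "\<And>g. g \<in> G3 \<Longrightarrow> psi o1 o2 e Lam g = K1 g * K2 g"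
    and P: "pos_kernel UNIV (\<lambda>h g. K1 (mult3 (star3 h) g))" "pos_kernel UNIV (\<lambda>h g. K2 (mult3 (star3 h) g))"
    and f: "\<And>g. g \<in> G3 \<Longrightarrow> f1 g = (\<Sum>j<m. a j * K1 (mult3 (star3 (k j)) g))"
      "\<And>g. g \<in> G3 \<Longrightarrow> f2 g = (\<Sum>j<m'. a' j * K2 (mult3 (star3 (k' j)) g))"
    and inv: "\<And>x g. x \<in> SL \<Longrightarrow> g \<in> G3 \<Longrightarrow> f1 (mult3 (x, x, x) g) * f2 (mult3 (x, x, x) g) = f1 g * f2 g"
    and nz: "f1 (mat 1, mat 1, mat 1) * f2 (mat 1, mat 1, mat 1) \<noteq> 0"
  shows "\<exists>w. V_coinvariant d \<rho> Lam w \<and> w \<noteq> (\<lambda>_. 0)"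
proof -
  let ?one = "(mat 1, mat 1, mat 1) :: 'n cmat \<times> 'n cmat \<times> 'n cmat"
  obtain \<xi>1 \<xi>2 where \<xi>: "\<xi>1 \<in> cspace {..<d l1}" "\<xi>1 \<noteq> (\<lambda>_. 0)" "\<xi>2 \<in> cspace {..<d l2}" "\<xi>2 \<noteq> (\<lambda>_. 0)" "cnjv e \<noteq> 0"
    "\<And>g. g \<in> G3 \<Longrightarrow> V_pairing d Lam (pure_tensor l \<xi>1 \<xi>2 (cnjv e)) (V_act d \<rho> Lam g Vv) = psi o1 o2 e Lam g"
    using psi_dual_exists by blast
  let ?\<Xi> = "pure_tensor l \<xi>1 \<xi>2 (cnjv e)"
  have actV: "V_act d \<rho> Lam g Vv \<in> V_space d Lam" for g
    by (cases g) (auto simp: V_act_pure intro!: pure_tensor_V_space)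
  have "\<exists>w\<in>cspace (idx d Lam). \<forall>g\<in>G3. pairing (idx d Lam) w (V_act d \<rho> Lam g Vv) = f1 g * f2 g"
  proof (rule functional_from_relations[OF finite_idx])
    show "V_act d \<rho> Lam g Vv \<in> cspace (idx d Lam)" for g using actV V_space_cspace by blast
    fix q :: nat and c and g :: "nat \<Rightarrow> 'n cmat \<times> 'n cmat \<times> 'n cmat"
    assume g: "\<forall>i<q. g i \<in> G3" and rel: "\<forall>I. (\<Sum>i<q. c i * V_act d \<rho> Lam (g i) Vv I) = 0"
    \<comment> \<open>A relation between orbit vectors persists after translation by
      \<open>h\<close>, so it is seen by the kernel at every point.\<close>
    have rel': "(\<Sum>i<q. c i * psi o1 o2 e Lam (mult3 h (g i))) = 0" if h: "h \<in> G3" for h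
    proof -
      have "V_act d \<rho> Lam h (\<lambda>I. \<Sum>i<q. c i * V_act d \<rho> Lam (g i) Vv I) = (\<lambda>_. 0)"
      proof -
        have "(\<lambda>I. \<Sum>i<q. c i * V_act d \<rho> Lam (g i) Vv I) = (\<lambda>_. 0)" using rel by blast
        then show ?thesis by (simp only: V_act_zero)
      qed
      then have "V_pairing d Lam ?\<Xi> (\<lambda>I. \<Sum>i<q. c i * V_act d \<rho> Lam h (V_act d \<rho> Lam (g i) Vv) I) = 0"
        unfolding V_act_sum by (simp add: V_pairing_def pairing_def)
      then have "(\<Sum>i<q. c i * V_pairing d Lam ?\<Xi> (V_act d \<rho> Lam h (V_act d \<rho> Lam (g i) Vv))) = 0"
        unfolding V_pairing_linear .
      moreover have "(\<Sum>i<q. c i * V_pairing d Lam ?\<Xi> (V_act d \<rho> Lam h (V_act d \<rho> Lam (g i) Vv))) =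
          (\<Sum>i<q. c i * psi o1 o2 e Lam (mult3 h (g i)))"
        using g h by (intro sum.cong HOL.refl) (simp add: V_act_mult3_inst \<xi>(6) mult3_G3)
      ultimately show ?thesis by simp
    qed
    obtain S :: "nat set" and \<Phi> where S: "finite S"
      "\<And>g h. K1 (mult3 (star3 h) g) = (\<Sum>s\<in>S. \<Phi> s g * cnj (\<Phi> s h))"
      using P(1) unfolding pos_kernel_def by blast
    obtain T :: "nat set" and \<Psi> where T: "finite T"
      "\<And>g h. K2 (mult3 (star3 h) g) = (\<Sum>s\<in>T. \<Psi> s g * cnj (\<Psi> s h))"
      using P(2) unfolding pos_kernel_def by blast
    define y where "y = (\<lambda>(s, t). \<Sum>i<q. c i * \<Phi> s (g i) * \<Psi> t (g i))"
    have KK: "(\<Sum>i<q. c i * (K1 (mult3 (star3 h) (g i)) * K2 (mult3 (star3 h') (g i)))) =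
        (\<Sum>(s, t)\<in>S \<times> T. y (s, t) * cnj (\<Phi> s h * \<Psi> t h'))" for h h'
    proof -
      have "(\<Sum>i<q. c i * (K1 (mult3 (star3 h) (g i)) * K2 (mult3 (star3 h') (g i)))) =
          (\<Sum>i<q. \<Sum>x\<in>S \<times> T. c i * \<Phi> (fst x) (g i) * \<Psi> (snd x) (g i) * cnj (\<Phi> (fst x) h * \<Psi> (snd x) h'))"
      proof (intro sum.cong HOL.refl)
        fix i
        show "c i * (K1 (mult3 (star3 h) (g i)) * K2 (mult3 (star3 h') (g i))) =
          (\<Sum>x\<in>S \<times> T. c i * \<Phi> (fst x) (g i) * \<Psi> (snd x) (g i) * cnj (\<Phi> (fst x) h * \<Psi> (snd x) h'))"
          unfolding S(2) T(2) sum_product sum.cartesian_product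
          by (simp add: sum_distrib_left case_prod_unfold mult_ac)
      qed
      also have "\<dots> = (\<Sum>x\<in>S \<times> T. \<Sum>i<q. c i * \<Phi> (fst x) (g i) * \<Psi> (snd x) (g i) * cnj (\<Phi> (fst x) h * \<Psi> (snd x) h'))"
        by (rule sum.swap)
      finally show ?thesis by (simp add: y_def case_prod_unfold sum_distrib_right)
    qed
    \<comment> \<open>The squared norm of the combined feature vector only involves both kernels at
      the same point \<open>g j\<close>, where their product is \<open>psi\<close> and
      \<open>rel'\<close> applies.\<close>
    have "(\<Sum>x\<in>S \<times> T. y x * cnj (y x)) = 0"
    proof -
      have "(\<Sum>j<q. cnj (c j) * (\<Sum>(s, t)\<in>S \<times> T. y (s, t) * cnj (\<Phi> s (g j) * \<Psi> t (g j)))) = 0"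
      proof (intro sum.neutral ballI)
        fix j assume "j \<in> {..<q}"
        then have gj: "g j \<in> G3" using g by simp
        have "(\<Sum>i<q. c i * (K1 (mult3 (star3 (g j)) (g i)) * K2 (mult3 (star3 (g j)) (g i)))) =
            (\<Sum>i<q. c i * psi o1 o2 e Lam (mult3 (star3 (g j)) (g i)))"
          using g by (intro sum.cong HOL.refl) (simp add: K mult3_G3 star3_G3 gj)
        also have "\<dots> = 0" by (rule rel'[OF star3_G3[OF gj]])
        finally show "cnj (c j) * (\<Sum>(s, t)\<in>S \<times> T. y (s, t) * cnj (\<Phi> s (g j) * \<Psi> t (g j))) = 0"
          unfolding KK by simp
      qed
      moreover have "(\<Sum>j<q. cnj (c j) * (\<Sum>(s, t)\<in>S \<times> T. y (s, t) * cnj (\<Phi> s (g j) * \<Psi> t (g j)))) =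
          (\<Sum>j<q. \<Sum>x\<in>S \<times> T. y x * (cnj (c j) * cnj (\<Phi> (fst x) (g j) * \<Psi> (snd x) (g j))))"
        by (simp add: sum_distrib_left case_prod_unfold mult_ac)
      moreover have "\<dots> = (\<Sum>x\<in>S \<times> T. \<Sum>j<q. y x * (cnj (c j) * cnj (\<Phi> (fst x) (g j) * \<Psi> (snd x) (g j))))"
        by (rule sum.swap)
      moreover have "\<dots> = (\<Sum>x\<in>S \<times> T. y x * cnj (y x))"
        by (simp add: y_def case_prod_unfold sum_distrib_left mult_ac)
      ultimately show ?thesis by simp
    qed
    then have y0: "y x = 0" if "x \<in> S \<times> T" for x
      using sum_mult_cnj_zero[of "S \<times> T" y x] S(1) T(1) that by simp
    \<comment> \<open>With the feature vector zero, the relation holds at independent points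
      \<open>h\<close> and \<open>h'\<close>, which is what the product of the two expansions
      \<open>f1\<close> and \<open>f2\<close> requires.\<close>
    have KK0: "(\<Sum>i<q. c i * (K1 (mult3 (star3 h) (g i)) * K2 (mult3 (star3 h') (g i)))) = 0" for h h'
      unfolding KK using y0 by (intro sum.neutral) auto
    have "(\<Sum>i<q. c i * (f1 (g i) * f2 (g i))) =
        (\<Sum>i<q. \<Sum>x\<in>{..<m} \<times> {..<m'}. a (fst x) * a' (snd x) *
          (c i * (K1 (mult3 (star3 (k (fst x))) (g i)) * K2 (mult3 (star3 (k' (snd x))) (g i)))))"
    proof (intro sum.cong HOL.refl)
      fix i assume "i \<in> {..<q}"
      then have gi: "g i \<in> G3" using g by simp
      show "c i * (f1 (g i) * f2 (g i)) = (\<Sum>x\<in>{..<m} \<times> {..<m'}. a (fst x) * a' (snd x) *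
          (c i * (K1 (mult3 (star3 (k (fst x))) (g i)) * K2 (mult3 (star3 (k' (snd x))) (g i)))))"
        unfolding f(1)[OF gi] f(2)[OF gi] sum_product sum.cartesian_product
        by (simp add: sum_distrib_left case_prod_unfold mult_ac)
    qed
    also have "\<dots> = (\<Sum>x\<in>{..<m} \<times> {..<m'}. a (fst x) * a' (snd x) *
          (\<Sum>i<q. c i * (K1 (mult3 (star3 (k (fst x))) (g i)) * K2 (mult3 (star3 (k' (snd x))) (g i)))))"
      by (subst sum.swap) (simp add: sum_distrib_left)
    finally show "(\<Sum>i<q. c i * (f1 (g i) * f2 (g i))) = 0" by (simp add: KK0)
  qed
  then obtain w0 where w0: "w0 \<in> cspace (idx d Lam)"
    "\<And>g. g \<in> G3 \<Longrightarrow> V_pairing d Lam w0 (V_act d \<rho> Lam g Vv) = f1 g * f2 g"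
    by (auto simp: V_pairing_def)
  \<comment> \<open>The functional found so far lives on the full coordinate space; symmetrizing
    places it in the dual of V_\<lambda> without changing its values on the orbit.\<close>
  obtain w where w: "w \<in> V_space d Lam" "\<forall>u\<in>V_space d Lam. V_pairing d Lam u w = V_pairing d Lam u w0"
    using symmetrization_exists[OF w0(1)] by blast
  have wf: "V_pairing d Lam w (V_act d \<rho> Lam g Vv) = f1 g * f2 g" if "g \<in> G3" for g
    using w(2) actV w0(2)[OF that] by (metis V_pairing_commute)
  obtain r :: nat and b h where h: "\<forall>j<r. h j \<in> G3" "w = (\<lambda>I. \<Sum>j<r. b j * V_coact d \<rho> Lam (h j) ?\<Xi> I)"
    using V_spanned_by_coorbit_inst[OF \<xi>(1-5) w(1)] by blast
  have "V_coact d \<rho> Lam (x, x, x) w = w" if x: "x \<in> SL" for x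
  proof -
    let ?x = "(x, x, x)"
    have xG: "?x \<in> G3" using x by (simp add: G3_def)
    have cV: "V_coact d \<rho> Lam ?x w \<in> V_space d Lam"
    proof -
      have "V_coact d \<rho> Lam ?x (V_coact d \<rho> Lam g ?\<Xi>) \<in> V_space d Lam" for g
        by (cases g) (auto simp: V_coact_pure intro!: pure_tensor_V_space simp del: transpose_matrix_vector)
      then show ?thesis unfolding h(2) V_coact_sum by (intro V_space_sum)
    qed
    define D where "D = (\<lambda>I. V_coact d \<rho> Lam ?x w I + (- 1) * w I)"
    have DV: "D \<in> V_space d Lam"
      using V_space_sum[of "{0, 1::nat}" "\<lambda>j. if j = 0 then V_coact d \<rho> Lam ?x w else w" d Lam "\<lambda>j. if j = 0 then 1 else - 1"]
        cV w(1) by (simp add: D_def)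
    have "D = (\<lambda>_. 0)"
    proof (rule V_separated_by_orbit_inst[OF hwv_tensor_factors e DV])
      fix g :: "'n cmat \<times> 'n cmat \<times> 'n cmat" assume g: "g \<in> G3"
      have xi: "matrix_inv x \<in> SL" using x by simp
      have ix: "inv3 ?x = (matrix_inv x, matrix_inv x, matrix_inv x)" by (simp add: inv3_def)
      have "V_pairing d Lam D (V_act d \<rho> Lam g Vv) =
          V_pairing d Lam (V_coact d \<rho> Lam ?x w) (V_act d \<rho> Lam g Vv) - V_pairing d Lam w (V_act d \<rho> Lam g Vv)"
        unfolding D_def V_pairing_def pairing_add pairing_scale by simp
      also have "V_pairing d Lam (V_coact d \<rho> Lam ?x w) (V_act d \<rho> Lam g Vv) =
          f1 (mult3 (inv3 ?x) g) * f2 (mult3 (inv3 ?x) g)"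
        unfolding V_pairing_V_coact[OF xG] V_act_mult3_inst[OF inv3_G3[OF xG] g]
        by (rule wf) (intro mult3_G3 inv3_G3 xG g)
      also have "\<dots> = f1 g * f2 g" unfolding ix by (rule inv[OF xi g])
      finally show "V_pairing d Lam D (V_act d \<rho> Lam g Vv) = 0" by (simp add: wf[OF g])
    qed
    then show ?thesis by (auto simp: D_def fun_eq_iff)
  qed
  then have "V_coinvariant d \<rho> Lam w" using w(1) by (simp add: V_coinvariant_def)
  moreover have "w \<noteq> (\<lambda>_. 0)"
  proof
    assume "w = (\<lambda>_. 0)"
    then have "f1 ?one * f2 ?one = 0" using wf[OF one_G3] by (simp add: V_pairing_def pairing_def)
    then show False using nz by simp
  qed
  ultimately show ?thesis by blast
qed

end

subsection \<open>Stabilizers and dense orbits\<close>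

lemma conj_set_mult: "g \<in> SL \<Longrightarrow> h \<in> SL \<Longrightarrow> conj_set g (conj_set h B) = conj_set (g ** h) B"
  by (simp add: conj_set_def image_image matrix_inv_mult_SL matrix_mul_assoc)

lemma conj_set_one: "conj_set (mat 1) B = B"
  by (simp add: conj_set_def)

lemma conj3_mult3: "g \<in> G3 \<Longrightarrow> h \<in> G3 \<Longrightarrow> conj3 g (conj3 h x) = conj3 (mult3 g h) x"
  by (auto simp: conj3_def mult3_def G3_def conj_set_mult split: prod.split)

lemma conj3_one: "conj3 (mat 1, mat 1, mat 1) x = x"
  by (simp add: conj3_def conj_set_one split: prod.split)

text \<open>The elements that move \<open>x\<close> within its diagonal orbit form an open set
  containing 1. Each of them is (k, k, k) times an element of the stabilizer of \<open>x\<close>, so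
  \<open>zero\<close> covers this set and the identity principle extends it.\<close>

lemma open_orbit_identity:
  fixes x :: "('n::finite) triple"
  assumes x: "in_open_orbit X x" and f: "f \<in> polynomial_functions triple_coords"
    and zero: "\<And>k b. k \<in> SL \<Longrightarrow> b \<in> G3 \<Longrightarrow> conj3 b x = x \<Longrightarrow> f (mult3 (k, k, k) b) = 0"
    and g: "g \<in> G3"
  shows "f g = 0"
proof (rule identity_G3[OF f])
  let ?U = "{g \<in> G3. conj3 g x \<in> {conj3 (g, g, g) x | g. g \<in> SL}}"
  show "openin (top_of_set G3) ?U" using x unfolding in_open_orbit_def open_in_var_def by blast
  show "(mat 1, mat 1, mat 1) \<in> ?U" using one_G3 by (auto intro!: exI[of _ "mat 1"])
  show "f g = 0" if gU: "g \<in> ?U" for g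
  proof -
    obtain k where k: "k \<in> SL" "conj3 g x = conj3 (k, k, k) x" using gU by blast
    have gG: "g \<in> G3" using gU by blast
    have kG: "(k, k, k) \<in> G3" using k(1) by (simp add: G3_def)
    define b where "b = mult3 (inv3 (k, k, k)) g"
    have bG: "b \<in> G3" by (simp add: b_def mult3_G3 inv3_G3 kG gG)
    have "conj3 b x = conj3 (mult3 (inv3 (k, k, k)) (k, k, k)) x"
      unfolding b_def by (simp add: conj3_mult3[symmetric] inv3_G3 kG gG k(2))
    also have "mult3 (inv3 (k, k, k)) (k, k, k) = (mat 1, mat 1, mat 1)"
      using k(1) by (simp add: mult3_def inv3_def SL_inv)
    finally have "f (mult3 (k, k, k) b) = 0" by (intro zero[OF k(1) bG]) (simp add: conj3_one)
    moreover have "mult3 (k, k, k) b = g"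
      using k(1) by (simp add: b_def mult3_def inv3_def matrix_mul_assoc SL_inv split: prod.split)
    ultimately show ?thesis by simp
  qed
  show "g \<in> G3" by (rule g)
qed

definition poly_on_G3 :: "(('n::finite) cmat \<times> 'n cmat \<times> 'n cmat \<Rightarrow> complex) \<Rightarrow> bool" where
  "poly_on_G3 F \<longleftrightarrow> (\<exists>f\<in>polynomial_functions triple_coords. \<forall>g\<in>G3. F g = f g)"

lemma open_orbit_identity_on_G3:
  fixes x :: "('n::finite) triple"
  assumes x: "in_open_orbit X x" and F: "poly_on_G3 F" "poly_on_G3 F'"
    and eq: "\<And>k b. k \<in> SL \<Longrightarrow> b \<in> G3 \<Longrightarrow> conj3 b x = x \<Longrightarrow> F (mult3 (k, k, k) b) = F' (mult3 (k, k, k) b)"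
    and g: "g \<in> G3"
  shows "F g = F' g"
proof -
  obtain f f' where f: "f \<in> polynomial_functions triple_coords" "\<forall>g\<in>G3. F g = f g"
    and f': "f' \<in> polynomial_functions triple_coords" "\<forall>g\<in>G3. F' g = f' g"
    using F unfolding poly_on_G3_def by blast
  have "f g - f' g = 0"
  proof (rule open_orbit_identity[OF x polynomial_functions_diff[OF f(1) f'(1)] _ g])
    fix k :: "'n cmat" and b :: "'n cmat \<times> 'n cmat \<times> 'n cmat"
    assume kb: "k \<in> SL" "b \<in> G3" "conj3 b x = x"
    then have "mult3 (k, k, k) b \<in> G3" by (intro mult3_G3) (simp_all add: G3_def)
    then show "f (mult3 (k, k, k) b) - f' (mult3 (k, k, k) b) = 0"
      using eq[OF kb] f(2) f'(2) by simp
  qed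
  then show ?thesis using f(2) f'(2) g by simp
qed

lemma poly_on_G3_mult: "poly_on_G3 F \<Longrightarrow> poly_on_G3 F' \<Longrightarrow> poly_on_G3 (\<lambda>g. F g * F' g)"
  unfolding poly_on_G3_def by (metis (mono_tags, lifting) polynomial_functions.mult)

lemma triple_coords_component:
  assumes "f \<in> polynomial_functions mat_coords"
  shows "(\<lambda>g. f (fst g)) \<in> polynomial_functions triple_coords"
    "(\<lambda>g. f (fst (snd g))) \<in> polynomial_functions triple_coords"
    "(\<lambda>g. f (snd (snd g))) \<in> polynomial_functions triple_coords"
  by (rule polynomial_functions_compose[OF assms]; rule polynomial_functions.coord;
      force simp: mat_coords_def triple_coords_def case_prod_unfold)+

lemma pure_tensor_pairing_polynomial:
  fixes \<gamma> :: "('n::finite) cmat \<Rightarrow> complex^'n"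
  assumes \<alpha>: "\<And>i. i < d l1 \<Longrightarrow> \<exists>f\<in>polynomial_functions mat_coords. \<forall>g\<in>SL. \<alpha> g i = f g"
    and \<beta>: "\<And>i. i < d l2 \<Longrightarrow> \<exists>f\<in>polynomial_functions mat_coords. \<forall>g\<in>SL. \<beta> g i = f g"
    and \<gamma>: "\<And>k. \<exists>f\<in>polynomial_functions mat_coords. \<forall>g\<in>SL. \<gamma> g $ k = f g"
  shows "poly_on_G3 (\<lambda>g. V_pairing d (l1, l2, l) w (pure_tensor l (\<alpha> (fst g)) (\<beta> (fst (snd g))) (\<gamma> (snd (snd g)))))"
proof -
  obtain A where A: "\<And>i. i < d l1 \<Longrightarrow> A i \<in> polynomial_functions mat_coords \<and> (\<forall>g\<in>SL. \<alpha> g i = A i g)"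
    using \<alpha> by metis
  obtain B where B: "\<And>i. i < d l2 \<Longrightarrow> B i \<in> polynomial_functions mat_coords \<and> (\<forall>g\<in>SL. \<beta> g i = B i g)"
    using \<beta> by metis
  obtain C where C: "\<And>k. C k \<in> polynomial_functions mat_coords" "\<And>k g. g \<in> SL \<Longrightarrow> \<gamma> g $ k = C k g"
    using \<gamma> by metis
  let ?f = "\<lambda>g. \<Sum>i<d l1. \<Sum>j<d l2. \<Sum>xs | length xs = l. w (i, j, xs) *
    (A i (fst g) * B j (fst (snd g)) * prod_list (map (\<lambda>k. C k (snd (snd g))) xs))"
  have "?f \<in> polynomial_functions triple_coords"
    using A B C(1) by (intro polynomial_functions_sum polynomial_functions_cmult polynomial_functions.mult
        polynomial_functions_prod_list triple_coords_component) auto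
  moreover have "V_pairing d (l1, l2, l) w (pure_tensor l (\<alpha> (fst g)) (\<beta> (fst (snd g))) (\<gamma> (snd (snd g)))) = ?f g"
    if "g \<in> G3" for g
  proof -
    have g: "fst g \<in> SL" "fst (snd g) \<in> SL" "snd (snd g) \<in> SL" using that by (auto simp: G3_def)
    have "($) (\<gamma> (snd (snd g))) = (\<lambda>k. C k (snd (snd g)))" using C(2)[OF g(3)] by (intro ext)
    then have c: "lprod (\<gamma> (snd (snd g))) xs = prod_list (map (\<lambda>k. C k (snd (snd g))) xs)" for xs
      unfolding lprod_def by (simp only:)
    have a: "\<alpha> (fst g) i = A i (fst g)" if "i < d l1" for i using A[OF that] g(1) by blast
    have b: "\<beta> (fst (snd g)) i = B i (fst (snd g))" if "i < d l2" for i using B[OF that] g(2) by blast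
    show ?thesis
      unfolding V_pairing_pure c by (intro sum.cong HOL.refl) (simp add: a b)
  qed
  ultimately show ?thesis unfolding poly_on_G3_def by (intro bexI[of _ ?f] ballI)
qed

lemma orbit_coordinate_polynomial:
  assumes "rational_rep d \<rho>" "i < d"
  shows "\<exists>f\<in>polynomial_functions mat_coords. \<forall>g\<in>SL. mat_act {..<d} (\<rho> g) v i = f g"
  using matrix_coefficient_polynomial[OF assms(1), of "unit_vec i" v] assms(2)
  by (simp add: pairing_unit_vec)

lemma V_act_pairing_polynomial:
  assumes R: "rational_rep (d l1) (\<rho> l1)" "rational_rep (d l2) (\<rho> l2)"
  shows "poly_on_G3 (\<lambda>g. V_pairing d (l1, l2, l) w (V_act d \<rho> (l1, l2, l) g (pure_tensor l \<alpha> \<beta> (\<gamma> :: complex^'n::finite))))"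
proof -
  have "V_act d \<rho> (l1, l2, l) g (pure_tensor l \<alpha> \<beta> \<gamma>) = pure_tensor l (mat_act {..<d l1} (\<rho> l1 (fst g)) \<alpha>)
      (mat_act {..<d l2} (\<rho> l2 (fst (snd g))) \<beta>) (snd (snd g) *v \<gamma>)" for g
    by (cases g) (simp add: V_act_pure)
  moreover have "\<exists>f\<in>polynomial_functions mat_coords. \<forall>g\<in>SL. (g *v \<gamma>) $ k = f g" for k
    unfolding mv_entry
    by (intro bexI[of _ "\<lambda>g. \<Sum>j\<in>UNIV. g $ k $ j * \<gamma> $ j"] ballI HOL.refl polynomial_functions_sum
        polynomial_functions.mult polynomial_functions.const polynomial_functions.coord)
      (auto simp: mat_coords_def)
  moreover have "poly_on_G3 (\<lambda>g. V_pairing d (l1, l2, l) w (pure_tensor l (mat_act {..<d l1} (\<rho> l1 (fst g)) \<alpha>)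
      (mat_act {..<d l2} (\<rho> l2 (fst (snd g))) \<beta>) (snd (snd g) *v \<gamma>)))"
    by (rule pure_tensor_pairing_polynomial[where \<alpha> = "\<lambda>g. mat_act {..<d l1} (\<rho> l1 g) \<alpha>"
          and \<beta> = "\<lambda>g. mat_act {..<d l2} (\<rho> l2 g) \<beta>" and \<gamma> = "\<lambda>g. g *v \<gamma>",
          OF orbit_coordinate_polynomial[OF R(1)] orbit_coordinate_polynomial[OF R(2)] calculation(2)])
  ultimately show ?thesis by simp
qed

lemma V_coact_pairing_polynomial:
  assumes R: "rational_rep (d l1) (\<rho> l1)" "rational_rep (d l2) (\<rho> l2)"
  shows "poly_on_G3 (\<lambda>g. V_pairing d (l1, l2, l) (V_coact d \<rho> (l1, l2, l) g (pure_tensor l \<alpha> \<beta> (\<gamma> :: complex^'n::finite))) u)"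
proof -
  have "V_coact d \<rho> (l1, l2, l) g (pure_tensor l \<alpha> \<beta> \<gamma>) = pure_tensor l (mat_act {..<d l1} (contragredient (\<rho> l1) (fst g)) \<alpha>)
      (mat_act {..<d l2} (contragredient (\<rho> l2) (fst (snd g))) \<beta>) (transpose (matrix_inv (snd (snd g))) *v \<gamma>)" for g
    by (cases g) (simp add: V_coact_pure del: transpose_matrix_vector)
  moreover have "\<exists>f\<in>polynomial_functions mat_coords. \<forall>g\<in>SL. (transpose (matrix_inv g) *v \<gamma>) $ k = f g" for k
  proof -
    have "(\<lambda>g. \<Sum>j\<in>UNIV. g $ j $ k * \<gamma> $ j) \<in> polynomial_functions mat_coords"
      by (intro polynomial_functions_sum polynomial_functions.mult polynomial_functions.const polynomial_functions.coord)
        (auto simp: mat_coords_def)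
    from polynomial_matrix_inv[OF this] show ?thesis
      by (simp add: mv_entry transpose_def del: transpose_matrix_vector)
  qed
  moreover have "poly_on_G3 (\<lambda>g. V_pairing d (l1, l2, l) u (pure_tensor l (mat_act {..<d l1} (contragredient (\<rho> l1) (fst g)) \<alpha>)
      (mat_act {..<d l2} (contragredient (\<rho> l2) (fst (snd g))) \<beta>) (transpose (matrix_inv (snd (snd g))) *v \<gamma>)))"
    by (rule pure_tensor_pairing_polynomial[where \<alpha> = "\<lambda>g. mat_act {..<d l1} (contragredient (\<rho> l1) g) \<alpha>"
          and \<beta> = "\<lambda>g. mat_act {..<d l2} (contragredient (\<rho> l2) g) \<beta>"
          and \<gamma> = "\<lambda>g. transpose (matrix_inv g) *v \<gamma>",
          OF orbit_coordinate_polynomial[OF rational_rep_contragredient[OF R(1)]]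
            orbit_coordinate_polynomial[OF rational_rep_contragredient[OF R(2)]] calculation(2)])
  ultimately show ?thesis
    unfolding V_pairing_commute[of _ _ _ u] by (simp del: transpose_matrix_vector)
qed

subsection \<open>The operator on a single flag variety\<close>

text \<open>A highest weight vector together with an extremal covector that does not annihilate it.
  The last clause stores the extremal coefficient, from which the behaviour of \<xi> under the lower
  triangular group is recovered when needed.\<close>

definition hwv_pair :: "nat \<Rightarrow> ('n::finite) matrep \<Rightarrow> 'n cmat \<Rightarrow> weight \<Rightarrow> (nat \<Rightarrow> complex) \<Rightarrow> (nat \<Rightarrow> complex) \<Rightarrow> bool" where
  "hwv_pair d \<rho> p \<nu> v \<xi> \<longleftrightarrow> irreducible_rep d \<rho> \<and> is_hwv d \<rho> p \<nu> v \<and> \<xi> \<in> cspace {..<d} \<and> pairing {..<d} \<xi> v \<noteq> 0 \<and>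
     (\<forall>g\<in>SL. pairing {..<d} \<xi> (mat_act {..<d} (\<rho> g) v) = pairing {..<d} \<xi> v * minors p \<nu> g)"

text \<open>Two frames of one flag meet here: \<open>p\<close> comes from the opposite pair,
  \<open>r\<close> diagonalizes the given Cartan subalgebra. Equivariance is proved in
  \<open>r\<close>, carried over to \<open>p\<close> through the common weight character, and
  factorized in \<open>p\<close>.\<close>

lemma flag_symbol:
  fixes p :: "('n::finite) cmat" and y :: "nat \<Rightarrow> 'n Ug"
  assumes n: "CARD('n) \<ge> 2" and p: "invertible p" "complete_flag (frame_flag p)"
    and l: "hwv_pair dl \<rho>l p \<kappa> vl \<xi>l" and m: "hwv_pair dm \<rho>m p \<mu> vm \<xi>m"
    and s: "hwv_pair ds \<rho>s p (\<lambda>i. \<kappa> i + \<mu> i) vs \<xi>s"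
    and h: "cartan_subalgebra \<hh>" "\<hh> \<subseteq> lie_algebra_of (borel_grp up p)"
    and y: "semi_invariant_generator dm \<rho>m \<mu> (borel_grp up p) \<hh> y"
  shows "\<exists>c. \<forall>h\<in>SL. \<forall>a\<in>SL. \<forall>k<dm.
    pairing {..<ds} (mat_act {..<ds} (contragredient \<rho>s h) \<xi>s)
      (twist dm \<rho>m ds \<rho>s (\<lambda>j. Uact ds \<rho>s (y j) vs) a k) =
    c * mat_act {..<dm} (contragredient \<rho>m h) \<xi>m k *
      pairing {..<dl} (mat_act {..<dl} (contragredient \<rho>l h) \<xi>l) (mat_act {..<dl} (\<rho>l a) vl)"
proof -
  note B = flag_stab_frame[OF p(1)]
  obtain r where r: "invertible r" "frame_flag p = frame_flag r" "\<hh> = {x. diagonal_mat (conj_from r (sl_mat x))}"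
    using cartan_frame[OF n p(2) h[folded B]] by blast
  have R: "rational_rep dl \<rho>l" "rational_rep dm \<rho>m" "rational_rep ds \<rho>s"
    using l m s irreducible_rational unfolding hwv_pair_def by blast+
  have vs: "is_hwv ds \<rho>s p (\<lambda>i. \<kappa> i + \<mu> i) vs" using s by (simp add: hwv_pair_def)
  have vsr: "is_hwv ds \<rho>s r (\<lambda>i. \<kappa> i + \<mu> i) vs" by (rule is_hwv_frame_change[OF p(1) r(1,2) vs])
  have yr: "y \<in> semi_invariants dm \<rho>m \<mu> (flag_stab (frame_flag r)) {x. diagonal_mat (conj_from r (sl_mat x))}"
    using y unfolding semi_invariant_generator_def by (simp add: B[symmetric] r(2,3))
  have eqv: "twist dm \<rho>m ds \<rho>s (\<lambda>j. Uact ds \<rho>s (y j) vs) b k = (\<lambda>i. wt p \<kappa> b * Uact ds \<rho>s (y k) vs i)"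
    if b: "b \<in> borel_grp up p" and k: "k < dm" for b k
    using symbol_borel_equivariant[OF n r(1) p(2)[unfolded r(2)] R(2,3) vsr yr
        wt_frame_change(1)[OF p(1) r(1,2) b] k]
    by (simp add: wt_frame_change(2)[OF p(1) r(1,2) b])
  have Y: "Uact ds \<rho>s (y j) vs \<in> cspace {..<ds}" for j
    using hwv_cspace(1)[OF p(1) R(3) vs] by (rule Uact_cspace)
  have lx: "\<And>g. g \<in> SL \<Longrightarrow> pairing {..<dl} \<xi>l (mat_act {..<dl} (\<rho>l g) vl) = pairing {..<dl} \<xi>l vl * minors p \<kappa> g"
    "pairing {..<dl} \<xi>l vl \<noteq> 0" using l by (simp_all add: hwv_pair_def)
  have mx: "irreducible_rep dm \<rho>m" "is_hwv dm \<rho>m p \<mu> vm" "\<xi>m \<in> cspace {..<dm}"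
    "\<And>g. g \<in> SL \<Longrightarrow> pairing {..<dm} \<xi>m (mat_act {..<dm} (\<rho>m g) vm) = pairing {..<dm} \<xi>m vm * minors p \<mu> g"
    "pairing {..<dm} \<xi>m vm \<noteq> 0" using m by (simp_all add: hwv_pair_def)
  have sx: "irreducible_rep ds \<rho>s" "\<xi>s \<in> cspace {..<ds}"
    "\<And>g. g \<in> SL \<Longrightarrow> pairing {..<ds} \<xi>s (mat_act {..<ds} (\<rho>s g) vs) = pairing {..<ds} \<xi>s vs * minors p (\<lambda>i. \<kappa> i + \<mu> i) g"
    using s by (simp_all add: hwv_pair_def)
  show ?thesis
    by (rule symbol_factorization[OF p(1) mx(1) sx(1) R(1) mx(2) vs mx(3) mx(4) mx(5) sx(2) sx(3) lx Y eqv])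
qed

subsection \<open>The operator on translates of the extremal section\<close>

text \<open>The same \<open>e\<close> and \<eta> serve all weights; scalars by which the given
  vectors deviate are absorbed into the flag factors. Normalized pairings are not part of it, only
  nonvanishing of each flag pairing.\<close>

definition adapted ::
    "(weight \<Rightarrow> nat) \<Rightarrow> (weight \<Rightarrow> ('n::finite) matrep) \<Rightarrow> 'n cmat \<Rightarrow> 'n cmat \<Rightarrow> complex^'n \<Rightarrow> complex^'n \<Rightarrow>
     weight3 \<Rightarrow> 'n tensor \<Rightarrow> 'n tensor \<Rightarrow> bool" where
  "adapted d \<rho> p q e \<eta> = (\<lambda>(l1, l2, l) t w. \<exists>\<alpha> \<beta> \<xi> \<zeta>.
     hwv_pair (d l1) (\<rho> l1) p l1 \<alpha> \<xi> \<and> hwv_pair (d l2) (\<rho> l2) q l2 \<beta> \<zeta> \<and>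
     t = pure_tensor l \<alpha> \<beta> e \<and> w = pure_tensor l \<xi> \<zeta> \<eta>)"

definition linear_form :: "(('i \<Rightarrow> complex) \<Rightarrow> complex) \<Rightarrow> bool" where
  "linear_form \<Phi> \<longleftrightarrow> (\<forall>(r::nat) a W. \<Phi> (\<lambda>I. \<Sum>j<r. a j * W j I) = (\<Sum>j<r. a j * \<Phi> (W j)))"

lemma linear_form_eval: "linear_form (\<lambda>w. w I)"
  by (simp add: linear_form_def)

lemma linear_form_left: "linear_form \<Phi> \<Longrightarrow> linear_form (\<lambda>w. c * \<Phi> w)"
  unfolding linear_form_def by (metis (no_types, lifting) mult.left_commute sum.cong sum_distrib_left)

lemma linear_form_right: "linear_form \<Phi> \<Longrightarrow> linear_form (\<lambda>w. \<Phi> w * c)"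
  using linear_form_left[of \<Phi> c] by (simp only: mult.commute)

lemma linear_form_sum: "(\<And>x. linear_form (\<Phi> x)) \<Longrightarrow> linear_form (\<lambda>w. \<Sum>x\<in>X. \<Phi> x w)"
proof -
  assume \<Phi>: "\<And>x. linear_form (\<Phi> x)"
  have "(\<Sum>x\<in>X. \<Phi> x (\<lambda>I. \<Sum>j<r. a j * W j I)) = (\<Sum>j<r. a j * (\<Sum>x\<in>X. \<Phi> x (W j)))"
    for r :: nat and a W
  proof -
    have "(\<Sum>x\<in>X. \<Phi> x (\<lambda>I. \<Sum>j<r. a j * W j I)) = (\<Sum>x\<in>X. \<Sum>j<r. a j * \<Phi> x (W j))"
      using \<Phi> by (simp only: linear_form_def)
    then show ?thesis unfolding sum_distrib_left by (subst sum.swap)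
  qed
  then show ?thesis by (simp only: linear_form_def) blast
qed

text \<open>Linearity in the section is not formal, since \<open>section_poly\<close> is a definite
  description and \<open>R_op\<close> is built from \<open>vector_derivative\<close>. It is read off
  from the explicit formula of \<open>V_operator_coefficient\<close>.\<close>

lemma V_operator_section_sum:
  fixes e :: "complex^'n::finite" and \<mu>1 \<mu>2 s1 s2 :: weight and r :: nat
  assumes n: "CARD('n) \<ge> 2" and e: "e \<noteq> 0"
    and R: "rational_rep (d s1) (\<rho> s1)" "rational_rep (d s2) (\<rho> s2)"
    and W: "\<And>j. j < r \<Longrightarrow> W j \<in> V_space d (s1, s2, m + l)" and g: "g \<in> G3"
  shows "V_operator d \<rho> y1 y2 e (\<mu>1, \<mu>2, m) u
      (V_section d \<rho> (s1, s2, m + l) (\<lambda>I. \<Sum>j<r. x j * W j I) (pure_tensor (m + l) v1 v2 e)) g =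
    (\<Sum>j<r. x j * V_operator d \<rho> y1 y2 e (\<mu>1, \<mu>2, m) u
      (V_section d \<rho> (s1, s2, m + l) (W j) (pure_tensor (m + l) v1 v2 e)) g)"
proof -
  obtain a b c where gabc: "g = (a, b, c)" and abc: "a \<in> SL" "b \<in> SL" "c \<in> SL"
    using g by (auto simp: G3_def)
  define \<Phi> where "\<Phi> w = (\<Sum>i<d \<mu>1. \<Sum>j<d \<mu>2. \<Sum>xs | length xs = m. u (i, j, xs) *
      (1 ^ (m + l) * (fact (m + l) / fact l) *
        (\<Sum>i'<d s1. \<Sum>j'<d s2. \<Sum>zs | length zs = l. w (i', j', xs @ zs) *
          (twist (d \<mu>1) (\<rho> \<mu>1) (d s1) (\<rho> s1) (\<lambda>k. Uact (d s1) (\<rho> s1) (y1 k) v1) a i i' *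
           twist (d \<mu>2) (\<rho> \<mu>2) (d s2) (\<rho> s2) (\<lambda>k. Uact (d s2) (\<rho> s2) (y2 k) v2) b j j' *
           lprod (c *v e) zs))))" for w
  have lin: "linear_form \<Phi>"
    unfolding \<Phi>_def by (intro linear_form_sum linear_form_left linear_form_right linear_form_eval)
  have eq: "V_operator d \<rho> y1 y2 e (\<mu>1, \<mu>2, m) u
      (V_section d \<rho> (s1, s2, m + l) w (pure_tensor (m + l) v1 v2 e)) g = \<Phi> w"
    if "w \<in> V_space d (s1, s2, m + l)" for w
    using V_operator_coefficient[OF n e R that abc, of y1 y2 \<mu>1 \<mu>2 u v1 v2 1]
    by (simp only: \<Phi>_def gabc vec.scale_one)
  have "(\<lambda>I. \<Sum>j<r. x j * W j I) \<in> V_space d (s1, s2, m + l)" using W by (intro V_space_sum) simp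
  then have "V_operator d \<rho> y1 y2 e (\<mu>1, \<mu>2, m) u
      (V_section d \<rho> (s1, s2, m + l) (\<lambda>I. \<Sum>j<r. x j * W j I) (pure_tensor (m + l) v1 v2 e)) g =
      (\<Sum>j<r. x j * \<Phi> (W j))"
    using lin[unfolded linear_form_def, rule_format, of x W r] by (simp only: eq)
  also have "\<dots> = (\<Sum>j<r. x j * V_operator d \<rho> y1 y2 e (\<mu>1, \<mu>2, m) u
      (V_section d \<rho> (s1, s2, m + l) (W j) (pure_tensor (m + l) v1 v2 e)) g)"
    by (intro sum.cong HOL.refl) (simp only: eq[OF W] lessThan_iff)
  finally show ?thesis .
qed

text \<open>A translate of a pure tensor is pure, so the sums of
  \<open>V_operator_coefficient\<close> split into two flag symbols and a power of a linear form.
  The translate enters each factor only through its own covectors, which leaves a constant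
  independent of \<open>h\<close>, \<open>g\<close> and \<open>u\<close>.\<close>

lemma operator_on_extremal_section:
  fixes e \<eta> :: "complex^'n::finite"
  assumes n: "CARD('n) \<ge> 2" and e: "e \<noteq> 0"
    and p: "invertible p" "complete_flag (frame_flag p)" and q: "invertible q" "complete_flag (frame_flag q)"
    and h1: "cartan_subalgebra \<hh>1" "\<hh>1 \<subseteq> lie_algebra_of (borel_grp up p)"
    and h2: "cartan_subalgebra \<hh>2" "\<hh>2 \<subseteq> lie_algebra_of (borel_grp up q)"
    and y1: "semi_invariant_generator (d \<mu>1) (\<rho> \<mu>1) \<mu>1 (borel_grp up p) \<hh>1 y1"
    and y2: "semi_invariant_generator (d \<mu>2) (\<rho> \<mu>2) \<mu>2 (borel_grp up q) \<hh>2 y2"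
    and lam: "adapted d \<rho> p q e \<eta> lam tk wk" and mu: "adapted d \<rho> p q e \<eta> (\<mu>1, \<mu>2, m) tm wm"
    and sig: "adapted d \<rho> p q e \<eta> (lam \<oplus>\<^sub>w (\<mu>1, \<mu>2, m)) ts ws"
  shows "\<exists>c. \<forall>h\<in>G3. \<forall>g\<in>G3. \<forall>u. V_operator d \<rho> y1 y2 e (\<mu>1, \<mu>2, m) u
      (V_section d \<rho> (lam \<oplus>\<^sub>w (\<mu>1, \<mu>2, m)) (V_coact d \<rho> (lam \<oplus>\<^sub>w (\<mu>1, \<mu>2, m)) h ws) ts) g =
    c * V_pairing d (\<mu>1, \<mu>2, m) (V_coact d \<rho> (\<mu>1, \<mu>2, m) h wm) u *
      V_pairing d lam (V_coact d \<rho> lam h wk) (V_act d \<rho> lam g tk)"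
proof -
  obtain k1 k2 l where lam_eq: "lam = (k1, k2, l)" by (metis prod_cases3)
  define s1 where "s1 = (\<lambda>i. k1 i + \<mu>1 i)"
  define s2 where "s2 = (\<lambda>i. k2 i + \<mu>2 i)"
  have sig_eq: "lam \<oplus>\<^sub>w (\<mu>1, \<mu>2, m) = (s1, s2, m + l)"
    by (simp add: wplus_def lam_eq s1_def s2_def add.commute)
  obtain \<alpha>l \<beta>l \<xi>l \<zeta>l where L: "hwv_pair (d k1) (\<rho> k1) p k1 \<alpha>l \<xi>l" "hwv_pair (d k2) (\<rho> k2) q k2 \<beta>l \<zeta>l"
    "tk = pure_tensor l \<alpha>l \<beta>l e" "wk = pure_tensor l \<xi>l \<zeta>l \<eta>"
    using lam unfolding adapted_def lam_eq by auto
  obtain \<alpha>m \<beta>m \<xi>m \<zeta>m where M: "hwv_pair (d \<mu>1) (\<rho> \<mu>1) p \<mu>1 \<alpha>m \<xi>m" "hwv_pair (d \<mu>2) (\<rho> \<mu>2) q \<mu>2 \<beta>m \<zeta>m"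
    "tm = pure_tensor m \<alpha>m \<beta>m e" "wm = pure_tensor m \<xi>m \<zeta>m \<eta>"
    using mu unfolding adapted_def by auto
  obtain \<alpha>s \<beta>s \<xi>s \<zeta>s where S: "hwv_pair (d s1) (\<rho> s1) p s1 \<alpha>s \<xi>s" "hwv_pair (d s2) (\<rho> s2) q s2 \<beta>s \<zeta>s"
    "ts = pure_tensor (m + l) \<alpha>s \<beta>s e" "ws = pure_tensor (m + l) \<xi>s \<zeta>s \<eta>"
    using sig unfolding adapted_def sig_eq by auto
  have R: "rational_rep (d s1) (\<rho> s1)" "rational_rep (d s2) (\<rho> s2)"
    using S(1,2) irreducible_rational unfolding hwv_pair_def by blast+
  define T1 where "T1 = twist (d \<mu>1) (\<rho> \<mu>1) (d s1) (\<rho> s1) (\<lambda>j. Uact (d s1) (\<rho> s1) (y1 j) \<alpha>s)"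
  define T2 where "T2 = twist (d \<mu>2) (\<rho> \<mu>2) (d s2) (\<rho> s2) (\<lambda>j. Uact (d s2) (\<rho> s2) (y2 j) \<beta>s)"
  obtain c1 where c1: "\<And>h a k. h \<in> SL \<Longrightarrow> a \<in> SL \<Longrightarrow> k < d \<mu>1 \<Longrightarrow>
    pairing {..<d s1} (mat_act {..<d s1} (contragredient (\<rho> s1) h) \<xi>s) (T1 a k) =
    c1 * mat_act {..<d \<mu>1} (contragredient (\<rho> \<mu>1) h) \<xi>m k *
      pairing {..<d k1} (mat_act {..<d k1} (contragredient (\<rho> k1) h) \<xi>l) (mat_act {..<d k1} (\<rho> k1 a) \<alpha>l)"
    using flag_symbol[OF n p L(1) M(1) S(1)[unfolded s1_def] h1 y1] unfolding T1_def s1_def by blast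
  obtain c2 where c2: "\<And>h a k. h \<in> SL \<Longrightarrow> a \<in> SL \<Longrightarrow> k < d \<mu>2 \<Longrightarrow>
    pairing {..<d s2} (mat_act {..<d s2} (contragredient (\<rho> s2) h) \<zeta>s) (T2 a k) =
    c2 * mat_act {..<d \<mu>2} (contragredient (\<rho> \<mu>2) h) \<zeta>m k *
      pairing {..<d k2} (mat_act {..<d k2} (contragredient (\<rho> k2) h) \<zeta>l) (mat_act {..<d k2} (\<rho> k2 a) \<beta>l)"
    using flag_symbol[OF n q L(2) M(2) S(2)[unfolded s2_def] h2 y2] unfolding T2_def s2_def by blast
  \<comment> \<open>Differentiating a polynomial of degree \<open>m + l\<close> exactly
    \<open>m\<close> times produces this falling factorial.\<close>
  define f :: complex where "f = fact (m + l) / fact l"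
  have "V_operator d \<rho> y1 y2 e (\<mu>1, \<mu>2, m) u (V_section d \<rho> (s1, s2, m + l) (V_coact d \<rho> (s1, s2, m + l) h ws) ts) g =
      (c1 * c2 * f) * V_pairing d (\<mu>1, \<mu>2, m) (V_coact d \<rho> (\<mu>1, \<mu>2, m) h wm) u *
      V_pairing d lam (V_coact d \<rho> lam h wk) (V_act d \<rho> lam g tk)"
    if hG: "h \<in> G3" and gG: "g \<in> G3" for h g u
  proof -
    obtain x y z where h: "h = (x, y, z)" and xyz: "x \<in> SL" "y \<in> SL" "z \<in> SL" using hG by (auto simp: G3_def)
    obtain a b c where g: "g = (a, b, c)" and abc: "a \<in> SL" "b \<in> SL" "c \<in> SL" using gG by (auto simp: G3_def)
    define \<gamma> where "\<gamma> = transpose (matrix_inv z) *v \<eta>"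
    define X where "X = mat_act {..<d s1} (contragredient (\<rho> s1) x) \<xi>s"
    define Y where "Y = mat_act {..<d s2} (contragredient (\<rho> s2) y) \<zeta>s"
    define Xm where "Xm = mat_act {..<d \<mu>1} (contragredient (\<rho> \<mu>1) x) \<xi>m"
    define Ym where "Ym = mat_act {..<d \<mu>2} (contragredient (\<rho> \<mu>2) y) \<zeta>m"
    define A where "A = pairing {..<d k1} (mat_act {..<d k1} (contragredient (\<rho> k1) x) \<xi>l) (mat_act {..<d k1} (\<rho> k1 a) \<alpha>l)"
    define B where "B = pairing {..<d k2} (mat_act {..<d k2} (contragredient (\<rho> k2) y) \<zeta>l) (mat_act {..<d k2} (\<rho> k2 b) \<beta>l)"
    define D where "D = dotp \<gamma> (c *v e) ^ l"
    have W: "V_coact d \<rho> (s1, s2, m + l) h ws = pure_tensor (m + l) X Y \<gamma>"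
      unfolding h S(4) V_coact_pure X_def Y_def \<gamma>_def ..
    have WV: "pure_tensor (m + l) X Y \<gamma> \<in> V_space d (s1, s2, m + l)"
      by (rule pure_tensor_V_space) (simp_all add: X_def Y_def)
    have inner: "(\<Sum>i'<d s1. \<Sum>j'<d s2. \<Sum>zs | length zs = l. pure_tensor (m + l) X Y \<gamma> (i', j', xs @ zs) *
        (T1 a i i' * T2 b j j' * lprod (c *v e) zs)) = (c1 * Xm i * A) * ((c2 * Ym j * B) * (lprod \<gamma> xs * D))"
      if ij: "i < d \<mu>1" "j < d \<mu>2" and xs: "length xs = m" for i j xs
    proof -
      have "(\<Sum>i'<d s1. \<Sum>j'<d s2. \<Sum>zs | length zs = l. pure_tensor (m + l) X Y \<gamma> (i', j', xs @ zs) *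
          (T1 a i i' * T2 b j j' * lprod (c *v e) zs)) =
        (\<Sum>i'<d s1. \<Sum>j'<d s2. \<Sum>zs | length zs = l. (X i' * T1 a i i') * ((Y j' * T2 b j j') *
          (lprod \<gamma> xs * (lprod \<gamma> zs * lprod (c *v e) zs))))"
        by (intro sum.cong HOL.refl)
          (simp add: pure_tensor_def xs lprod_def mult_ac)
      also have "\<dots> = pairing {..<d s1} X (T1 a i) * (pairing {..<d s2} Y (T2 b j) * (lprod \<gamma> xs * D))"
        unfolding sum3_product pairing_def D_def tpoly_power[symmetric] tpoly_def by (simp only: sum_distrib_left)
      also have "\<dots> = (c1 * Xm i * A) * ((c2 * Ym j * B) * (lprod \<gamma> xs * D))"
        unfolding X_def Y_def c1[OF xyz(1) abc(1) ij(1)] c2[OF xyz(2) abc(2) ij(2)] Xm_def Ym_def A_def B_def ..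
      finally show ?thesis .
    qed
    have "V_operator d \<rho> y1 y2 e (\<mu>1, \<mu>2, m) u (V_section d \<rho> (s1, s2, m + l) (V_coact d \<rho> (s1, s2, m + l) h ws) ts) g =
        (\<Sum>i<d \<mu>1. \<Sum>j<d \<mu>2. \<Sum>xs | length xs = m. u (i, j, xs) * (1 ^ (m + l) * f *
        (\<Sum>i'<d s1. \<Sum>j'<d s2. \<Sum>zs | length zs = l. pure_tensor (m + l) X Y \<gamma> (i', j', xs @ zs) *
        (T1 a i i' * T2 b j j' * lprod (c *v e) zs))))"
      using V_operator_coefficient[OF n e R WV abc, of y1 y2 \<mu>1 \<mu>2 u \<alpha>s \<beta>s 1]
      unfolding W g S(3) f_def T1_def T2_def by (simp only: vec.scale_one)
    also have "\<dots> = (\<Sum>i<d \<mu>1. \<Sum>j<d \<mu>2. \<Sum>xs | length xs = m. (c1 * c2 * f * (A * B * D)) *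
        (u (i, j, xs) * (Xm i * Ym j * lprod \<gamma> xs)))"
      by (intro sum.cong HOL.refl, subst inner) (simp_all add: mult_ac)
    also have "\<dots> = (c1 * c2 * f * (A * B * D)) * V_pairing d (\<mu>1, \<mu>2, m) u (pure_tensor m Xm Ym \<gamma>)"
      unfolding V_pairing_pure sum_distrib_left ..
    also have "V_pairing d (\<mu>1, \<mu>2, m) u (pure_tensor m Xm Ym \<gamma>) = V_pairing d (\<mu>1, \<mu>2, m) (V_coact d \<rho> (\<mu>1, \<mu>2, m) h wm) u"
      unfolding h M(4) V_coact_pure Xm_def Ym_def \<gamma>_def by (rule V_pairing_commute)
    also have "A * B * D = V_pairing d lam (V_coact d \<rho> lam h wk) (V_act d \<rho> lam g tk)"
      unfolding lam_eq h g L(3,4) V_coact_pure V_act_pure V_pairing_pure_pure A_def B_def D_def \<gamma>_def ..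
    finally show ?thesis by (simp only: mult_ac)
  qed
  then show ?thesis unfolding sig_eq by blast
qed

subsection \<open>Invariants and the open orbits\<close>

lemma pure_tensor_scale:
  "pure_tensor l (\<lambda>i. a * \<alpha> i) (\<lambda>j. b * \<beta> j) (s *s \<gamma>) = (\<lambda>I. a * b * s ^ l * pure_tensor l \<alpha> \<beta> \<gamma> I)"
  using lprod_scale[of s \<gamma>] by (auto simp: pure_tensor_def lprod_def[symmetric] fun_eq_iff mult_ac)

lemma hwv_pair_factors:
  assumes "hwv_pair d \<rho> p \<nu> v \<xi>"
  shows "v \<in> cspace {..<d}" "v \<noteq> (\<lambda>_. 0)" "\<xi> \<in> cspace {..<d}" "\<xi> \<noteq> (\<lambda>_. 0)" "irreducible_rep d \<rho>" "rational_rep d \<rho>"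
  using assms irreducible_rational by (auto simp: hwv_pair_def is_hwv_def pairing_def)

lemma dual_hwv_translate:
  assumes p: "invertible p" and h: "hwv_pair d \<rho> p \<nu> v \<xi>" and b: "b \<in> borel_grp down p" and g: "g \<in> SL"
  shows "mat_act {..<d} (contragredient \<rho> (g ** b)) \<xi> =
    (\<lambda>i. wt p \<nu> (matrix_inv b) * mat_act {..<d} (contragredient \<rho> g) \<xi> i)"
proof -
  note f = hwv_pair_factors[OF h]
  have bS: "b \<in> SL" using b by (rule borel_SL)
  have "mat_act {..<d} (contragredient \<rho> b) \<xi> i = wt p \<nu> (matrix_inv b) * \<xi> i" for i
  proof (cases "i < d")
    case True
    have "is_hwv d \<rho> p \<nu> v"
      "\<And>g. g \<in> SL \<Longrightarrow> pairing {..<d} \<xi> (mat_act {..<d} (\<rho> g) v) = pairing {..<d} \<xi> v * minors p \<nu> g"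
      using h by (simp_all add: hwv_pair_def)
    from dual_vector_borel[OF p f(6) this(1) f(5,3) this(2) borel_inverse[OF p inj_down b] unit_vec_cspace[OF True]]
    have "pairing {..<d} (mat_act {..<d} (contragredient \<rho> b) \<xi>) (unit_vec i) =
        wt p \<nu> (matrix_inv b) * pairing {..<d} \<xi> (unit_vec i)"
      unfolding pairing_contragredient[OF f(6) bS] .
    then show ?thesis using True by (simp add: pairing_unit_vec)
  next
    case False
    then show ?thesis using f(3) by (simp add: mat_act_def cspace_def)
  qed
  then have "mat_act {..<d} (contragredient \<rho> b) \<xi> = (\<lambda>i. wt p \<nu> (matrix_inv b) * \<xi> i)" by (rule ext)
  then show ?thesis
    by (simp add: act_mult[OF rational_rep_contragredient[OF f(6)] g bS] mat_act_scale)
qed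

lemma adapted_obtain:
  assumes "adapted d \<rho> p q e \<eta> lam t w"
  obtains l1 l2 l \<alpha> \<beta> \<xi> \<zeta> where "lam = (l1, l2, l)"
    "hwv_pair (d l1) (\<rho> l1) p l1 \<alpha> \<xi>" "hwv_pair (d l2) (\<rho> l2) q l2 \<beta> \<zeta>"
    "t = pure_tensor l \<alpha> \<beta> e" "w = pure_tensor l \<xi> \<zeta> \<eta>"
  using assms by (cases lam) (auto simp: adapted_def)

lemma mult3_one: "mult3 (mat 1, mat 1, mat 1) g = g" "mult3 g (mat 1, mat 1, mat 1) = g"
  by (simp_all add: mult3_def split: prod.split)

lemma diagonal_translate_cancel:
  assumes "k \<in> SL" "h \<in> G3"
  shows "mult3 (inv3 (mult3 (k, k, k) h)) (mult3 (k, k, k) g) = mult3 (inv3 h) g"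
proof -
  have "matrix_inv (k ** a) ** (k ** b) = matrix_inv a ** b" if "a \<in> SL" for a b :: "'a cmat"
    using assms(1) that by (simp add: matrix_inv_mult_SL matrix_mul_assoc) (simp add: matrix_mul_assoc[symmetric] SL_inv)
  then show ?thesis using assms(2) by (auto simp: mult3_def inv3_def G3_def split: prod.split)
qed

lemma V_pairing_minus:
  "V_pairing d lam (\<lambda>I. x I + (- c) * y I) t = V_pairing d lam x t - c * V_pairing d lam y t"
  "V_pairing d lam t (\<lambda>I. x I + (- c) * y I) = V_pairing d lam t x - c * V_pairing d lam t y"
  unfolding V_pairing_def pairing_add pairing_scale by simp_all

lemma V_pairing_scale:
  "V_pairing d lam (\<lambda>I. c * x I) t = c * V_pairing d lam x t"
  "V_pairing d lam t (\<lambda>I. c * x I) = c * V_pairing d lam t x"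
  unfolding V_pairing_def pairing_scale by simp_all

lemma V_space_minus:
  assumes "x \<in> V_space d lam" "y \<in> V_space d lam"
  shows "(\<lambda>I. x I + (- c) * y I) \<in> V_space d lam"
  using V_space_sum[of "{0, 1::nat}" "\<lambda>j. if j = 0 then x else y" d lam "\<lambda>j. if j = 0 then 1 else - c"] assms by simp

lemma poly_on_G3_zero: "poly_on_G3 (\<lambda>_. 0)"
  unfolding poly_on_G3_def by (intro bexI[OF _ polynomial_functions.const[of 0]]) simp

context
  fixes d :: "weight \<Rightarrow> nat" and \<rho> :: "weight \<Rightarrow> ('n::finite) matrep" and p q :: "'n cmat"
    and e \<eta> :: "complex^'n" and L L' :: "(complex^'n) set"
  assumes n: "CARD('n) \<ge> 2"
    and p: "invertible p" "complete_flag (frame_flag p)" and q: "invertible q" "complete_flag (frame_flag q)"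
    and L: "is_line L" "e \<in> L" "e \<noteq> 0" and L': "is_line L'" "\<eta> \<in> L'" "\<eta> \<noteq> 0"
    and orbit: "in_open_orbit X_var (borel_grp up p, borel_grp up q, line_stab L)"
    and orbit': "in_open_orbit X'_var (borel_grp down p, borel_grp down q, coline_stab L')"
begin

abbreviation (input) "adapt \<equiv> adapted d \<rho> p q e \<eta>"

lemma stabilizer_acts_by_scalar:
  assumes b: "b \<in> G3" "conj3 b (borel_grp up p, borel_grp up q, line_stab L) = (borel_grp up p, borel_grp up q, line_stab L)"
    and a: "adapt lam t w" and g: "g \<in> G3"
  shows "\<exists>c. V_act d \<rho> lam (mult3 g b) t = (\<lambda>I. c * V_act d \<rho> lam g t I)"
proof -
  obtain l1 l2 l \<alpha> \<beta> \<xi> \<zeta> where A: "lam = (l1, l2, l)"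
    "hwv_pair (d l1) (\<rho> l1) p l1 \<alpha> \<xi>" "hwv_pair (d l2) (\<rho> l2) q l2 \<beta> \<zeta>" "t = pure_tensor l \<alpha> \<beta> e"
    using adapted_obtain[OF a] by metis
  obtain b1 b2 b3 where bb: "b = (b1, b2, b3)" "b1 \<in> SL" "b2 \<in> SL" "b3 \<in> SL" using b(1) by (auto simp: G3_def)
  obtain g1 g2 g3 where gg: "g = (g1, g2, g3)" "g1 \<in> SL" "g2 \<in> SL" "g3 \<in> SL" using g by (auto simp: G3_def)
  have b1: "b1 \<in> borel_grp up p"
    using flag_stab_normalizer[OF n p(2) bb(2)] b(2) by (simp add: flag_stab_frame[OF p(1)] bb(1) conj3_def)
  have b2: "b2 \<in> borel_grp up q"
    using flag_stab_normalizer[OF n q(2) bb(3)] b(2) by (simp add: flag_stab_frame[OF q(1)] bb(1) conj3_def)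
  have "b3 \<in> line_stab L" using line_stab_normalizer[OF n L(1) bb(4)] b(2) by (simp add: bb(1) conj3_def)
  then have "b3 *v e \<in> L" using L(2) by (simp add: line_stab_def)
  then obtain s where s: "b3 *v e = s *s e" using line_generator[OF L] by auto
  have hw: "is_hwv (d l1) (\<rho> l1) p l1 \<alpha>" "is_hwv (d l2) (\<rho> l2) q l2 \<beta>" using A(2,3) by (simp_all add: hwv_pair_def)
  have "(g3 ** b3) *v e = s *s (g3 *v e)" by (simp add: matrix_vector_mul_assoc[symmetric] s mv_scale)
  then show ?thesis
    unfolding A(1,4) gg(1) bb(1) mult3_def prod.case V_act_pure
      hwv_act_cell[OF p(1) hwv_pair_factors(6)[OF A(2)] hw(1) gg(2) b1]
      hwv_act_cell[OF q(1) hwv_pair_factors(6)[OF A(3)] hw(2) gg(3) b2]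
    by (simp only: pure_tensor_scale) blast
qed

text \<open>The order of quantifiers matters: one \<theta>, depending on \<open>b\<close> alone,
  serves all weights. Its multiplicativity in the weight is the source of the multiplicativity of
  the invariant coefficients.\<close>

lemma costabilizer_acts_by_character:
  assumes b: "b \<in> G3" "conj3 b (borel_grp down p, borel_grp down q, coline_stab L') = (borel_grp down p, borel_grp down q, coline_stab L')"
  shows "\<exists>\<theta>. (\<forall>lam mu. \<theta> (lam \<oplus>\<^sub>w mu) = \<theta> lam * \<theta> mu) \<and> (\<forall>lam t w g. adapt lam t w \<longrightarrow> g \<in> G3 \<longrightarrow>
    V_coact d \<rho> lam (mult3 g b) w = (\<lambda>I. \<theta> lam * V_coact d \<rho> lam g w I))"
proof -
  obtain b1 b2 b3 where bb: "b = (b1, b2, b3)" "b1 \<in> SL" "b2 \<in> SL" "b3 \<in> SL" using b(1) by (auto simp: G3_def)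
  have "borel_grp down p \<in> borel_subgroups" "borel_grp down q \<in> borel_subgroups"
    using orbit' by (simp_all add: in_open_orbit_def X'_var_def)
  then obtain F1 F2 where F: "complete_flag F1" "borel_grp down p = flag_stab F1"
    "complete_flag F2" "borel_grp down q = flag_stab F2"
    unfolding borel_subgroups_def by blast
  have b1: "b1 \<in> borel_grp down p"
    using flag_stab_normalizer[OF n F(1) bb(2)] b(2) by (simp add: F(2) bb(1) conj3_def)
  have b2: "b2 \<in> borel_grp down q"
    using flag_stab_normalizer[OF n F(3) bb(3)] b(2) by (simp add: F(4) bb(1) conj3_def)
  have "b3 \<in> coline_stab L'" using coline_stab_normalizer[OF n L'(1) bb(4)] b(2) by (simp add: bb(1) conj3_def)
  then have "transpose (matrix_inv b3) *v \<eta> \<in> L'"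
    using L'(2) unfolding coline_stab_iff line_stab_def by blast
  then obtain s where s: "transpose (matrix_inv b3) *v \<eta> = s *s \<eta>" using line_generator[OF L'] by blast
  define \<theta> :: "weight3 \<Rightarrow> complex" where "\<theta> = (\<lambda>(l1, l2, l). wt p l1 (matrix_inv b1) * wt q l2 (matrix_inv b2) * s ^ l)"
  have "\<theta> (lam \<oplus>\<^sub>w mu) = \<theta> lam * \<theta> mu" for lam mu
    by (auto simp: \<theta>_def wplus_def wt_add power_add split: prod.split)
  moreover have "V_coact d \<rho> lam (mult3 g b) w = (\<lambda>I. \<theta> lam * V_coact d \<rho> lam g w I)"
    if a: "adapt lam t w" and g: "g \<in> G3" for lam t w g
  proof -
    obtain l1 l2 l \<alpha> \<beta> \<xi> \<zeta> where A: "lam = (l1, l2, l)"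
      "hwv_pair (d l1) (\<rho> l1) p l1 \<alpha> \<xi>" "hwv_pair (d l2) (\<rho> l2) q l2 \<beta> \<zeta>" "w = pure_tensor l \<xi> \<zeta> \<eta>"
      using adapted_obtain[OF a] by metis
    obtain g1 g2 g3 where gg: "g = (g1, g2, g3)" "g1 \<in> SL" "g2 \<in> SL" "g3 \<in> SL" using g by (auto simp: G3_def)
    have "transpose (matrix_inv (g3 ** b3)) *v \<eta> = s *s (transpose (matrix_inv g3) *v \<eta>)"
      unfolding matrix_inv_mult_SL[OF gg(4) bb(4)] matrix_transpose_mul matrix_vector_mul_assoc[symmetric] s mv_scale ..
    then show ?thesis
      unfolding A(1,4) gg(1) bb(1) mult3_def prod.case V_coact_pure \<theta>_def
        dual_hwv_translate[OF p(1) A(2) b1 gg(2)] dual_hwv_translate[OF q(1) A(3) b2 gg(3)]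
      by (simp only: pure_tensor_scale)
  qed
  ultimately show ?thesis by blast
qed

lemma V_act_one_adapted: "adapt lam t w \<Longrightarrow> V_act d \<rho> lam (mat 1, mat 1, mat 1) t = t"
  by (erule adapted_obtain) (simp add: V_act_pure act_one hwv_pair_factors)

lemma V_coact_one_adapted: "adapt lam t w \<Longrightarrow> V_coact d \<rho> lam (mat 1, mat 1, mat 1) w = w"
  by (erule adapted_obtain) (simp add: V_coact_pure act_one[OF rational_rep_contragredient] hwv_pair_factors)

text \<open>At (k, k, k) b the value of an invariant section is a scalar times its value at 1, since
  \<open>b\<close> acts on \<open>t\<close> by a scalar. After subtracting the right multiple of
  \<open>w0\<close>, the section vanishes on the dense orbit. Only the section of \<open>w1\<close>
  is assumed invariant, which is the form in which the result is applied.\<close>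

lemma invariant_functional_unique:
  assumes a: "adapt lam t w" and w0: "V_coinvariant d \<rho> lam w0" "V_pairing d lam w0 t = 1"
    and w1: "w1 \<in> V_space d lam"
    and inv: "\<And>k g. k \<in> SL \<Longrightarrow> g \<in> G3 \<Longrightarrow>
      V_pairing d lam w1 (V_act d \<rho> lam (mult3 (k, k, k) g) t) = V_pairing d lam w1 (V_act d \<rho> lam g t)"
  shows "w1 = (\<lambda>I. V_pairing d lam w1 t * w0 I)"
proof -
  obtain l1 l2 l \<alpha> \<beta> \<xi> \<zeta> where A: "lam = (l1, l2, l)"
    "hwv_pair (d l1) (\<rho> l1) p l1 \<alpha> \<xi>" "hwv_pair (d l2) (\<rho> l2) q l2 \<beta> \<zeta>" "t = pure_tensor l \<alpha> \<beta> e"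
    using adapted_obtain[OF a] by metis
  note f = hwv_pair_factors[OF A(2)] hwv_pair_factors[OF A(3)]
  define c where "c = V_pairing d lam w1 t"
  define D where "D = (\<lambda>I. w1 I + (- c) * w0 I)"
  have DV: "D \<in> V_space d lam"
    unfolding D_def using w0(1) by (intro V_space_minus w1) (simp add: V_coinvariant_def)
  have inv0: "V_pairing d lam w0 (V_act d \<rho> lam (mult3 (k, k, k) g) t) = V_pairing d lam w0 (V_act d \<rho> lam g t)"
    if "k \<in> SL" "g \<in> G3" for k g
    unfolding A(1,4)
    by (rule coinvariant_pairing[where d = d and \<rho> = \<rho> and ?l1.0 = l1 and ?l2.0 = l2 and l = l,
          OF n f(5) f(11) w0(1)[unfolded A(1)] that])
  have z: "V_pairing d lam D (V_act d \<rho> lam g t) = 0" if g: "g \<in> G3" for g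
  proof (rule open_orbit_identity_on_G3[OF orbit _ poly_on_G3_zero _ g])
    show "poly_on_G3 (\<lambda>g. V_pairing d lam D (V_act d \<rho> lam g t))"
      unfolding A(1,4) by (rule V_act_pairing_polynomial[where d = d and \<rho> = \<rho> and ?l1.0 = l1 and ?l2.0 = l2, OF f(6) f(12)])
    fix k :: "'n cmat" and b assume k: "k \<in> SL" and b: "b \<in> G3"
      "conj3 b (borel_grp up p, borel_grp up q, line_stab L) = (borel_grp up p, borel_grp up q, line_stab L)"
    obtain x where "V_act d \<rho> lam (mult3 (mat 1, mat 1, mat 1) b) t = (\<lambda>I. x * V_act d \<rho> lam (mat 1, mat 1, mat 1) t I)"
      using stabilizer_acts_by_scalar[OF b a one_G3] by blast
    then have x: "V_act d \<rho> lam b t = (\<lambda>I. x * t I)" by (simp only: mult3_one V_act_one_adapted[OF a])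
    have "V_pairing d lam D (V_act d \<rho> lam (mult3 (k, k, k) b) t) = V_pairing d lam D (V_act d \<rho> lam b t)"
      unfolding D_def V_pairing_minus inv[OF k b(1)] inv0[OF k b(1)] ..
    also have "\<dots> = 0" unfolding x V_pairing_scale D_def V_pairing_minus w0(2) c_def by simp
    finally show "V_pairing d lam D (V_act d \<rho> lam (mult3 (k, k, k) b) t) = 0" .
  qed
  have "D = (\<lambda>_. 0)"
    by (rule V_separated_by_orbit[where d = d and \<rho> = \<rho> and ?l1.0 = l1 and ?l2.0 = l2 and l = l,
          OF n f(5) f(11) f(1,2) f(7,8) L(3) DV[unfolded A(1)] z[unfolded A(1,4)]])
  then have "w1 I = c * w0 I" for I unfolding D_def by (drule_tac fun_cong[of _ _ I]) simp
  then show ?thesis unfolding c_def by (rule ext)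
qed

lemma invariant_vector_unique:
  assumes a: "adapt lam t w" and u0: "V_invariant d \<rho> lam u0" "V_pairing d lam w u0 = 1"
    and u1: "V_invariant d \<rho> lam u1"
  shows "u1 = (\<lambda>I. V_pairing d lam w u1 * u0 I)"
proof -
  obtain l1 l2 l \<alpha> \<beta> \<xi> \<zeta> where A: "lam = (l1, l2, l)"
    "hwv_pair (d l1) (\<rho> l1) p l1 \<alpha> \<xi>" "hwv_pair (d l2) (\<rho> l2) q l2 \<beta> \<zeta>" "w = pure_tensor l \<xi> \<zeta> \<eta>"
    using adapted_obtain[OF a] by metis
  note f = hwv_pair_factors[OF A(2)] hwv_pair_factors[OF A(3)]
  define c where "c = V_pairing d lam w u1"
  define D where "D = (\<lambda>I. u1 I + (- c) * u0 I)"
  have DV: "D \<in> V_space d lam"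
    unfolding D_def using u0(1) u1 by (intro V_space_minus) (simp_all add: V_invariant_def)
  have inv: "V_pairing d lam (V_coact d \<rho> lam (mult3 (k, k, k) g) w) u = V_pairing d lam (V_coact d \<rho> lam g w) u"
    if "V_invariant d \<rho> lam u" "k \<in> SL" "g \<in> G3" for k g u
    unfolding A(1,4)
    by (rule invariant_copairing[where d = d and \<rho> = \<rho> and ?l1.0 = l1 and ?l2.0 = l2 and l = l,
          OF n f(5) f(11) that[unfolded A(1)]])
  have z: "V_pairing d lam (V_coact d \<rho> lam g w) D = 0" if g: "g \<in> G3" for g
  proof (rule open_orbit_identity_on_G3[OF orbit' _ poly_on_G3_zero _ g])
    show "poly_on_G3 (\<lambda>g. V_pairing d lam (V_coact d \<rho> lam g w) D)"
      unfolding A(1,4) by (rule V_coact_pairing_polynomial[where d = d and \<rho> = \<rho> and ?l1.0 = l1 and ?l2.0 = l2, OF f(6) f(12)])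
    fix k :: "'n cmat" and b assume k: "k \<in> SL" and b: "b \<in> G3"
      "conj3 b (borel_grp down p, borel_grp down q, coline_stab L') = (borel_grp down p, borel_grp down q, coline_stab L')"
    obtain x where "V_coact d \<rho> lam (mult3 (mat 1, mat 1, mat 1) b) w = (\<lambda>I. x * V_coact d \<rho> lam (mat 1, mat 1, mat 1) w I)"
      using costabilizer_acts_by_character[OF b] a one_G3 by metis
    then have x: "V_coact d \<rho> lam b w = (\<lambda>I. x * w I)" by (simp only: mult3_one V_coact_one_adapted[OF a])
    have "V_pairing d lam (V_coact d \<rho> lam (mult3 (k, k, k) b) w) D = V_pairing d lam (V_coact d \<rho> lam b w) D"
      unfolding D_def V_pairing_minus inv[OF u1 k b(1)] inv[OF u0(1) k b(1)] ..
    also have "\<dots> = 0" unfolding x V_pairing_scale D_def V_pairing_minus u0(2) c_def by simp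
    finally show "V_pairing d lam (V_coact d \<rho> lam (mult3 (k, k, k) b) w) D = 0" .
  qed
  have "D = (\<lambda>_. 0)"
    by (rule V_separated_by_coorbit[where d = d and \<rho> = \<rho> and ?l1.0 = l1 and ?l2.0 = l2 and l = l,
          OF n f(5) f(11) f(3,4) f(9,10) L'(3) DV[unfolded A(1)] z[unfolded A(1,4)]])
  then have "u1 I = c * u0 I" for I unfolding D_def by (drule_tac fun_cong[of _ _ I]) simp
  then show ?thesis unfolding c_def by (rule ext)
qed

text \<open>At (k, k, k) b with \<open>b\<close> in the stabilizer each coefficient equals
  \<open>\<theta>\<close> of its weight, thanks to the normalization of the invariant vectors; the
  open orbit on X' spreads the identity.\<close>

lemma invariant_coefficients_multiplicative:
  assumes a: "adapt lam tk wk" "adapt mu tm wm" "adapt (lam \<oplus>\<^sub>w mu) ts ws"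
    and uk: "V_invariant d \<rho> lam uk" "V_pairing d lam wk uk = 1"
    and um: "V_invariant d \<rho> mu um" "V_pairing d mu wm um = 1"
    and us: "V_invariant d \<rho> (lam \<oplus>\<^sub>w mu) us" "V_pairing d (lam \<oplus>\<^sub>w mu) ws us = 1"
    and h: "h \<in> G3"
  shows "V_pairing d (lam \<oplus>\<^sub>w mu) (V_coact d \<rho> (lam \<oplus>\<^sub>w mu) h ws) us =
    V_pairing d lam (V_coact d \<rho> lam h wk) uk * V_pairing d mu (V_coact d \<rho> mu h wm) um"
proof -
  have poly: "poly_on_G3 (\<lambda>g. V_pairing d \<nu> (V_coact d \<rho> \<nu> g w) u)" if "adapt \<nu> t w" for \<nu> t w u
    using that by (rule adapted_obtain) (simp add: V_coact_pairing_polynomial hwv_pair_factors)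
  show ?thesis
  proof (rule open_orbit_identity_on_G3[OF orbit' poly[OF a(3)] poly_on_G3_mult[OF poly[OF a(1)] poly[OF a(2)]] _ h])
    fix k :: "'n cmat" and b assume k: "k \<in> SL" and b: "b \<in> G3"
      "conj3 b (borel_grp down p, borel_grp down q, coline_stab L') = (borel_grp down p, borel_grp down q, coline_stab L')"
    obtain \<theta> where \<theta>: "\<theta> (lam \<oplus>\<^sub>w mu) = \<theta> lam * \<theta> mu"
      "\<And>\<nu> t w g. adapt \<nu> t w \<Longrightarrow> g \<in> G3 \<Longrightarrow> V_coact d \<rho> \<nu> (mult3 g b) w = (\<lambda>I. \<theta> \<nu> * V_coact d \<rho> \<nu> g w I)"
      using costabilizer_acts_by_character[OF b] by metis
    have "V_pairing d \<nu> (V_coact d \<rho> \<nu> (mult3 (k, k, k) b) w) u = \<theta> \<nu>"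
      if A: "adapt \<nu> t w" and u: "V_invariant d \<rho> \<nu> u" "V_pairing d \<nu> w u = 1" for \<nu> t w u
    proof -
      obtain l1 l2 l \<alpha> \<beta> \<xi> \<zeta> where B: "\<nu> = (l1, l2, l)"
        "hwv_pair (d l1) (\<rho> l1) p l1 \<alpha> \<xi>" "hwv_pair (d l2) (\<rho> l2) q l2 \<beta> \<zeta>" "w = pure_tensor l \<xi> \<zeta> \<eta>"
        using adapted_obtain[OF A] by metis
      have "V_pairing d \<nu> (V_coact d \<rho> \<nu> (mult3 (k, k, k) b) w) u = V_pairing d \<nu> (V_coact d \<rho> \<nu> b w) u"
        unfolding B(1,4)
        by (rule invariant_copairing[where d = d and \<rho> = \<rho> and ?l1.0 = l1 and ?l2.0 = l2 and l = l,
              OF n hwv_pair_factors(5)[OF B(2)] hwv_pair_factors(5)[OF B(3)] u(1)[unfolded B(1)] k b(1)])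
      also have "V_coact d \<rho> \<nu> b w = (\<lambda>I. \<theta> \<nu> * w I)"
        using \<theta>(2)[OF A one_G3] by (simp only: mult3_one V_coact_one_adapted[OF A])
      finally show ?thesis by (simp add: V_pairing_scale u(2))
    qed
    then show "V_pairing d (lam \<oplus>\<^sub>w mu) (V_coact d \<rho> (lam \<oplus>\<^sub>w mu) (mult3 (k, k, k) b) ws) us =
        V_pairing d lam (V_coact d \<rho> lam (mult3 (k, k, k) b) wk) uk * V_pairing d mu (V_coact d \<rho> mu (mult3 (k, k, k) b) wm) um"
      using a uk um us \<theta>(1) by metis
  qed
qed

lemma V_pairing_diagonal_translate:
  assumes a: "adapt lam t w" and k: "k \<in> SL" and h: "h \<in> G3" and g: "g \<in> G3"
  shows "V_pairing d lam (V_coact d \<rho> lam (mult3 (k, k, k) h) w) (V_act d \<rho> lam (mult3 (k, k, k) g) t) =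
    V_pairing d lam (V_coact d \<rho> lam h w) (V_act d \<rho> lam g t)"
proof -
  obtain l1 l2 l \<alpha> \<beta> \<xi> \<zeta> where A: "lam = (l1, l2, l)"
    "hwv_pair (d l1) (\<rho> l1) p l1 \<alpha> \<xi>" "hwv_pair (d l2) (\<rho> l2) q l2 \<beta> \<zeta>" "t = pure_tensor l \<alpha> \<beta> e"
    using adapted_obtain[OF a] by metis
  have kG: "(k, k, k) \<in> G3" using k by (simp add: G3_def)
  note act = V_act_mult3[where d = d and \<rho> = \<rho> and ?l1.0 = l1 and ?l2.0 = l2 and l = l,
      OF n hwv_pair_factors(5)[OF A(2)] hwv_pair_factors(5)[OF A(3)]]
  show ?thesis
    unfolding A(1,4) V_pairing_V_coact[OF mult3_G3[OF kG h]] V_pairing_V_coact[OF h]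
      act[OF inv3_G3[OF mult3_G3[OF kG h]] mult3_G3[OF kG g]] act[OF inv3_G3[OF h] g]
      diagonal_translate_cancel[OF k h] ..
qed

lemma operator_on_invariant_section:
  assumes a: "adapt lam tk wk" "adapt (\<mu>1, \<mu>2, m) tm wm" "adapt (lam \<oplus>\<^sub>w (\<mu>1, \<mu>2, m)) ts ws"
    and fk: "V_coinvariant d \<rho> lam fk" "V_pairing d lam fk tk = 1"
    and fs: "V_coinvariant d \<rho> (lam \<oplus>\<^sub>w (\<mu>1, \<mu>2, m)) fs"
    and uk: "V_invariant d \<rho> lam uk" "V_pairing d lam wk uk = 1"
    and um: "V_invariant d \<rho> (\<mu>1, \<mu>2, m) um" "V_pairing d (\<mu>1, \<mu>2, m) wm um = 1"
    and us: "V_invariant d \<rho> (lam \<oplus>\<^sub>w (\<mu>1, \<mu>2, m)) us" "V_pairing d (lam \<oplus>\<^sub>w (\<mu>1, \<mu>2, m)) ws us = 1"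
    and op: "\<And>h g u. h \<in> G3 \<Longrightarrow> g \<in> G3 \<Longrightarrow> V_operator d \<rho> y1 y2 e (\<mu>1, \<mu>2, m) u
      (V_section d \<rho> (lam \<oplus>\<^sub>w (\<mu>1, \<mu>2, m)) (V_coact d \<rho> (lam \<oplus>\<^sub>w (\<mu>1, \<mu>2, m)) h ws) ts) g =
      c * V_pairing d (\<mu>1, \<mu>2, m) (V_coact d \<rho> (\<mu>1, \<mu>2, m) h wm) u *
        V_pairing d lam (V_coact d \<rho> lam h wk) (V_act d \<rho> lam g tk)"
    and g: "g \<in> G3"
  shows "V_operator d \<rho> y1 y2 e (\<mu>1, \<mu>2, m) um (V_section d \<rho> (lam \<oplus>\<^sub>w (\<mu>1, \<mu>2, m)) fs ts) g * V_pairing d lam fk uk =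
    V_pairing d (lam \<oplus>\<^sub>w (\<mu>1, \<mu>2, m)) fs us * c * V_section d \<rho> lam fk tk g"
proof -
  let ?\<mu> = "(\<mu>1, \<mu>2, m)"
  let ?\<sigma> = "lam \<oplus>\<^sub>w ?\<mu>"
  obtain k1 k2 l where lam_eq: "lam = (k1, k2, l)" by (metis prod_cases3)
  define s1 where "s1 = (\<lambda>i. k1 i + \<mu>1 i)"
  define s2 where "s2 = (\<lambda>i. k2 i + \<mu>2 i)"
  have \<sigma>: "?\<sigma> = (s1, s2, m + l)" by (simp add: wplus_def lam_eq s1_def s2_def add.commute)
  obtain \<alpha> \<beta> \<xi> \<zeta> where S: "hwv_pair (d s1) (\<rho> s1) p s1 \<alpha> \<xi>" "hwv_pair (d s2) (\<rho> s2) q s2 \<beta> \<zeta>"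
    "ts = pure_tensor (m + l) \<alpha> \<beta> e" "ws = pure_tensor (m + l) \<xi> \<zeta> \<eta>"
    using a(3) unfolding adapted_def \<sigma> by auto
  note f1 = hwv_pair_factors[OF S(1)] note f2 = hwv_pair_factors[OF S(2)]
  have fsV: "fs \<in> V_space d (s1, s2, m + l)" using fs unfolding \<sigma> by (simp add: V_coinvariant_def)
  obtain r :: nat and x h where h0: "\<forall>j<r. h j \<in> G3"
    "fs = (\<lambda>I. \<Sum>j<r. x j * V_coact d \<rho> (s1, s2, m + l) (h j) (pure_tensor (m + l) \<xi> \<zeta> \<eta>) I)"
    using V_spanned_by_coorbit[where d = d and \<rho> = \<rho> and ?l1.0 = s1 and ?l2.0 = s2 and l = "m + l",
        OF n f1(5) f2(5) f1(3,4) f2(3,4) L'(3) fsV] by blast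
  have "\<And>j. j < r \<Longrightarrow> h j \<in> G3" using h0(1) by blast
  note h = this h0(2)
  define F where "F = V_operator d \<rho> y1 y2 e ?\<mu> um (V_section d \<rho> ?\<sigma> fs ts)"
  define U where "U h = V_pairing d ?\<mu> (V_coact d \<rho> ?\<mu> h wm) um" for h
  have coV: "V_coact d \<rho> (s1, s2, m + l) h (pure_tensor (m + l) \<xi> \<zeta> \<eta>) \<in> V_space d (s1, s2, m + l)" for h
    by (cases h) (auto simp: V_coact_pure intro!: pure_tensor_V_space simp del: transpose_matrix_vector)
  \<comment> \<open>Stated for an arbitrary expansion of \<open>fs\<close> with coefficients
    \<open>x\<close>: invariance of \<open>F\<close> is obtained by using the expansion whose points
    are all translated by (k, k, k).\<close>
  have F_sum: "F g = (\<Sum>j<r. x j * (c * U (h' j) * V_pairing d lam (V_coact d \<rho> lam (h' j) wk) (V_act d \<rho> lam g tk)))"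
    if g: "g \<in> G3" and h': "\<And>j. j < r \<Longrightarrow> h' j \<in> G3"
      "fs = (\<lambda>I. \<Sum>j<r. x j * V_coact d \<rho> (s1, s2, m + l) (h' j) (pure_tensor (m + l) \<xi> \<zeta> \<eta>) I)" for g h'
  proof -
    have "F g = (\<Sum>j<r. x j * V_operator d \<rho> y1 y2 e ?\<mu> um
        (V_section d \<rho> (s1, s2, m + l) (V_coact d \<rho> (s1, s2, m + l) (h' j) (pure_tensor (m + l) \<xi> \<zeta> \<eta>))
          (pure_tensor (m + l) \<alpha> \<beta> e)) g)"
      unfolding F_def \<sigma> S(3) h'(2)
      by (rule V_operator_section_sum[where d = d and \<rho> = \<rho> and ?s1.0 = s1 and ?s2.0 = s2, OF n L(3) f1(6) f2(6) coV g])
    also have "\<dots> = (\<Sum>j<r. x j * (c * U (h' j) * V_pairing d lam (V_coact d \<rho> lam (h' j) wk) (V_act d \<rho> lam g tk)))"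
      using op[OF h'(1) g, of _ um] unfolding \<sigma> S(3,4) U_def by (intro sum.cong HOL.refl) simp
    finally show ?thesis .
  qed
  \<comment> \<open>The covector whose section is the image of \<open>fs\<close>; its coefficients
    are those of \<open>fs\<close> weighted by the numbers that the extremal computation
    produces.\<close>
  define \<Theta> where "\<Theta> = (\<lambda>I. \<Sum>j<r. (x j * c * U (h j)) * V_coact d \<rho> lam (h j) wk I)"
  have \<Theta>F: "V_pairing d lam \<Theta> (V_act d \<rho> lam g tk) = F g" if "g \<in> G3" for g
    unfolding \<Theta>_def V_pairing_linear by (rule HOL.trans[OF _ F_sum[OF that h, symmetric]]) (simp only: mult.assoc)
  have \<Theta>V: "\<Theta> \<in> V_space d lam"
    unfolding \<Theta>_def
  proof (rule V_space_sum)
    fix j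
    from a(1) obtain l1 l2 l' \<alpha> \<beta> \<xi> \<zeta> where "lam = (l1, l2, l')" "wk = pure_tensor l' \<xi> \<zeta> \<eta>"
      by (rule adapted_obtain)
    then show "V_coact d \<rho> lam (h j) wk \<in> V_space d lam"
      by (cases "h j") (auto simp: V_coact_pure intro!: pure_tensor_V_space simp del: transpose_matrix_vector)
  qed
  have inv: "F (mult3 (k, k, k) g) = F g" if k: "k \<in> SL" and g: "g \<in> G3" for k g
  proof -
    have kG: "(k, k, k) \<in> G3" using k by (simp add: G3_def)
    have "fs = V_coact d \<rho> (s1, s2, m + l) (k, k, k) fs"
      using fs k unfolding \<sigma> by (simp add: V_coinvariant_def)
    also have "\<dots> = (\<lambda>I. \<Sum>j<r. x j * V_coact d \<rho> (s1, s2, m + l) (mult3 (k, k, k) (h j)) (pure_tensor (m + l) \<xi> \<zeta> \<eta>) I)"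
      unfolding h(2) V_coact_sum
      by (intro ext sum.cong HOL.refl)
        (simp add: V_coact_mult3[where d = d and \<rho> = \<rho> and ?l1.0 = s1 and ?l2.0 = s2 and l = "m + l", OF n f1(5) f2(5) kG h(1)])
    finally have fs': "fs = \<dots>" .
    have "F (mult3 (k, k, k) g) = (\<Sum>j<r. x j * (c * U (mult3 (k, k, k) (h j)) *
        V_pairing d lam (V_coact d \<rho> lam (mult3 (k, k, k) (h j)) wk) (V_act d \<rho> lam (mult3 (k, k, k) g) tk)))"
      by (rule F_sum[OF mult3_G3[OF kG g] mult3_G3[OF kG h(1)] fs'])
    also have "\<dots> = (\<Sum>j<r. x j * (c * U (h j) * V_pairing d lam (V_coact d \<rho> lam (h j) wk) (V_act d \<rho> lam g tk)))"
    proof (intro sum.cong HOL.refl)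
      fix j assume "j \<in> {..<r}"
      then have hj: "h j \<in> G3" using h(1) by simp
      from a(2) obtain \<alpha> \<beta> \<xi> \<zeta> where M: "hwv_pair (d \<mu>1) (\<rho> \<mu>1) p \<mu>1 \<alpha> \<xi>" "hwv_pair (d \<mu>2) (\<rho> \<mu>2) q \<mu>2 \<beta> \<zeta>"
        "wm = pure_tensor m \<xi> \<zeta> \<eta>" unfolding adapted_def by auto
      have "U (mult3 (k, k, k) (h j)) = U (h j)"
        unfolding U_def M(3)
        by (rule invariant_copairing[where d = d and \<rho> = \<rho> and ?l1.0 = \<mu>1 and ?l2.0 = \<mu>2 and l = m,
              OF n hwv_pair_factors(5)[OF M(1)] hwv_pair_factors(5)[OF M(2)] um(1) k hj])
      then show "x j * (c * U (mult3 (k, k, k) (h j)) *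
          V_pairing d lam (V_coact d \<rho> lam (mult3 (k, k, k) (h j)) wk) (V_act d \<rho> lam (mult3 (k, k, k) g) tk)) =
        x j * (c * U (h j) * V_pairing d lam (V_coact d \<rho> lam (h j) wk) (V_act d \<rho> lam g tk))"
        by (simp add: V_pairing_diagonal_translate[OF a(1) k hj g])
    qed
    also have "\<dots> = F g" by (rule F_sum[OF g h, symmetric])
    finally show ?thesis .
  qed
  define b where "b = V_pairing d lam \<Theta> tk"
  have "\<Theta> = (\<lambda>I. b * fk I)"
    unfolding b_def
  proof (rule invariant_functional_unique[OF a(1) fk \<Theta>V])
    fix k :: "'n cmat" and g :: "'n cmat \<times> 'n cmat \<times> 'n cmat" assume kg: "k \<in> SL" "g \<in> G3"
    then have "mult3 (k, k, k) g \<in> G3" by (intro mult3_G3) (simp_all add: G3_def)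
    then show "V_pairing d lam \<Theta> (V_act d \<rho> lam (mult3 (k, k, k) g) tk) = V_pairing d lam \<Theta> (V_act d \<rho> lam g tk)"
      by (simp only: \<Theta>F inv kg)
  qed
  then have \<Theta>b: "V_pairing d lam \<Theta> t = b * V_pairing d lam fk t" for t by (simp only: V_pairing_scale)
  have Fg: "F g = b * V_section d \<rho> lam fk tk g" unfolding \<Theta>F[OF g, symmetric] \<Theta>b V_section_def ..
  \<comment> \<open>Pairing with \<open>uk\<close> recombines the coefficients at \<lambda> and
    \<mu> into the one at \<lambda> + \<mu>, so the expansion of \<open>fs\<close> collapses to its
    pairing with \<open>us\<close>.\<close>
  have "b * V_pairing d lam fk uk = V_pairing d lam \<Theta> uk" by (rule \<Theta>b[symmetric])
  also have "\<dots> = (\<Sum>j<r. c * (x j * V_pairing d (s1, s2, m + l) (V_coact d \<rho> (s1, s2, m + l) (h j) (pure_tensor (m + l) \<xi> \<zeta> \<eta>)) us))"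
    unfolding \<Theta>_def V_pairing_linear
  proof (intro sum.cong HOL.refl)
    fix j assume "j \<in> {..<r}"
    then have hj: "h j \<in> G3" using h(1) by simp
    show "x j * c * U (h j) * V_pairing d lam (V_coact d \<rho> lam (h j) wk) uk =
        c * (x j * V_pairing d (s1, s2, m + l) (V_coact d \<rho> (s1, s2, m + l) (h j) (pure_tensor (m + l) \<xi> \<zeta> \<eta>)) us)"
      using invariant_coefficients_multiplicative[OF a uk um us hj] unfolding \<sigma> S(4) U_def by simp
  qed
  also have "\<dots> = c * V_pairing d ?\<sigma> fs us"
    unfolding \<sigma> sum_distrib_left[symmetric] V_pairing_linear(1)[symmetric] h(2)[symmetric] ..
  finally show ?thesis using Fg unfolding F_def by (simp add: mult_ac)
qed

end

subsection \<open>Normalization of the extremal vectors\<close>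

lemma highest_weight_vector_scale:
  "highest_weight_vector d \<rho> B v \<Longrightarrow> c \<noteq> 0 \<Longrightarrow> highest_weight_vector d \<rho> B (\<lambda>i. c * v i)"
  unfolding highest_weight_vector_def mat_act_scale
  by (auto simp: cspace_def fun_eq_iff mult.left_commute)

lemma hwv_pairI:
  fixes p :: "('n::finite) cmat"
  assumes irr: "irrep_of_highest_weight \<nu> d \<rho>" and p: "complete_flag (frame_flag p)" "invertible p"
    and v: "highest_weight_vector d \<rho> (borel_grp up p) v"
    and \<xi>: "highest_weight_vector d (contragredient \<rho>) (borel_grp down p) \<xi>"
    and nz: "pairing {..<d} \<xi> v \<noteq> 0"
  shows "hwv_pair d \<rho> p \<nu> v \<xi>"
proof -
  have i: "irreducible_rep d \<rho>" using irr by (simp add: irrep_of_highest_weight_def)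
  have h: "is_hwv d \<rho> p \<nu> v" by (rule highest_weight_vector_is_hwv[OF irr p v])
  have \<xi>': "\<xi> \<in> cspace {..<d}"
    "\<And>b. b \<in> borel_grp down p \<Longrightarrow> \<exists>c. mat_act {..<d} (contragredient \<rho> b) \<xi> = (\<lambda>i. c * \<xi> i)"
    using \<xi> by (simp_all add: highest_weight_vector_def)
  have "pairing {..<d} \<xi> (mat_act {..<d} (\<rho> g) v) = pairing {..<d} \<xi> v * minors p \<nu> g" if "g \<in> SL" for g
    by (rule dual_line_coefficient[OF p(2) irreducible_rational[OF i] h \<xi>' nz that])
  then show ?thesis using i h \<xi>'(1) nz by (simp add: hwv_pair_def)
qed

lemma pure_tensor_absorb: "pure_tensor l \<alpha> \<beta> (s *s \<gamma>) = pure_tensor l (\<lambda>i. s ^ l * \<alpha> i) \<beta> \<gamma>"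
  using pure_tensor_scale[of l 1 \<alpha> 1 \<beta> s \<gamma>] pure_tensor_scale[of l "s ^ l" \<alpha> 1 \<beta> 1 \<gamma>] by simp

text \<open>The line vectors of \<open>t\<close> and \<open>w\<close> are multiples of
  \<open>e\<close> and \<eta>; the powers of the two scalars are moved into the first flag factor. A
  nonzero total pairing then forces each flag pairing to be nonzero.\<close>

lemma adaptedI:
  fixes p q :: "('n::finite) cmat"
  assumes irr: "irrep_of_highest_weight l1 (d l1) (\<rho> l1)" "irrep_of_highest_weight l2 (d l2) (\<rho> l2)"
    and p: "complete_flag (frame_flag p)" "invertible p" and q: "complete_flag (frame_flag q)" "invertible q"
    and P: "line_of P = L" "is_line L" "e \<in> L" "e \<noteq> 0"
    and P': "coline_of P' = L'" "is_line L'" "\<eta> \<in> L'" "\<eta> \<noteq> 0"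
    and t: "V_highest d \<rho> (borel_grp up p, borel_grp up q, P) (l1, l2, l) t"
    and w: "V_cohighest d \<rho> (borel_grp down p, borel_grp down q, P') (l1, l2, l) w"
    and tw: "V_pairing d (l1, l2, l) w t \<noteq> 0"
  shows "adapted d \<rho> p q e \<eta> (l1, l2, l) t w"
proof -
  obtain v1 v2 e' where v: "highest_weight_vector (d l1) (\<rho> l1) (borel_grp up p) v1"
    "highest_weight_vector (d l2) (\<rho> l2) (borel_grp up q) v2" "e' \<in> L" "e' \<noteq> 0" "t = pure_tensor l v1 v2 e'"
    using t unfolding V_highest_def prod.case P(1) by blast
  obtain \<xi>1 \<xi>2 \<eta>' where \<xi>: "highest_weight_vector (d l1) (contragredient (\<rho> l1)) (borel_grp down p) \<xi>1"
    "highest_weight_vector (d l2) (contragredient (\<rho> l2)) (borel_grp down q) \<xi>2" "\<eta>' \<in> L'" "\<eta>' \<noteq> 0"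
    "w = pure_tensor l \<xi>1 \<xi>2 \<eta>'"
    using w unfolding V_cohighest_def prod.case P'(1) by blast
  obtain s where s: "e' = s *s e" using v(3) line_generator[OF P(2,3,4)] by blast
  obtain s' where s': "\<eta>' = s' *s \<eta>" using \<xi>(3) line_generator[OF P'(2,3,4)] by blast
  have nz: "s \<noteq> 0" "s' \<noteq> 0" using v(4) \<xi>(4) s s' by auto
  let ?v = "\<lambda>i. s ^ l * v1 i" let ?\<xi> = "\<lambda>i. s' ^ l * \<xi>1 i"
  have t': "t = pure_tensor l ?v v2 e" unfolding v(5) s pure_tensor_absorb ..
  have w': "w = pure_tensor l ?\<xi> \<xi>2 \<eta>" unfolding \<xi>(5) s' pure_tensor_absorb ..
  have "pairing {..<d l1} ?\<xi> ?v \<noteq> 0" "pairing {..<d l2} \<xi>2 v2 \<noteq> 0"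
    using tw unfolding t' w' V_pairing_pure_pure by auto
  then have "hwv_pair (d l1) (\<rho> l1) p l1 ?v ?\<xi>" "hwv_pair (d l2) (\<rho> l2) q l2 v2 \<xi>2"
    using nz by (auto intro!: hwv_pairI irr p q v(1,2) \<xi>(1,2) highest_weight_vector_scale)
  then show ?thesis using t' w' unfolding adapted_def prod.case by blast
qed

subsection \<open>Positivity: \<open>\<Omega>\<close> is closed under addition\<close>

text \<open>In unitary frames of the same flags, the product of the invariant sections for \<lambda>
  and \<mu> is an invariant function, nonzero at 1, which \<open>coinvariant_from_function\<close>
  realizes as a section for \<lambda> + \<mu>.\<close>

lemma coinvariant_sum_exists:
  fixes p q :: "('n::finite) cmat"
  assumes n: "CARD('n) \<ge> 2"
    and irr: "irrep_of_highest_weight s1 (d s1) (\<rho> s1)" "irrep_of_highest_weight s2 (d s2) (\<rho> s2)"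
    and p: "complete_flag (frame_flag p)" "invertible p" and q: "complete_flag (frame_flag q)" "invertible q"
    and e: "e \<noteq> 0"
    and a: "adapted d \<rho> p q e \<eta> lam tk wk" "adapted d \<rho> p q e \<eta> mu tm wm" and s: "lam \<oplus>\<^sub>w mu = (s1, s2, s)"
    and fk: "V_coinvariant d \<rho> lam fk" "V_pairing d lam fk tk = 1"
    and fm: "V_coinvariant d \<rho> mu fm" "V_pairing d mu fm tm = 1"
  shows "\<exists>w. V_coinvariant d \<rho> (s1, s2, s) w \<and> w \<noteq> (\<lambda>_. 0)"
proof -
  obtain o1 where o1: "adj o1 ** o1 = mat 1" "invertible o1" "frame_flag p = frame_flag o1"
    using orthonormal_frame[OF p(1)] by blast
  obtain o2 where o2: "adj o2 ** o2 = mat 1" "invertible o2" "frame_flag q = frame_flag o2"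
    using orthonormal_frame[OF q(1)] by blast
  have sec: "(\<exists>(r::nat) x k. \<forall>g\<in>G3. V_section d \<rho> \<nu> f t g = (\<Sum>j<r. x j * psi o1 o2 e \<nu> (mult3 (star3 (k j)) g))) \<and>
      (\<forall>k\<in>SL. \<forall>g\<in>G3. V_section d \<rho> \<nu> f t (mult3 (k, k, k) g) = V_section d \<rho> \<nu> f t g) \<and>
      V_section d \<rho> \<nu> f t (mat 1, mat 1, mat 1) = V_pairing d \<nu> f t"
    if A: "adapted d \<rho> p q e \<eta> \<nu> t w" and f: "V_coinvariant d \<rho> \<nu> f" for \<nu> t w f
  proof -
    obtain l1 l2 l \<alpha> \<beta> \<xi> \<zeta> where B: "\<nu> = (l1, l2, l)"
      "hwv_pair (d l1) (\<rho> l1) p l1 \<alpha> \<xi>" "hwv_pair (d l2) (\<rho> l2) q l2 \<beta> \<zeta>" "t = pure_tensor l \<alpha> \<beta> e"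
      using adapted_obtain[OF A] by metis
    note F = hwv_pair_factors[OF B(2)] hwv_pair_factors[OF B(3)]
    have h: "is_hwv (d l1) (\<rho> l1) o1 l1 \<alpha>" "is_hwv (d l2) (\<rho> l2) o2 l2 \<beta>"
      using B(2,3) is_hwv_frame_change[OF p(2) o1(2,3)] is_hwv_frame_change[OF q(2) o2(2,3)] by (simp_all add: hwv_pair_def)
    have fV: "f \<in> V_space d (l1, l2, l)" using f B(1) by (simp add: V_coinvariant_def)
    note ctx = n F(5) F(11) o1(1,2) o2(1,2) h e
    obtain r :: nat and x k where K: "(\<forall>j<r. k j \<in> G3) \<and> (\<forall>g\<in>G3. V_section d \<rho> (l1, l2, l) f (pure_tensor l \<alpha> \<beta> e) g =
        (\<Sum>j<r. x j * psi o1 o2 e (l1, l2, l) (mult3 (star3 (k j)) g)))"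
      using section_as_kernel_sum[where d = d and \<rho> = \<rho> and ?l1.0 = l1 and ?l2.0 = l2 and l = l and ?o1.0 = o1
          and ?o2.0 = o2 and ?v1.0 = \<alpha> and ?v2.0 = \<beta> and e = e, OF ctx fV] by blast
    have "V_section d \<rho> (l1, l2, l) f (pure_tensor l \<alpha> \<beta> e) (mult3 (k, k, k) g) = V_section d \<rho> (l1, l2, l) f (pure_tensor l \<alpha> \<beta> e) g"
      if "k \<in> SL" "g \<in> G3" for k g
      by (rule coinvariant_section[where d = d and \<rho> = \<rho> and ?l1.0 = l1 and ?l2.0 = l2 and l = l and ?o1.0 = o1
            and ?o2.0 = o2 and ?v1.0 = \<alpha> and ?v2.0 = \<beta> and e = e, OF ctx f[unfolded B(1)] that])
    moreover have "V_section d \<rho> (l1, l2, l) f (pure_tensor l \<alpha> \<beta> e) (mat 1, mat 1, mat 1) = V_pairing d (l1, l2, l) f (pure_tensor l \<alpha> \<beta> e)"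
      by (simp add: V_section_def V_act_pure act_one F)
    ultimately show ?thesis using K unfolding B(1,4) by blast
  qed
  obtain r :: nat and x k where k: "\<And>g. g \<in> G3 \<Longrightarrow> V_section d \<rho> lam fk tk g = (\<Sum>j<r. x j * psi o1 o2 e lam (mult3 (star3 (k j)) g))"
    using sec[OF a(1) fk(1)] by blast
  obtain r' :: nat and x' k' where k': "\<And>g. g \<in> G3 \<Longrightarrow> V_section d \<rho> mu fm tm g = (\<Sum>j<r'. x' j * psi o1 o2 e mu (mult3 (star3 (k' j)) g))"
    using sec[OF a(2) fm(1)] by blast
  obtain v1 where v1: "is_hwv (d s1) (\<rho> s1) o1 s1 v1"
    using irrep_frame_hwv[OF irr(1) p(1)[unfolded o1(3)] o1(2)] by blast
  obtain v2 where v2: "is_hwv (d s2) (\<rho> s2) o2 s2 v2"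
    using irrep_frame_hwv[OF irr(2) q(1)[unfolded o2(3)] o2(2)] by blast
  have i: "irreducible_rep (d s1) (\<rho> s1)" "irreducible_rep (d s2) (\<rho> s2)"
    using irr by (simp_all add: irrep_of_highest_weight_def)
  have K: "psi o1 o2 e (s1, s2, s) g = psi o1 o2 e lam g * psi o1 o2 e mu g" for g
    unfolding s[symmetric] by (rule psi_wplus)
  have inv: "V_section d \<rho> lam fk tk (mult3 (y, y, y) g) * V_section d \<rho> mu fm tm (mult3 (y, y, y) g) =
      V_section d \<rho> lam fk tk g * V_section d \<rho> mu fm tm g" if "y \<in> SL" "g \<in> G3" for y g
    using sec[OF a(1) fk(1)] sec[OF a(2) fm(1)] that by simp
  have nz: "V_section d \<rho> lam fk tk (mat 1, mat 1, mat 1) * V_section d \<rho> mu fm tm (mat 1, mat 1, mat 1) \<noteq> 0"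
    using sec[OF a(1) fk(1)] sec[OF a(2) fm(1)] fk(2) fm(2) by simp
  show ?thesis
    by (rule coinvariant_from_function[where d = d and \<rho> = \<rho> and ?l1.0 = s1 and ?l2.0 = s2 and l = s and ?o1.0 = o1
          and ?o2.0 = o2 and ?v1.0 = v1 and ?v2.0 = v2 and e = e and ?K1.0 = "psi o1 o2 e lam" and ?K2.0 = "psi o1 o2 e mu"
          and ?f1.0 = "V_section d \<rho> lam fk tk" and ?f2.0 = "V_section d \<rho> mu fm tm"
          and m = r and a = x and k = k and m' = r' and a' = x' and k' = k',
          OF n i o1(1,2) o2(1,2) v1 v2 e K pos_kernel_psi[OF o1(1) o2(1)] pos_kernel_psi[OF o1(1) o2(1)] k k' inv nz])
qed

lemma invariant_pairing_exists:
  fixes p q :: "('n::finite) cmat"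
  assumes n: "CARD('n) \<ge> 2"
    and p: "complete_flag (frame_flag p)" "invertible p" and q: "complete_flag (frame_flag q)" "invertible q"
    and e: "e \<noteq> 0" and A: "adapted d \<rho> p q e \<eta> \<nu> t w"
    and f: "V_coinvariant d \<rho> \<nu> f" "V_pairing d \<nu> f t \<noteq> 0"
  shows "\<exists>u. V_invariant d \<rho> \<nu> u \<and> V_pairing d \<nu> f u \<noteq> 0"
proof -
  obtain o1 where o1: "adj o1 ** o1 = mat 1" "invertible o1" "frame_flag p = frame_flag o1"
    using orthonormal_frame[OF p(1)] by blast
  obtain o2 where o2: "adj o2 ** o2 = mat 1" "invertible o2" "frame_flag q = frame_flag o2"
    using orthonormal_frame[OF q(1)] by blast
  obtain l1 l2 l \<alpha> \<beta> \<xi> \<zeta> where B: "\<nu> = (l1, l2, l)"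
    "hwv_pair (d l1) (\<rho> l1) p l1 \<alpha> \<xi>" "hwv_pair (d l2) (\<rho> l2) q l2 \<beta> \<zeta>" "t = pure_tensor l \<alpha> \<beta> e"
    using adapted_obtain[OF A] by metis
  have h: "is_hwv (d l1) (\<rho> l1) o1 l1 \<alpha>" "is_hwv (d l2) (\<rho> l2) o2 l2 \<beta>"
    using B(2,3) is_hwv_frame_change[OF p(2) o1(2,3)] is_hwv_frame_change[OF q(2) o2(2,3)] by (simp_all add: hwv_pair_def)
  show ?thesis
    unfolding B(1)
    by (rule invariant_pairing_nonzero[where d = d and \<rho> = \<rho> and ?l1.0 = l1 and ?l2.0 = l2 and l = l and ?o1.0 = o1
          and ?o2.0 = o2 and ?v1.0 = \<alpha> and ?v2.0 = \<beta> and e = e,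
          OF n hwv_pair_factors(5)[OF B(2)] hwv_pair_factors(5)[OF B(3)] o1(1,2) o2(1,2) h e f[unfolded B(1,4)]])
qed

section \<open>Comparison of the constants\<close>

theorem lemma11:
  fixes d :: "weight \<Rightarrow> nat"
    and \<rho> :: "weight \<Rightarrow> ('n::finite) matrep"
    and B1 B2 P B1' B2' P' :: "'n cmat set"
    and v vm u um :: "weight3 \<Rightarrow> 'n tensor"
    and \<hh>1 \<hh>2 :: "'n sl set"
    and p1 p2 :: "nat \<Rightarrow> 'n Ug"
    and e :: "complex^'n"
    and \<mu>1 \<mu>2 :: weight and m :: nat
  assumes n: "CARD('n) \<ge> 2"
    and irreps: "\<And>\<nu>. \<nu> \<in> dominant_weights TYPE('n) \<Longrightarrow> irrep_of_highest_weight \<nu> (d \<nu>) (\<rho> \<nu>)"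
    and position: "general_position (B1, B2, P) (B1', B2', P')"
    and v: "\<And>lam. lam \<in> Omega d \<rho> \<Longrightarrow> V_highest d \<rho> (B1, B2, P) lam (v lam)"
    and vm: "\<And>lam. lam \<in> Omega d \<rho> \<Longrightarrow>
      V_cohighest d \<rho> (B1', B2', P') lam (vm lam) \<and> V_pairing d lam (vm lam) (v lam) = 1"
    and um: "\<And>lam. lam \<in> Omega d \<rho> \<Longrightarrow>
      V_coinvariant d \<rho> lam (um lam) \<and> V_pairing d lam (um lam) (v lam) = 1"
    and u: "\<And>lam. lam \<in> Omega d \<rho> \<Longrightarrow>
      V_invariant d \<rho> lam (u lam) \<and> V_pairing d lam (vm lam) (u lam) = 1"
    and e: "e \<in> line_of P" "e \<noteq> 0"
    and \<mu>: "(\<mu>1, \<mu>2, m) \<in> Omega d \<rho>"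
    and cartan1: "cartan_subalgebra \<hh>1" "\<hh>1 \<subseteq> lie_algebra_of B1"
    and cartan2: "cartan_subalgebra \<hh>2" "\<hh>2 \<subseteq> lie_algebra_of B2"
    and p1: "semi_invariant_generator (d \<mu>1) (\<rho> \<mu>1) \<mu>1 B1 \<hh>1 p1"
    and p2: "semi_invariant_generator (d \<mu>2) (\<rho> \<mu>2) \<mu>2 B2 \<hh>2 p2"
  defines "\<mu> \<equiv> (\<mu>1, \<mu>2, m)"
  defines "f_G \<equiv> \<lambda>lam. V_section d \<rho> lam (um lam) (v lam)"
  defines "H \<equiv> \<lambda>lam. V_pairing d lam (um lam) (u lam)"
  defines "b_G \<equiv> \<lambda>lam. H (lam \<oplus>\<^sub>w \<mu>) / H lam * b_K d \<rho> p1 p2 e v vm \<mu> lam"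
  shows "\<forall>lam \<in> Omega d \<rho>. \<forall>g \<in> G3.
    V_operator d \<rho> p1 p2 e \<mu> (u \<mu>) (f_G (lam \<oplus>\<^sub>w \<mu>)) g = b_G lam * f_G lam g"
proof -
  obtain p F1 where p: "invertible p" "complete_flag (frame_flag p)" "B1 = borel_grp up p" "B1' = borel_grp down p"
    using position opposite_borels_frame[OF n, of B1 B1'] unfolding general_position_def by auto
  obtain q F2 where q: "invertible q" "complete_flag (frame_flag q)" "B2 = borel_grp up q" "B2' = borel_grp down q"
    using position opposite_borels_frame[OF n, of B2 B2'] unfolding general_position_def by auto
  have X: "in_open_orbit X_var (B1, B2, P)" "in_open_orbit X'_var (B1', B2', P')"
    using position by (simp_all add: general_position_def)
  obtain L where L: "is_line L" "P = line_stab L" using X(1) by (auto simp: in_open_orbit_def X_var_def)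
  obtain L' where L': "is_line L'" "P' = coline_stab L'" using X(2) by (auto simp: in_open_orbit_def X'_var_def)
  have lP: "line_of P = L" "coline_of P' = L'"
    using line_of_line_stab[OF n L(1)] coline_of_coline_stab[OF n L'(1)] L(2) L'(2) by simp_all
  have eL: "e \<in> L" using e(1) lP(1) by simp
  obtain x \<eta> where "\<eta> \<in> L'" "(\<Sum>i\<in>UNIV. \<eta> $ i * x $ i) \<noteq> 0"
    using position unfolding general_position_def prod.case lP by blast
  then have \<eta>: "\<eta> \<in> L'" "\<eta> \<noteq> 0" by auto
  note orbit = X[unfolded p(3,4) q(3,4) L(2) L'(2)]
  note ctx = n p(1,2) q(1,2) L(1) eL e(2) L'(1) \<eta> orbit
  have adapt: "adapted d \<rho> p q e \<eta> lam (v lam) (vm lam)" if lam: "lam \<in> Omega d \<rho>" for lam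
  proof -
    obtain l1 l2 l where l: "lam = (l1, l2, l)" by (metis prod_cases3)
    have D: "l1 \<in> dominant_weights TYPE('n)" "l2 \<in> dominant_weights TYPE('n)"
      using lam by (simp_all add: Omega_def l)
    have "V_pairing d (l1, l2, l) (vm lam) (v lam) \<noteq> 0" using vm[OF lam] by (simp add: l)
    then show ?thesis
      using adaptedI[OF irreps[OF D(1)] irreps[OF D(2)] p(2,1) q(2,1) lP(1) L(1) eL e(2) lP(2) L'(1) \<eta>,
          of l "v lam" "vm lam"] v[OF lam] vm[OF lam] by (simp add: l p(3,4) q(3,4))
  qed
  show ?thesis
  proof (intro ballI)
    fix lam :: weight3 and g :: "'n cmat \<times> 'n cmat \<times> 'n cmat" assume lam: "lam \<in> Omega d \<rho>" and g: "g \<in> G3"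
    have mu: "(\<mu>1, \<mu>2, m) \<in> Omega d \<rho>" by (rule \<mu>)
    let ?\<mu> = "(\<mu>1, \<mu>2, m)" and ?\<sigma> = "lam \<oplus>\<^sub>w (\<mu>1, \<mu>2, m)"
    \<comment> \<open>The assumptions on \<open>v\<close>, \<open>vm\<close>, \<open>um\<close> and
      \<open>u\<close> speak only about weights in \<open>Omega\<close>, so membership of the sum
      has to precede their use.\<close>
    have sig: "?\<sigma> \<in> Omega d \<rho>"
    proof -
      obtain s1 s2 s where s: "?\<sigma> = (s1, s2, s)" by (metis prod_cases3)
      have D: "s1 \<in> dominant_weights TYPE('n)" "s2 \<in> dominant_weights TYPE('n)"
        using lam mu s by (auto simp: Omega_def wplus_def dominant_weights_def)
      have "\<exists>w. V_coinvariant d \<rho> (s1, s2, s) w \<and> w \<noteq> (\<lambda>_. 0)"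
        by (rule coinvariant_sum_exists[OF n irreps[OF D(1)] irreps[OF D(2)] p(2,1) q(2,1) e(2)
              adapt[OF lam] adapt[OF mu] s]) (use um[OF lam] um[OF mu] in blast)+
      then show ?thesis using D by (simp add: Omega_def s)
    qed
    obtain c where c: "\<And>h g u. h \<in> G3 \<Longrightarrow> g \<in> G3 \<Longrightarrow> V_operator d \<rho> p1 p2 e ?\<mu> u
        (V_section d \<rho> ?\<sigma> (V_coact d \<rho> ?\<sigma> h (vm ?\<sigma>)) (v ?\<sigma>)) g =
      c * V_pairing d ?\<mu> (V_coact d \<rho> ?\<mu> h (vm ?\<mu>)) u * V_pairing d lam (V_coact d \<rho> lam h (vm lam)) (V_act d \<rho> lam g (v lam))"
      using operator_on_extremal_section[OF n e(2) p(1,2) q(1,2) cartan1[unfolded p(3)] cartan2[unfolded q(3)]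
          p1[unfolded p(3)] p2[unfolded q(3)] adapt[OF lam] adapt[OF mu] adapt[OF sig]] by blast
    note co1 = V_coact_one_adapted[OF ctx]
    \<comment> \<open>The constant is determined by the value at 1, where the section of
      \<open>vm lam\<close> equals 1; existence is the case of trivial translate and
      \<open>u = v \<mu>\<close>.\<close>
    have bK: "b_K d \<rho> p1 p2 e v vm ?\<mu> lam = c"
      unfolding b_K_def
    proof (rule the_equality)
      show "\<forall>g\<in>G3. V_operator d \<rho> p1 p2 e ?\<mu> (v ?\<mu>) (V_section d \<rho> ?\<sigma> (vm ?\<sigma>) (v ?\<sigma>)) g =
          c * V_section d \<rho> lam (vm lam) (v lam) g"
        using c[OF one_G3, of _ "v ?\<mu>"] vm[OF mu]
        by (simp add: co1[OF adapt[OF lam]] co1[OF adapt[OF mu]] co1[OF adapt[OF sig]] V_section_def)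
      then have c': "V_operator d \<rho> p1 p2 e ?\<mu> (v ?\<mu>) (V_section d \<rho> ?\<sigma> (vm ?\<sigma>) (v ?\<sigma>)) (mat 1, mat 1, mat 1) =
          c * V_section d \<rho> lam (vm lam) (v lam) (mat 1, mat 1, mat 1)" using one_G3 by blast
      have "V_section d \<rho> lam (vm lam) (v lam) (mat 1, mat 1, mat 1) = 1"
        using vm[OF lam] by (simp add: V_section_def V_act_one_adapted[OF ctx adapt[OF lam]])
      then show "c2 = c" if "\<forall>g\<in>G3. V_operator d \<rho> p1 p2 e ?\<mu> (v ?\<mu>) (V_section d \<rho> ?\<sigma> (vm ?\<sigma>) (v ?\<sigma>)) g =
          c2 * V_section d \<rho> lam (vm lam) (v lam) g" for c2
        using bspec[OF that one_G3] c' by simp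
    qed
    \<comment> \<open>Positivity yields some invariant vector that pairs nontrivially with
      \<open>um lam\<close>; by uniqueness it is a multiple of \<open>u lam\<close>, which therefore
      pairs nontrivially as well.\<close>
    have H: "H lam \<noteq> 0"
    proof
      assume H0: "H lam = 0"
      obtain x where x: "V_invariant d \<rho> lam x" "V_pairing d lam (um lam) x \<noteq> 0"
        using invariant_pairing_exists[OF n p(2,1) q(2,1) e(2) adapt[OF lam], of "um lam"] um[OF lam] by auto
      have "x = (\<lambda>I. V_pairing d lam (vm lam) x * u lam I)"
        by (rule invariant_vector_unique[OF ctx adapt[OF lam] _ _ x(1)]) (use u[OF lam] in blast)+
      then have "V_pairing d lam (um lam) x = V_pairing d lam (vm lam) x * H lam"
        unfolding H_def by (metis V_pairing_scale(2))
      then show False using x(2) H0 by simp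
    qed
    have "V_operator d \<rho> p1 p2 e ?\<mu> (u ?\<mu>) (V_section d \<rho> ?\<sigma> (um ?\<sigma>) (v ?\<sigma>)) g * H lam =
        H ?\<sigma> * c * V_section d \<rho> lam (um lam) (v lam) g"
      unfolding H_def
      by (rule operator_on_invariant_section[OF ctx adapt[OF lam] adapt[OF mu] adapt[OF sig] _ _ _ _ _ _ _ _ _ c g])
        (use um[OF lam] um[OF sig] u[OF lam] u[OF mu] u[OF sig] in blast)+
    then show "V_operator d \<rho> p1 p2 e \<mu> (u \<mu>) (f_G (lam \<oplus>\<^sub>w \<mu>)) g = b_G lam * f_G lam g"
      using H unfolding \<mu>_def f_G_def b_G_def bK by (simp add: field_simps)
  qed
qed

end
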